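(* Let $n \geq 5$ be an integer. Then $$ \begin{aligned} \mathrm{CW}_{\mathrm{depth},\mathrm{reg},\dim,\deg h}(n) &= \mathrm{CW}_{2,\mathrm{reg},\dim,\deg h}(n) \\ &\cup \left\{ (a,d,d,d) \in \mathbb{N}^4 \;\middle|\; 3 \leq a \leq d \leq \left\lfloor \tfrac{n-1}{2} \right\rfloor,\ n < a+2d \right\} \\ &\cup \left\{ (a,a,d,d) \in \mathbb{N}^4 \;\middle|\; 3 \leq a < d \leq n-a,\ n \leq 2a+d-1 \right\} \\ &\cup \left\{ (a,r,d,d) \in \mathbb{N}^4 \;\middle|\; 3 \leq a < r < d < n-r,\ n+2 \leq a+r+d \right\}, \end{aligned} $$ where $$\mathrm{CW}_{2,\mathrm{reg},\dim,\deg h}(n) = \{(2,2,n-2,n-2),\ (2,2,n-3,n-3)\}$$ if $n$ is even, and $$\mathrm{CW}_{2,\mathrm{reg},\dim,\deg h}(n) = \left\{(2,2,n-2,n-2),\ (2,2,n-3,n-3),\ \left(2,\tfrac{n-1}{2},\tfrac{n-1}{2},\tfrac{n-1}{2}\right)\right\}$$ if $n$ is odd.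
   Context: Let $K$ be a field. For a finite simple graph $G$ with vertex set $\{x_1,\ldots,x_n\}$, let $R=K[x_1,\ldots,x_n]$ (standard grading) and let $I(G)=(x_ix_j \mid \{x_i,x_j\}\in E(G))\subseteq R$ be its edge ideal. $\mathrm{depth}(R/I(G))$ is the length of a longest regular sequence, $\dim R/I(G)$ is the Krull dimension, and $\mathrm{reg}(R/I(G))=\max\{j-i \mid \beta_{i,j}(R/I(G))\neq 0\}$ is the Castelnuovo--Mumford regularity. Writing the Hilbert series of $R/I(G)$ as $h(t)/(1-t)^{d}$ with $d=\dim R/I(G)$, the polynomial $h(t)$ (with $h(1)\neq 0$) is the $h$-polynomial, and $\deg h(R/I(G))$ denotes its degree. A matching of $G$ is a set of pairwise disjoint edges; an induced matching is a matching $\mathcal{M}$ such that for distinct $e,e'\in\mathcal{M}$ no edge $f$ of $G$ meets both $e$ and $e'$. The matching number $\mathrm{m}(G)$ (resp. induced matching number $\mathrm{im}(G)$) is the maximum cardinality of a matching (resp. induced matching). A star graph is a graph obtained by joining some edges at one common vertex; a star triangle is a graph obtained by joining some triangles at one common vertex. A finite connected simple graph $G$ is a Cameron--Walker graph if $\mathrm{im}(G)=\mathrm{m}(G)$ and $G$ is neither a star graph nor a star triangle. $\mathrm{CW}(n)$ is the set of all Cameron--Walker graphs with $n$ vertices, and $$\mathrm{CW}_{\mathrm{depth},\mathrm{reg},\dim,\deg h}(n)=\{(\mathrm{depth}(R/I(G)),\mathrm{reg}(R/I(G)),\dim R/I(G),\deg h(R/I(G))) \mid G\in \mathrm{CW}(n)\}.$$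 *)

theory Defs
  imports
    "HOL-Library.Poly_Mapping"
    "HOL-Algebra.QuotRing"
    "HOL-Algebra.Embedded_Algebras"
    "HOL-Computational_Algebra.Polynomial_FPS"
begin

section \<open>Graphs\<close>

text \<open>A graph is given by its vertex set \<open>V\<close> and its set \<open>E\<close> of edges, each edge being a
  two-element subset of \<open>V\<close>.\<close>

definition simple_graph :: "'v set \<Rightarrow> 'v set set \<Rightarrow> bool" where
  "simple_graph V E \<longleftrightarrow> finite V \<and> (\<forall>e\<in>E. e \<subseteq> V \<and> card e = 2)"

definition connected_graph :: "'v set \<Rightarrow> 'v set set \<Rightarrow> bool" where
  "connected_graph V E \<longleftrightarrow> V \<noteq> {} \<and> (\<forall>u\<in>V. \<forall>v\<in>V. (u, v) \<in> {(a, b). {a, b} \<in> E}\<^sup>*)"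

definition matching :: "'v set set \<Rightarrow> 'v set set \<Rightarrow> bool" where
  "matching E M \<longleftrightarrow> M \<subseteq> E \<and> pairwise disjnt M"

definition induced_matching :: "'v set set \<Rightarrow> 'v set set \<Rightarrow> bool" where
  "induced_matching E M \<longleftrightarrow> matching E M \<and>
     (\<forall>e\<in>M. \<forall>e'\<in>M. e \<noteq> e' \<longrightarrow> \<not> (\<exists>f\<in>E. f \<inter> e \<noteq> {} \<and> f \<inter> e' \<noteq> {}))"

definition matching_number :: "'v set set \<Rightarrow> nat" where
  "matching_number E = Max {card M | M. matching E M}"

definition induced_matching_number :: "'v set set \<Rightarrow> nat" where
  "induced_matching_number E = Max {card M | M. induced_matching E M}"

text \<open>A star: at least one edge, and all edges are joined at the common vertex \<open>c\<close>.\<close>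

definition star_graph :: "'v set \<Rightarrow> 'v set set \<Rightarrow> bool" where
  "star_graph V E \<longleftrightarrow>
     (\<exists>c L. L \<noteq> {} \<and> c \<notin> L \<and> V = insert c L \<and> E = {{c, v} | v. v \<in> L})"

text \<open>A star triangle: at least one triangle, all triangles joined at the common vertex \<open>c\<close>;
  \<open>T\<close> is the set of the edges opposite to \<open>c\<close> in these triangles.\<close>

definition star_triangle :: "'v set \<Rightarrow> 'v set set \<Rightarrow> bool" where
  "star_triangle V E \<longleftrightarrow>
     (\<exists>c T. T \<noteq> {} \<and> (\<forall>e\<in>T. card e = 2) \<and> pairwise disjnt T \<and> c \<notin> \<Union>T \<and>
        V = insert c (\<Union>T) \<and> E = T \<union> {{c, v} | v. v \<in> \<Union>T})"

definition cameron_walker :: "'v set \<Rightarrow> 'v set set \<Rightarrow> bool" where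
  "cameron_walker V E \<longleftrightarrow> simple_graph V E \<and> connected_graph V E \<and>
     induced_matching_number E = matching_number E \<and>
     \<not> star_graph V E \<and> \<not> star_triangle V E"


section \<open>The polynomial ring\<close>

text \<open>A polynomial is a finitely supported map from monomials to coefficients, a monomial being a
  finitely supported map from variable indices to exponents. The ring
  \<open>K[x\<^sub>1,\<dots>,x\<^sub>n]\<close> consists of the polynomials in which only
  the variables with index in \<open>{1..n}\<close> occur; the field \<open>K\<close> is the type \<open>'k\<close>.\<close>

type_synonym 'k mpoly = "(nat \<Rightarrow>\<^sub>0 nat) \<Rightarrow>\<^sub>0 'k"

definition poly_ring :: "nat \<Rightarrow> 'k::field mpoly ring" where
  "poly_ring n =
     \<lparr>carrier = {p. \<forall>m\<in>Poly_Mapping.keys p. Poly_Mapping.keys m \<subseteq> {1..n}},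
      monoid.mult = (*), one = 1, zero = 0, add = (+)\<rparr>"

definition const :: "'k::field \<Rightarrow> 'k mpoly" where
  "const c = Poly_Mapping.single 0 c"

definition var :: "nat \<Rightarrow> 'k::field mpoly" where
  "var i = Poly_Mapping.single (Poly_Mapping.single i 1) 1"

definition monom_degree :: "(nat \<Rightarrow>\<^sub>0 nat) \<Rightarrow> nat" where
  "monom_degree m = (\<Sum>i\<in>Poly_Mapping.keys m. Poly_Mapping.lookup m i)"

text \<open>The homogeneous component of degree \<open>d\<close> in the standard grading; it is zero for
  \<open>d < 0\<close>.\<close>

definition hom_part :: "nat \<Rightarrow> int \<Rightarrow> 'k::field mpoly set" where
  "hom_part n d =
     {p \<in> carrier (poly_ring n). \<forall>m\<in>Poly_Mapping.keys p. int (monom_degree m) = d}"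

text \<open>The graded maximal ideal \<open>(x\<^sub>1,\<dots>,x\<^sub>n)\<close>: the constant
  coefficient vanishes.\<close>

definition graded_max_ideal :: "nat \<Rightarrow> 'k::field mpoly set" where
  "graded_max_ideal n = {p \<in> carrier (poly_ring n). Poly_Mapping.lookup p 0 = 0}"

definition edge_ideal :: "nat \<Rightarrow> nat set set \<Rightarrow> 'k::field mpoly set" where
  "edge_ideal n E = Idl\<^bsub>poly_ring n\<^esub> {var i * var j | i j. {i, j} \<in> E}"


section \<open>Invariants of \<open>R/I\<close> for a homogeneous ideal \<open>I\<close> of \<open>R = K[x\<^sub>1,\<dots>,x\<^sub>n]\<close>\<close>

subsection \<open>Krull dimension\<close>

definition krull_dim :: "('a, 'b) ring_scheme \<Rightarrow> nat" where
  "krull_dim A =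
     Sup {d. \<exists>P. (\<forall>i\<le>d. primeideal (P i) A) \<and> (\<forall>i<d. P i \<subset> P (Suc i))}"

definition quot_dim :: "nat \<Rightarrow> 'k::field mpoly set \<Rightarrow> nat" where
  "quot_dim n I = krull_dim (poly_ring n Quot I)"

subsection \<open>Depth\<close>

text \<open>The sequence \<open>f\<^sub>1,\<dots>,f\<^sub>r\<close> is regular on \<open>A/I\<close> if
  each \<open>f\<^sub>i\<close> is a nonzerodivisor on \<open>A/(I + (f\<^sub>1,\<dots>,f\<^sub>i\<^sub>-\<^sub>1))\<close> and
  \<open>A \<noteq> I + (f\<^sub>1,\<dots>,f\<^sub>r)\<close>.\<close>

definition regular_sequence :: "('a, 'b) ring_scheme \<Rightarrow> 'a set \<Rightarrow> 'a list \<Rightarrow> bool" where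
  "regular_sequence A I fs \<longleftrightarrow> set fs \<subseteq> carrier A \<and>
     (\<forall>i<length fs. \<forall>g\<in>carrier A.
        fs ! i \<otimes>\<^bsub>A\<^esub> g \<in> Idl\<^bsub>A\<^esub> (I \<union> set (take i fs)) \<longrightarrow> g \<in> Idl\<^bsub>A\<^esub> (I \<union> set (take i fs))) \<and>
     Idl\<^bsub>A\<^esub> (I \<union> set fs) \<noteq> carrier A"

text \<open>As usual for graded rings, depth is taken with respect to the graded maximal ideal. (Without
  this restriction one could localise away from the origin and get longer sequences.)\<close>

definition quot_depth :: "nat \<Rightarrow> 'k::field mpoly set \<Rightarrow> nat" where
  "quot_depth n I =
     Max {length fs | fs. regular_sequence (poly_ring n) I fs \<and> set fs \<subseteq> graded_max_ideal n}"

subsection \<open>Graded Betti numbers and regularity\<close>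

text \<open>The free module \<open>R\<^sup>r\<close>; vectors are extended by zero beyond the index range
  \<open>{..<r}\<close>.\<close>

definition free_mod :: "nat \<Rightarrow> nat \<Rightarrow> (nat \<Rightarrow> 'k::field mpoly) set" where
  "free_mod n r = {v. (\<forall>a<r. v a \<in> carrier (poly_ring n)) \<and> (\<forall>a\<ge>r. v a = 0)}"

text \<open>The \<open>R\<close>-linear map \<open>R\<^sup>r \<rightarrow> R\<^sup>s\<close> sending the
  \<open>a\<close>-th basis element to the vector with entries \<open>M a b\<close>.\<close>

definition mat_map ::
  "nat \<Rightarrow> nat \<Rightarrow> (nat \<Rightarrow> nat \<Rightarrow> 'k::field mpoly) \<Rightarrow> (nat \<Rightarrow> 'k mpoly) \<Rightarrow> (nat \<Rightarrow> 'k mpoly)"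
  where "mat_map r s M v = (\<lambda>b. if b < s then (\<Sum>a<r. v a * M a b) else 0)"

text \<open>A minimal graded free resolution
  \<open>\<dots> \<rightarrow> F\<^sub>2 \<rightarrow> F\<^sub>1 \<rightarrow> F\<^sub>0 = R \<rightarrow> R/I \<rightarrow> 0\<close> of
  \<open>R/I\<close>. The list \<open>ds i\<close> contains the degrees of the basis elements of
  \<open>F\<^sub>i\<close>, so \<open>F\<^sub>i\<close> is the direct sum of the \<open>R(- ds i ! a)\<close>, and \<open>D i\<close> is the
  matrix of \<open>F\<^sub>i\<^sub>+\<^sub>1 \<rightarrow> F\<^sub>i\<close>. The conditions are, in this order: the
  augmentation is the projection of \<open>R\<close> onto \<open>R/I\<close>; the maps are homogeneous of
  degree 0; their entries lie in the graded maximal ideal (minimality); exactness at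
  \<open>F\<^sub>0\<close>; exactness at \<open>F\<^sub>i\<close> for \<open>i > 0\<close>.\<close>

definition min_graded_free_resolution ::
  "nat \<Rightarrow> 'k::field mpoly set \<Rightarrow> (nat \<Rightarrow> int list) \<Rightarrow> (nat \<Rightarrow> nat \<Rightarrow> nat \<Rightarrow> 'k mpoly) \<Rightarrow> bool"
  where
  "min_graded_free_resolution n I ds D \<longleftrightarrow>
     ds 0 = [0] \<and>
     (\<forall>i. \<forall>a<length (ds (Suc i)). \<forall>b<length (ds i). D i a b \<in> hom_part n (ds (Suc i) ! a - ds i ! b)) \<and>
     (\<forall>i. \<forall>a<length (ds (Suc i)). \<forall>b<length (ds i). D i a b \<in> graded_max_ideal n) \<and>
     mat_map (length (ds 1)) 1 (D 0) ` free_mod n (length (ds 1)) = {v \<in> free_mod n 1. v 0 \<in> I} \<and>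
     (\<forall>i. mat_map (length (ds (i + 2))) (length (ds (i + 1))) (D (i + 1)) ` free_mod n (length (ds (i + 2)))
        = {v \<in> free_mod n (length (ds (i + 1))).
             mat_map (length (ds (i + 1))) (length (ds i)) (D i) v = (\<lambda>_. 0)})"

text \<open>The multiplicity of \<open>R(-j)\<close> in \<open>F\<^sub>i\<close>. Minimal graded free
  resolutions are unique up to isomorphism, so it does not matter which one is chosen.\<close>

definition betti :: "nat \<Rightarrow> 'k::field mpoly set \<Rightarrow> nat \<Rightarrow> int \<Rightarrow> nat" where
  "betti n I i j =
     count_list ((SOME ds. \<exists>D. min_graded_free_resolution n I ds D) i) j"

definition quot_reg :: "nat \<Rightarrow> 'k::field mpoly set \<Rightarrow> int" where
  "quot_reg n I = Max {j - int i | i j. betti n I i j \<noteq> 0}"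

subsection \<open>Hilbert series and \<open>h\<close>-polynomial\<close>

text \<open>The \<open>K\<close>-dimension of \<open>(R/I)\<^sub>k\<close>, which is the image of
  \<open>R\<^sub>k\<close> in \<open>R/I\<close>. The field \<open>K\<close> is embedded into
  \<open>R/I\<close> by the classes of the constants.\<close>

definition hilbert_fun :: "nat \<Rightarrow> 'k::field mpoly set \<Rightarrow> nat \<Rightarrow> nat" where
  "hilbert_fun n I k =
     (let R = poly_ring n; A = R Quot I
      in ((ring.dim A) over (range (\<lambda>c. I +>\<^bsub>R\<^esub> const c))) ((\<lambda>p. I +>\<^bsub>R\<^esub> p) ` hom_part n (int k)))"

definition hilbert_series :: "nat \<Rightarrow> 'k::field mpoly set \<Rightarrow> int fps" where
  "hilbert_series n I = Abs_fps (\<lambda>k. int (hilbert_fun n I k))"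

text \<open>The polynomial \<open>h\<close> with Hilbert series \<open>h(t)/(1-t)\<^sup>d\<close>, where
  \<open>d = dim R/I\<close>; it is unique since \<open>(1-t)\<^sup>d\<close> is invertible.\<close>

definition h_poly :: "nat \<Rightarrow> 'k::field mpoly set \<Rightarrow> int poly" where
  "h_poly n I =
     (THE h. hilbert_series n I * (1 - fps_X) ^ quot_dim n I = fps_of_poly h)"


section \<open>Invariants of Cameron--Walker graphs\<close>

text \<open>The edge sets of the Cameron--Walker graphs with vertex set \<open>{1..n}\<close>.\<close>

definition CW :: "nat \<Rightarrow> nat set set set" where
  "CW n = {E. cameron_walker {1..n} E}"

text \<open>The tuple of depth, regularity, dimension and degree of the \<open>h\<close>-polynomial of
  \<open>R/I(G)\<close> over the field \<open>'k\<close>. The conversion \<open>nat\<close> does not lose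
  anything, because \<open>\<beta>\<^sub>0\<^sub>,\<^sub>0 \<noteq> 0\<close> makes the regularity nonnegative.\<close>

definition invariants :: "'k::field itself \<Rightarrow> nat \<Rightarrow> nat set set \<Rightarrow> nat \<times> nat \<times> nat \<times> nat" where
  "invariants _ n E =
     (let I = (edge_ideal n E :: 'k mpoly set)
      in (quot_depth n I, nat (quot_reg n I), quot_dim n I, degree (h_poly n I)))"

definition CW_invariants :: "'k::field itself \<Rightarrow> nat \<Rightarrow> (nat \<times> nat \<times> nat \<times> nat) set" where
  "CW_invariants K n = {invariants K n E | E. E \<in> CW n}"

text \<open>The tuples of the graphs of depth 2.\<close>

definition CW2_invariants :: "'k::field itself \<Rightarrow> nat \<Rightarrow> (nat \<times> nat \<times> nat \<times> nat) set" where
  "CW2_invariants K n = {(a, r, d, h). (a, r, d, h) \<in> CW_invariants K n \<and> a = 2}"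

end

theory Submission
  imports Defs "HOL-Algebra.Ring_Divisibility"
begin

text \<open>The proof reads all four invariants off the graph and then solves an elementary counting problem.

A Cameron--Walker graph consists of a set \<open>A\<close> of vertices with a leaf at each of them, a set
\<open>U\<close> of further vertices which are joined to \<open>A\<close> by a bipartite graph without isolated vertices in
\<open>U\<close>, and triangles attached at vertices of \<open>U\<close> (\<open>cameron_walker_shape\<close>). To see this, take an
induced matching \<open>M\<close> that is also a maximum matching, and let \<open>U\<close> be the set of vertices it misses. As
there is no augmenting path, \<open>U\<close> is independent, and if both ends of an edge of \<open>M\<close> have neighbours in
\<open>U\<close> then they have the same single neighbour. So an edge of \<open>M\<close> is either the base of a triangle or
consists of a vertex of \<open>A\<close> and its leaf.

Let \<open>m\<close> be the number of vertices in \<open>A\<close>, \<open>t\<close> the number of triangles, \<open>q\<close> the number of vertices in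
\<open>U\<close> which are apex of a triangle, and \<open>z\<close> the number of the other vertices in \<open>U\<close>. Then
\<open>n = 2 * m + 2 * t + z + q\<close>, and the invariants are as follows.

\<^item> The regularity is \<open>m + t\<close>, the matching number. By Hochster's formula (\<open>betti_edge_ideal\<close>) the
  regularity is the largest number of vertices of a face in which an induced subcomplex of the
  independence complex has reduced cohomology. This lies between the induced matching number and the
  matching number, which agree here.
\<^item> The dimension is \<open>m + t + z\<close>, the largest cardinality of an independent set
  (\<open>quot_dim_edge_ideal\<close>).
\<^item> The degree of the \<open>h\<close>-polynomial equals the dimension, because the coefficient in question is, up
  to sign, the reduced Euler characteristic of the independence complex
  (\<open>degree_h_poly_edge_ideal\<close>), and this is \<open>1\<close> or \<open>- 1\<close> by a sign-reversing involution.
\<^item> The depth is the least cardinality of a maximal independent set (\<open>depth_edge_ideal\<close>). Depth is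
  computed by Koszul homology (\<open>quot_depth_eq\<close>), hence by the cohomology of the induced
  subcomplexes. The least maximal independent set yields a nonvanishing group, and the lower bound holds
  since all vertices of \<open>A\<close> and all apexes can be removed as shedding vertices, as in the proof that
  vertex decomposable complexes are sequentially Cohen--Macaulay.

A maximal independent set with trace \<open>B\<close> on \<open>U\<close> has \<open>m\<close> vertices in the whiskers, those of \<open>B\<close>, and one
in each triangle whose apex is not in \<open>B\<close>. Hence the depth is at least \<open>m + q\<close>, and exactly that if
\<open>z = 0\<close>. It is at most \<open>m + t\<close>, by \<open>B = {}\<close>. The three families of the theorem are the cases
\<open>z = 0\<close>, depth \<open>m + t\<close> with \<open>z > 0\<close>, and smaller depth. Conversely, \<open>CW_invariants_realize\<close>
builds a graph with depth \<open>m + q\<close> for the numbers \<open>m\<close>, \<open>t\<close>, \<open>q\<close>, \<open>z\<close> that can be computed from a tuple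
in one of the families.\<close>

section \<open>Signed coboundaries\<close>

text \<open>Cochains are functions on finite sets of indices. With all weights \<open>1\<close> the operator \<open>cobd\<close> is the
simplicial coboundary; with the variables as weights it is the differential of the Koszul complex.\<close>

definition pos_sign :: "nat \<Rightarrow> nat set \<Rightarrow> 'a::comm_ring_1" where
  "pos_sign k T = (- 1) ^ card {j\<in>T. j < k}"

definition cobd :: "(nat \<Rightarrow> 'a::comm_ring_1) \<Rightarrow> (nat set \<Rightarrow> 'a) \<Rightarrow> nat set \<Rightarrow> 'a" where
  "cobd w c T = (\<Sum>k\<in>T. pos_sign k T * w k * c (T - {k}))"

definition contr :: "nat \<Rightarrow> (nat set \<Rightarrow> 'a::comm_ring_1) \<Rightarrow> nat set \<Rightarrow> 'a" where
  "contr k c T = (if k \<in> T then 0 else pos_sign k T * c (insert k T))"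

lemma pos_sign_square [simp]: "pos_sign k T * pos_sign k T = (1::'a::comm_ring_1)"
  unfolding pos_sign_def by (simp flip: power_add)

lemma pos_sign_square_left [simp]: "pos_sign k T * (pos_sign k T * x) = (x::'a::comm_ring_1)"
  by (metis mult.assoc mult_1 pos_sign_square)

lemma pos_sign_remove_self [simp]: "pos_sign k (T - {k}) = pos_sign k T"
  unfolding pos_sign_def by (rule arg_cong[of _ _ "\<lambda>S. (- 1) ^ card S"]) auto

lemma pos_sign_insert:
  assumes "finite T" "k \<notin> T"
  shows "pos_sign j (insert k T) = (if k < j then - pos_sign j T else (pos_sign j T :: 'a::comm_ring_1))"
proof (cases "k < j")
  case True
  have "{i \<in> insert k T. i < j} = insert k {i \<in> T. i < j}" using True by auto
  then show ?thesis using True assms by (simp add: pos_sign_def)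
next
  case False
  have "{i \<in> insert k T. i < j} = {i \<in> T. i < j}" using False by auto
  then show ?thesis using False by (simp add: pos_sign_def)
qed

lemma pos_sign_swap:
  assumes "finite T" "j \<in> T" "k \<notin> T"
  shows "pos_sign k T * pos_sign j (insert k T) =
    - (pos_sign j T * pos_sign k (T - {j}) :: 'a::comm_ring_1)"
proof -
  have "pos_sign k T = (if j < k then - pos_sign k (T - {j}) else (pos_sign k (T - {j}) :: 'a))"
    using pos_sign_insert[of "T - {j}" j k] assms by (simp add: insert_absorb)
  moreover have "pos_sign j (insert k T) = (if k < j then - pos_sign j T else (pos_sign j T :: 'a))"
    by (rule pos_sign_insert[OF assms(1,3)])
  moreover have "j < k \<longleftrightarrow> \<not> k < j"
    using assms by (metis less_asym nat_neq_iff)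
  ultimately show ?thesis by auto
qed

lemma cobd_cong: "(\<And>k. k \<in> T \<Longrightarrow> c (T - {k}) = c' (T - {k})) \<Longrightarrow> cobd w c T = cobd w c' T"
  unfolding cobd_def by (intro sum.cong) auto

lemma cobd_empty [simp]: "cobd w c {} = 0"
  by (simp add: cobd_def)

lemma cobd_diff: "cobd w (\<lambda>T. c T - d T) T = cobd w c T - cobd w d T"
  unfolding cobd_def by (simp add: sum_subtractf algebra_simps)

lemma cobd_add: "cobd w (\<lambda>T. c T + d T) T = cobd w c T + cobd w d T"
  unfolding cobd_def by (simp add: sum.distrib algebra_simps)

lemma cobd_uminus: "cobd w (\<lambda>T. - d T) T = - cobd w d T"
  unfolding cobd_def by (simp add: sum_negf)

lemma cobd_scale: "cobd w (\<lambda>T. r * d T) T = r * cobd w d T"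
  unfolding cobd_def by (simp add: sum_distrib_left algebra_simps)

text \<open>The contraction with \<open>k\<close> is a chain homotopy between multiplication by \<open>w k\<close> and
  zero; the next two lemmas are the two cases \<open>k \<notin> T\<close> and \<open>k \<in> T\<close> of
  \<open>contr k (cobd w c) + cobd w (contr k c) = w k * c\<close>.\<close>

lemma contr_cobd:
  fixes c :: "nat set \<Rightarrow> 'a::comm_ring_1"
  assumes "finite T" "k \<notin> T"
  shows "pos_sign k T * cobd w c (insert k T) = w k * c T - cobd w (contr k c) T"
proof -
  have "cobd w c (insert k T) = pos_sign k (insert k T) * w k * c (insert k T - {k})
      + (\<Sum>j\<in>T. pos_sign j (insert k T) * w j * c (insert k T - {j}))"
    unfolding cobd_def using assms by (subst sum.insert) auto
  moreover have "pos_sign k (insert k T) = (pos_sign k T :: 'a)" "insert k T - {k} = T"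
    using assms by (auto simp: pos_sign_insert)
  moreover have "T - {k} = T" using assms by auto
  ultimately have "pos_sign k T * cobd w c (insert k T) = w k * c T
      + (\<Sum>j\<in>T. pos_sign k T * pos_sign j (insert k T) * w j * c (insert k T - {j}))"
    by (simp add: distrib_left sum_distrib_left mult.assoc)
  also have "(\<Sum>j\<in>T. pos_sign k T * pos_sign j (insert k T) * w j * c (insert k T - {j}))
      = (\<Sum>j\<in>T. - (pos_sign j T * w j * contr k c (T - {j})))"
  proof (rule sum.cong[OF refl])
    fix j assume j: "j \<in> T"
    then have "insert k T - {j} = insert k (T - {j})" using assms by auto
    then show "pos_sign k T * pos_sign j (insert k T) * w j * c (insert k T - {j})
        = - (pos_sign j T * w j * contr k c (T - {j}))"
      using assms by (simp add: pos_sign_swap[OF assms(1) j assms(2)] contr_def algebra_simps)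
  qed
  finally show ?thesis by (simp add: sum_negf cobd_def)
qed

lemma cobd_contr:
  assumes "finite T" "k \<in> T"
  shows "cobd w (contr k c) T = w k * c T"
proof -
  have "cobd w (contr k c) T = (\<Sum>j\<in>T. if j = k then w k * c T else 0)"
    unfolding cobd_def
    using assms by (intro sum.cong) (auto simp: contr_def insert_absorb mult_ac)
  then show ?thesis using assms by simp
qed

lemma cobd_cobd: "finite T \<Longrightarrow> cobd w (cobd w c) T = 0"
proof (induction T arbitrary: c rule: finite_induct)
  case empty
  then show ?case by simp
next
  case (insert k T)
  have "cobd w (contr k (cobd w c)) T = cobd w (\<lambda>S. w k * c S - cobd w (contr k c) S) T"
    using insert.hyps by (intro cobd_cong) (auto simp: contr_def contr_cobd)
  also have "\<dots> = w k * cobd w c T"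
    by (simp add: cobd_diff cobd_scale insert.IH)
  finally have "pos_sign k T * cobd w (cobd w c) (insert k T) = 0"
    using contr_cobd[OF insert.hyps, of w "cobd w c"] by simp
  then show ?case by (metis mult_zero_right pos_sign_square_left)
qed

section \<open>Reduced cohomology of simplicial complexes\<close>

text \<open>In \<open>acyclic_at K \<Phi> p\<close> the degree \<open>p\<close> is the number of vertices of a
  face, so that the reduced cohomology of \<open>\<Phi>\<close> over \<open>K\<close> in dimension \<open>p - 1\<close>
  vanishes.\<close>

definition acyclic_at :: "'a::comm_ring_1 itself \<Rightarrow> nat set set \<Rightarrow> nat \<Rightarrow> bool" where
  "acyclic_at _ \<Phi> p \<longleftrightarrow>
     (\<forall>a::nat set \<Rightarrow> 'a. (\<forall>F\<in>\<Phi>. card F = Suc p \<longrightarrow> cobd (\<lambda>_. 1) a F = 0) \<longrightarrow>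
        (\<exists>b. \<forall>F\<in>\<Phi>. card F = p \<longrightarrow> a F = cobd (\<lambda>_. 1) b F))"

lemma acyclic_atD:
  fixes a :: "nat set \<Rightarrow> 'a::comm_ring_1"
  assumes "acyclic_at TYPE('a) \<Phi> p"
    and "\<And>F. F \<in> \<Phi> \<Longrightarrow> card F = Suc p \<Longrightarrow> cobd (\<lambda>_. 1) a F = 0"
  shows "\<exists>b. \<forall>F\<in>\<Phi>. card F = p \<longrightarrow> a F = cobd (\<lambda>_. 1) b F"
  using assms unfolding acyclic_at_def by blast

definition complex :: "nat set set \<Rightarrow> bool" where
  "complex \<Phi> \<longleftrightarrow> (\<forall>F\<in>\<Phi>. finite F \<and> (\<forall>G. G \<subseteq> F \<longrightarrow> G \<in> \<Phi>))"

definition deletion :: "nat \<Rightarrow> nat set set \<Rightarrow> nat set set" where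
  "deletion v \<Phi> = {F\<in>\<Phi>. v \<notin> F}"

definition link :: "nat \<Rightarrow> nat set set \<Rightarrow> nat set set" where
  "link v \<Phi> = {F. v \<notin> F \<and> insert v F \<in> \<Phi>}"

text \<open>The contraction with the apex of a cone is a null homotopy.\<close>

lemma acyclic_at_cone:
  assumes \<Phi>: "complex \<Phi>" and cone: "\<And>F. F \<in> \<Phi> \<Longrightarrow> insert k F \<in> \<Phi>"
  shows "acyclic_at TYPE('a::comm_ring_1) \<Phi> p"
  unfolding acyclic_at_def
proof (intro allI impI)
  fix a :: "nat set \<Rightarrow> 'a"
  assume a: "\<forall>F\<in>\<Phi>. card F = Suc p \<longrightarrow> cobd (\<lambda>_. 1) a F = 0"
  have "a F = cobd (\<lambda>_. 1) (contr k a) F" if F: "F \<in> \<Phi>" "card F = p" for F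
  proof -
    have fin: "finite F" using \<Phi> F by (auto simp: complex_def)
    show ?thesis
    proof (cases "k \<in> F")
      case True
      then show ?thesis using cobd_contr[OF fin True, of "\<lambda>_. 1" a] by simp
    next
      case False
      then have "cobd (\<lambda>_. 1) a (insert k F) = 0" using a cone F fin by simp
      then show ?thesis using contr_cobd[OF fin False, of "\<lambda>_. 1" a] by simp
    qed
  qed
  then show "\<exists>b. \<forall>F\<in>\<Phi>. card F = p \<longrightarrow> a F = cobd (\<lambda>_. 1) b F" by blast
qed

text \<open>This lemma and the next are the two pieces of the long exact sequence of the pair given by \<open>\<Phi>\<close> and
the deletion of \<open>v\<close>, whose relative cohomology is the cohomology of the link, shifted by one.\<close>

lemma acyclic_at_deletion_link:
  assumes \<Phi>: "complex \<Phi>"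
    and del: "acyclic_at TYPE('a::comm_ring_1) (deletion v \<Phi>) p"
    and lnk: "p = 0 \<or> acyclic_at TYPE('a) (link v \<Phi>) (p - 1)"
  shows "acyclic_at TYPE('a) \<Phi> p"
  unfolding acyclic_at_def
proof (intro allI impI)
  let ?d = "cobd (\<lambda>_. 1::'a)"
  fix a :: "nat set \<Rightarrow> 'a"
  assume a: "\<forall>F\<in>\<Phi>. card F = Suc p \<longrightarrow> ?d a F = 0"
  have fin: "finite F" if "F \<in> \<Phi>" for F using \<Phi> that by (auto simp: complex_def)
  obtain b0 where b0: "\<And>F. F \<in> deletion v \<Phi> \<Longrightarrow> card F = p \<Longrightarrow> a F = ?d b0 F"
    using acyclic_atD[OF del, of a] a by (auto simp: deletion_def)
  define b0' where "b0' = (\<lambda>F. if v \<in> F then 0 else b0 F)"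
  define a' where "a' = (\<lambda>F. a F - ?d b0' F)"
  have a'_del: "a' F = 0" if "F \<in> \<Phi>" "v \<notin> F" "card F = p" for F
  proof -
    have "?d b0' F = ?d b0 F" using that by (intro cobd_cong) (auto simp: b0'_def)
    then show ?thesis using b0 that by (simp add: a'_def deletion_def)
  qed
  have a'_cocycle: "?d a' F = 0" if "F \<in> \<Phi>" "card F = Suc p" for F
    using that a fin by (simp add: a'_def cobd_diff cobd_cobd)
  show "\<exists>b. \<forall>F\<in>\<Phi>. card F = p \<longrightarrow> a F = ?d b F"
  proof (cases p)
    case 0
    then have "a F = ?d b0 F" if "F \<in> \<Phi>" "card F = p" for F
      using b0 that fin[of F] by (auto simp: deletion_def)
    then show ?thesis by blast
  next
    case (Suc q)
    have lnkI: "F \<in> \<Phi>" "card (insert v F) = Suc (card F)" if "F \<in> link v \<Phi>" for F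
    proof -
      have "insert v F \<in> \<Phi>" "v \<notin> F" using that by (auto simp: link_def)
      then show "F \<in> \<Phi>" "card (insert v F) = Suc (card F)"
        using \<Phi> fin[of "insert v F"] by (auto simp: complex_def)
    qed
    have contr_cocycle: "?d (contr v a') F = 0" if F: "F \<in> link v \<Phi>" "card F = p" for F
    proof -
      have "?d a' (insert v F) = 0"
        using a'_cocycle[of "insert v F"] lnkI(2)[OF F(1)] F by (auto simp: link_def)
      moreover have "a' F = 0" using a'_del[of F] lnkI(1)[OF F(1)] F by (auto simp: link_def)
      ultimately show ?thesis
        using contr_cobd[of F v "\<lambda>_. 1" a'] F fin lnkI(1)[of F] by (auto simp: link_def)
    qed
    have "acyclic_at TYPE('a) (link v \<Phi>) q" using lnk Suc by simp
    then obtain b1 where b1: "\<And>F. F \<in> link v \<Phi> \<Longrightarrow> card F = q \<Longrightarrow> contr v a' F = ?d b1 F"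
      using acyclic_atD[of "link v \<Phi>" q "contr v a'"] contr_cocycle Suc by blast
    define b2 where "b2 = (\<lambda>F. if v \<in> F then - (pos_sign v (F - {v}) * b1 (F - {v})) else 0)"
    have "a F = ?d (\<lambda>F. b0' F + b2 F) F" if F: "F \<in> \<Phi>" "card F = p" for F
    proof (cases "v \<in> F")
      case False
      then have "?d b2 F = ?d (\<lambda>_. 0) F" by (intro cobd_cong) (auto simp: b2_def)
      then show ?thesis using a'_del F False by (simp add: a'_def cobd_add) (simp add: cobd_def)
    next
      case True
      define G where "G = F - {v}"
      have G: "insert v G = F" "v \<notin> G" "finite G" "card G = q"
        using True F Suc fin by (auto simp: G_def)
      have "?d (contr v b2) G = ?d (\<lambda>S. - b1 S) G"
        using G by (intro cobd_cong) (auto simp: contr_def b2_def simp flip: mult.assoc)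
      then have "pos_sign v G * ?d b2 F = ?d b1 G"
        using contr_cobd[OF G(3,2), of "\<lambda>_. 1" b2] G by (simp add: cobd_uminus b2_def)
      also have "\<dots> = contr v a' G" using b1[of G] G F by (auto simp: link_def)
      also have "\<dots> = pos_sign v G * a' F" using G by (simp add: contr_def)
      finally have "?d b2 F = a' F" by (metis pos_sign_square_left)
      then show ?thesis by (simp add: a'_def cobd_add)
    qed
    then show ?thesis by blast
  qed
qed

lemma acyclic_at_link:
  assumes \<Phi>: "complex \<Phi>"
    and del: "acyclic_at TYPE('a::comm_ring_1) (deletion v \<Phi>) k"
    and whole: "acyclic_at TYPE('a) \<Phi> (Suc k)"
  shows "acyclic_at TYPE('a) (link v \<Phi>) k"
  unfolding acyclic_at_def
proof (intro allI impI)
  let ?d = "cobd (\<lambda>_. 1::'a)"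
  fix z :: "nat set \<Rightarrow> 'a"
  assume z: "\<forall>F\<in>link v \<Phi>. card F = Suc k \<longrightarrow> ?d z F = 0"
  have fin: "finite F" if "F \<in> \<Phi>" for F using \<Phi> that by (auto simp: complex_def)
  have sub: "F \<in> \<Phi>" if "F \<in> link v \<Phi>" for F
    using \<Phi> that by (auto simp: complex_def link_def)
  define a where "a = (\<lambda>F. if v \<in> F then pos_sign v (F - {v}) * z (F - {v}) else 0)"
  have contr_a: "contr v a F = z F" if "v \<notin> F" for F
    using that by (simp add: contr_def a_def)
  have "?d a F = 0" if F: "F \<in> \<Phi>" "card F = Suc (Suc k)" for F
  proof (cases "v \<in> F")
    case False
    then have "?d a F = ?d (\<lambda>_. 0) F" by (intro cobd_cong) (auto simp: a_def)
    then show ?thesis by (simp add: cobd_def)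
  next
    case True
    define G where "G = F - {v}"
    have G: "insert v G = F" "v \<notin> G" "finite G" "card G = Suc k" "G \<in> link v \<Phi>"
      using True F fin by (auto simp: G_def link_def insert_absorb)
    have "?d (contr v a) G = ?d z G" using G contr_a by (intro cobd_cong) auto
    then have "pos_sign v G * ?d a F = 0"
      using contr_cobd[OF G(3,2), of "\<lambda>_. 1" a] G z by (simp add: a_def)
    then show ?thesis by (metis mult_zero_right pos_sign_square_left)
  qed
  then obtain b where b: "\<And>F. F \<in> \<Phi> \<Longrightarrow> card F = Suc k \<Longrightarrow> a F = ?d b F"
    using acyclic_atD[OF whole, of a] by blast
  have "?d b F = 0" if "F \<in> deletion v \<Phi>" "card F = Suc k" for F
    using b[of F] that by (simp add: deletion_def a_def)
  then obtain c where c: "\<And>F. F \<in> deletion v \<Phi> \<Longrightarrow> card F = k \<Longrightarrow> b F = ?d c F"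
    using acyclic_atD[OF del, of b] by blast
  have "z F = ?d (\<lambda>F. c F - contr v b F) F" if F: "F \<in> link v \<Phi>" "card F = k" for F
  proof -
    have v: "v \<notin> F" "insert v F \<in> \<Phi>" using F by (auto simp: link_def)
    have finF: "finite F" using fin[OF v(2)] by simp
    have "z F = pos_sign v F * ?d b (insert v F)"
      using contr_a[OF v(1)] b[of "insert v F"] v F finF by (simp add: contr_def)
    also have "\<dots> = b F - ?d (contr v b) F" using contr_cobd[OF finF v(1), of "\<lambda>_. 1" b] by simp
    also have "b F = ?d c F" using c[of F] F sub v by (simp add: deletion_def)
    finally show ?thesis by (simp add: cobd_diff)
  qed
  then show "\<exists>b. \<forall>F\<in>link v \<Phi>. card F = k \<longrightarrow> z F = ?d b F" by blast
qed

section \<open>Independence complexes\<close>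

definition indeps :: "nat set set \<Rightarrow> nat set \<Rightarrow> nat set set" where
  "indeps E W = {F. F \<subseteq> W \<and> (\<forall>e\<in>E. \<not> e \<subseteq> F)}"

definition nbrs :: "nat set set \<Rightarrow> nat \<Rightarrow> nat set" where
  "nbrs E v = {u. {u, v} \<in> E}"

definition max_indep :: "nat set set \<Rightarrow> nat set \<Rightarrow> nat set \<Rightarrow> bool" where
  "max_indep E V S \<longleftrightarrow> S \<in> indeps E V \<and> (\<forall>v\<in>V - S. \<exists>s\<in>S. {v, s} \<in> E)"

lemma complex_indeps: "finite W \<Longrightarrow> complex (indeps E W)"
  by (auto simp: complex_def indeps_def intro: finite_subset)

lemma deletion_indeps: "deletion v (indeps E W) = indeps E (W - {v})"
  by (auto simp: deletion_def indeps_def)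

lemma insert_indeps_iff:
  assumes E: "\<forall>e\<in>E. card e = 2" and v: "v \<notin> F"
  shows "insert v F \<in> indeps E W \<longleftrightarrow> v \<in> W \<and> F \<in> indeps E (W - {v} - nbrs E v)"
proof
  assume *: "insert v F \<in> indeps E W"
  then have "{u, v} \<notin> E" if "u \<in> F" for u using that by (force simp: indeps_def)
  then show "v \<in> W \<and> F \<in> indeps E (W - {v} - nbrs E v)"
    using * v by (fastforce simp: indeps_def nbrs_def)
next
  assume *: "v \<in> W \<and> F \<in> indeps E (W - {v} - nbrs E v)"
  have "\<not> e \<subseteq> insert v F" if e: "e \<in> E" for e
  proof
    assume sub: "e \<subseteq> insert v F"
    obtain a b where ab: "e = {a, b}" "a \<noteq> b" using E e by (metis card_2_iff)
    show False
    proof (cases "v \<in> e")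
      case False
      then show False using * sub e by (auto simp: indeps_def)
    next
      case True
      then obtain u where "e = {u, v}" "u \<noteq> v" using ab by auto
      then show False using * sub e by (auto simp: indeps_def nbrs_def)
    qed
  qed
  then show "insert v F \<in> indeps E W" using * by (auto simp: indeps_def)
qed

lemma link_indeps:
  assumes "\<forall>e\<in>E. card e = 2" "v \<in> W"
  shows "link v (indeps E W) = indeps E (W - {v} - nbrs E v)"
proof (rule Set.set_eqI)
  fix F
  show "F \<in> link v (indeps E W) \<longleftrightarrow> F \<in> indeps E (W - {v} - nbrs E v)"
    using insert_indeps_iff[OF assms(1), of v F W] assms(2)
    by (cases "v \<in> F") (auto simp: link_def, auto simp: indeps_def)
qed

lemma acyclic_at_indeps_isolated:
  assumes E: "\<forall>e\<in>E. card e = 2" and W: "finite W" "v \<in> W" "nbrs E v \<inter> W = {}"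
  shows "acyclic_at TYPE('a::comm_ring_1) (indeps E W) p"
proof (rule acyclic_at_cone[OF complex_indeps[OF W(1)]])
  fix F assume F: "F \<in> indeps E W"
  show "insert v F \<in> indeps E W"
  proof (cases "v \<in> F")
    case True
    then show ?thesis using F by (simp add: insert_absorb)
  next
    case False
    then show ?thesis
      using insert_indeps_iff[OF E False] F W by (fastforce simp: indeps_def)
  qed
qed

lemma indeps_empty: "\<forall>e\<in>E. card e = 2 \<Longrightarrow> indeps E {} = {{}}"
  by (auto simp: indeps_def)

lemma not_acyclic_at_indeps_empty:
  assumes E: "\<forall>e\<in>E. card e = 2"
  shows "\<not> acyclic_at TYPE('a::comm_ring_1) (indeps E {}) p \<longleftrightarrow> p = 0"
proof
  assume "p = 0"
  have "\<not> (\<exists>b. \<forall>F\<in>indeps E {}. card F = p \<longrightarrow> (1::'a) = cobd (\<lambda>_. 1) b F)"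
    by (simp add: indeps_empty[OF E] \<open>p = 0\<close>)
  then show "\<not> acyclic_at TYPE('a) (indeps E {}) p"
    using acyclic_atD[of "indeps E {}" p "\<lambda>_. 1::'a"] by (auto simp: indeps_empty[OF E])
next
  assume "\<not> acyclic_at TYPE('a) (indeps E {}) p"
  then show "p = 0" by (auto simp: acyclic_at_def indeps_empty[OF E])
qed

lemma not_acyclic_at_indeps_cases:
  assumes E: "\<forall>e\<in>E. card e = 2" and W: "finite W" "v \<in> W"
    and ne: "\<not> acyclic_at TYPE('a::comm_ring_1) (indeps E W) p"
  shows "\<not> acyclic_at TYPE('a) (indeps E (W - {v})) p \<or>
    0 < p \<and> \<not> acyclic_at TYPE('a) (indeps E (W - {v} - nbrs E v)) (p - 1)"
  using acyclic_at_deletion_link[OF complex_indeps[OF W(1), of E], of v p, where ?'a = 'a] ne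
  by (cases p) (auto simp: deletion_indeps link_indeps[OF E W(2)])

lemma not_acyclic_at_link_cases:
  assumes E: "\<forall>e\<in>E. card e = 2" and W: "finite W" "v \<in> W"
    and ne: "\<not> acyclic_at TYPE('a::comm_ring_1) (indeps E (W - {v} - nbrs E v)) p"
  shows "\<not> acyclic_at TYPE('a) (indeps E (W - {v})) p \<or> \<not> acyclic_at TYPE('a) (indeps E W) (Suc p)"
  using acyclic_at_link[OF complex_indeps[OF W(1), of E], of v p, where ?'a = 'a] ne
  by (auto simp: deletion_indeps link_indeps[OF E W(2)])

text \<open>Removing an end \<open>v\<close> of an edge either keeps the cohomology class or, passing to the link, lowers the
degree by one. In the second case the neighbours of \<open>v\<close> are gone too, so the edge can be added to the
matching found in the rest.\<close>

lemma cohomology_degree_le_matching: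
  assumes E: "\<forall>e\<in>E. card e = 2" and W: "finite W"
    and ne: "\<not> acyclic_at TYPE('a::comm_ring_1) (indeps E W) p"
  shows "\<exists>M. matching E M \<and> \<Union>M \<subseteq> W \<and> p \<le> card M"
  using W ne
proof (induction "card W" arbitrary: W p rule: less_induct)
  case less
  note W = less.prems(1)
  show ?case
  proof (cases "\<exists>u\<in>W. \<exists>v\<in>W. {u, v} \<in> E")
    case True
    then obtain u v where uv: "u \<in> W" "v \<in> W" "{u, v} \<in> E" by blast
    then have "u \<noteq> v" using E by force
    have cd: "card (W - {v}) < card W" "card (W - {v} - nbrs E v) < card W"
      by (rule psubset_card_mono[OF W], use uv in blast)+
    consider "\<not> acyclic_at TYPE('a) (indeps E (W - {v})) p"
      | "0 < p" "\<not> acyclic_at TYPE('a) (indeps E (W - {v} - nbrs E v)) (p - 1)"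
      using not_acyclic_at_indeps_cases[OF E W uv(2) less.prems(2)] by blast
    then show ?thesis
    proof cases
      case 1
      then obtain M where "matching E M" "\<Union>M \<subseteq> W - {v}" "p \<le> card M"
        using less.hyps[OF cd(1) finite_Diff[OF W]] by blast
      then show ?thesis by (intro exI[of _ M]) auto
    next
      case 2
      then obtain M where M: "matching E M" "\<Union>M \<subseteq> W - {v} - nbrs E v" "p - 1 \<le> card M"
        using less.hyps[OF cd(2)] finite_Diff[OF W] by (meson finite_Diff)
      have "finite M" using M(2) W by (meson finite_Diff finite_UnionD finite_subset)
      have "{u, v} \<notin> M" using M(2) by auto
      have "u \<in> nbrs E v" using uv by (simp add: nbrs_def)
      then have "disjnt {u, v} e" if "e \<in> M" for e
        using M(2) that by (auto simp: disjnt_def)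
      then have "matching E (insert {u, v} M)"
        using M(1) uv(3) by (auto simp: matching_def pairwise_insert disjnt_sym)
      moreover have "p \<le> card (insert {u, v} M)"
        using M(3) \<open>finite M\<close> \<open>{u, v} \<notin> M\<close> by simp
      ultimately show ?thesis using M uv by (intro exI[of _ "insert {u, v} M"]) auto
    qed
  next
    case False
    have "W = {}"
    proof (rule ccontr)
      assume "W \<noteq> {}"
      then obtain v where v: "v \<in> W" by blast
      then have "nbrs E v \<inter> W = {}" using False unfolding nbrs_def by blast
      then show False using acyclic_at_indeps_isolated[OF E W v] less.prems(2) by blast
    qed
    then have "p = 0" using not_acyclic_at_indeps_empty[OF E] less.prems(2) by blast
    then show ?thesis by (intro exI[of _ "{}"]) (auto simp: matching_def)
  qed
qed

text \<open>On an induced matching the independence complex is the boundary of a cross polytope, a sphere. For the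
induction, let \<open>a\<close> be an end of the added edge: the link of \<open>a\<close> is the complex of the remaining edges, and
the deletion of \<open>a\<close> is a cone over the other end.\<close>

lemma induced_matching_not_acyclic:
  assumes E: "\<forall>e\<in>E. card e = 2" and "finite M" "induced_matching E M"
  shows "\<not> acyclic_at TYPE('a::comm_ring_1) (indeps E (\<Union>M)) (card M)"
  using assms(2,3)
proof (induction M rule: finite_induct)
  case empty
  then show ?case using not_acyclic_at_indeps_empty[OF E, where ?'a = 'a] by simp
next
  case (insert e M)
  have "matching E (insert e M)" using insert.prems by (simp add: induced_matching_def)
  then have im: "e \<in> E" "M \<subseteq> E" "\<And>e'. e' \<in> M \<Longrightarrow> e \<inter> e' = {}"
    using insert.hyps(2) unfolding matching_def pairwise_insert disjnt_def by blast+
  have im4: "f \<inter> e' = {}" if "e' \<in> M" "f \<in> E" "f \<inter> e \<noteq> {}" for e' f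
    using insert.prems[unfolded induced_matching_def, THEN conjunct2, rule_format, of e e']
      that insert.hyps(2) by auto
  obtain a b where ab: "e = {a, b}" "a \<noteq> b" using E im by (metis card_2_iff)
  let ?W = "\<Union>(insert e M)"
  have "finite e'" if "e' \<in> insert e M" for e'
  proof -
    have "card e' = 2" using that im(1,2) E by blast
    then show ?thesis by (metis card.infinite zero_neq_numeral)
  qed
  then have W: "finite ?W" "a \<in> ?W" using insert.hyps ab by auto
  have IH: "\<not> acyclic_at TYPE('a) (indeps E (\<Union>M)) (card M)"
    by (rule insert.IH, use insert.prems in \<open>unfold induced_matching_def matching_def pairwise_insert\<close>) blast
  have notM: "a \<notin> \<Union>M" "b \<notin> \<Union>M" using im(3) ab by auto
  have nb: "x \<notin> \<Union>M" if "{x, y} \<in> E" "y \<in> e" for x y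
    using im4[of _ "{x, y}"] that by auto
  have "x \<noteq> y" if "{x, y} \<in> E" for x y using that E by force
  then have "?W - {a} - nbrs E a = \<Union>M"
    using nb notM im(1) ab by (auto simp: nbrs_def insert_commute)
  moreover have "acyclic_at TYPE('a) (indeps E (?W - {a})) (card M)"
    using W nb ab E by (intro acyclic_at_indeps_isolated[of E _ b]) (fastforce simp: nbrs_def)+
  ultimately show ?case
    using not_acyclic_at_link_cases[OF E W, of "card M", where ?'a = 'a] IH insert.hyps by simp
qed

text \<open>By induction along the vertices of \<open>A\<close>, replacing the graph by the link of one of them. A class in the
link comes from a class either in the deletion or, one degree higher, in the whole complex. In both cases
the sum of the degree and the number of missing vertices is as required.\<close>

lemma maximal_indep_not_acyclic:
  assumes E: "\<forall>e\<in>E. card e = 2" and "finite V" "max_indep E V A"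
  shows "\<exists>W\<subseteq>V. card (V - W) \<le> card A \<and>
    \<not> acyclic_at TYPE('a::comm_ring_1) (indeps E W) (card A - card (V - W))"
  using assms(2,3)
proof (induction "card A" arbitrary: A V)
  case 0
  then have "A = {}" by (auto simp: max_indep_def indeps_def dest: finite_subset)
  then have "V = {}" using 0 by (auto simp: max_indep_def)
  then show ?case using \<open>A = {}\<close> not_acyclic_at_indeps_empty[OF E, where ?'a = 'a] by auto
next
  case (Suc k)
  then obtain v where v: "v \<in> A" by fastforce
  have AV: "A \<subseteq> V" "finite A" using Suc.prems by (auto simp: max_indep_def indeps_def dest: finite_subset)
  let ?L = "V - {v} - nbrs E v"
  have "insert v (A - {v}) \<in> indeps E V" using Suc.prems v by (auto simp: max_indep_def insert_absorb)
  then have AL: "A - {v} \<in> indeps E ?L" using insert_indeps_iff[OF E, of v "A - {v}"] by simp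
  have "max_indep E ?L (A - {v})"
    using Suc.prems AL by (auto simp: max_indep_def nbrs_def)
  moreover have k: "k = card (A - {v})" using Suc.hyps(2) v AV by simp
  ultimately obtain W where W: "W \<subseteq> ?L" "card (?L - W) \<le> k"
    "\<not> acyclic_at TYPE('a) (indeps E W) (k - card (?L - W))"
    using Suc.hyps(1)[of "A - {v}" ?L] Suc.prems by (metis finite_Diff)
  define W1 where "W1 = W \<union> (nbrs E v \<inter> V)"
  have vW: "v \<notin> W" "v \<notin> nbrs E v" "v \<in> V" using W E v AV by (force simp: nbrs_def)+
  have "insert v W1 - {v} - nbrs E v = W" "insert v W1 - {v} = W1"
    using W vW by (auto simp: W1_def)
  moreover have "finite (insert v W1)"
    using W Suc.prems by (auto simp: W1_def intro: finite_subset)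
  ultimately have or: "\<not> acyclic_at TYPE('a) (indeps E W1) (k - card (?L - W)) \<or>
      \<not> acyclic_at TYPE('a) (indeps E (insert v W1)) (Suc (k - card (?L - W)))"
    using not_acyclic_at_link_cases[OF E, of "insert v W1" v "k - card (?L - W)", where ?'a = 'a] W by simp
  have V1: "V - insert v W1 = ?L - W" "V - W1 = insert v (?L - W)"
    using W vW by (auto simp: W1_def)
  have "card (V - W1) = Suc (card (?L - W))"
    unfolding V1 using Suc.prems by (subst card_insert_disjoint) auto
  moreover have "W1 \<subseteq> V" "insert v W1 \<subseteq> V" using W vW by (auto simp: W1_def)
  ultimately show ?case
    using or W(2) V1(1) unfolding Suc.hyps(2)[symmetric]
    by (elim disjE) (rule exI[of _ W1] exI[of _ "insert v W1"], simp add: Suc_diff_le)+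
qed

text \<open>The vertices of \<open>C\<close> can be removed one at a time by shedding; what remains has only
  isolated vertices and isolated edges. The vertex \<open>s\<close> makes \<open>c\<close> a shedding vertex: a maximal independent
  set of the graph without \<open>c\<close> contains \<open>s\<close> or a neighbour of \<open>s\<close>, hence a neighbour of \<open>c\<close>. The
  last condition on \<open>s\<close> ensures that \<open>s\<close> survives when another vertex of \<open>C\<close> and its neighbours are
  removed.\<close>

definition shedding_core :: "nat set set \<Rightarrow> nat set \<Rightarrow> nat set \<Rightarrow> bool" where
  "shedding_core E V C \<longleftrightarrow>
     (\<forall>c\<in>C \<inter> V. \<exists>s\<in>V - C. {s, c} \<in> E \<and> nbrs E s \<inter> V \<subseteq> insert c (nbrs E c) \<and> nbrs E s \<inter> C = {c}) \<and>
     (\<forall>s\<in>V - C. \<forall>u\<in>V - C. \<forall>u'\<in>V - C. {s, u} \<in> E \<longrightarrow> {s, u'} \<in> E \<longrightarrow> u = u')"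

text \<open>Induction over the shedding vertices. If \<open>c\<close> is removed, the maximal independent sets are still maximal in
the whole graph; if \<open>c\<close> is removed with its neighbours, they become so after adding \<open>c\<close>. Thus the bound
\<open>d\<close> is kept for the deletion and drops by at most one for the link, which suffices as the cohomology
class survives in the deletion or moves to the link with degree lowered by one.\<close>

lemma shedding_core_depth:
  assumes E: "\<forall>e\<in>E. card e = 2" and "finite V" "shedding_core E V C"
    and "\<And>S. max_indep E V S \<Longrightarrow> d \<le> card S"
    and "W \<subseteq> V" "\<not> acyclic_at TYPE('a::comm_ring_1) (indeps E W) k"
  shows "d \<le> card (V - W) + k"
  using assms(2-)
proof (induction "card V" arbitrary: V C W d k rule: less_induct)
  case less
  note V = less.prems(1) and core = less.prems(2)
  note WV = less.prems(4)
  have noloop: "x \<noteq> y" if "{x, y} \<in> E" for x y using that E by force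
  have finW: "finite W" using WV V by (rule finite_subset)
  show ?case
  proof (cases "\<exists>u\<in>V. \<exists>v\<in>V. {u, v} \<in> E")
    case False
    have "max_indep E V V"
      using False E by (auto simp: max_indep_def indeps_def card_2_iff)
    then have "d \<le> card V" by (rule less.prems(3))
    moreover have "W = {}"
    proof (rule ccontr)
      assume "W \<noteq> {}"
      then obtain v where v: "v \<in> W" by blast
      then have "nbrs E v \<inter> W = {}" using False WV unfolding nbrs_def by blast
      then show False using acyclic_at_indeps_isolated[OF E finW v] less.prems(5) by blast
    qed
    ultimately show ?thesis by simp
  next
    case True
    \<comment> \<open>Once the core is used up, either end of an isolated edge is a shedding vertex.\<close>
    obtain c s where cs: "c \<in> V" "s \<in> V" "{s, c} \<in> E" "nbrs E s \<inter> V \<subseteq> insert c (nbrs E c)"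
      and core': "c \<in> C \<or> C \<inter> V = {}"
    proof (cases "C \<inter> V = {}")
      case True
      obtain u v where "u \<in> V" "v \<in> V" "{u, v} \<in> E" using \<open>\<exists>u\<in>V. \<exists>v\<in>V. {u, v} \<in> E\<close> by blast
      moreover have "u' = v" if "u' \<in> V" "{u', u} \<in> E" for u'
      proof -
        have "V - C = V" using True by auto
        then show ?thesis
          using core that calculation unfolding shedding_core_def by (metis insert_commute)
      qed
      then have "nbrs E u \<inter> V \<subseteq> insert v (nbrs E v)" by (auto simp: nbrs_def)
      ultimately show ?thesis using that[of v u] True by blast
    next
      case False
      then obtain c where c: "c \<in> C" "c \<in> V" by blast
      then obtain s where "s \<in> V" "{s, c} \<in> E" "nbrs E s \<inter> V \<subseteq> insert c (nbrs E c)"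
        using core unfolding shedding_core_def by blast
      then show ?thesis using that c by blast
    qed
    let ?D = "V - {c}" and ?L = "V - {c} - nbrs E c"
    have cd: "card ?D < card V" "card ?L < card V"
      by (rule psubset_card_mono[OF V], use cs in blast)+
    have maxD: "d \<le> card S" if S: "max_indep E ?D S" for S
    proof (rule less.prems(3))
      have "\<exists>t\<in>S. {c, t} \<in> E"
      proof (cases "s \<in> S")
        case True
        then show ?thesis using cs by (auto simp: insert_commute)
      next
        case False
        then obtain t where "t \<in> S" "{s, t} \<in> E"
          using S cs noloop unfolding max_indep_def by blast
        moreover have "t \<in> V" "t \<noteq> c" using S \<open>t \<in> S\<close> by (auto simp: max_indep_def indeps_def)
        ultimately show ?thesis using cs by (auto simp: nbrs_def insert_commute)
      qed
      then show "max_indep E V S" using S by (auto simp: max_indep_def indeps_def)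
    qed
    have maxL: "d - 1 \<le> card S" if S: "max_indep E ?L S" for S
    proof -
      have "c \<notin> S" using S by (auto simp: max_indep_def indeps_def)
      then have "insert c S \<in> indeps E V"
        using insert_indeps_iff[OF E] S cs by (auto simp: max_indep_def)
      then have "max_indep E V (insert c S)"
        using S by (auto simp: max_indep_def nbrs_def)
      then have "d \<le> card (insert c S)" by (rule less.prems(3))
      moreover have "finite S" using S V by (auto simp: max_indep_def indeps_def dest: finite_subset)
      ultimately show ?thesis using \<open>c \<notin> S\<close> by simp
    qed
    have coreD: "shedding_core E ?D (C - {c})"
    proof -
      have "?D - (C - {c}) = V - C" if "c \<in> C" using that by auto
      moreover have "?D - (C - {c}) \<subseteq> V - C" if "c \<notin> C" using that by auto
      ultimately have sub: "?D - (C - {c}) \<subseteq> V - C" by blast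
      have ex: "\<exists>s\<in>?D - (C - {c}). {s, x} \<in> E \<and> nbrs E s \<inter> ?D \<subseteq> insert x (nbrs E x) \<and>
          nbrs E s \<inter> (C - {c}) = {x}" if x: "x \<in> (C - {c}) \<inter> ?D" for x
      proof -
        obtain s where "s \<in> V - C" "{s, x} \<in> E" "nbrs E s \<inter> V \<subseteq> insert x (nbrs E x)" "nbrs E s \<inter> C = {x}"
          using core[unfolded shedding_core_def, THEN conjunct1] x by blast
        moreover have "c \<in> C" using core' x by auto
        ultimately show ?thesis using x by (intro bexI[of _ s]) auto
      qed
      show ?thesis
        unfolding shedding_core_def using ex core[unfolded shedding_core_def, THEN conjunct2] sub
        by (intro conjI) (blast, meson subsetD)
    qed
    have coreL: "shedding_core E ?L (C - {c} - nbrs E c)"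
    proof -
      have sub: "?L - (C - {c} - nbrs E c) \<subseteq> V - C" by auto
      have ex: "\<exists>s\<in>?L - (C - {c} - nbrs E c). {s, x} \<in> E \<and> nbrs E s \<inter> ?L \<subseteq> insert x (nbrs E x) \<and>
          nbrs E s \<inter> (C - {c} - nbrs E c) = {x}" if x: "x \<in> (C - {c} - nbrs E c) \<inter> ?L" for x
      proof -
        obtain s where s: "s \<in> V - C" "{s, x} \<in> E" "nbrs E s \<inter> V \<subseteq> insert x (nbrs E x)" "nbrs E s \<inter> C = {x}"
          using core[unfolded shedding_core_def, THEN conjunct1] x by blast
        moreover have "c \<in> C" using core' x by auto
        moreover have "c \<notin> nbrs E s" using s(4) x \<open>c \<in> C\<close> by auto
        then have "s \<notin> nbrs E c" by (auto simp: nbrs_def insert_commute)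
        ultimately show ?thesis using x by (intro bexI[of _ s]) auto
      qed
      show ?thesis
        unfolding shedding_core_def using ex core[unfolded shedding_core_def, THEN conjunct2] sub
        by (intro conjI) (blast, meson subsetD)
    qed
    show ?thesis
    proof (cases "c \<in> W")
      case False
      then have "W \<subseteq> ?D" using WV by auto
      then have "d \<le> card (?D - W) + k"
        using less.hyps[OF cd(1) _ coreD maxD] less.prems(5) V by simp
      also have "card (?D - W) \<le> card (V - W)" using V by (intro card_mono) auto
      finally show ?thesis by simp
    next
      case True
      consider "\<not> acyclic_at TYPE('a) (indeps E (W - {c})) k"
        | "0 < k" "\<not> acyclic_at TYPE('a) (indeps E (W - {c} - nbrs E c)) (k - 1)"
        using not_acyclic_at_indeps_cases[OF E finW True less.prems(5)] by blast
      then show ?thesis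
      proof cases
        case 1
        have "W - {c} \<subseteq> ?D" using WV by auto
        then have "d \<le> card (?D - (W - {c})) + k"
          using less.hyps[OF cd(1) _ coreD maxD] 1 V by simp
        also have "?D - (W - {c}) = V - W" using True by auto
        finally show ?thesis .
      next
        case 2
        have "W - {c} - nbrs E c \<subseteq> ?L" using WV by auto
        then have "d - 1 \<le> card (?L - (W - {c} - nbrs E c)) + (k - 1)"
          using less.hyps[OF cd(2) _ coreL maxL _ 2(2)] V by blast
        moreover have "card (?L - (W - {c} - nbrs E c)) \<le> card (V - W)"
          using V True by (intro card_mono) auto
        ultimately show ?thesis using 2 by simp
      qed
    qed
  qed
qed

section \<open>The polynomial ring\<close>

abbreviation polys :: "nat \<Rightarrow> 'k::field mpoly set" where
  "polys n \<equiv> carrier (poly_ring n)"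

lemma polys_iff: "p \<in> polys n \<longleftrightarrow> (\<forall>m\<in>Poly_Mapping.keys p. Poly_Mapping.keys m \<subseteq> {1..n})"
  by (simp add: poly_ring_def)

lemma poly_ring_simps [simp]:
  "x \<otimes>\<^bsub>poly_ring n\<^esub> y = x * y" "x \<oplus>\<^bsub>poly_ring n\<^esub> y = x + y" "\<one>\<^bsub>poly_ring n\<^esub> = 1" "\<zero>\<^bsub>poly_ring n\<^esub> = 0"
  by (simp_all add: poly_ring_def)

lemma keys_add_nat: "Poly_Mapping.keys (a + b :: 'a \<Rightarrow>\<^sub>0 nat) = Poly_Mapping.keys a \<union> Poly_Mapping.keys b"
  by (auto simp: in_keys_iff lookup_add)

lemma polys_0 [simp, intro]: "0 \<in> polys n"
  by (simp add: polys_iff)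

lemma polys_1 [simp, intro]: "1 \<in> polys n"
  by (auto simp: polys_iff)

lemma polys_add [simp, intro]: "p \<in> polys n \<Longrightarrow> q \<in> polys n \<Longrightarrow> p + q \<in> polys n"
  using keys_add[of p q] by (force simp: polys_iff)

lemma polys_uminus [simp, intro]: "p \<in> polys n \<Longrightarrow> - p \<in> polys n"
  by (auto simp: polys_iff in_keys_iff)

lemma polys_minus [simp, intro]: "p \<in> polys n \<Longrightarrow> q \<in> polys n \<Longrightarrow> p - q \<in> polys n"
  using polys_add[of p n "- q"] by auto

lemma polys_mult [simp, intro]: "p \<in> polys n \<Longrightarrow> q \<in> polys n \<Longrightarrow> p * q \<in> polys n"
  using keys_mult[of p q] by (fastforce simp: polys_iff keys_add_nat)

lemma polys_sum [simp, intro]: "(\<And>i. i \<in> A \<Longrightarrow> f i \<in> polys n) \<Longrightarrow> sum f A \<in> polys n"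
  by (induction A rule: infinite_finite_induct) auto

lemma polys_power [simp, intro]: "p \<in> polys n \<Longrightarrow> p ^ k \<in> polys n"
  by (induction k) auto

lemma polys_single [simp, intro]:
  "Poly_Mapping.keys m \<subseteq> {1..n} \<Longrightarrow> Poly_Mapping.single m c \<in> polys n"
  by (simp add: polys_iff)

lemma polys_const [simp, intro]: "const c \<in> polys n"
  by (auto simp: const_def)

lemma polys_var [simp, intro]: "k \<in> {1..n} \<Longrightarrow> var k \<in> polys n"
  by (auto simp: var_def)

lemma polys_pos_sign [simp, intro]: "pos_sign k T \<in> polys n"
  unfolding pos_sign_def by (intro polys_power polys_uminus polys_1)

lemma polys_cobd [intro]:
  "T \<subseteq> {1..n} \<Longrightarrow> (\<And>S. S \<subseteq> {1..n} \<Longrightarrow> c S \<in> polys n) \<Longrightarrow> cobd var c T \<in> polys n"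
  unfolding cobd_def by (intro polys_sum polys_mult polys_var polys_pos_sign) blast+

lemma cring_poly_ring: "cring (poly_ring n :: 'k::field mpoly ring)"
proof (rule cringI)
  show "abelian_group (poly_ring n :: 'k mpoly ring)"
    by (rule abelian_groupI) (auto simp: algebra_simps intro: bexI[of _ "- _"])
  show "comm_monoid (poly_ring n :: 'k mpoly ring)"
    by (rule comm_monoidI) (auto simp: algebra_simps)
qed (auto simp: algebra_simps)

interpretation PR: cring "poly_ring n" for n
  by (rule cring_poly_ring)

lemma poly_ring_a_inv [simp]: "p \<in> polys n \<Longrightarrow> \<ominus>\<^bsub>poly_ring n\<^esub> p = - p"
  by (rule PR.minus_equality) auto

lemma poly_ring_a_minus [simp]:
  "p \<in> polys n \<Longrightarrow> q \<in> polys n \<Longrightarrow> p \<ominus>\<^bsub>poly_ring n\<^esub> q = p - q"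
  by (simp add: a_minus_def)

subsection \<open>Ideals\<close>

definition poly_ideal :: "nat \<Rightarrow> 'k::field mpoly set \<Rightarrow> bool" where
  "poly_ideal n J \<longleftrightarrow> J \<subseteq> polys n \<and> 0 \<in> J \<and> (\<forall>p\<in>J. \<forall>q\<in>J. p + q \<in> J) \<and>
     (\<forall>p\<in>polys n. \<forall>q\<in>J. p * q \<in> J)"

lemma poly_idealD:
  assumes "poly_ideal n J"
  shows "J \<subseteq> polys n" "0 \<in> J" "p \<in> J \<Longrightarrow> q \<in> J \<Longrightarrow> p + q \<in> J"
    "r \<in> polys n \<Longrightarrow> q \<in> J \<Longrightarrow> r * q \<in> J" "r \<in> polys n \<Longrightarrow> q \<in> J \<Longrightarrow> q * r \<in> J"
    "q \<in> J \<Longrightarrow> - q \<in> J" "p \<in> J \<Longrightarrow> q \<in> J \<Longrightarrow> p - q \<in> J"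
proof -
  show *: "J \<subseteq> polys n" "0 \<in> J" "p \<in> J \<Longrightarrow> q \<in> J \<Longrightarrow> p + q \<in> J" for p q
    using assms by (auto simp: poly_ideal_def)
  show **: "r \<in> polys n \<Longrightarrow> q \<in> J \<Longrightarrow> r * q \<in> J" for r q
    using assms by (auto simp: poly_ideal_def)
  then show "r \<in> polys n \<Longrightarrow> q \<in> J \<Longrightarrow> q * r \<in> J" by (metis mult.commute)
  show ***: "q \<in> J \<Longrightarrow> - q \<in> J" for q using **[of "- 1" q] by auto
  show "p \<in> J \<Longrightarrow> q \<in> J \<Longrightarrow> p - q \<in> J" using *(3)[of p "- q"] ***[of q] by simp
qed

lemma poly_ideal_sum:
  "poly_ideal n J \<Longrightarrow> (\<And>i. i \<in> A \<Longrightarrow> f i \<in> J) \<Longrightarrow> sum f A \<in> J"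
  by (induction A rule: infinite_finite_induct) (auto simp: poly_idealD)

lemma ideal_poly_ring_iff: "ideal J (poly_ring n) \<longleftrightarrow> poly_ideal n J"
proof
  assume "ideal J (poly_ring n)"
  then interpret ideal J "poly_ring n" .
  show "poly_ideal n J"
    unfolding poly_ideal_def
  proof (intro conjI ballI)
    show "J \<subseteq> polys n" using a_Hcarr by blast
    show "0 \<in> J" using zero_closed by simp
    show "p + q \<in> J" if "p \<in> J" "q \<in> J" for p q using a_closed[OF that] by simp
    show "p * q \<in> J" if "p \<in> polys n" "q \<in> J" for p q using I_l_closed[OF that(2,1)] by simp
  qed
next
  assume J: "poly_ideal n J"
  show "ideal J (poly_ring n)"
  proof (rule idealI)
    show "ring (poly_ring n)" by (rule PR.ring_axioms)
    show "subgroup J (add_monoid (poly_ring n))"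
    proof (rule subgroup.intro)
      show "inv\<^bsub>add_monoid (poly_ring n)\<^esub> x \<in> J" if "x \<in> J" for x
        using poly_ring_a_inv[of x n] poly_idealD(1,6)[OF J] that by (auto simp: a_inv_def)
    qed (simp_all add: poly_idealD[OF J])
    show "x \<otimes>\<^bsub>poly_ring n\<^esub> a \<in> J" "a \<otimes>\<^bsub>poly_ring n\<^esub> x \<in> J" if "a \<in> J" "x \<in> polys n" for a x
      using poly_idealD(4,5)[OF J that(2,1)] by simp_all
  qed
qed

lemma poly_ideal_genideal: "S \<subseteq> polys n \<Longrightarrow> poly_ideal n (Idl\<^bsub>poly_ring n\<^esub> S)"
  using PR.genideal_ideal ideal_poly_ring_iff by blast

lemma genideal_superset: "S \<subseteq> polys n \<Longrightarrow> S \<subseteq> Idl\<^bsub>poly_ring n\<^esub> S"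
  by (rule PR.genideal_self)

lemma genideal_least: "poly_ideal n J \<Longrightarrow> S \<subseteq> J \<Longrightarrow> Idl\<^bsub>poly_ring n\<^esub> S \<subseteq> J"
  by (rule PR.genideal_minimal) (simp_all add: ideal_poly_ring_iff)

lemma genideal_of_ideal: "poly_ideal n J \<Longrightarrow> Idl\<^bsub>poly_ring n\<^esub> J = J"
  using genideal_least[of n J J] genideal_superset[of J n] poly_idealD(1)[of n J] by auto

definition add_gen :: "nat \<Rightarrow> 'k::field mpoly set \<Rightarrow> 'k mpoly \<Rightarrow> 'k mpoly set" where
  "add_gen n J f = {p + f * g | p g. p \<in> J \<and> g \<in> polys n}"

lemma add_gen_iff: "p \<in> add_gen n J f \<longleftrightarrow> (\<exists>g\<in>polys n. p - f * g \<in> J)"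
  by (force simp: add_gen_def)

lemma poly_ideal_add_gen:
  assumes J: "poly_ideal n J" and f: "f \<in> polys n"
  shows "poly_ideal n (add_gen n J f)"
  unfolding poly_ideal_def
proof (intro conjI ballI subsetI)
  fix p q assume "p \<in> add_gen n J f" "q \<in> add_gen n J f"
  then obtain p' g q' h where "p = p' + f * g" "p' \<in> J" "g \<in> polys n" "q = q' + f * h" "q' \<in> J" "h \<in> polys n"
    by (auto simp: add_gen_def)
  then have "p + q = (p' + q') + f * (g + h)" "p' + q' \<in> J" "g + h \<in> polys n"
    using poly_idealD[OF J] by (auto simp: algebra_simps)
  then show "p + q \<in> add_gen n J f" unfolding add_gen_def by blast
next
  fix r p :: "'a mpoly" assume r: "r \<in> polys n" and "p \<in> add_gen n J f"
  then obtain p' g where "p = p' + f * g" "p' \<in> J" "g \<in> polys n"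
    by (auto simp: add_gen_def)
  then have "r * p = r * p' + f * (r * g)" "r * p' \<in> J" "r * g \<in> polys n"
    using poly_idealD(4)[OF J r, of p'] r by (simp_all add: algebra_simps)
  then show "r * p \<in> add_gen n J f" unfolding add_gen_def by blast
next
  show "0 \<in> add_gen n J f"
    unfolding add_gen_def using poly_idealD(2)[OF J] by (force intro: exI[of _ 0])
  show "p \<in> polys n" if "p \<in> add_gen n J f" for p
    using that f poly_idealD(1)[OF J] by (auto simp: add_gen_def)
qed

lemma add_gen_superset:
  assumes "poly_ideal n J"
  shows "J \<subseteq> add_gen n J f" "f \<in> add_gen n J f"
proof -
  show "J \<subseteq> add_gen n J f" unfolding add_gen_def by (force intro: exI[of _ 0])
  show "f \<in> add_gen n J f" unfolding add_gen_def using poly_idealD(2)[OF assms] by (force intro: exI[of _ 1])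
qed

lemma add_gen_least:
  "poly_ideal n J' \<Longrightarrow> J \<subseteq> J' \<Longrightarrow> f \<in> J' \<Longrightarrow> add_gen n J f \<subseteq> J'"
  by (auto simp: add_gen_def poly_idealD subset_iff)

lemma genideal_insert:
  assumes S: "S \<subseteq> polys n" and f: "f \<in> polys n"
  shows "Idl\<^bsub>poly_ring n\<^esub> (insert f S) = add_gen n (Idl\<^bsub>poly_ring n\<^esub> S) f"
proof -
  note J = poly_ideal_genideal[OF S]
  note J' = poly_ideal_genideal[of "insert f S" n]
  show ?thesis
  proof (rule subset_antisym)
    show "Idl\<^bsub>poly_ring n\<^esub> (insert f S) \<subseteq> add_gen n (Idl\<^bsub>poly_ring n\<^esub> S) f"
      using add_gen_superset[OF J, of f] genideal_superset[OF S]
      by (intro genideal_least poly_ideal_add_gen[OF J f]) blast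
    show "add_gen n (Idl\<^bsub>poly_ring n\<^esub> S) f \<subseteq> Idl\<^bsub>poly_ring n\<^esub> (insert f S)"
      using genideal_superset[of "insert f S" n] J' S f
      by (intro add_gen_least genideal_least) auto
  qed
qed

subsection \<open>Coefficients\<close>

lemma poly_mapping_sum_single: "p = (\<Sum>m\<in>Poly_Mapping.keys p. Poly_Mapping.single m (Poly_Mapping.lookup p m))"
proof (rule poly_mapping_eqI)
  fix k
  have "(\<Sum>m\<in>Poly_Mapping.keys p. Poly_Mapping.lookup (Poly_Mapping.single m (Poly_Mapping.lookup p m)) k)
     = (\<Sum>m\<in>Poly_Mapping.keys p. if m = k then Poly_Mapping.lookup p k else 0)"
    by (intro sum.cong) (auto simp: lookup_single when_def)
  then show "Poly_Mapping.lookup p k =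
    Poly_Mapping.lookup (\<Sum>m\<in>Poly_Mapping.keys p. Poly_Mapping.single m (Poly_Mapping.lookup p m)) k"
    by (simp add: lookup_sum in_keys_iff)
qed

lemma lookup_single_times:
  fixes p :: "'k::field mpoly"
  shows "Poly_Mapping.lookup (Poly_Mapping.single t c * p) m =
    (\<Sum>l\<in>Poly_Mapping.keys p. if t + l = m then c * Poly_Mapping.lookup p l else 0)"
proof -
  have "Poly_Mapping.single t c * p =
      (\<Sum>l\<in>Poly_Mapping.keys p. Poly_Mapping.single (t + l) (c * Poly_Mapping.lookup p l))"
    by (subst poly_mapping_sum_single[of p]) (simp add: sum_distrib_left mult_single)
  then show ?thesis by (simp add: lookup_sum lookup_single when_def)
qed

lemma lookup_single_times_add [simp]:
  fixes p :: "'k::field mpoly"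
  shows "Poly_Mapping.lookup (Poly_Mapping.single t c * p) (t + l) = c * Poly_Mapping.lookup p l"
  by (simp add: lookup_single_times in_keys_iff)

lemma lookup_single_times_not:
  fixes p :: "'k::field mpoly"
  assumes "\<And>l. m \<noteq> t + l"
  shows "Poly_Mapping.lookup (Poly_Mapping.single t c * p) m = 0"
  unfolding lookup_single_times by (rule sum.neutral) (use assms in metis)

lemma lookup_const_times [simp]: "Poly_Mapping.lookup (const c * p) m = c * Poly_Mapping.lookup p m"
  unfolding const_def using lookup_single_times_add[of 0 c p m] by simp

lemma lookup_var_times:
  "Poly_Mapping.lookup (var k * p) m =
    (if k \<in> Poly_Mapping.keys m then Poly_Mapping.lookup p (m - Poly_Mapping.single k 1) else 0)"
proof (cases "k \<in> Poly_Mapping.keys m")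
  case True
  then have "m = Poly_Mapping.single k 1 + (m - Poly_Mapping.single k 1)"
    by (intro poly_mapping_eqI) (auto simp: lookup_add lookup_minus lookup_single when_def in_keys_iff)
  then show ?thesis using True unfolding var_def by (metis lookup_single_times_add mult_1)
next
  case False
  then have "m \<noteq> Poly_Mapping.single k 1 + l" for l by (auto simp: keys_add_nat)
  then show ?thesis using False by (simp add: var_def lookup_single_times_not)
qed

lemma pos_sign_times_lookup:
  "Poly_Mapping.lookup (pos_sign k T * p) m = pos_sign k T * Poly_Mapping.lookup (p :: 'k::field mpoly) m"
proof (cases "even (card {j\<in>T. j < k})")
  case True
  then show ?thesis by (simp add: pos_sign_def)
next
  case False
  then show ?thesis by (simp add: pos_sign_def)
qed

definition sqfree :: "nat set \<Rightarrow> (nat \<Rightarrow>\<^sub>0 nat)" where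
  "sqfree S = (\<Sum>i\<in>S. Poly_Mapping.single i 1)"

lemma lookup_sqfree: "finite S \<Longrightarrow> Poly_Mapping.lookup (sqfree S) i = (if i \<in> S then 1 else 0)"
  by (simp add: sqfree_def lookup_sum lookup_single when_def)

lemma keys_sqfree [simp]: "finite S \<Longrightarrow> Poly_Mapping.keys (sqfree S) = S"
  by (auto simp: in_keys_iff lookup_sqfree split: if_splits)

lemma sqfree_minus_add:
  assumes "S \<subseteq> Poly_Mapping.keys u"
  shows "u - sqfree S + sqfree S = u"
proof -
  have "finite S" by (rule finite_subset[OF assms finite_keys])
  then show ?thesis using assms
    by (intro poly_mapping_eqI) (auto simp: lookup_add lookup_minus lookup_sqfree in_keys_iff)
qed

lemma sqfree_union:
  "finite S \<Longrightarrow> finite T \<Longrightarrow> S \<inter> T = {} \<Longrightarrow> sqfree (S \<union> T) = sqfree S + sqfree T"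
  by (simp add: sqfree_def sum.union_disjoint)

text \<open>If \<open>P\<close> is closed under multiples, this is the monomial ideal with the monomials satisfying \<open>P\<close>.\<close>

definition mono_ideal :: "nat \<Rightarrow> ((nat \<Rightarrow>\<^sub>0 nat) \<Rightarrow> bool) \<Rightarrow> 'k::field mpoly set" where
  "mono_ideal n P = {p \<in> polys n. \<forall>m\<in>Poly_Mapping.keys p. P m}"

lemma mono_idealI:
  "p \<in> polys n \<Longrightarrow> (\<And>m. Poly_Mapping.keys m \<subseteq> {1..n} \<Longrightarrow> \<not> P m \<Longrightarrow> Poly_Mapping.lookup p m = 0) \<Longrightarrow> p \<in> mono_ideal n P"
  unfolding mono_ideal_def polys_iff in_keys_iff by blast

lemma poly_ideal_mono_ideal:
  assumes P: "\<And>m m'. P m \<Longrightarrow> P (m' + m)"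
  shows "poly_ideal n (mono_ideal n P)"
  unfolding poly_ideal_def
proof (intro conjI ballI)
  fix p q :: "'a mpoly" assume "p \<in> polys n" "q \<in> mono_ideal n P"
  then show "p * q \<in> mono_ideal n P"
    using keys_mult[of p q] P by (fastforce simp: mono_ideal_def)
next
  fix p q :: "'a mpoly" assume "p \<in> mono_ideal n P" "q \<in> mono_ideal n P"
  then show "p + q \<in> mono_ideal n P"
    using keys_add[of p q] by (auto simp: mono_ideal_def)
qed (auto simp: mono_ideal_def)

definition edge_mono :: "nat set set \<Rightarrow> (nat \<Rightarrow>\<^sub>0 nat) \<Rightarrow> bool" where
  "edge_mono E m \<longleftrightarrow> (\<exists>e\<in>E. e \<subseteq> Poly_Mapping.keys m)"

lemma edge_mono_add: "edge_mono E m \<Longrightarrow> edge_mono E (m' + m)"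
  unfolding edge_mono_def keys_add_nat by blast

lemma poly_ideal_edge_mono: "poly_ideal n (mono_ideal n (edge_mono E))"
  by (intro poly_ideal_mono_ideal edge_mono_add)

text \<open>The ideal of all polynomials supported on monomials divisible by some \<open>x\<^sub>i * x\<^sub>j\<close> with \<open>{i, j}\<close> an edge
is easier to handle than the generated ideal.\<close>

lemma edge_ideal_eq:
  assumes E: "simple_graph {1..n} E"
  shows "edge_ideal n E = (mono_ideal n (edge_mono E) :: 'k::field mpoly set)"
proof
  have var2: "(var i * var j :: 'k mpoly) = Poly_Mapping.single (sqfree {i, j}) 1" if "i \<noteq> j" for i j
    using that by (simp add: var_def mult_single sqfree_def)
  have edge: "i \<noteq> j" "i \<in> {1..n}" "j \<in> {1..n}" if "{i, j} \<in> E" for i j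
    using E that by (force simp: simple_graph_def)+
  let ?G = "{var i * var j | i j. {i, j} \<in> E} :: 'k mpoly set"
  have G: "?G \<subseteq> polys n" using edge by blast
  have "(var i * var j :: 'k mpoly) \<in> mono_ideal n (edge_mono E)" if "{i, j} \<in> E" for i j
    unfolding var2[OF edge(1)[OF that]] using edge[OF that] that
    by (auto simp: mono_ideal_def edge_mono_def)
  then show "edge_ideal n E \<subseteq> (mono_ideal n (edge_mono E) :: 'k mpoly set)"
    unfolding edge_ideal_def by (intro genideal_least poly_ideal_edge_mono) auto
  note J = poly_ideal_genideal[OF G]
  show "mono_ideal n (edge_mono E) \<subseteq> (edge_ideal n E :: 'k mpoly set)"
  proof
    fix p :: "'k mpoly" assume p: "p \<in> mono_ideal n (edge_mono E)"
    have "Poly_Mapping.single m (Poly_Mapping.lookup p m) \<in> edge_ideal n E" if m: "m \<in> Poly_Mapping.keys p" for m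
    proof -
      obtain e where e: "e \<in> E" "e \<subseteq> Poly_Mapping.keys m" using p m by (auto simp: mono_ideal_def edge_mono_def)
      have "card e = 2" using E e(1) by (simp add: simple_graph_def)
      then obtain i j where ij: "e = {i, j}" "i \<noteq> j" by (auto simp: card_2_iff)
      have "Poly_Mapping.keys (m - sqfree {i, j}) \<subseteq> {1..n}"
        using p m by (auto simp: mono_ideal_def polys_iff in_keys_iff lookup_minus subset_iff)
      then have "Poly_Mapping.single (m - sqfree {i, j}) (Poly_Mapping.lookup p m) * (var i * var j) \<in> edge_ideal n E"
        unfolding edge_ideal_def using e ij
        by (intro poly_idealD(4)[OF J] polys_single genideal_superset[OF G, THEN subsetD]) auto
      then show ?thesis using ij e by (simp add: var2 mult_single sqfree_minus_add)
    qed
    then have "(\<Sum>m\<in>Poly_Mapping.keys p. Poly_Mapping.single m (Poly_Mapping.lookup p m)) \<in> edge_ideal n E"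
      unfolding edge_ideal_def by (intro poly_ideal_sum[OF J]) auto
    then show "p \<in> edge_ideal n E" using poly_mapping_sum_single[of p] by simp
  qed
qed

section \<open>The Koszul complex in a fixed multidegree\<close>

text \<open>A cochain \<open>c\<close> of the Koszul complex is placed in multidegree \<open>u\<close> by giving the
  monomial \<open>m\<close> of \<open>c T\<close> the multidegree \<open>m + sqfree ({1..n} - T)\<close>. Only sets \<open>T\<close>
  containing the complement \<open>Z\<close> of the support of \<open>u\<close> occur, and these are indexed by
  \<open>T - Z\<close>. The product of signs turns the signs of the Koszul complex into those of a simplicial
  complex.\<close>

definition component :: "nat \<Rightarrow> (nat \<Rightarrow>\<^sub>0 nat) \<Rightarrow> (nat set \<Rightarrow> 'k::field mpoly) \<Rightarrow> nat set \<Rightarrow> 'k" where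
  "component n u c F =
     (\<Prod>k\<in>F. pos_sign k ({1..n} - Poly_Mapping.keys u)) *
     Poly_Mapping.lookup (c (({1..n} - Poly_Mapping.keys u) \<union> F)) (u - sqfree (Poly_Mapping.keys u - F))"

lemma pos_sign_union:
  "finite A \<Longrightarrow> finite B \<Longrightarrow> A \<inter> B = {} \<Longrightarrow> pos_sign k (A \<union> B) = pos_sign k A * pos_sign k B"
  unfolding pos_sign_def
  by (subst power_add[symmetric], subst card_Un_disjoint[symmetric])
     (auto intro!: arg_cong[of _ _ "\<lambda>S. (- 1) ^ card S"])

lemma prod_pos_sign_square [simp]:
  "(\<Prod>k\<in>F. pos_sign k Z) * (\<Prod>k\<in>F. pos_sign k Z) = (1::'a::comm_ring_1)"
  by (simp flip: prod.distrib)

lemma component_cobd: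
  assumes F: "F \<subseteq> Poly_Mapping.keys u"
  shows "cobd (\<lambda>_. 1) (component n u c) F = component n u (cobd var c) F"
proof -
  define W where "W = Poly_Mapping.keys u"
  define Z where "Z = {1..n} - W"
  have fin: "finite F" "finite Z" "finite W" using F by (auto simp: Z_def W_def intro: finite_subset)
  have disj: "Z \<inter> F = {}" using F by (auto simp: Z_def W_def)
  let ?\<epsilon> = "\<lambda>F. \<Prod>k\<in>F. pos_sign k Z :: 'a"
  let ?u = "u - sqfree (W - F)"
  have comp: "component n u d G = ?\<epsilon> G * Poly_Mapping.lookup (d (Z \<union> G)) (u - sqfree (W - G))" for d G
    by (simp only: component_def W_def Z_def)
  have summand: "Poly_Mapping.lookup (pos_sign k (Z \<union> F) * var k * c (Z \<union> F - {k})) ?u =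
      (if k \<in> F then pos_sign k Z * pos_sign k F *
         Poly_Mapping.lookup (c (Z \<union> (F - {k}))) (u - sqfree (W - (F - {k}))) else 0)"
    if k: "k \<in> Z \<union> F" for k
  proof (cases "k \<in> F")
    case False
    then have "k \<notin> Poly_Mapping.keys ?u" using k by (auto simp: Z_def W_def in_keys_iff lookup_minus)
    then show ?thesis using False by (simp add: mult.assoc pos_sign_times_lookup lookup_var_times)
  next
    case True
    then have kW: "k \<in> W" using F by (auto simp: W_def)
    have "k \<in> Poly_Mapping.keys ?u"
      using True kW fin by (auto simp: in_keys_iff lookup_minus lookup_sqfree W_def)
    moreover have "?u - Poly_Mapping.single k 1 = u - sqfree (W - (F - {k}))"
      using True kW fin
      by (intro poly_mapping_eqI) (auto simp: lookup_minus lookup_sqfree lookup_single when_def)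
    moreover have "Z \<union> F - {k} = Z \<union> (F - {k})" using True disj by auto
    ultimately show ?thesis
      using True fin disj
      by (simp add: mult.assoc pos_sign_times_lookup lookup_var_times pos_sign_union)
  qed
  have "Poly_Mapping.lookup (cobd var c (Z \<union> F)) ?u =
      (\<Sum>k\<in>Z \<union> F. if k \<in> F then pos_sign k Z * pos_sign k F *
         Poly_Mapping.lookup (c (Z \<union> (F - {k}))) (u - sqfree (W - (F - {k}))) else 0)"
    unfolding cobd_def lookup_sum by (intro sum.cong refl summand)
  also have "\<dots> = (\<Sum>k\<in>F. pos_sign k Z * pos_sign k F *
         Poly_Mapping.lookup (c (Z \<union> (F - {k}))) (u - sqfree (W - (F - {k}))))"
    using fin by (simp add: sum.If_cases Int_absorb1)
  finally have "component n u (cobd var c) F = (\<Sum>k\<in>F. ?\<epsilon> F * (pos_sign k Z * pos_sign k F *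
         Poly_Mapping.lookup (c (Z \<union> (F - {k}))) (u - sqfree (W - (F - {k})))))"
    by (simp add: comp sum_distrib_left)
  also have "\<dots> = cobd (\<lambda>_. 1) (component n u c) F"
    unfolding cobd_def
  proof (intro sum.cong refl)
    fix k assume k: "k \<in> F"
    have "?\<epsilon> F = pos_sign k Z * ?\<epsilon> (F - {k})" using fin k by (simp add: prod.remove)
    then show "?\<epsilon> F * (pos_sign k Z * pos_sign k F *
         Poly_Mapping.lookup (c (Z \<union> (F - {k}))) (u - sqfree (W - (F - {k})))) =
         pos_sign k F * 1 * component n u c (F - {k})"
      unfolding comp by (simp add: mult_ac)
  qed
  finally show ?thesis by simp
qed

lemma component_eq:
  assumes T: "T \<subseteq> {1..n}" and m: "Poly_Mapping.keys m \<subseteq> {1..n}"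
    and u: "u = m + sqfree ({1..n} - T)"
  shows "component n u c (T \<inter> Poly_Mapping.keys u) =
    (\<Prod>k\<in>T \<inter> Poly_Mapping.keys u. pos_sign k ({1..n} - Poly_Mapping.keys u)) * Poly_Mapping.lookup (c T) m"
proof -
  have ku: "Poly_Mapping.keys u = Poly_Mapping.keys m \<union> ({1..n} - T)"
    by (simp add: u keys_add_nat)
  have "({1..n} - Poly_Mapping.keys u) \<union> T \<inter> Poly_Mapping.keys u = T" using T m ku by auto
  moreover have "Poly_Mapping.keys u - T \<inter> Poly_Mapping.keys u = {1..n} - T" using T m ku by auto
  ultimately show ?thesis by (simp add: component_def u)
qed

lemma lookup_eq_component:
  assumes T: "T \<subseteq> {1..n}" and m: "Poly_Mapping.keys m \<subseteq> {1..n}"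
    and u: "u = m + sqfree ({1..n} - T)"
  shows "Poly_Mapping.lookup (c T) m =
    (\<Prod>k\<in>T \<inter> Poly_Mapping.keys u. pos_sign k ({1..n} - Poly_Mapping.keys u)) *
    component n u c (T \<inter> Poly_Mapping.keys u)"
  unfolding component_eq[OF assms, of c] by (simp flip: mult.assoc)

text \<open>The complex in multidegree \<open>u\<close> of the quotient by the monomial ideal given by \<open>P\<close>.\<close>

definition degree_complex :: "((nat \<Rightarrow>\<^sub>0 nat) \<Rightarrow> bool) \<Rightarrow> (nat \<Rightarrow>\<^sub>0 nat) \<Rightarrow> nat set set" where
  "degree_complex P u = {F. F \<subseteq> Poly_Mapping.keys u \<and> \<not> P (u - sqfree (Poly_Mapping.keys u - F))}"

text \<open>A Koszul cochain splits into multidegrees, and modulo a monomial ideal each multidegree \<open>u\<close> carries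
the simplicial cochain complex of \<open>degree_complex P u\<close>. The predicate \<open>Q\<close> keeps track of the
multidegrees that occur, so that gradings are preserved.\<close>

lemma koszul_exact_multigraded:
  fixes c :: "nat set \<Rightarrow> 'k::field mpoly"
  assumes c: "\<And>T. T \<subseteq> {1..n} \<Longrightarrow> c T \<in> polys n"
    and cocycle: "\<And>T. T \<subseteq> {1..n} \<Longrightarrow> card T = Suc p \<Longrightarrow> cobd var c T \<in> mono_ideal n P"
    and Q: "\<And>T m. T \<subseteq> {1..n} \<Longrightarrow> card T = p \<Longrightarrow> m \<in> Poly_Mapping.keys (c T) \<Longrightarrow> Q (m + sqfree ({1..n} - T))"
    and acyc: "\<And>u. Poly_Mapping.keys u \<subseteq> {1..n} \<Longrightarrow> Q u \<Longrightarrow> n - card (Poly_Mapping.keys u) \<le> p \<Longrightarrow>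
      acyclic_at TYPE('k) (degree_complex P u) (p - (n - card (Poly_Mapping.keys u)))"
  shows "\<exists>b. (\<forall>T\<subseteq>{1..n}. b T \<in> polys n \<and>
      (\<forall>m\<in>Poly_Mapping.keys (b T). Q (m + sqfree ({1..n} - T)))) \<and>
    (\<forall>T\<subseteq>{1..n}. card T = p \<longrightarrow> c T - cobd var b T \<in> mono_ideal n P)"
proof -
  define U where "U = (\<Union>T\<in>{T. T \<subseteq> {1..n} \<and> card T = p}. (\<lambda>m. m + sqfree ({1..n} - T)) ` Poly_Mapping.keys (c T))"
  have finU: "finite U" unfolding U_def by auto
  have U: "Poly_Mapping.keys u \<subseteq> {1..n}" "Q u" if "u \<in> U" for u
  proof -
    obtain T m where *: "T \<subseteq> {1..n}" "card T = p" "m \<in> Poly_Mapping.keys (c T)" "u = m + sqfree ({1..n} - T)"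
      using \<open>u \<in> U\<close> unfolding U_def by blast
    then show "Q u" using Q by simp
    have "Poly_Mapping.keys m \<subseteq> {1..n}" using c[OF *(1)] *(3) unfolding polys_iff by blast
    then show "Poly_Mapping.keys u \<subseteq> {1..n}" by (simp add: *(4) keys_add_nat)
  qed
  have "\<exists>\<beta>. \<forall>F\<in>degree_complex P u. card F + (n - card (Poly_Mapping.keys u)) = p \<longrightarrow>
      component n u c F = cobd (\<lambda>_. 1) \<beta> F" if u: "u \<in> U" for u
  proof (cases "n - card (Poly_Mapping.keys u) \<le> p")
    case False
    then show ?thesis by auto
  next
    case True
    let ?z = "n - card (Poly_Mapping.keys u)"
    have "cobd (\<lambda>_. 1) (component n u c) F = 0"
      if F: "F \<in> degree_complex P u" "card F = Suc (p - ?z)" for F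
    proof -
      let ?T = "({1..n} - Poly_Mapping.keys u) \<union> F"
      have FW: "F \<subseteq> Poly_Mapping.keys u" "finite F"
        using F by (auto simp: degree_complex_def intro: finite_subset)
      have "card ({1..n} - Poly_Mapping.keys u) = ?z"
        using U(1)[OF u] by (subst card_Diff_subset) auto
      then have "card ?T = Suc p" using FW F True
        by (subst card_Un_disjoint) auto
      then have "cobd var c ?T \<in> mono_ideal n P" using FW U(1)[OF u] by (intro cocycle) auto
      then have "component n u (cobd var c) F = 0"
        using F by (auto simp: component_def mono_ideal_def degree_complex_def in_keys_iff)
      then show ?thesis by (simp only: component_cobd[OF FW(1)])
    qed
    then obtain \<beta> where "\<forall>F\<in>degree_complex P u. card F = p - ?z \<longrightarrow> component n u c F = cobd (\<lambda>_. 1) \<beta> F"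
      using acyclic_atD[OF acyc[OF U(1)[OF u] U(2)[OF u] True], of "component n u c"] by blast
    then show ?thesis using True by (intro exI[of _ \<beta>]) auto
  qed
  then obtain \<beta> where \<beta>: "\<And>u F. u \<in> U \<Longrightarrow> F \<in> degree_complex P u \<Longrightarrow>
      card F + (n - card (Poly_Mapping.keys u)) = p \<Longrightarrow> component n u c F = cobd (\<lambda>_. 1) (\<beta> u) F"
    by metis
  \<comment> \<open>The solutions in the single multidegrees are put together, inverting \<open>component\<close>.\<close>
  define b where "b = (\<lambda>T. \<Sum>u\<in>{u\<in>U. {1..n} - T \<subseteq> Poly_Mapping.keys u}.
      Poly_Mapping.single (u - sqfree ({1..n} - T))
        ((\<Prod>k\<in>T \<inter> Poly_Mapping.keys u. pos_sign k ({1..n} - Poly_Mapping.keys u)) *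
          \<beta> u (T \<inter> Poly_Mapping.keys u)))"
  have keys_b: "\<exists>u\<in>U. {1..n} - T \<subseteq> Poly_Mapping.keys u \<and> m = u - sqfree ({1..n} - T)"
    if "m \<in> Poly_Mapping.keys (b T)" for T m
    using keys_sum[of "\<lambda>u. Poly_Mapping.single (u - sqfree ({1..n} - T))
        ((\<Prod>k\<in>T \<inter> Poly_Mapping.keys u. pos_sign k ({1..n} - Poly_Mapping.keys u)) *
          \<beta> u (T \<inter> Poly_Mapping.keys u))" "{u\<in>U. {1..n} - T \<subseteq> Poly_Mapping.keys u}"] that
    unfolding b_def by (auto split: if_splits)
  have b_polys: "b T \<in> polys n" for T
  proof -
    have "Poly_Mapping.keys m \<subseteq> {1..n}" if m: "m \<in> Poly_Mapping.keys (b T)" for m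
    proof -
      obtain u where "u \<in> U" "m = u - sqfree ({1..n} - T)" using keys_b[OF m] by blast
      then have "Poly_Mapping.keys m \<subseteq> Poly_Mapping.keys u" by (auto simp: in_keys_iff lookup_minus)
      then show ?thesis using U \<open>u \<in> U\<close> by blast
    qed
    then show ?thesis by (simp add: polys_iff)
  qed
  have comp_b: "component n u b F = (if u \<in> U then \<beta> u F else 0)"
    if u: "Poly_Mapping.keys u \<subseteq> {1..n}" and F: "F \<subseteq> Poly_Mapping.keys u" for u F
  proof -
    let ?T = "({1..n} - Poly_Mapping.keys u) \<union> F"
    let ?S = "Poly_Mapping.keys u - F"
    have T: "{1..n} - ?T = ?S" using u F by auto
    have FT: "?T \<inter> Poly_Mapping.keys u = F" using F by auto
    let ?\<epsilon> = "\<lambda>v. \<Prod>k\<in>?T \<inter> Poly_Mapping.keys v. pos_sign k ({1..n} - Poly_Mapping.keys v) :: 'k"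
    have eq: "v - sqfree ?S = u - sqfree ?S \<longleftrightarrow> v = u" if "?S \<subseteq> Poly_Mapping.keys v" for v
      using sqfree_minus_add[OF that] sqfree_minus_add[of ?S u] by (metis Diff_subset)
    have "Poly_Mapping.lookup (b ?T) (u - sqfree ?S) =
        (\<Sum>v\<in>{v\<in>U. ?S \<subseteq> Poly_Mapping.keys v}. if v = u then ?\<epsilon> u * \<beta> u F else 0)"
      unfolding b_def lookup_sum T
      by (intro sum.cong refl) (auto simp: lookup_single when_def eq FT[simplified])
    also have "\<dots> = (if u \<in> U then ?\<epsilon> u * \<beta> u F else 0)"
      using finU by (simp add: sum.delta)
    finally show ?thesis by (simp add: component_def FT[simplified] flip: mult.assoc)
  qed
  have "c T - cobd var b T \<in> mono_ideal n P" if T: "T \<subseteq> {1..n}" "card T = p" for T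
  proof (rule mono_idealI)
    show "c T - cobd var b T \<in> polys n" using c T b_polys by (intro polys_minus polys_cobd) auto
    fix m assume m: "Poly_Mapping.keys m \<subseteq> {1..n}" "\<not> P m"
    define u where "u = m + sqfree ({1..n} - T)"
    let ?F = "T \<inter> Poly_Mapping.keys u"
    have ku: "Poly_Mapping.keys u = Poly_Mapping.keys m \<union> ({1..n} - T)"
      by (simp add: u_def keys_add_nat)
    have FT: "Poly_Mapping.keys u - ?F = {1..n} - T" using ku T m by auto
    then have F: "?F \<in> degree_complex P u" using m by (auto simp: degree_complex_def u_def)
    have "T = ?F \<union> ({1..n} - Poly_Mapping.keys u)" using ku T m by auto
    then have "card T = card ?F + card ({1..n} - Poly_Mapping.keys u)"
      using finite_subset[OF T(1)] by (metis Int_Diff Diff_disjoint card_Un_disjoint finite_Diff finite_Int finite_atLeastAtMost inf_assoc inf_commute inf_bot_right)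
    also have "card ({1..n} - Poly_Mapping.keys u) = n - card (Poly_Mapping.keys u)"
      using ku m by (subst card_Diff_subset) auto
    finally have cardF: "card ?F + (n - card (Poly_Mapping.keys u)) = p" using T by simp
    have "component n u c ?F = component n u (cobd var b) ?F"
    proof (cases "u \<in> U")
      case True
      have "component n u (cobd var b) ?F = cobd (\<lambda>_. 1) (component n u b) ?F"
        by (rule component_cobd[symmetric]) auto
      also have "\<dots> = cobd (\<lambda>_. 1) (\<beta> u) ?F"
        by (intro cobd_cong, subst comp_b[OF U(1)[OF True]]) (use True in auto)
      finally show ?thesis using \<beta>[OF True F cardF] by simp
    next
      case False
      have "component n u (cobd var b) ?F = cobd (\<lambda>_. 1) (component n u b) ?F"
        by (rule component_cobd[symmetric]) auto
      also have "\<dots> = cobd (\<lambda>_. 1) (\<lambda>_. 0) ?F"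
        by (intro cobd_cong, subst comp_b) (use False ku m in auto)
      also have "\<dots> = 0" by (simp add: cobd_def)
      moreover have "Poly_Mapping.lookup (c T) m = 0"
      proof (rule ccontr)
        assume "Poly_Mapping.lookup (c T) m \<noteq> 0"
        then have "u \<in> (\<lambda>m. m + sqfree ({1..n} - T)) ` Poly_Mapping.keys (c T)"
          unfolding u_def by (intro imageI) (simp add: in_keys_iff)
        then have "u \<in> U" unfolding U_def using T by (intro UN_I[of T]) simp_all
        then show False using False by simp
      qed
      then have "component n u c ?F = 0"
        using component_eq[OF T(1) m(1) u_def, of c] by simp
      ultimately show ?thesis by simp
    qed
    then show "Poly_Mapping.lookup (c T - cobd var b T) m = 0"
      using lookup_eq_component[OF T(1) m(1) u_def, of c]
        lookup_eq_component[OF T(1) m(1) u_def, of "cobd var b"]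
      by (simp add: lookup_minus)
  qed
  moreover have "Q (m + sqfree ({1..n} - T))" if m: "m \<in> Poly_Mapping.keys (b T)" for T m
  proof -
    obtain u where "u \<in> U" "{1..n} - T \<subseteq> Poly_Mapping.keys u" "m = u - sqfree ({1..n} - T)"
      using keys_b[OF m] by blast
    then show ?thesis using U(2) sqfree_minus_add by simp
  qed
  ultimately show ?thesis using b_polys by (intro exI[of _ b]) blast
qed

lemma degree_complex_complex:
  assumes P: "\<And>m m'. P m \<Longrightarrow> P (m' + m)"
  shows "complex (degree_complex P u)"
  unfolding complex_def
proof (intro ballI conjI allI impI)
  fix F assume F: "F \<in> degree_complex P u"
  then show fin: "finite F" by (auto simp: degree_complex_def intro: finite_subset)
  fix G assume G: "G \<subseteq> F"
  let ?W = "Poly_Mapping.keys u"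
  have "u - sqfree (?W - F) = sqfree (F - G) + (u - sqfree (?W - G))"
  proof (rule poly_mapping_eqI)
    fix k
    have "k \<in> ?W" if "k \<in> F" using that F by (auto simp: degree_complex_def)
    then show "Poly_Mapping.lookup (u - sqfree (?W - F)) k =
        Poly_Mapping.lookup (sqfree (F - G) + (u - sqfree (?W - G))) k"
      using G fin by (auto simp: lookup_minus lookup_add lookup_sqfree in_keys_iff)
  qed
  then have "\<not> P (u - sqfree (?W - G))" using F P by (auto simp: degree_complex_def)
  then show "G \<in> degree_complex P u" using F G by (auto simp: degree_complex_def)
qed

lemma acyclic_at_degree_complex_free:
  assumes "Poly_Mapping.keys u \<noteq> {}"
  shows "acyclic_at TYPE('a::comm_ring_1) (degree_complex (\<lambda>_. False) u) p"
proof -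
  obtain k where "k \<in> Poly_Mapping.keys u" using assms by blast
  then show ?thesis
    by (intro acyclic_at_cone[of _ k] degree_complex_complex) (auto simp: degree_complex_def)
qed

text \<open>A vertex that occurs in \<open>u\<close> with exponent at least two stays in the support of
  \<open>u - sqfree S\<close> for all \<open>S\<close>, and is therefore an apex of the complex. Hence only squarefree
  multidegrees contribute.\<close>

lemma acyclic_at_degree_complex_nonsqfree:
  assumes k: "Poly_Mapping.lookup u k \<ge> 2"
  shows "acyclic_at TYPE('a::comm_ring_1) (degree_complex (edge_mono E) u) p"
proof (rule acyclic_at_cone[of _ k])
  show "complex (degree_complex (edge_mono E) u)"
    by (rule degree_complex_complex) (rule edge_mono_add)
  fix F assume F: "F \<in> degree_complex (edge_mono E) u"
  let ?W = "Poly_Mapping.keys u"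
  have kW: "k \<in> ?W" using k by (simp add: in_keys_iff)
  have "Poly_Mapping.keys (u - sqfree (?W - insert k F)) = Poly_Mapping.keys (u - sqfree (?W - F))"
    using k by (auto simp: in_keys_iff lookup_minus lookup_sqfree split: if_splits)
  then show "insert k F \<in> degree_complex (edge_mono E) u"
    using F kW by (auto simp: degree_complex_def edge_mono_def)
qed

lemma degree_complex_sqfree:
  assumes "finite W"
  shows "degree_complex (edge_mono E) (sqfree W) = indeps E W"
proof -
  have "Poly_Mapping.keys (sqfree W - sqfree (W - F)) = F" if "F \<subseteq> W" for F
    using that assms by (auto simp: in_keys_iff lookup_minus lookup_sqfree split: if_splits)
  then show ?thesis using assms by (auto simp: degree_complex_def indeps_def edge_mono_def)
qed

lemma sqfree_or_square:
  obtains "u = sqfree (Poly_Mapping.keys u)" | k where "Poly_Mapping.lookup u k \<ge> 2"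
proof (cases "\<exists>k. Poly_Mapping.lookup u k \<ge> 2")
  case False
  then have "Poly_Mapping.lookup u k = (if k \<in> Poly_Mapping.keys u then 1 else 0)" for k
    by (metis One_nat_def in_keys_iff less_2_cases not_le)
  then have "u = sqfree (Poly_Mapping.keys u)"
    by (intro poly_mapping_eqI) (simp add: lookup_sqfree)
  then show ?thesis using that by blast
qed (use that in blast)

lemma koszul_exact_edge:
  fixes c :: "nat set \<Rightarrow> 'k::field mpoly"
  assumes c: "\<And>T. T \<subseteq> {1..n} \<Longrightarrow> c T \<in> polys n"
    and cocycle: "\<And>T. T \<subseteq> {1..n} \<Longrightarrow> card T = Suc p \<Longrightarrow> cobd var c T \<in> mono_ideal n (edge_mono E)"
    and Q: "\<And>T m. T \<subseteq> {1..n} \<Longrightarrow> card T = p \<Longrightarrow> m \<in> Poly_Mapping.keys (c T) \<Longrightarrow> Q (m + sqfree ({1..n} - T))"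
    and acyc: "\<And>W. W \<subseteq> {1..n} \<Longrightarrow> Q (sqfree W) \<Longrightarrow> n - card W \<le> p \<Longrightarrow>
      acyclic_at TYPE('k) (indeps E W) (p - (n - card W))"
  shows "\<exists>b. (\<forall>T\<subseteq>{1..n}. b T \<in> polys n \<and>
      (\<forall>m\<in>Poly_Mapping.keys (b T). Q (m + sqfree ({1..n} - T)))) \<and>
    (\<forall>T\<subseteq>{1..n}. card T = p \<longrightarrow> c T - cobd var b T \<in> mono_ideal n (edge_mono E))"
proof (rule koszul_exact_multigraded[where Q = Q])
  show "c T \<in> polys n" if "T \<subseteq> {1..n}" for T by (rule c[OF that])
  show "cobd var c T \<in> mono_ideal n (edge_mono E)" if "T \<subseteq> {1..n}" "card T = Suc p" for T
    by (rule cocycle[OF that])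
  show "Q (m + sqfree ({1..n} - T))"
    if "T \<subseteq> {1..n}" "card T = p" "m \<in> Poly_Mapping.keys (c T)" for T m by (rule Q[OF that])
  fix u assume u: "Poly_Mapping.keys u \<subseteq> {1..n}" "Q u" "n - card (Poly_Mapping.keys u) \<le> p"
  show "acyclic_at TYPE('k) (degree_complex (edge_mono E) u) (p - (n - card (Poly_Mapping.keys u)))"
  proof (cases rule: sqfree_or_square[of u])
    case 1
    then show ?thesis
      using acyc[of "Poly_Mapping.keys u"] u degree_complex_sqfree[of "Poly_Mapping.keys u" E] by simp
  next
    case (2 k)
    then show ?thesis by (rule acyclic_at_degree_complex_nonsqfree)
  qed
qed

lemma monom_degree_superset:
  "finite A \<Longrightarrow> Poly_Mapping.keys m \<subseteq> A \<Longrightarrow> monom_degree m = (\<Sum>i\<in>A. Poly_Mapping.lookup m i)"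
  unfolding monom_degree_def by (rule sum.mono_neutral_left) (auto simp: in_keys_iff)

lemma monom_degree_add: "monom_degree (a + b) = monom_degree a + monom_degree b"
proof -
  let ?A = "Poly_Mapping.keys a \<union> Poly_Mapping.keys b"
  have "monom_degree (a + b) = (\<Sum>i\<in>?A. Poly_Mapping.lookup (a + b) i)"
    by (rule monom_degree_superset) (auto simp: keys_add_nat)
  also have "\<dots> = monom_degree a + monom_degree b"
    by (simp add: lookup_add sum.distrib monom_degree_superset[of ?A a] monom_degree_superset[of ?A b])
  finally show ?thesis .
qed

lemma monom_degree_sqfree [simp]: "finite S \<Longrightarrow> monom_degree (sqfree S) = card S"
  by (simp add: monom_degree_def lookup_sqfree)

lemma monom_degree_0 [simp]: "monom_degree 0 = 0"
  by (simp add: monom_degree_def)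

lemma monom_degree_single [simp]: "monom_degree (Poly_Mapping.single i k) = k"
  by (simp add: monom_degree_def)

text \<open>The cochain of the Koszul complex in total degree \<open>j\<close> attached to \<open>T\<close> has coefficients
  in degree \<open>j - (n - card T)\<close>.\<close>

lemma hom_part_iff_total_degree:
  assumes "T \<subseteq> {1..n}"
  shows "p \<in> hom_part n (j - int (n - card T)) \<longleftrightarrow>
    p \<in> polys n \<and> (\<forall>m\<in>Poly_Mapping.keys p. int (monom_degree (m + sqfree ({1..n} - T))) = j)"
proof -
  have "card ({1..n} - T) = n - card T" using assms by (subst card_Diff_subset) (auto intro: finite_subset)
  then show ?thesis by (auto simp: hom_part_def monom_degree_add)
qed

lemma mono_ideal_False: "mono_ideal n (\<lambda>_. False) = {0}"
  by (auto simp: mono_ideal_def)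

text \<open>The Koszul complex of the polynomial ring itself is exact except in multidegree \<open>0\<close>, where only the top
cochain degree \<open>n\<close> survives; this is excluded by the assumption on the constant coefficient.\<close>

lemma koszul_exact_free:
  fixes c :: "nat set \<Rightarrow> 'k::field mpoly"
  assumes c: "\<And>T. T \<subseteq> {1..n} \<Longrightarrow> c T \<in> hom_part n (j - int (n - card T))"
    and p: "p < n \<or> p = n \<and> Poly_Mapping.lookup (c {1..n}) 0 = 0"
    and cocycle: "\<And>T. T \<subseteq> {1..n} \<Longrightarrow> card T = Suc p \<Longrightarrow> cobd var c T = 0"
  shows "\<exists>b. (\<forall>T\<subseteq>{1..n}. b T \<in> hom_part n (j - int (n - card T))) \<and>
    (\<forall>T\<subseteq>{1..n}. card T = p \<longrightarrow> c T = cobd var b T)"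
proof -
  have "\<exists>b. (\<forall>T\<subseteq>{1..n}. b T \<in> polys n \<and>
      (\<forall>m\<in>Poly_Mapping.keys (b T). int (monom_degree (m + sqfree ({1..n} - T))) = j \<and>
         Poly_Mapping.keys (m + sqfree ({1..n} - T)) \<noteq> {})) \<and>
    (\<forall>T\<subseteq>{1..n}. card T = p \<longrightarrow> c T - cobd var b T \<in> mono_ideal n (\<lambda>_. False))"
  proof (rule koszul_exact_multigraded[where Q = "\<lambda>u. int (monom_degree u) = j \<and> Poly_Mapping.keys u \<noteq> {}"])
    show "c T \<in> polys n" if "T \<subseteq> {1..n}" for T using c[OF that] by (simp add: hom_part_def)
    show "cobd var c T \<in> mono_ideal n (\<lambda>_. False)" if "T \<subseteq> {1..n}" "card T = Suc p" for T
      using cocycle that by (simp add: mono_ideal_False)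
    show "int (monom_degree (m + sqfree ({1..n} - T))) = j \<and> Poly_Mapping.keys (m + sqfree ({1..n} - T)) \<noteq> {}"
      if T: "T \<subseteq> {1..n}" "card T = p" "m \<in> Poly_Mapping.keys (c T)" for T m
    proof
      show "int (monom_degree (m + sqfree ({1..n} - T))) = j"
        using c[OF T(1)] T hom_part_iff_total_degree by blast
      show "Poly_Mapping.keys (m + sqfree ({1..n} - T)) \<noteq> {}"
      proof (cases "p < n")
        case True
        then have "T \<noteq> {1..n}" using T(2) by auto
        then show ?thesis using T(1) by (auto simp: keys_add_nat)
      next
        case False
        then have "T = {1..n}" using T p by (intro card_subset_eq) auto
        then have "m \<noteq> 0" using False p T(3) by (auto simp: in_keys_iff)
        then show ?thesis unfolding keys_add_nat
          by (metis Un_empty empty_iff in_keys_iff lookup_zero poly_mapping_eqI)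
      qed
    qed
    show "acyclic_at TYPE('k) (degree_complex (\<lambda>_. False) u) (p - (n - card (Poly_Mapping.keys u)))"
      if "int (monom_degree u) = j \<and> Poly_Mapping.keys u \<noteq> {}" for u
      using that by (intro acyclic_at_degree_complex_free) simp
  qed
  then obtain b where "\<forall>T\<subseteq>{1..n}. b T \<in> polys n \<and>
      (\<forall>m\<in>Poly_Mapping.keys (b T). int (monom_degree (m + sqfree ({1..n} - T))) = j \<and>
         Poly_Mapping.keys (m + sqfree ({1..n} - T)) \<noteq> {})"
    "\<forall>T\<subseteq>{1..n}. card T = p \<longrightarrow> c T - cobd var b T \<in> mono_ideal n (\<lambda>_. False)"
    by blast
  then show ?thesis
    by (intro exI[of _ b]) (auto simp: mono_ideal_False hom_part_iff_total_degree)
qed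

text \<open>Conversely, a simplicial cocycle on the subgraph induced by \<open>W\<close> becomes a Koszul cocycle concentrated in the
squarefree multidegree \<open>W\<close>, and a Koszul primitive would have a component there.\<close>

lemma koszul_not_exact_edge:
  assumes W: "W \<subseteq> {1..n}" and q: "\<not> acyclic_at TYPE('k::field) (indeps E W) q"
    and p: "p = q + (n - card W)"
  shows "\<exists>c::nat set \<Rightarrow> 'k mpoly. (\<forall>T\<subseteq>{1..n}. c T \<in> hom_part n (int (card W) - int (n - card T))) \<and>
    (\<forall>T\<subseteq>{1..n}. card T = Suc p \<longrightarrow> cobd var c T \<in> mono_ideal n (edge_mono E)) \<and>
    \<not> (\<exists>b. (\<forall>T\<subseteq>{1..n}. b T \<in> polys n) \<and>
         (\<forall>T\<subseteq>{1..n}. card T = p \<longrightarrow> c T - cobd var b T \<in> mono_ideal n (edge_mono E)))"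
proof -
  have fin: "finite W" using W finite_subset by blast
  obtain a :: "nat set \<Rightarrow> 'k" where
    a: "\<And>F. F \<in> indeps E W \<Longrightarrow> card F = Suc q \<Longrightarrow> cobd (\<lambda>_. 1) a F = 0"
    and na: "\<And>b. \<exists>F\<in>indeps E W. card F = q \<and> a F \<noteq> cobd (\<lambda>_. 1) b F"
    using q unfolding acyclic_at_def by blast
  define Z where "Z = {1..n} - W"
  have finZ: "finite Z" by (simp add: Z_def)
  have cardZ: "card Z = n - card W" unfolding Z_def using W fin by (subst card_Diff_subset) auto
  define c where "c = (\<lambda>T. if Z \<subseteq> T then Poly_Mapping.single (sqfree (T \<inter> W))
    ((\<Prod>k\<in>T \<inter> W. pos_sign k Z) * a (T \<inter> W)) else 0)"
  have total: "sqfree (T \<inter> W) + sqfree ({1..n} - T) = sqfree W" if "Z \<subseteq> T" "T \<subseteq> {1..n}" for T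
  proof -
    have "W = (T \<inter> W) \<union> ({1..n} - T)" using that W by (auto simp: Z_def)
    moreover have "sqfree ((T \<inter> W) \<union> ({1..n} - T)) = sqfree (T \<inter> W) + sqfree ({1..n} - T)"
      using fin by (intro sqfree_union) auto
    ultimately show ?thesis by metis
  qed
  have c_polys: "c T \<in> polys n" for T
    using W fin by (auto simp: c_def intro!: polys_single)
  have comp_c: "component n (sqfree W) c F = a F" if F: "F \<subseteq> W" for F
  proof -
    have "(Z \<union> F) \<inter> W = F" using F by (auto simp: Z_def)
    moreover have "sqfree W - sqfree (W - F) = sqfree F"
      using F fin by (intro poly_mapping_eqI) (auto simp: lookup_minus lookup_sqfree finite_subset)
    ultimately show ?thesis
      using fin by (simp add: component_def c_def flip: Z_def[simplified] mult.assoc)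
  qed
  have "c T \<in> hom_part n (int (card W) - int (n - card T))" if T: "T \<subseteq> {1..n}" for T
    unfolding hom_part_iff_total_degree[OF T]
  proof (intro conjI ballI c_polys)
    fix m assume "m \<in> Poly_Mapping.keys (c T)"
    then have "Z \<subseteq> T" "m = sqfree (T \<inter> W)" by (auto simp: c_def split: if_splits)
    then show "int (monom_degree (m + sqfree ({1..n} - T))) = int (card W)"
      using total[OF _ T] fin by simp
  qed
  moreover have "cobd var c T \<in> mono_ideal n (edge_mono E)" if T: "T \<subseteq> {1..n}" "card T = Suc p" for T
  proof (rule mono_idealI)
    show "cobd var c T \<in> polys n" using T c_polys by (intro polys_cobd) auto
    fix m assume m: "Poly_Mapping.keys m \<subseteq> {1..n}" "\<not> edge_mono E m"
    define u where "u = m + sqfree ({1..n} - T)"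
    let ?F = "T \<inter> Poly_Mapping.keys u"
    have "component n u (cobd var c) ?F = 0"
    proof (cases "u = sqfree W")
      case True
      have "Poly_Mapping.keys u = Poly_Mapping.keys m \<union> ({1..n} - T)" by (simp add: u_def keys_add_nat)
      then have "Z \<subseteq> T" using True fin by (auto simp: Z_def)
      have "m = sqfree (T \<inter> W)"
        using total[OF \<open>Z \<subseteq> T\<close> T(1)] True by (simp add: u_def) (metis add_right_cancel)
      then have F: "?F \<in> indeps E W" using m fin True by (auto simp: indeps_def edge_mono_def)
      have "T = Z \<union> (T \<inter> W)" using \<open>Z \<subseteq> T\<close> T by (auto simp: Z_def)
      moreover have "card (Z \<union> (T \<inter> W)) = card Z + card (T \<inter> W)"
        using fin finZ by (intro card_Un_disjoint) (auto simp: Z_def)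
      ultimately have "card T = card Z + card (T \<inter> W)" by simp
      then have cardF: "card ?F = Suc q" using fin True T p cardZ by simp
      have "component n u (cobd var c) ?F = cobd (\<lambda>_. 1) (component n u c) ?F"
        by (rule component_cobd[symmetric]) simp
      also have "\<dots> = cobd (\<lambda>_. 1) a ?F"
        unfolding True using fin by (intro cobd_cong comp_c) auto
      finally show ?thesis using a[OF F cardF] by simp
    next
      case False
      have comp0: "component n u c F = 0" if "F \<subseteq> Poly_Mapping.keys u" for F
      proof (rule ccontr)
        let ?T = "({1..n} - Poly_Mapping.keys u) \<union> F"
        assume "component n u c F \<noteq> 0"
        then have "Poly_Mapping.lookup (c ?T) (u - sqfree (Poly_Mapping.keys u - F)) \<noteq> 0"
          by (auto simp: component_def)
        then have Z: "Z \<subseteq> ?T" "u - sqfree (Poly_Mapping.keys u - F) = sqfree (?T \<inter> W)"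
          by (auto simp: c_def lookup_single when_def split: if_splits)
        have ku: "Poly_Mapping.keys u \<subseteq> {1..n}" using m by (auto simp: u_def keys_add_nat)
        then have T': "?T \<subseteq> {1..n}" "Poly_Mapping.keys u - F = {1..n} - ?T" using that by auto
        have "u = u - sqfree (Poly_Mapping.keys u - F) + sqfree (Poly_Mapping.keys u - F)"
          by (rule sqfree_minus_add[symmetric]) auto
        also have "\<dots> = sqfree (?T \<inter> W) + sqfree ({1..n} - ?T)"
          by (simp only: Z(2)) (simp only: T'(2))
        also have "\<dots> = sqfree W" by (rule total[OF Z(1) T'(1)])
        finally show False using False by simp
      qed
      have "cobd (\<lambda>_. 1) (component n u c) ?F = cobd (\<lambda>_. 1) (\<lambda>_. 0) ?F"
        by (intro cobd_cong comp0) auto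
      then show ?thesis using component_cobd[of ?F u n c] by (simp add: cobd_def)
    qed
    then show "Poly_Mapping.lookup (cobd var c T) m = 0"
      using lookup_eq_component[OF T(1) m(1) u_def, of "cobd var c"] by simp
  qed
  moreover have False if b: "\<And>T. T \<subseteq> {1..n} \<Longrightarrow> card T = p \<Longrightarrow> c T - cobd var b T \<in> mono_ideal n (edge_mono E)" for b
  proof -
    obtain F where F: "F \<in> indeps E W" "card F = q" "a F \<noteq> cobd (\<lambda>_. 1) (component n (sqfree W) b) F"
      using na by blast
    have FW: "F \<subseteq> W" "finite F" using F fin by (auto simp: indeps_def intro: finite_subset)
    let ?T = "Z \<union> F"
    have "card ?T = card Z + card F"
      using finZ FW by (intro card_Un_disjoint) (auto simp: Z_def)
    then have T: "?T \<subseteq> {1..n}" "card ?T = p" "?T \<inter> W = F" "{1..n} - ?T = W - F"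
      using FW W F(2) p cardZ by (auto simp: Z_def)
    have tot: "sqfree W = sqfree F + sqfree ({1..n} - ?T)"
      using total[of ?T] T(1,3) by auto
    have "\<not> edge_mono E (sqfree F)" using F FW by (auto simp: edge_mono_def indeps_def)
    then have "Poly_Mapping.lookup (c ?T - cobd var b ?T) (sqfree F) = 0"
      using b[OF T(1,2)] by (auto simp: mono_ideal_def in_keys_iff)
    moreover have "component n (sqfree W) d F = (\<Prod>k\<in>F. pos_sign k Z) * Poly_Mapping.lookup (d ?T) (sqfree F)"
      for d :: "nat set \<Rightarrow> 'k mpoly"
    proof -
      have "Poly_Mapping.keys (sqfree F) \<subseteq> {1..n}" using FW W by auto
      then show ?thesis
        using component_eq[OF T(1) _ tot, of d] unfolding keys_sqfree[OF fin] T(3) unfolding Z_def by blast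
    qed
    ultimately have "component n (sqfree W) c F = component n (sqfree W) (cobd var b) F"
      by (simp add: lookup_minus)
    then show False using F(3) comp_c[OF FW(1)] component_cobd[of F "sqfree W" n b] FW fin by simp
  qed
  ultimately show ?thesis by (intro exI[of _ c]) blast
qed

section \<open>Submodules of free modules are finitely generated\<close>

text \<open>Dickson's lemma is obtained from monotone subsequences, one coordinate at a time; it provides finitely many
leading terms of a submodule which divide all others, and these give generators.\<close>

lemma nat_seq_mono_subseq:
  fixes g :: "nat \<Rightarrow> nat"
  shows "\<exists>\<phi>::nat \<Rightarrow> nat. strict_mono \<phi> \<and> (\<forall>i j. i \<le> j \<longrightarrow> g (\<phi> i) \<le> g (\<phi> j))"
proof -
  obtain f :: "nat \<Rightarrow> nat" where f: "strict_mono f" "monoseq (\<lambda>n. g (f n))"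
    using seq_monosub by blast
  show ?thesis
  proof (cases "\<forall>m n. m \<le> n \<longrightarrow> g (f m) \<le> g (f n)")
    case True
    then show ?thesis using f by blast
  next
    case False
    then have dec: "g (f n) \<le> g (f m)" if "m \<le> n" for m n
      using f that unfolding monoseq_def by blast
    obtain N where N: "\<And>n. g (f N) \<le> g (f n)"
      using ex_has_least_nat[of "\<lambda>_. True" _ "\<lambda>n. g (f n)"] by auto
    have "g (f (i + N)) = g (f N)" for i using dec[of N "i + N"] N[of "i + N"] by simp
    then have "\<forall>i j. i \<le> j \<longrightarrow> g (f (i + N)) \<le> g (f (j + N))" by simp
    moreover have "strict_mono (\<lambda>i. f (i + N))" using f by (simp add: strict_mono_def)
    ultimately show ?thesis by blast
  qed
qed

lemma dickson_subseq:
  fixes g :: "nat \<Rightarrow> 'c \<Rightarrow> nat"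
  assumes "finite X"
  shows "\<exists>\<phi>::nat \<Rightarrow> nat. strict_mono \<phi> \<and> (\<forall>x\<in>X. \<forall>i j. i \<le> j \<longrightarrow> g (\<phi> i) x \<le> g (\<phi> j) x)"
  using assms
proof (induction X rule: finite_induct)
  case empty
  then show ?case by (intro exI[of _ id]) (simp add: strict_mono_def)
next
  case (insert x X)
  then obtain \<phi> :: "nat \<Rightarrow> nat" where \<phi>: "strict_mono \<phi>"
    "\<And>x i j. x \<in> X \<Longrightarrow> i \<le> j \<Longrightarrow> g (\<phi> i) x \<le> g (\<phi> j) x" by blast
  obtain \<psi> :: "nat \<Rightarrow> nat" where \<psi>: "strict_mono \<psi>" "\<And>i j. i \<le> j \<Longrightarrow> g (\<phi> (\<psi> i)) x \<le> g (\<phi> (\<psi> j)) x"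
    using nat_seq_mono_subseq[of "\<lambda>i. g (\<phi> i) x"] by blast
  have "\<psi> i \<le> \<psi> j" if "i \<le> j" for i j using \<psi>(1) that by (simp add: strict_mono_less_eq)
  then have "\<forall>y\<in>insert x X. \<forall>i j. i \<le> j \<longrightarrow> g (\<phi> (\<psi> i)) y \<le> g (\<phi> (\<psi> j)) y"
    using \<phi>(2) \<psi>(2) by blast
  moreover have "strict_mono (\<lambda>i. \<phi> (\<psi> i))" using \<phi>(1) \<psi>(1) by (simp add: strict_mono_def)
  ultimately show ?case by blast
qed

text \<open>A term \<open>(a, m)\<close> is the monomial \<open>m\<close> in the component \<open>a\<close> of a free module.\<close>

definition term_dvd :: "nat \<times> (nat \<Rightarrow>\<^sub>0 nat) \<Rightarrow> nat \<times> (nat \<Rightarrow>\<^sub>0 nat) \<Rightarrow> bool" where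
  "term_dvd s t \<longleftrightarrow> fst s = fst t \<and> (\<forall>k. Poly_Mapping.lookup (snd s) k \<le> Poly_Mapping.lookup (snd t) k)"

definition terms :: "nat \<Rightarrow> nat \<Rightarrow> (nat \<times> (nat \<Rightarrow>\<^sub>0 nat)) set" where
  "terms n r = {..<r} \<times> {m. Poly_Mapping.keys m \<subseteq> {1..n}}"

text \<open>Using both \<open>a\<close> and \<open>r - a\<close> as coordinates forces the components to agree.\<close>

lemma dickson_terms:
  assumes "\<And>i::nat. s i \<in> terms n r"
  shows "\<exists>i j. i < j \<and> term_dvd (s i) (s j)"
proof -
  define g where "g = (\<lambda>i x. case x of None \<Rightarrow> fst (s i) | Some k \<Rightarrow>
     if k = 0 then r - fst (s i) else Poly_Mapping.lookup (snd (s i)) k)"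
  have "finite (insert None (Some ` {0..n}))" by simp
  from dickson_subseq[OF this, of g] obtain \<phi> :: "nat \<Rightarrow> nat" where \<phi>: "strict_mono \<phi>"
    "\<And>x i j. x \<in> insert None (Some ` {0..n}) \<Longrightarrow> i \<le> j \<Longrightarrow> g (\<phi> i) x \<le> g (\<phi> j) x"
    by blast
  let ?i = "\<phi> 0" and ?j = "\<phi> 1"
  have pos: "fst (s i) < r" for i using assms[of i] by (auto simp: terms_def)
  have "fst (s ?i) \<le> fst (s ?j)" "r - fst (s ?i) \<le> r - fst (s ?j)"
    using \<phi>(2)[of None 0 1] \<phi>(2)[of "Some 0" 0 1] by (auto simp: g_def)
  then have "fst (s ?i) = fst (s ?j)" using pos[of ?i] pos[of ?j] by linarith
  moreover have "Poly_Mapping.lookup (snd (s ?i)) k \<le> Poly_Mapping.lookup (snd (s ?j)) k" for k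
  proof (cases "k \<in> {1..n}")
    case True
    then show ?thesis using \<phi>(2)[of "Some k" 0 1] by (auto simp: g_def)
  next
    case False
    then have "k \<notin> Poly_Mapping.keys (snd (s ?i))" using assms[of ?i] by (auto simp: terms_def)
    then show ?thesis by (simp add: in_keys_iff)
  qed
  moreover have "?i < ?j" using \<phi>(1) by (simp add: strict_mono_def)
  ultimately show ?thesis unfolding term_dvd_def by blast
qed

definition term_less :: "nat \<times> (nat \<Rightarrow>\<^sub>0 nat) \<Rightarrow> nat \<times> (nat \<Rightarrow>\<^sub>0 nat) \<Rightarrow> bool" where
  "term_less s t \<longleftrightarrow> fst s < fst t \<or> fst s = fst t \<and> snd s < snd t"

lemma monom_pointwise_le:
  fixes m m' :: "nat \<Rightarrow>\<^sub>0 nat"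
  assumes "\<And>k. Poly_Mapping.lookup m k \<le> Poly_Mapping.lookup m' k"
  shows "m \<le> m'"
proof (rule ccontr)
  assume "\<not> m \<le> m'"
  then have "m' < m" by simp
  then show False using assms
    by (auto simp: less_poly_mapping.rep_eq less_fun_def) (metis leD)
qed

lemma wf_term_less: "wf {(s, t). term_less s t \<and> s \<in> terms n r \<and> t \<in> terms n r}"
  unfolding wf_iff_no_infinite_down_chain
proof
  assume "\<exists>f. \<forall>i. (f (Suc i), f i) \<in> {(s, t). term_less s t \<and> s \<in> terms n r \<and> t \<in> terms n r}"
  then obtain f where f: "\<And>i. term_less (f (Suc i)) (f i)" "\<And>i. f i \<in> terms n r" by blast
  have less: "term_less (f j) (f i)" if "i < j" for i j
    using that
  proof (induction j)
    case (Suc j)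
    then show ?case using f(1)[of j] by (cases "i = j") (auto simp: term_less_def)
  qed simp
  obtain i j where "i < j" "term_dvd (f i) (f j)" using dickson_terms[of f, OF f(2)] by blast
  then show False using less[OF \<open>i < j\<close>] monom_pointwise_le[of "snd (f i)" "snd (f j)"]
    by (auto simp: term_dvd_def term_less_def)
qed

lemma dickson_basis:
  assumes L: "L \<subseteq> terms n r"
  shows "\<exists>B\<subseteq>L. finite B \<and> (\<forall>t\<in>L. \<exists>b\<in>B. term_dvd b t)"
proof -
  define B where "B = {t\<in>L. \<forall>s\<in>L. term_dvd s t \<longrightarrow> s = t}"
  have "finite B"
  proof (rule ccontr)
    assume "infinite B"
    then obtain s :: "nat \<Rightarrow> _" where s: "inj s" "range s \<subseteq> B" using infinite_countable_subset by blast
    then have "s i \<in> terms n r" for i using L by (auto simp: B_def)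
    then obtain i j where ij: "i < j" "term_dvd (s i) (s j)" using dickson_terms by blast
    moreover have "s i \<in> B" "s j \<in> B" using s by auto
    ultimately have "s i = s j" by (auto simp: B_def)
    then show False using s(1) ij(1) by (auto dest: injD)
  qed
  moreover have "\<exists>b\<in>B. term_dvd b t" if "t \<in> L" for t
    using that
  proof (induction "monom_degree (snd t)" arbitrary: t rule: less_induct)
    case less
    show ?case
    proof (cases "t \<in> B")
      case True
      then show ?thesis by (auto simp: term_dvd_def)
    next
      case False
      then obtain s where s: "s \<in> L" "term_dvd s t" "s \<noteq> t" using less.prems by (auto simp: B_def)
      have "snd t = snd s + (snd t - snd s)"
        using s by (intro poly_mapping_eqI) (simp add: lookup_add lookup_minus term_dvd_def)
      then have deg: "monom_degree (snd t) = monom_degree (snd s) + monom_degree (snd t - snd s)"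
        by (metis monom_degree_add)
      have "snd t - snd s \<noteq> 0"
        using s \<open>snd t = snd s + (snd t - snd s)\<close> by (auto simp: term_dvd_def prod_eq_iff)
      then have "0 < monom_degree (snd t - snd s)"
        by (auto simp: monom_degree_def poly_mapping_eq_iff in_keys_iff fun_eq_iff intro!: sum_pos2)
      then obtain b where "b \<in> B" "term_dvd b s" using less.hyps[of s] s deg by auto
      then show ?thesis using s(2) by (auto simp: term_dvd_def intro: order_trans)
    qed
  qed
  moreover have "B \<subseteq> L" by (auto simp: B_def)
  ultimately show ?thesis by blast
qed

definition submod :: "nat \<Rightarrow> nat \<Rightarrow> (nat \<Rightarrow> 'k::field mpoly) set \<Rightarrow> bool" where
  "submod n r N \<longleftrightarrow> N \<subseteq> free_mod n r \<and> (\<lambda>_. 0) \<in> N \<and>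
     (\<forall>v\<in>N. \<forall>w\<in>N. (\<lambda>b. v b + w b) \<in> N) \<and> (\<forall>p\<in>polys n. \<forall>v\<in>N. (\<lambda>b. p * v b) \<in> N)"

lemma submodD:
  assumes "submod n r N"
  shows "N \<subseteq> free_mod n r" "(\<lambda>_. 0) \<in> N" "v \<in> N \<Longrightarrow> w \<in> N \<Longrightarrow> (\<lambda>b. v b + w b) \<in> N"
    "p \<in> polys n \<Longrightarrow> v \<in> N \<Longrightarrow> (\<lambda>b. p * v b) \<in> N"
  using assms by (auto simp: submod_def)

lemma submod_diff: "submod n r N \<Longrightarrow> v \<in> N \<Longrightarrow> w \<in> N \<Longrightarrow> (\<lambda>b. v b - w b) \<in> N"
  using submodD(3)[of n r N v "\<lambda>b. (- 1) * w b"] submodD(4)[of n r N "- 1" w] by auto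

lemma submod_sum:
  "submod n r N \<Longrightarrow> (\<And>i. i \<in> A \<Longrightarrow> f i \<in> N) \<Longrightarrow> (\<lambda>b. \<Sum>i\<in>A. f i b) \<in> N"
  by (induction A rule: infinite_finite_induct) (auto simp: submodD)

lemma submod_cobd:
  assumes "submod n r N" "\<And>k. k \<in> T \<Longrightarrow> c (T - {k}) \<in> N" "T \<subseteq> {1..n}"
  shows "(\<lambda>b. cobd var (\<lambda>S. c S b) T) \<in> N"
  unfolding cobd_def using assms
  by (intro submod_sum[OF assms(1)] submodD(4)[OF assms(1)] polys_mult polys_pos_sign polys_var) blast+

lemma submod_free_mod: "submod n r (free_mod n r)"
  by (auto simp: submod_def free_mod_def)

inductive_set mspan :: "nat \<Rightarrow> (nat \<Rightarrow> 'k::field mpoly) set \<Rightarrow> (nat \<Rightarrow> 'k mpoly) set"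
  for n :: nat and G :: "(nat \<Rightarrow> 'k::field mpoly) set" where
  zero: "(\<lambda>_. 0) \<in> mspan n G"
| step: "v \<in> mspan n G \<Longrightarrow> p \<in> polys n \<Longrightarrow> g \<in> G \<Longrightarrow> (\<lambda>b. p * g b + v b) \<in> mspan n G"

definition lead_pos :: "(nat \<Rightarrow> 'k::field mpoly) \<Rightarrow> nat" where
  "lead_pos v = Max {a. v a \<noteq> 0}"

definition lead_term :: "(nat \<Rightarrow> 'k::field mpoly) \<Rightarrow> nat \<times> (nat \<Rightarrow>\<^sub>0 nat)" where
  "lead_term v = (lead_pos v, Max (Poly_Mapping.keys (v (lead_pos v))))"

lemma lead_term_props:
  assumes v: "v \<in> free_mod n r" "v \<noteq> (\<lambda>_. 0)" and t: "lead_term v = (a, m)"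
  shows "(a, m) \<in> terms n r" "m \<in> Poly_Mapping.keys (v a)"
    "\<And>l. l \<in> Poly_Mapping.keys (v a) \<Longrightarrow> l \<le> m" "\<And>b. a < b \<Longrightarrow> v b = 0"
proof -
  have sub: "{a. v a \<noteq> 0} \<subseteq> {..<r}" using v by (auto simp: free_mod_def not_less[symmetric])
  then have fin: "finite {a. v a \<noteq> 0}" using finite_subset by blast
  have ne: "{a. v a \<noteq> 0} \<noteq> {}" using v by auto
  have a: "a = Max {a. v a \<noteq> 0}" using t by (simp add: lead_term_def lead_pos_def)
  then have va: "v a \<noteq> 0" using Max_in[OF fin ne] by simp
  have m: "m = Max (Poly_Mapping.keys (v a))" using t by (auto simp: lead_term_def)
  have kne: "Poly_Mapping.keys (v a) \<noteq> {}"
    using va by (metis empty_iff in_keys_iff lookup_zero poly_mapping_eqI)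
  show mk: "m \<in> Poly_Mapping.keys (v a)" using Max_in[OF finite_keys kne] m by simp
  show "l \<le> m" if "l \<in> Poly_Mapping.keys (v a)" for l using that m by simp
  show "v b = 0" if "a < b" for b using Max_ge[OF fin, of b] a that by (metis leD mem_Collect_eq)
  have "a < r" using va sub by auto
  then show "(a, m) \<in> terms n r" using v(1) mk by (auto simp: terms_def free_mod_def polys_iff)
qed

text \<open>Division with remainder: subtracting a multiple of an element of \<open>G\<close> cancels the leading term, and
the term order is well-founded.\<close>

lemma mspan_of_lead_terms:
  assumes N: "submod n r N" and G: "G \<subseteq> N" "\<And>g. g \<in> G \<Longrightarrow> g \<noteq> (\<lambda>_. 0)"
    and div: "\<And>v. v \<in> N \<Longrightarrow> v \<noteq> (\<lambda>_. 0) \<Longrightarrow> \<exists>g\<in>G. term_dvd (lead_term g) (lead_term v)"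
    and v: "v \<in> N"
  shows "v \<in> mspan n G"
proof (cases "v = (\<lambda>_. 0)")
  case False
  then have "lead_term v = t \<longrightarrow> v \<in> mspan n G" for t
    using v
  proof (induction t arbitrary: v rule: wf_induct_rule[OF wf_term_less[of n r]])
    case (1 t)
    show ?case
    proof
      assume t: "lead_term v = t"
      obtain a m where am: "t = (a, m)" by (cases t)
      have vF: "v \<in> free_mod n r" using 1 N by (auto simp: submod_def)
      note v = lead_term_props[OF vF 1(2) t[unfolded am]]
      obtain g where g: "g \<in> G" "term_dvd (lead_term g) (lead_term v)" using div 1 by blast
      then obtain l where gl: "lead_term g = (a, l)" "\<And>k. Poly_Mapping.lookup l k \<le> Poly_Mapping.lookup m k"
        using t am by (cases "lead_term g") (auto simp: term_dvd_def)
      have gN: "g \<in> N" "g \<noteq> (\<lambda>_. 0)" using g G by auto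
      have gF: "g \<in> free_mod n r" using gN N by (auto simp: submod_def)
      note gp = lead_term_props[OF gF gN(2) gl(1)]
      have m: "m = (m - l) + l" using gl(2) by (intro poly_mapping_eqI) (simp add: lookup_add lookup_minus)
      define q where "q = Poly_Mapping.single (m - l) (Poly_Mapping.lookup (v a) m / Poly_Mapping.lookup (g a) l)"
      have q: "q \<in> polys n"
        using v(1) unfolding q_def by (intro polys_single) (auto simp: terms_def in_keys_iff lookup_minus subset_iff)
      define w where "w = (\<lambda>b. v b - q * g b)"
      have wN: "w \<in> N" unfolding w_def by (intro submod_diff[OF N] submodD(4)[OF N q] gN 1(3))
      have "w \<in> mspan n G"
      proof (cases "w = (\<lambda>_. 0)")
        case True
        then show ?thesis by (simp add: mspan.zero)
      next
        case False
        have wF: "w \<in> free_mod n r" using wN N by (auto simp: submod_def)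
        obtain a' m' where am': "lead_term w = (a', m')" by (cases "lead_term w")
        note wp = lead_term_props[OF wF False am']
        have "w b = 0" if "a < b" for b using v(4)[OF that] gp(4)[OF that] by (simp add: w_def)
        then have "a' \<le> a" using wp(2) by (metis keys_zero empty_iff not_le)
        moreover have "m' < m" if "a' = a"
        proof -
          have "Poly_Mapping.lookup (q * g a) m = Poly_Mapping.lookup (v a) m"
            unfolding q_def using gp(2) by (subst m, subst lookup_single_times_add) (simp add: in_keys_iff)
          then have "m' \<noteq> m" using wp(2) that by (auto simp: w_def lookup_minus in_keys_iff)
          moreover have "m' \<le> m"
          proof (cases "m' \<in> Poly_Mapping.keys (v a)")
            case True
            then show ?thesis by (rule v(3))
          next
            case False
            then have "m' \<in> Poly_Mapping.keys (q * g a)"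
              using wp(2) that by (auto simp: w_def lookup_minus in_keys_iff)
            then obtain k where "m' = (m - l) + k" "k \<in> Poly_Mapping.keys (g a)"
              using keys_mult[of q "g a"] by (auto simp: q_def split: if_splits)
            then show ?thesis using gp(3)[of k] m add_left_mono[of k l "m - l"] by metis
          qed
          ultimately show ?thesis by simp
        qed
        ultimately have "term_less (a', m') t" by (auto simp: term_less_def am)
        then show ?thesis using 1(1)[of "(a', m')" w] am am' wp(1) v(1) False wN by blast
      qed
      then have "(\<lambda>b. q * g b + w b) \<in> mspan n G" by (rule mspan.step[OF _ q g(1)])
      then show "v \<in> mspan n G" by (simp add: w_def)
    qed
  qed
  then show ?thesis by blast
qed (simp add: mspan.zero)

lemma mspan_mat_map:
  assumes G: "G \<subseteq> free_mod n r" "finite G"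
  shows "\<exists>s M. (\<forall>k<s. M k \<in> G) \<and> mspan n G \<subseteq> mat_map s r M ` free_mod n s"
proof -
  obtain M where M: "bij_betw M {..<card G} G" using ex_bij_betw_nat_finite[OF G(2)] by (auto simp: atLeast0LessThan)
  let ?s = "card G"
  have "v \<in> mat_map ?s r M ` free_mod n ?s" if "v \<in> mspan n G" for v
    using that
  proof induction
    case zero
    have "(\<lambda>_. 0) = mat_map ?s r M (\<lambda>_. 0)" by (auto simp: mat_map_def)
    then show ?case by (intro image_eqI[of _ _ "\<lambda>_. 0"]) (auto simp: free_mod_def)
  next
    case (step v p g)
    then obtain a where a: "v = mat_map ?s r M a" "a \<in> free_mod n ?s" by blast
    obtain k where k: "k < ?s" "g = M k" using step M by (auto simp: bij_betw_def)
    let ?a = "a(k := a k + p)"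
    have "(\<lambda>b. p * g b + v b) = mat_map ?s r M ?a"
    proof
      fix b
      show "p * g b + v b = mat_map ?s r M ?a b"
      proof (cases "b < r")
        case True
        have "(\<Sum>i<?s. ?a i * M i b) = (\<Sum>i<?s. a i * M i b + (if i = k then p * M k b else 0))"
          by (intro sum.cong) (auto simp: algebra_simps)
        then show ?thesis using True k a by (simp add: mat_map_def sum.distrib)
      next
        case False
        then show ?thesis using step(3) G(1) a by (auto simp: mat_map_def free_mod_def)
      qed
    qed
    moreover have "?a \<in> free_mod n ?s" using a step k by (auto simp: free_mod_def)
    ultimately show ?case by blast
  qed
  moreover have "\<forall>k<?s. M k \<in> G" using M by (auto simp: bij_betw_def)
  ultimately show ?thesis by blast
qed

lemma mat_map_in_submod:
  assumes N: "submod n r N" "\<And>k. k < s \<Longrightarrow> M k \<in> N" and a: "a \<in> free_mod n s"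
  shows "mat_map s r M a \<in> N"
proof -
  have "(\<lambda>b. \<Sum>k<s. a k * M k b) \<in> N"
    using a N by (intro submod_sum[OF N(1)] submodD(4)[OF N(1)]) (auto simp: free_mod_def)
  moreover have "(\<lambda>b. \<Sum>k<s. a k * M k b) = mat_map s r M a"
    using N submodD(1)[OF N(1)] by (fastforce simp: mat_map_def free_mod_def intro!: sum.neutral)
  ultimately show ?thesis by simp
qed

theorem submod_finitely_generated:
  assumes N: "submod n r N"
  shows "\<exists>s M. (\<forall>k<s. M k \<in> N) \<and> N = mat_map s r M ` free_mod n s"
proof -
  let ?L = "lead_term ` {v\<in>N. v \<noteq> (\<lambda>_. 0)}"
  have "lead_term v \<in> terms n r" if v: "v \<in> N" "v \<noteq> (\<lambda>_. 0)" for v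
  proof -
    have "v \<in> free_mod n r" using v(1) submodD(1)[OF N] by blast
    then show ?thesis
      using lead_term_props(1)[OF _ v(2), of n r "fst (lead_term v)" "snd (lead_term v)"] by simp
  qed
  then have "?L \<subseteq> terms n r" by blast
  from dickson_basis[OF this] obtain B where
    B: "B \<subseteq> ?L" "finite B" "\<And>t. t \<in> ?L \<Longrightarrow> \<exists>b\<in>B. term_dvd b t"
    by blast
  obtain G where G: "G \<subseteq> {v\<in>N. v \<noteq> (\<lambda>_. 0)}" "finite G" "B = lead_term ` G"
    using finite_subset_image[OF B(2,1)] by blast
  have "v \<in> mspan n G" if "v \<in> N" for v
    by (rule mspan_of_lead_terms[OF N _ _ _ that]) (use G B in auto)
  moreover obtain s M where sM: "\<forall>k<s. M k \<in> G" "mspan n G \<subseteq> mat_map s r M ` free_mod n s"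
    using mspan_mat_map[of G n r] G submodD(1)[OF N] by blast
  moreover have "mat_map s r M a \<in> N" if "a \<in> free_mod n s" for a
    using that sM(1) G(1) by (intro mat_map_in_submod[OF N]) auto
  ultimately have "N = mat_map s r M ` free_mod n s" by blast
  then show ?thesis using sM(1) G(1) by blast
qed

section \<open>Associated primes and prime avoidance\<close>

lemma noetherian_poly_ring: "noetherian_ring (poly_ring n :: 'k::field mpoly ring)"
proof (rule ring.noetherian_ringI[OF PR.ring_axioms])
  fix J :: "'k mpoly set" assume "ideal J (poly_ring n)"
  then have J: "poly_ideal n J" by (simp add: ideal_poly_ring_iff)
  let ?N = "{v \<in> free_mod n 1. v 0 \<in> J}"
  have "submod n 1 ?N"
    using poly_idealD[OF J] by (auto simp: submod_def free_mod_def)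
  from submod_finitely_generated[OF this] obtain s M where
    M: "\<And>k. k < s \<Longrightarrow> M k \<in> ?N" "?N = mat_map s 1 M ` free_mod n s" by blast
  let ?A = "(\<lambda>k. M k 0) ` {..<s}"
  have A: "?A \<subseteq> J" "?A \<subseteq> polys n" using M(1) poly_idealD(1)[OF J] by blast+
  note AI = poly_ideal_genideal[OF A(2)]
  have "J \<subseteq> Idl\<^bsub>poly_ring n\<^esub> ?A"
  proof
    fix p assume p: "p \<in> J"
    then have "(\<lambda>b. if b = 0 then p else 0) \<in> ?N" using poly_idealD(1)[OF J] by (auto simp: free_mod_def)
    then obtain a where a: "a \<in> free_mod n s" "(\<lambda>b. if b = 0 then p else 0) = mat_map s 1 M a"
      using M(2) by blast
    from fun_cong[OF a(2), of 0] have "p = (\<Sum>k<s. a k * M k 0)" by (simp add: mat_map_def)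
    also have "\<dots> \<in> Idl\<^bsub>poly_ring n\<^esub> ?A"
      using a(1) genideal_superset[OF A(2)]
      by (intro poly_ideal_sum[OF AI] poly_idealD(4)[OF AI]) (auto simp: free_mod_def)
    finally show "p \<in> Idl\<^bsub>poly_ring n\<^esub> ?A" .
  qed
  then have "J = Idl\<^bsub>poly_ring n\<^esub> ?A" using genideal_least[OF J A(1)] by blast
  then show "\<exists>A\<subseteq>polys n. finite A \<and> J = Idl\<^bsub>poly_ring n\<^esub> A" using A(2) by blast
qed

lemma maximal_ideal_in_family:
  fixes \<A> :: "'k::field mpoly set set"
  assumes "\<A> \<noteq> {}" "\<And>A. A \<in> \<A> \<Longrightarrow> poly_ideal n A"
  shows "\<exists>M\<in>\<A>. \<forall>A\<in>\<A>. M \<subseteq> A \<longrightarrow> A = M"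
proof -
  interpret noetherian_ring "poly_ring n :: 'k mpoly ring" by (rule noetherian_poly_ring)
  have "\<exists>U\<in>\<A>. \<forall>X\<in>C. X \<subseteq> U" if C: "subset.chain \<A> C" for C
  proof (cases "C = {}")
    case True
    then show ?thesis using assms(1) by auto
  next
    case False
    have "subset.chain {I. ideal I (poly_ring n)} C"
      using C assms(2) by (auto simp: subset.chain_def ideal_poly_ring_iff)
    then have "\<Union>C \<in> C" by (rule ideal_chain_is_trivial[OF False])
    then show ?thesis using C by (auto simp: subset.chain_def)
  qed
  then show ?thesis by (rule subset_Zorn)
qed

definition colon :: "nat \<Rightarrow> 'k::field mpoly set \<Rightarrow> 'k mpoly \<Rightarrow> 'k mpoly set" where
  "colon n J z = {p \<in> polys n. p * z \<in> J}"

lemma poly_ideal_colon: "poly_ideal n J \<Longrightarrow> z \<in> polys n \<Longrightarrow> poly_ideal n (colon n J z)"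
  by (subst poly_ideal_def) (auto simp: colon_def distrib_right poly_idealD mult.assoc)

text \<open>The elements which are nonzero modulo \<open>J\<close> and whose annihilator is maximal among the annihilators of
  such elements. These annihilators are the maximal associated primes of \<open>J\<close>.\<close>

definition max_colon :: "nat \<Rightarrow> 'k::field mpoly set \<Rightarrow> 'k mpoly \<Rightarrow> bool" where
  "max_colon n J z \<longleftrightarrow> z \<in> polys n \<and> z \<notin> J \<and>
     (\<forall>y\<in>polys n - J. colon n J z \<subseteq> colon n J y \<longrightarrow> colon n J y = colon n J z)"

lemma max_colon_prime:
  assumes J: "poly_ideal n J" and z: "max_colon n J z"
    and pq: "p \<in> polys n" "q \<in> polys n" "p * q \<in> colon n J z"
  shows "p \<in> colon n J z \<or> q \<in> colon n J z"
proof (rule disjCI)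
  assume "q \<notin> colon n J z"
  then have "q * z \<notin> J" "q * z \<in> polys n" using pq z by (auto simp: colon_def max_colon_def)
  moreover have "colon n J z \<subseteq> colon n J (q * z)"
    using poly_idealD(4)[OF J pq(2)] by (auto simp: colon_def) (metis mult.left_commute)
  ultimately have "colon n J (q * z) = colon n J z" using z by (auto simp: max_colon_def)
  moreover have "p \<in> colon n J (q * z)" using pq by (auto simp: colon_def mult.assoc)
  ultimately show "p \<in> colon n J z" by simp
qed

lemma max_colon_above:
  assumes J: "poly_ideal n J" and y: "y \<in> polys n" "y \<notin> J"
  shows "\<exists>z. max_colon n J z \<and> colon n J y \<subseteq> colon n J z"
proof -
  define \<A> where "\<A> = {colon n J z | z. z \<in> polys n - J \<and> colon n J y \<subseteq> colon n J z}"
  have "\<A> \<noteq> {}" "\<And>A. A \<in> \<A> \<Longrightarrow> poly_ideal n A"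
    using y poly_ideal_colon[OF J] by (auto simp: \<A>_def)
  from maximal_ideal_in_family[OF this] obtain M where
    M: "M \<in> \<A>" "\<And>A. A \<in> \<A> \<Longrightarrow> M \<subseteq> A \<Longrightarrow> A = M" by blast
  obtain z where z: "z \<in> polys n - J" "M = colon n J z" "colon n J y \<subseteq> colon n J z"
    using M(1) unfolding \<A>_def by blast
  have "max_colon n J z"
    unfolding max_colon_def
  proof (intro conjI ballI impI)
    fix w assume "w \<in> polys n - J" "colon n J z \<subseteq> colon n J w"
    then have "colon n J w \<in> \<A>" "M \<subseteq> colon n J w" using z unfolding \<A>_def by blast+
    then show "colon n J w = colon n J z" using M(2) z(2) by blast
  qed (use z in auto)
  then show ?thesis using z by blast
qed

text \<open>By the Noetherian property there is a largest ideal generated by \<open>J\<close> and finitely many elements with maximal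
annihilator. If \<open>z\<close> is another such element, it is contained in this ideal. Were its annihilator different
from those of the generators, each generator would be killed by some element outside the prime annihilator
of \<open>z\<close>; the product of these elements kills \<open>z\<close> but lies outside that prime.\<close>

lemma finite_max_colons:
  assumes J: "poly_ideal n J"
  shows "finite {colon n J z | z. max_colon n J z}"
proof -
  let ?Z = "{z. max_colon n J z}"
  define \<A> where "\<A> = {Idl\<^bsub>poly_ring n\<^esub> (J \<union> F) | F. finite F \<and> F \<subseteq> ?Z}"
  have Z: "?Z \<subseteq> polys n" by (auto simp: max_colon_def)
  have JF: "J \<union> F \<subseteq> polys n" if "F \<subseteq> ?Z" for F using that Z poly_idealD(1)[OF J] by blast
  have "\<A> \<noteq> {}" "\<And>A. A \<in> \<A> \<Longrightarrow> poly_ideal n A"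
    using poly_ideal_genideal[OF JF] by (auto simp: \<A>_def)
  from maximal_ideal_in_family[OF this] obtain M where
    M: "M \<in> \<A>" "\<And>A. A \<in> \<A> \<Longrightarrow> M \<subseteq> A \<Longrightarrow> A = M" by blast
  obtain F where F: "finite F" "F \<subseteq> ?Z" "M = Idl\<^bsub>poly_ring n\<^esub> (J \<union> F)"
    using M(1) unfolding \<A>_def by blast
  have "\<exists>y\<in>F. colon n J z = colon n J y" if z: "max_colon n J z" for z
  proof (rule ccontr)
    assume no: "\<not> (\<exists>y\<in>F. colon n J z = colon n J y)"
    have zF: "insert z F \<subseteq> ?Z" using z F by auto
    have "Idl\<^bsub>poly_ring n\<^esub> (J \<union> F) \<subseteq> Idl\<^bsub>poly_ring n\<^esub> (J \<union> insert z F)"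
      using genideal_superset[OF JF[OF zF]] by (intro genideal_least poly_ideal_genideal JF zF) auto
    moreover have "Idl\<^bsub>poly_ring n\<^esub> (J \<union> insert z F) \<in> \<A>"
      unfolding \<A>_def using F(1) zF by (intro CollectI exI[of _ "insert z F"]) simp
    ultimately have "Idl\<^bsub>poly_ring n\<^esub> (J \<union> insert z F) = Idl\<^bsub>poly_ring n\<^esub> (J \<union> F)"
      using M(2) F(3) by blast
    then have zI: "z \<in> Idl\<^bsub>poly_ring n\<^esub> (J \<union> F)" using genideal_superset[OF JF[OF zF]] by auto
    have "\<exists>p. p \<in> colon n J y - colon n J z" if y: "y \<in> F" for y
    proof (rule ccontr)
      assume "\<nexists>p. p \<in> colon n J y - colon n J z"
      then have "colon n J y \<subseteq> colon n J z" by blast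
      moreover have "max_colon n J y" using y F by blast
      ultimately have "colon n J z = colon n J y" using z by (auto simp: max_colon_def)
      then show False using no y by blast
    qed
    then obtain p where p: "\<And>y. y \<in> F \<Longrightarrow> p y \<in> colon n J y - colon n J z" by metis
    have "(\<Prod>y\<in>G. p y) \<in> polys n \<and> (\<Prod>y\<in>G. p y) \<notin> colon n J z \<and> (\<forall>y\<in>G. (\<Prod>y\<in>G. p y) * y \<in> J)"
      if "G \<subseteq> F" for G
      using finite_subset[OF that F(1)] that
    proof (induction G rule: finite_induct)
      case empty
      then show ?case using z by (auto simp: colon_def max_colon_def)
    next
      case (insert x G)
      let ?q = "\<Prod>y\<in>G. p y"
      have q: "?q \<in> polys n" "?q \<notin> colon n J z" "\<And>y. y \<in> G \<Longrightarrow> ?q * y \<in> J" using insert by auto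
      have x: "p x \<in> polys n" "p x * x \<in> J" "p x \<notin> colon n J z" using p[of x] insert.prems by (auto simp: colon_def)
      have "p x * ?q \<notin> colon n J z" using max_colon_prime[OF J z x(1) q(1)] x q by blast
      moreover have "p x * ?q * y \<in> J" if "y \<in> insert x G" for y
      proof (cases "y = x")
        case True
        then show ?thesis using poly_idealD(4)[OF J q(1) x(2)] by (simp add: mult_ac)
      next
        case False
        then show ?thesis using poly_idealD(4)[OF J x(1) q(3)[of y]] that by (simp add: mult_ac)
      qed
      ultimately show ?case using q x insert.hyps by simp
    qed
    then have q: "(\<Prod>y\<in>F. p y) \<in> polys n" "(\<Prod>y\<in>F. p y) \<notin> colon n J z" "\<And>y. y \<in> F \<Longrightarrow> (\<Prod>y\<in>F. p y) * y \<in> J"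
      by blast+
    \<comment> \<open>The product annihilates the generators in \<open>F\<close> and hence also \<open>z\<close>.\<close>
    have "J \<union> F \<subseteq> colon n J (\<Prod>y\<in>F. p y)"
      using q(3) poly_idealD(5)[OF J q(1)] JF[OF F(2)] by (auto simp: colon_def mult.commute)
    then have "z \<in> colon n J (\<Prod>y\<in>F. p y)"
      using genideal_least[OF poly_ideal_colon[OF J q(1)]] zI by blast
    then show False using q(1,2) by (auto simp: colon_def mult.commute)
  qed
  then have "{colon n J z | z. max_colon n J z} \<subseteq> colon n J ` F" by auto
  then show ?thesis using F(1) finite_surj by blast
qed

text \<open>Adding a prime \<open>P\<close> to the family: if the element \<open>f\<close> found before lies in \<open>P\<close>, it is corrected by a
product \<open>g\<close> which lies in \<open>A\<close> and in all other primes, but not in \<open>P\<close>.\<close>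

lemma prime_avoidance:
  fixes A :: "'k::field mpoly set"
  assumes A: "poly_ideal n A" and "finite \<P>"
    and "\<And>P. P \<in> \<P> \<Longrightarrow> poly_ideal n P"
    and "\<And>P p q. P \<in> \<P> \<Longrightarrow> p \<in> polys n \<Longrightarrow> q \<in> polys n \<Longrightarrow> p * q \<in> P \<Longrightarrow> p \<in> P \<or> q \<in> P"
    and "\<And>P P'. P \<in> \<P> \<Longrightarrow> P' \<in> \<P> \<Longrightarrow> P \<subseteq> P' \<Longrightarrow> P = P'"
    and "\<And>P. P \<in> \<P> \<Longrightarrow> \<not> A \<subseteq> P"
  shows "\<exists>f\<in>A. \<forall>P\<in>\<P>. f \<notin> P"
  using assms(2-)
proof (induction \<P> rule: finite_induct)
  case empty
  then show ?case using poly_idealD(2)[OF A] by auto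
next
  case (insert P \<P>)
  have "\<exists>f\<in>A. \<forall>P\<in>\<P>. f \<notin> P"
  proof (rule insert.IH)
    show "poly_ideal n Q" if "Q \<in> \<P>" for Q using insert.prems(1)[of Q] that by simp
    show "p \<in> Q \<or> q \<in> Q" if "Q \<in> \<P>" "p \<in> polys n" "q \<in> polys n" "p * q \<in> Q" for Q p q
      using insert.prems(2)[of Q p q] that by simp
    show "Q = Q'" if "Q \<in> \<P>" "Q' \<in> \<P>" "Q \<subseteq> Q'" for Q Q' using insert.prems(3)[of Q Q'] that by simp
    show "\<not> A \<subseteq> Q" if "Q \<in> \<P>" for Q using insert.prems(4)[of Q] that by simp
  qed
  then obtain f where f: "f \<in> A" "\<forall>P\<in>\<P>. f \<notin> P" by blast
  show ?case
  proof (cases "f \<in> P")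
    case False
    then show ?thesis using f by blast
  next
    case True
    note ideals = insert.prems(1) and incomparable = insert.prems(3) and PP = insert.hyps(2)
    note P = ideals[OF insertI1]
    have prime: "p * q \<notin> P" if "p \<in> polys n" "q \<in> polys n" "p \<notin> P" "q \<notin> P" for p q
      using insert.prems(2)[of P p q] that by blast
    obtain h where h: "h \<in> A" "h \<notin> P" using insert.prems(4)[of P] by blast
    have sub: "A \<subseteq> polys n" using poly_idealD(1)[OF A] .
    have "\<exists>g\<in>A. g \<notin> P \<and> (\<forall>P'\<in>\<Q>. g \<in> P')" if "\<Q> \<subseteq> \<P>" for \<Q>
      using finite_subset[OF that insert.hyps(1)] that
    proof (induction \<Q> rule: finite_induct)
      case empty
      then show ?case using h by blast
    next
      case (insert Q \<Q>)
      then obtain g where g: "g \<in> A" "g \<notin> P" "\<forall>P'\<in>\<Q>. g \<in> P'" by blast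
      have QP: "Q \<in> \<P>" using insert.prems by blast
      then have "\<not> Q \<subseteq> P" using PP incomparable[of Q P] by blast
      then obtain q where q: "q \<in> Q" "q \<notin> P" by blast
      have Q: "poly_ideal n Q" using ideals QP by blast
      have qp: "q \<in> polys n" "g \<in> polys n" using poly_idealD(1)[OF Q] q g sub by auto
      have "q * g \<in> P'" if "P' \<in> insert Q \<Q>" for P'
      proof (cases "P' = Q")
        case True
        then show ?thesis using poly_idealD(5)[OF Q qp(2) q(1)] by simp
      next
        case False
        then have P': "P' \<in> \<Q>" using that by blast
        then have "poly_ideal n P'" using ideals insert.prems by blast
        then show ?thesis using poly_idealD(4) qp g(3) P' by blast
      qed
      moreover have "q * g \<in> A" by (rule poly_idealD(4)[OF A qp(1) g(1)])
      moreover have "q * g \<notin> P" by (rule prime) (use qp q g in auto)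
      ultimately show ?case by blast
    qed
    then obtain g where g: "g \<in> A" "g \<notin> P" "\<forall>P'\<in>\<P>. g \<in> P'" by blast
    have "f + g \<notin> P" using poly_idealD(7)[OF P, of "f + g" f] True g by auto
    moreover have "f + g \<notin> P'" if "P' \<in> \<P>" for P'
      using poly_idealD(7)[of n P' "f + g" g] insert.prems(1)[of P'] f g that by auto
    moreover have "f + g \<in> A" by (rule poly_idealD(3)[OF A f(1) g(1)])
    ultimately show ?thesis by blast
  qed
qed

lemma poly_ideal_graded_max: "poly_ideal n (graded_max_ideal n)"
proof -
  have "Poly_Mapping.lookup (p * q) 0 = 0" if "Poly_Mapping.lookup q 0 = 0" for p q :: "'k::field mpoly"
  proof -
    have "p * q = (\<Sum>m\<in>Poly_Mapping.keys p. Poly_Mapping.single m (Poly_Mapping.lookup p m) * q)"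
      by (subst poly_mapping_sum_single[of p]) (simp add: sum_distrib_right)
    moreover have "Poly_Mapping.lookup (Poly_Mapping.single m (Poly_Mapping.lookup p m) * q) 0 = 0" for m
    proof (cases "m = 0")
      case True
      then show ?thesis using lookup_single_times_add[of m _ q 0] that by simp
    next
      case False
      have "0 \<noteq> m + l" for l :: "nat \<Rightarrow>\<^sub>0 nat"
        using False by (metis add_eq_0_iff_both_eq_0 keys_add_nat keys_zero Un_empty poly_mapping_eqI in_keys_iff empty_iff lookup_zero)
      then show ?thesis by (rule lookup_single_times_not)
    qed
    ultimately show ?thesis by (simp add: lookup_sum)
  qed
  then show ?thesis by (auto simp: poly_ideal_def graded_max_ideal_def lookup_add)
qed

text \<open>If every element of the graded maximal ideal is a zerodivisor modulo \<open>J\<close>, then the graded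
  maximal ideal is contained in one of the finitely many maximal annihilators.\<close>

lemma socle_if_no_nonzerodivisor:
  fixes J :: "'k::field mpoly set"
  assumes J: "poly_ideal n J"
    and zd: "\<And>f. f \<in> graded_max_ideal n \<Longrightarrow> \<exists>g\<in>polys n - J. f * g \<in> J"
  shows "\<exists>z\<in>polys n - J. \<forall>f\<in>graded_max_ideal n. f * z \<in> J"
proof -
  let ?\<P> = "{colon n J z | z. max_colon n J z}"
  have "\<exists>P\<in>?\<P>. graded_max_ideal n \<subseteq> P"
  proof (rule ccontr)
    assume no: "\<not> (\<exists>P\<in>?\<P>. graded_max_ideal n \<subseteq> P)"
    have "\<exists>f\<in>graded_max_ideal n. \<forall>P\<in>?\<P>. f \<notin> P"
    proof (rule prime_avoidance[OF poly_ideal_graded_max finite_max_colons[OF J]])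
      fix P assume "P \<in> ?\<P>"
      then obtain z where z: "P = colon n J z" "max_colon n J z" by blast
      then show "poly_ideal n P" using poly_ideal_colon[OF J] by (auto simp: max_colon_def)
      show "p \<in> P \<or> q \<in> P" if "p \<in> polys n" "q \<in> polys n" "p * q \<in> P" for p q
        using max_colon_prime[OF J] z that by blast
      show "\<not> graded_max_ideal n \<subseteq> P" using no \<open>P \<in> ?\<P>\<close> by blast
    next
      fix P P' assume "P \<in> ?\<P>" "P' \<in> ?\<P>" "P \<subseteq> P'"
      then show "P = P'" by (auto simp: max_colon_def)
    qed
    then obtain f where f: "f \<in> graded_max_ideal n" "\<forall>P\<in>?\<P>. f \<notin> P" by blast
    obtain g where g: "g \<in> polys n - J" "f * g \<in> J" using zd[OF f(1)] by blast
    then obtain z where "max_colon n J z" "colon n J g \<subseteq> colon n J z"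
      using max_colon_above[OF J] by blast
    moreover have "f \<in> colon n J g" using f(1) g by (auto simp: colon_def graded_max_ideal_def)
    ultimately show False using f(2) by blast
  qed
  then show ?thesis by (auto simp: max_colon_def colon_def)
qed

section \<open>Depth\<close>

text \<open>Exactness modulo \<open>J\<close> at cochain degree \<open>p\<close>, which is the vanishing of the Koszul
  homology of \<open>R/J\<close> in degree \<open>n - p\<close>.\<close>

definition koszul_exact :: "nat \<Rightarrow> 'k::field mpoly set \<Rightarrow> nat \<Rightarrow> bool" where
  "koszul_exact n J p \<longleftrightarrow>
     (\<forall>c. (\<forall>T\<subseteq>{1..n}. c T \<in> polys n) \<longrightarrow> (\<forall>T\<subseteq>{1..n}. card T = Suc p \<longrightarrow> cobd var c T \<in> J) \<longrightarrow>
        (\<exists>b. (\<forall>T\<subseteq>{1..n}. b T \<in> polys n) \<and> (\<forall>T\<subseteq>{1..n}. card T = p \<longrightarrow> c T - cobd var b T \<in> J)))"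

lemma koszul_exactD:
  assumes "koszul_exact n J p" "\<And>T. T \<subseteq> {1..n} \<Longrightarrow> c T \<in> polys n"
    "\<And>T. T \<subseteq> {1..n} \<Longrightarrow> card T = Suc p \<Longrightarrow> cobd var c T \<in> J"
  shows "\<exists>b. (\<forall>T\<subseteq>{1..n}. b T \<in> polys n) \<and> (\<forall>T\<subseteq>{1..n}. card T = p \<longrightarrow> c T - cobd var b T \<in> J)"
  using assms unfolding koszul_exact_def by simp

lemma finite_subset_ivl: "T \<subseteq> {1..n} \<Longrightarrow> finite (T :: nat set)"
  using finite_subset by blast

lemma graded_max_induct [consumes 1, case_names var add mult zero]:
  assumes f: "f \<in> graded_max_ideal n"
    and var: "\<And>k. k \<in> {1..n} \<Longrightarrow> P (var k)"
    and add: "\<And>f g. P f \<Longrightarrow> P g \<Longrightarrow> P (f + g)"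
    and mult: "\<And>f g. f \<in> polys n \<Longrightarrow> P g \<Longrightarrow> P (f * g)"
    and zero: "P 0"
  shows "P f"
proof -
  have mono: "P (Poly_Mapping.single m (Poly_Mapping.lookup f m))" if m: "m \<in> Poly_Mapping.keys f" for m
  proof -
    have "m \<noteq> 0" using m f by (auto simp: graded_max_ideal_def in_keys_iff)
    then obtain k where k: "k \<in> Poly_Mapping.keys m"
      by (metis empty_iff in_keys_iff lookup_zero poly_mapping_eqI)
    have kn: "Poly_Mapping.keys m \<subseteq> {1..n}" using f m by (auto simp: graded_max_ideal_def polys_iff)
    have "m = (m - Poly_Mapping.single k 1) + Poly_Mapping.single k 1"
      using k by (intro poly_mapping_eqI) (auto simp: lookup_add lookup_minus lookup_single when_def in_keys_iff)
    then have "Poly_Mapping.single m (Poly_Mapping.lookup f m) =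
        Poly_Mapping.single (m - Poly_Mapping.single k 1) (Poly_Mapping.lookup f m) * var k"
      by (simp add: var_def mult_single)
    moreover have "Poly_Mapping.keys (m - Poly_Mapping.single k 1) \<subseteq> {1..n}"
      using kn by (auto simp: in_keys_iff lookup_minus subset_iff)
    ultimately show ?thesis using mult var k kn by (auto intro!: polys_single)
  qed
  have *: "P (\<Sum>m\<in>M. Poly_Mapping.single m (Poly_Mapping.lookup f m))" if "M \<subseteq> Poly_Mapping.keys f" for M
    using finite_subset[OF that finite_keys] that by (induction M rule: finite_induct) (auto intro: zero add mono)
  show ?thesis by (subst poly_mapping_sum_single) (rule *[OF order_refl])
qed

text \<open>The graded maximal ideal annihilates Koszul homology: for a variable this is the homotopy
  \<open>contr\<close>.\<close>

lemma graded_max_annihilates: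
  fixes c :: "nat set \<Rightarrow> 'k::field mpoly"
  assumes J: "poly_ideal n J" and c: "\<And>T. T \<subseteq> {1..n} \<Longrightarrow> c T \<in> polys n"
    and cocycle: "\<And>T. T \<subseteq> {1..n} \<Longrightarrow> card T = Suc p \<Longrightarrow> cobd var c T \<in> J"
    and f: "f \<in> graded_max_ideal n"
  shows "\<exists>b. (\<forall>T\<subseteq>{1..n}. b T \<in> polys n) \<and> (\<forall>T\<subseteq>{1..n}. card T = p \<longrightarrow> f * c T - cobd var b T \<in> J)"
  using f
proof (induction rule: graded_max_induct)
  case (var k)
  show ?case
  proof (intro exI[of _ "contr k c"] conjI allI impI)
    fix T :: "nat set" assume T: "T \<subseteq> {1..n}"
    then show "contr k c T \<in> polys n"
      unfolding contr_def using c var by (auto intro!: polys_mult polys_pos_sign)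
    assume card: "card T = p"
    show "Defs.var k * c T - cobd Defs.var (contr k c) T \<in> J"
    proof (cases "k \<in> T")
      case True
      then show ?thesis using cobd_contr[OF finite_subset_ivl[OF T] True, of Defs.var c] poly_idealD(2)[OF J] by simp
    next
      case False
      have "pos_sign k T * cobd Defs.var c (insert k T) \<in> J"
        using T card False var finite_subset_ivl[OF T] by (intro poly_idealD(4)[OF J] cocycle polys_pos_sign) auto
      then show ?thesis using contr_cobd[OF finite_subset_ivl[OF T] False, of Defs.var c] by simp
    qed
  qed
next
  case (add f g)
  then obtain b b' where "\<forall>T\<subseteq>{1..n}. b T \<in> polys n" "\<forall>T\<subseteq>{1..n}. card T = p \<longrightarrow> f * c T - cobd Defs.var b T \<in> J"
    "\<forall>T\<subseteq>{1..n}. b' T \<in> polys n" "\<forall>T\<subseteq>{1..n}. card T = p \<longrightarrow> g * c T - cobd Defs.var b' T \<in> J" by blast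
  moreover have "(f + g) * c T - cobd Defs.var (\<lambda>T. b T + b' T) T =
     (f * c T - cobd Defs.var b T) + (g * c T - cobd Defs.var b' T)" for T
    by (simp add: cobd_add algebra_simps)
  ultimately show ?case
    by (intro exI[of _ "\<lambda>T. b T + b' T"]) (simp add: poly_idealD(3)[OF J] del: add_diff_eq)
next
  case (mult f g)
  then obtain b where b: "\<forall>T\<subseteq>{1..n}. b T \<in> polys n" "\<forall>T\<subseteq>{1..n}. card T = p \<longrightarrow> g * c T - cobd Defs.var b T \<in> J" by blast
  have "f * g * c T - cobd Defs.var (\<lambda>T. f * b T) T = f * (g * c T - cobd Defs.var b T)" for T
    by (simp add: cobd_scale algebra_simps)
  then show ?case
    using b mult by (intro exI[of _ "\<lambda>T. f * b T"]) (simp add: poly_idealD(4)[OF J])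
next
  case zero
  show ?case using poly_idealD(2)[OF J] by (intro exI[of _ "\<lambda>_. 0"]) (simp add: cobd_def)
qed

definition nonzerodivisor :: "nat \<Rightarrow> 'k::field mpoly set \<Rightarrow> 'k mpoly \<Rightarrow> bool" where
  "nonzerodivisor n J f \<longleftrightarrow> (\<forall>g\<in>polys n. f * g \<in> J \<longrightarrow> g \<in> J)"

text \<open>This lemma and the next contain the part of the long exact sequence for multiplication by \<open>f\<close> that is
needed. Since \<open>f\<close> acts as zero on Koszul homology, a class modulo \<open>J\<close> gives a class modulo \<open>J\<close> and
\<open>f\<close> one cochain degree below.\<close>

lemma koszul_not_exact_add_gen:
  fixes J :: "'k::field mpoly set"
  assumes J: "poly_ideal n J" and f: "f \<in> graded_max_ideal n" "nonzerodivisor n J f"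
    and ne: "\<not> koszul_exact n J p"
  shows "0 < p \<and> \<not> koszul_exact n (add_gen n J f) (p - 1)"
proof -
  have fp: "f \<in> polys n" using f by (simp add: graded_max_ideal_def)
  obtain c where c: "\<And>T. T \<subseteq> {1..n} \<Longrightarrow> c T \<in> polys n"
    and cocycle: "\<And>T. T \<subseteq> {1..n} \<Longrightarrow> card T = Suc p \<Longrightarrow> cobd var c T \<in> J"
    and nb: "\<And>b. (\<forall>T\<subseteq>{1..n}. b T \<in> polys n) \<Longrightarrow> \<not> (\<forall>T\<subseteq>{1..n}. card T = p \<longrightarrow> c T - cobd var b T \<in> J)"
    using ne unfolding koszul_exact_def by metis
  from graded_max_annihilates[where c = c and p = p, OF J c cocycle f(1)] obtain b where
    "(\<forall>T\<subseteq>{1..n}. b T \<in> polys n) \<and> (\<forall>T\<subseteq>{1..n}. card T = p \<longrightarrow> f * c T - cobd var b T \<in> J)" ..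
  then have b: "\<And>T. T \<subseteq> {1..n} \<Longrightarrow> b T \<in> polys n"
    "\<And>T. T \<subseteq> {1..n} \<Longrightarrow> card T = p \<Longrightarrow> f * c T - cobd var b T \<in> J"
    by simp_all
  have no: False if g: "\<And>T. T \<subseteq> {1..n} \<Longrightarrow> g T \<in> polys n"
    "\<And>T. T \<subseteq> {1..n} \<Longrightarrow> card T = p \<Longrightarrow> cobd var b T - f * cobd var g T \<in> J" for g
  proof -
    have "c T - cobd var g T \<in> J" if T: "T \<subseteq> {1..n}" "card T = p" for T
    proof -
      have "f * (c T - cobd var g T) = (f * c T - cobd var b T) + (cobd var b T - f * cobd var g T)"
        by (simp add: algebra_simps)
      also have "\<dots> \<in> J" using poly_idealD(3)[OF J b(2)[OF T] g(2)[OF T]] .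
      finally show ?thesis
        using f(2) c[OF T(1)] polys_cobd[of T n g] g(1) T(1) by (simp add: nonzerodivisor_def)
    qed
    then show False using nb[of g] g(1) by blast
  qed
  have "0 < p"
  proof (rule ccontr)
    assume "\<not> 0 < p"
    then have "cobd var b T = 0" if "T \<subseteq> {1..n}" "card T = p" for T
      using that finite_subset_ivl[of T n] by simp
    then show False using no[of "\<lambda>_. 0"] poly_idealD(2)[OF J] by (simp add: cobd_def)
  qed
  moreover have "\<not> koszul_exact n (add_gen n J f) (p - 1)"
  proof
    assume ex: "koszul_exact n (add_gen n J f) (p - 1)"
    have bJ: "cobd var b T \<in> add_gen n J f" if T: "T \<subseteq> {1..n}" "card T = Suc (p - 1)" for T
    proof -
      have "cobd var b T - f * c T \<in> J"
        using poly_idealD(6)[OF J b(2)[OF T(1)]] T \<open>0 < p\<close> by simp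
      then show ?thesis unfolding add_gen_iff using c[OF T(1)] by blast
    qed
    from koszul_exactD[where c = b, OF ex b(1) bJ] obtain e where "(\<forall>T\<subseteq>{1..n}. e T \<in> polys n) \<and>
      (\<forall>T\<subseteq>{1..n}. card T = p - 1 \<longrightarrow> b T - cobd var e T \<in> add_gen n J f)" ..
    then have "\<forall>T. \<exists>g. T \<subseteq> {1..n} \<and> card T = p - 1 \<longrightarrow> g \<in> polys n \<and> b T - cobd var e T - f * g \<in> J"
      unfolding add_gen_iff by blast
    then obtain g0 where g0: "\<And>T. T \<subseteq> {1..n} \<Longrightarrow> card T = p - 1 \<Longrightarrow>
        g0 T \<in> polys n \<and> b T - cobd var e T - f * g0 T \<in> J" by metis
    define g where "g = (\<lambda>T. if card T = p - 1 then g0 T else 0)"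
    have g: "g T \<in> polys n" if "T \<subseteq> {1..n}" for T using g0 that by (auto simp: g_def)
    have "cobd var b T - f * cobd var g T \<in> J" if T: "T \<subseteq> {1..n}" "card T = p" for T
    proof -
      have fin: "finite T" using T(1) by (rule finite_subset_ivl)
      have "cobd var (\<lambda>S. b S - cobd var e S - f * g S) T = cobd var b T - f * cobd var g T"
        by (simp add: cobd_diff cobd_scale cobd_cobd[OF fin])
      moreover have "cobd var (\<lambda>S. b S - cobd var e S - f * g S) T \<in> J"
        unfolding cobd_def[of var "\<lambda>S. b S - cobd var e S - f * g S"]
      proof (intro poly_ideal_sum[OF J] poly_idealD(4)[OF J] polys_mult polys_pos_sign polys_var)
        fix k assume k: "k \<in> T"
        then show "k \<in> {1..n}" using T by blast
        have "T - {k} \<subseteq> {1..n}" "card (T - {k}) = p - 1" using k T fin by auto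
        then show "b (T - {k}) - cobd var e (T - {k}) - f * g (T - {k}) \<in> J"
          using g0[of "T - {k}"] by (simp add: g_def)
      qed
      ultimately show ?thesis by simp
    qed
    then show False using no g by blast
  qed
  ultimately show ?thesis by blast
qed

lemma koszul_exact_add_gen:
  fixes J :: "'k::field mpoly set"
  assumes J: "poly_ideal n J" and f: "f \<in> polys n" "nonzerodivisor n J f"
    and ex: "koszul_exact n J p" "koszul_exact n J (Suc p)"
  shows "koszul_exact n (add_gen n J f) p"
  unfolding koszul_exact_def
proof (intro allI impI)
  fix c :: "nat set \<Rightarrow> 'k mpoly"
  assume c: "\<forall>T\<subseteq>{1..n}. c T \<in> polys n"
    and cocycle: "\<forall>T\<subseteq>{1..n}. card T = Suc p \<longrightarrow> cobd var c T \<in> add_gen n J f"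
  then have "\<forall>T. \<exists>g. T \<subseteq> {1..n} \<and> card T = Suc p \<longrightarrow> g \<in> polys n \<and> cobd var c T - f * g \<in> J"
    unfolding add_gen_iff by blast
  then obtain b0 where b0: "\<And>T. T \<subseteq> {1..n} \<Longrightarrow> card T = Suc p \<Longrightarrow>
      b0 T \<in> polys n \<and> cobd var c T - f * b0 T \<in> J" by metis
  define b where "b = (\<lambda>T. if card T = Suc p then b0 T else 0)"
  have b: "b T \<in> polys n" if "T \<subseteq> {1..n}" for T using b0 that by (auto simp: b_def)
  have bJ: "cobd var b T \<in> J" if T: "T \<subseteq> {1..n}" "card T = Suc (Suc p)" for T
  proof -
    have fin: "finite T" using T(1) by (rule finite_subset_ivl)
    have "cobd var (\<lambda>S. cobd var c S - f * b S) T = - (f * cobd var b T)"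
      by (simp add: cobd_diff cobd_scale cobd_cobd[OF fin])
    moreover have "cobd var (\<lambda>S. cobd var c S - f * b S) T \<in> J"
      unfolding cobd_def[of var "\<lambda>S. cobd var c S - f * b S"]
    proof (intro poly_ideal_sum[OF J] poly_idealD(4)[OF J] polys_mult polys_pos_sign polys_var)
      fix k assume k: "k \<in> T"
      then show "k \<in> {1..n}" using T by blast
      have "T - {k} \<subseteq> {1..n}" "card (T - {k}) = Suc p" using k T fin by auto
      then show "cobd var c (T - {k}) - f * b (T - {k}) \<in> J"
        using b0[of "T - {k}"] by (simp add: b_def)
    qed
    ultimately have "f * cobd var b T \<in> J" using poly_idealD(6)[OF J] by force
    then show ?thesis using f(2) polys_cobd[OF T(1) b] by (simp add: nonzerodivisor_def)
  qed
  from koszul_exactD[where c = b, OF ex(2) b bJ] obtain e where "(\<forall>T\<subseteq>{1..n}. e T \<in> polys n) \<and>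
    (\<forall>T\<subseteq>{1..n}. card T = Suc p \<longrightarrow> b T - cobd var e T \<in> J)" ..
  then have e: "\<And>T. T \<subseteq> {1..n} \<Longrightarrow> e T \<in> polys n"
    "\<And>T. T \<subseteq> {1..n} \<Longrightarrow> card T = Suc p \<Longrightarrow> b T - cobd var e T \<in> J"
    by simp_all
  have ceJ: "cobd var (\<lambda>T. c T - f * e T) T \<in> J" if T: "T \<subseteq> {1..n}" "card T = Suc p" for T
  proof -
    have "cobd var (\<lambda>T. c T - f * e T) T = (cobd var c T - f * b T) + f * (b T - cobd var e T)"
      by (simp add: cobd_diff cobd_scale algebra_simps)
    moreover have "cobd var c T - f * b T \<in> J" using b0 T by (simp add: b_def)
    ultimately show ?thesis using poly_idealD(3)[OF J] poly_idealD(4)[OF J f(1) e(2)[OF T]] by simp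
  qed
  have ce: "c T - f * e T \<in> polys n" if "T \<subseteq> {1..n}" for T using c e f that by auto
  from koszul_exactD[where c = "\<lambda>T. c T - f * e T", OF ex(1) ce ceJ] obtain g where
    "(\<forall>T\<subseteq>{1..n}. g T \<in> polys n) \<and>
     (\<forall>T\<subseteq>{1..n}. card T = p \<longrightarrow> c T - f * e T - cobd var g T \<in> J)" ..
  then have g: "\<And>T. T \<subseteq> {1..n} \<Longrightarrow> g T \<in> polys n"
    "\<And>T. T \<subseteq> {1..n} \<Longrightarrow> card T = p \<Longrightarrow> c T - f * e T - cobd var g T \<in> J"
    by simp_all
  have "c T - cobd var g T \<in> add_gen n J f" if T: "T \<subseteq> {1..n}" "card T = p" for T
    unfolding add_gen_iff using g(2)[OF T] e(1)[OF T(1)] by (intro bexI[of _ "e T"]) (simp_all add: algebra_simps)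
  then show "\<exists>b. (\<forall>T\<subseteq>{1..n}. b T \<in> polys n) \<and> (\<forall>T\<subseteq>{1..n}. card T = p \<longrightarrow> c T - cobd var b T \<in> add_gen n J f)"
    using g(1) by blast
qed

lemma regular_sequence_Cons:
  fixes I :: "'k::field mpoly set"
  shows "regular_sequence (poly_ring n) I (f # fs) \<longleftrightarrow>
    f \<in> polys n \<and> nonzerodivisor n (Idl\<^bsub>poly_ring n\<^esub> I) f \<and> regular_sequence (poly_ring n) (insert f I) fs"
  unfolding regular_sequence_def nonzerodivisor_def
  by (simp add: All_less_Suc2 conj_ac)

lemma regular_sequence_length_le:
  fixes I :: "'k::field mpoly set"
  assumes "I \<subseteq> polys n" "regular_sequence (poly_ring n) I fs" "set fs \<subseteq> graded_max_ideal n"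
    and "\<not> koszul_exact n (Idl\<^bsub>poly_ring n\<^esub> I) p"
  shows "length fs \<le> p"
  using assms
proof (induction fs arbitrary: I p)
  case (Cons f fs)
  note J = poly_ideal_genideal[OF Cons.prems(1)]
  have f: "f \<in> graded_max_ideal n" "f \<in> polys n" "nonzerodivisor n (Idl\<^bsub>poly_ring n\<^esub> I) f"
    "regular_sequence (poly_ring n) (insert f I) fs"
    using Cons.prems(2,3) by (auto simp: regular_sequence_Cons)
  have "0 < p \<and> \<not> koszul_exact n (Idl\<^bsub>poly_ring n\<^esub> (insert f I)) (p - 1)"
    unfolding genideal_insert[OF Cons.prems(1) f(2)]
    by (rule koszul_not_exact_add_gen[OF J f(1,3) Cons.prems(4)])
  then show ?case using Cons.IH[of "insert f I" "p - 1"] Cons.prems f by auto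
qed simp

text \<open>Exactness at cochain degree \<open>0\<close> says that \<open>R/J\<close> has no socle, so the graded maximal ideal contains a
nonzerodivisor; dividing by it uses up one of the exact degrees.\<close>

lemma regular_sequence_exists:
  fixes I :: "'k::field mpoly set"
  assumes "I \<subseteq> graded_max_ideal n" "\<And>p. p < d \<Longrightarrow> koszul_exact n (Idl\<^bsub>poly_ring n\<^esub> I) p"
  shows "\<exists>fs. regular_sequence (poly_ring n) I fs \<and> set fs \<subseteq> graded_max_ideal n \<and> length fs = d"
  using assms
proof (induction d arbitrary: I)
  case 0
  have "Idl\<^bsub>poly_ring n\<^esub> I \<subseteq> graded_max_ideal n" by (rule genideal_least[OF poly_ideal_graded_max 0(1)])
  moreover have "1 \<notin> graded_max_ideal n" by (simp add: graded_max_ideal_def)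
  ultimately have "Idl\<^bsub>poly_ring n\<^esub> I \<noteq> polys n" using polys_1 by blast
  then show ?case by (intro exI[of _ "[]"]) (simp add: regular_sequence_def)
next
  case (Suc d)
  have I: "I \<subseteq> polys n" using Suc.prems(1) by (auto simp: graded_max_ideal_def)
  let ?J = "Idl\<^bsub>poly_ring n\<^esub> I"
  note J = poly_ideal_genideal[OF I]
  have "\<exists>f\<in>graded_max_ideal n. nonzerodivisor n ?J f"
  proof (rule ccontr)
    assume no: "\<not> (\<exists>f\<in>graded_max_ideal n. nonzerodivisor n ?J f)"
    have "\<exists>g\<in>polys n - ?J. f * g \<in> ?J" if "f \<in> graded_max_ideal n" for f
      using no that unfolding nonzerodivisor_def by blast
    from socle_if_no_nonzerodivisor[OF J this] obtain z where
      z: "z \<in> polys n" "z \<notin> ?J" "\<And>f. f \<in> graded_max_ideal n \<Longrightarrow> f * z \<in> ?J" by blast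
    define c where "c = (\<lambda>T::nat set. if T = {} then z else 0)"
    have c: "c T \<in> polys n" for T using z by (simp add: c_def)
    have "cobd var c T \<in> ?J" if T: "T \<subseteq> {1..n}" "card T = Suc 0" for T
    proof -
      obtain k where k: "T = {k}" using T(2) by (auto simp: card_Suc_eq)
      have "Poly_Mapping.single k (Suc 0) \<noteq> (0 :: nat \<Rightarrow>\<^sub>0 nat)" by (metis lookup_single_eq lookup_zero nat.distinct(1))
      then have "var k \<in> graded_max_ideal n"
        using T k by (auto simp: graded_max_ideal_def) (simp add: var_def lookup_single when_def)
      then have "pos_sign k T * (var k * z) \<in> ?J" using z(3) by (intro poly_idealD(4)[OF J polys_pos_sign])
      then show ?thesis by (simp add: cobd_def k c_def mult.assoc)
    qed
    from koszul_exactD[where c = c, OF Suc.prems(2)[of 0] c this] obtain b where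
      "\<forall>T\<subseteq>{1..n}. card T = 0 \<longrightarrow> c T - cobd var b T \<in> ?J" by blast
    from spec[OF this, of "{}"] show False using z(2) by (simp add: c_def)
  qed
  then obtain f where f: "f \<in> graded_max_ideal n" "nonzerodivisor n ?J f" by blast
  then have fp: "f \<in> polys n" by (simp add: graded_max_ideal_def)
  have "koszul_exact n (Idl\<^bsub>poly_ring n\<^esub> (insert f I)) p" if "p < d" for p
    unfolding genideal_insert[OF I fp]
    using that by (intro koszul_exact_add_gen[OF J fp f(2)] Suc.prems(2)) simp_all
  moreover have "insert f I \<subseteq> graded_max_ideal n" using f Suc.prems by blast
  ultimately obtain fs where "regular_sequence (poly_ring n) (insert f I) fs" "set fs \<subseteq> graded_max_ideal n" "length fs = d"
    using Suc.IH by blast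
  then show ?case using f fp by (intro exI[of _ "f # fs"]) (simp add: regular_sequence_Cons)
qed

text \<open>The depth is the least cochain degree in which the Koszul complex is not exact. Every regular sequence is at
most that long, and one of that length can be found element by element.\<close>

theorem quot_depth_eq:
  fixes I :: "'k::field mpoly set"
  assumes I: "poly_ideal n I" "I \<subseteq> graded_max_ideal n"
    and ex: "\<And>p. p < d \<Longrightarrow> koszul_exact n I p" and ne: "\<not> koszul_exact n I d"
  shows "quot_depth n I = d"
proof -
  let ?S = "{length fs | fs. regular_sequence (poly_ring n) I fs \<and> set fs \<subseteq> graded_max_ideal n}"
  have le: "k \<le> d" if "k \<in> ?S" for k
    using that regular_sequence_length_le[of I n _ d] poly_idealD(1)[OF I(1)] ne
    by (auto simp: genideal_of_ideal[OF I(1)])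
  then have "finite ?S" using finite_nat_set_iff_bounded_le by blast
  moreover obtain fs where "regular_sequence (poly_ring n) I fs" "set fs \<subseteq> graded_max_ideal n" "length fs = d"
    using regular_sequence_exists[OF I(2), of d] ex by (auto simp: genideal_of_ideal[OF I(1)])
  then have "d \<in> ?S" by blast
  ultimately show ?thesis unfolding quot_depth_def using le by (intro Max_eqI) blast+
qed

lemma koszul_exact_edge_ideal:
  assumes "\<And>W. W \<subseteq> {1..n} \<Longrightarrow> n - card W \<le> p \<Longrightarrow>
      acyclic_at TYPE('k::field) (indeps E W) (p - (n - card W))"
  shows "koszul_exact n (mono_ideal n (edge_mono E) :: 'k mpoly set) p"
  unfolding koszul_exact_def
proof (intro allI impI)
  fix c :: "nat set \<Rightarrow> 'k mpoly"
  assume c: "\<forall>T\<subseteq>{1..n}. c T \<in> polys n"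
    and cocycle: "\<forall>T\<subseteq>{1..n}. card T = Suc p \<longrightarrow> cobd var c T \<in> mono_ideal n (edge_mono E)"
  have "\<exists>b. (\<forall>T\<subseteq>{1..n}. b T \<in> polys n \<and> (\<forall>m\<in>Poly_Mapping.keys (b T). True)) \<and>
    (\<forall>T\<subseteq>{1..n}. card T = p \<longrightarrow> c T - cobd var b T \<in> mono_ideal n (edge_mono E))"
    by (rule koszul_exact_edge) (use c cocycle assms in auto)
  then show "\<exists>b. (\<forall>T\<subseteq>{1..n}. b T \<in> polys n) \<and>
    (\<forall>T\<subseteq>{1..n}. card T = p \<longrightarrow> c T - cobd var b T \<in> mono_ideal n (edge_mono E))" by simp
qed

lemma not_koszul_exact_edge_ideal:
  assumes W: "W \<subseteq> {1..n}" "\<not> acyclic_at TYPE('k::field) (indeps E W) q"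
  shows "\<not> koszul_exact n (mono_ideal n (edge_mono E) :: 'k mpoly set) (q + (n - card W))"
proof
  assume ex: "koszul_exact n (mono_ideal n (edge_mono E) :: 'k mpoly set) (q + (n - card W))"
  obtain c :: "nat set \<Rightarrow> 'k mpoly" where
    c: "\<forall>T\<subseteq>{1..n}. c T \<in> hom_part n (int (card W) - int (n - card T))"
    "\<forall>T\<subseteq>{1..n}. card T = Suc (q + (n - card W)) \<longrightarrow> cobd var c T \<in> mono_ideal n (edge_mono E)"
    "\<not> (\<exists>b. (\<forall>T\<subseteq>{1..n}. b T \<in> polys n) \<and>
         (\<forall>T\<subseteq>{1..n}. card T = q + (n - card W) \<longrightarrow> c T - cobd var b T \<in> mono_ideal n (edge_mono E)))"
    using koszul_not_exact_edge[OF W refl] by blast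
  have "c T \<in> polys n" if "T \<subseteq> {1..n}" for T using c(1) that by (auto simp: hom_part_def)
  then show False using koszul_exactD[where c = c, OF ex] c(2,3) by simp
qed

text \<open>Both bounds are statements on the induced subcomplexes of the independence complex: \<open>shedding_core_depth\<close>
excludes cohomology in small degrees, and \<open>maximal_indep_not_acyclic\<close> provides some in degree \<open>d\<close>.\<close>

theorem depth_edge_ideal:
  assumes E: "simple_graph {1..n} E" and core: "shedding_core E {1..n} C"
    and le: "\<And>S. max_indep E {1..n} S \<Longrightarrow> d \<le> card S"
    and S: "max_indep E {1..n} S" "card S = d"
  shows "quot_depth n (edge_ideal n E :: 'k::field mpoly set) = d"
  unfolding edge_ideal_eq[OF E]
proof (rule quot_depth_eq[OF poly_ideal_edge_mono])
  have E2: "\<forall>e\<in>E. card e = 2" using E by (simp add: simple_graph_def)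
  show "mono_ideal n (edge_mono E) \<subseteq> (graded_max_ideal n :: 'k mpoly set)"
  proof
    fix p :: "'k mpoly" assume p: "p \<in> mono_ideal n (edge_mono E)"
    have "\<not> edge_mono E 0" using E2 by (auto simp: edge_mono_def)
    then show "p \<in> graded_max_ideal n" using p by (auto simp: graded_max_ideal_def mono_ideal_def in_keys_iff)
  qed
  have card_compl: "card ({1..n} - W) = n - card W" if "W \<subseteq> {1..n}" for W
    using that finite_subset_ivl[OF that] by (simp add: card_Diff_subset)
  show "koszul_exact n (mono_ideal n (edge_mono E) :: 'k mpoly set) p" if "p < d" for p
  proof (rule koszul_exact_edge_ideal, rule ccontr)
    fix W assume W: "W \<subseteq> {1..n}" "n - card W \<le> p"
      "\<not> acyclic_at TYPE('k) (indeps E W) (p - (n - card W))"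
    have "d \<le> card ({1..n} - W) + (p - (n - card W))"
      by (rule shedding_core_depth[OF E2 _ core le W(1,3)]) simp_all
    then show False using W(2) that card_compl[OF W(1)] by simp
  qed
  obtain W where W: "W \<subseteq> {1..n}" "card ({1..n} - W) \<le> card S"
    "\<not> acyclic_at TYPE('k) (indeps E W) (card S - card ({1..n} - W))"
    using maximal_indep_not_acyclic[OF E2 _ S(1)] by blast
  then show "\<not> koszul_exact n (mono_ideal n (edge_mono E) :: 'k mpoly set) d"
    using not_koszul_exact_edge_ideal[OF W(1,3)] card_compl[OF W(1)] S(2) by simp
qed

section \<open>Graded free resolutions and Koszul homology\<close>

subsection \<open>Homogeneous components\<close>

definition hcomp :: "int \<Rightarrow> 'k::field mpoly \<Rightarrow> 'k mpoly" where
  "hcomp d p = (\<Sum>m\<in>{m\<in>Poly_Mapping.keys p. int (monom_degree m) = d}. Poly_Mapping.single m (Poly_Mapping.lookup p m))"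

lemma lookup_hcomp: "Poly_Mapping.lookup (hcomp d p) m = (if int (monom_degree m) = d then Poly_Mapping.lookup p m else 0)"
proof -
  have "Poly_Mapping.lookup (hcomp d p) m =
      (\<Sum>l\<in>{l\<in>Poly_Mapping.keys p. int (monom_degree l) = d}. if l = m then Poly_Mapping.lookup p m else 0)"
    unfolding hcomp_def lookup_sum by (intro sum.cong refl) (auto simp: lookup_single when_def)
  then show ?thesis by (auto simp: in_keys_iff)
qed

lemma keys_hcomp: "Poly_Mapping.keys (hcomp d p) = {m\<in>Poly_Mapping.keys p. int (monom_degree m) = d}"
  by (auto simp: in_keys_iff lookup_hcomp split: if_splits)

lemma hcomp_in_hom_part: "p \<in> polys n \<Longrightarrow> hcomp d p \<in> hom_part n d"
  by (auto simp: hom_part_def polys_iff keys_hcomp)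

lemma hcomp_polys [simp, intro]: "p \<in> polys n \<Longrightarrow> hcomp d p \<in> polys n"
  by (auto simp: polys_iff keys_hcomp)

lemma hom_part_lookup: "p \<in> hom_part n d \<Longrightarrow> int (monom_degree m) \<noteq> d \<Longrightarrow> Poly_Mapping.lookup p m = 0"
  by (auto simp: hom_part_def in_keys_iff)

lemma hcomp_hom_part: "p \<in> hom_part n e \<Longrightarrow> hcomp d p = (if d = e then p else 0)"
  by (intro poly_mapping_eqI) (auto simp: lookup_hcomp hom_part_lookup)

lemma hcomp_0 [simp]: "hcomp d 0 = 0"
  by (simp add: hcomp_def)

lemma hcomp_add: "hcomp d (p + q) = hcomp d p + hcomp d q"
  by (intro poly_mapping_eqI) (simp add: lookup_hcomp lookup_add)

lemma hcomp_sum: "hcomp d (sum f A) = (\<Sum>i\<in>A. hcomp d (f i))"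
  by (induction A rule: infinite_finite_induct) (simp_all add: hcomp_add)

lemma hcomp_single_mult:
  assumes q: "q \<in> hom_part n e"
  shows "hcomp d (Poly_Mapping.single m c * q) = (if int (monom_degree m) = d - e then Poly_Mapping.single m c * q else 0)"
proof (rule poly_mapping_eqI)
  fix l
  show "Poly_Mapping.lookup (hcomp d (Poly_Mapping.single m c * q)) l =
    Poly_Mapping.lookup (if int (monom_degree m) = d - e then Poly_Mapping.single m c * q else 0) l"
  proof (cases "\<exists>k. l = m + k")
    case True
    then obtain k where "l = m + k" by blast
    then show ?thesis using hom_part_lookup[OF q, of k] by (auto simp: lookup_hcomp monom_degree_add)
  next
    case False
    then have "Poly_Mapping.lookup (Poly_Mapping.single m c * q) l = 0" by (intro lookup_single_times_not) auto
    then show ?thesis by (simp add: lookup_hcomp)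
  qed
qed

lemma hcomp_mult:
  assumes q: "q \<in> hom_part n e"
  shows "hcomp d (p * q) = hcomp (d - e) p * q"
proof -
  have "p * q = (\<Sum>m\<in>Poly_Mapping.keys p. Poly_Mapping.single m (Poly_Mapping.lookup p m) * q)"
    by (subst poly_mapping_sum_single[of p]) (simp add: sum_distrib_right)
  then have "hcomp d (p * q) = (\<Sum>m\<in>Poly_Mapping.keys p. if int (monom_degree m) = d - e then Poly_Mapping.single m (Poly_Mapping.lookup p m) * q else 0)"
    by (simp add: hcomp_sum hcomp_single_mult[OF q])
  also have "\<dots> = hcomp (d - e) p * q"
    unfolding hcomp_def sum_distrib_right by (rule sum.inter_filter[symmetric]) simp
  finally show ?thesis .
qed

lemma hom_part_0 [simp, intro]: "0 \<in> hom_part n d"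
  by (simp add: hom_part_def)

lemma hom_part_add: "p \<in> hom_part n d \<Longrightarrow> q \<in> hom_part n d \<Longrightarrow> p + q \<in> hom_part n d"
  using keys_add[of p q] by (auto simp: hom_part_def)

lemma hom_part_diff: "p \<in> hom_part n d \<Longrightarrow> q \<in> hom_part n d \<Longrightarrow> p - q \<in> hom_part n d"
  using keys_diff[of p q] by (auto simp: hom_part_def)

lemma hom_part_sum: "(\<And>i. i \<in> A \<Longrightarrow> f i \<in> hom_part n d) \<Longrightarrow> sum f A \<in> hom_part n d"
  by (induction A rule: infinite_finite_induct) (auto simp: hom_part_add)

lemma hom_part_mult:
  assumes "p \<in> hom_part n d" "q \<in> hom_part n e"
  shows "p * q \<in> hom_part n (d + e)"
proof -
  have "hcomp (d + e) (p * q) = p * q"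
    using hcomp_mult[OF assms(2), of "d + e" p] hcomp_hom_part[OF assms(1), of d] by simp
  then show ?thesis using hcomp_in_hom_part[of "p * q" n "d + e"] assms by (auto simp: hom_part_def)
qed

lemma hom_part_pos_sign_var: "k \<in> {1..n} \<Longrightarrow> pos_sign k T * var k \<in> hom_part n 1"
  using polys_mult[OF polys_pos_sign polys_var, of k n k T]
  by (auto simp: hom_part_def in_keys_iff pos_sign_times_lookup var_def lookup_single when_def split: if_splits)

subsection \<open>Graded pieces of free modules\<close>

definition free_piece :: "nat \<Rightarrow> int list \<Rightarrow> int \<Rightarrow> (nat \<Rightarrow> 'k::field mpoly) set" where
  "free_piece n ds d = {v \<in> free_mod n (length ds). \<forall>b<length ds. v b \<in> hom_part n (d - ds ! b)}"

definition vcomp :: "int list \<Rightarrow> int \<Rightarrow> (nat \<Rightarrow> 'k::field mpoly) \<Rightarrow> nat \<Rightarrow> 'k mpoly" where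
  "vcomp ds d v = (\<lambda>b. if b < length ds then hcomp (d - ds ! b) (v b) else 0)"

definition vcobd :: "(nat set \<Rightarrow> nat \<Rightarrow> 'k::field mpoly) \<Rightarrow> nat set \<Rightarrow> nat \<Rightarrow> 'k mpoly" where
  "vcobd c T = (\<lambda>b. cobd var (\<lambda>S. c S b) T)"

lemma vcomp_in_free_piece: "v \<in> free_mod n (length ds) \<Longrightarrow> vcomp ds d v \<in> free_piece n ds d"
  by (auto simp: free_piece_def free_mod_def vcomp_def hcomp_in_hom_part)

lemma vcomp_free_piece: "v \<in> free_piece n ds d \<Longrightarrow> vcomp ds d v = v"
  by (rule ext) (auto simp: free_piece_def free_mod_def vcomp_def hcomp_hom_part)

lemma vcomp_mat_map:
  assumes M: "\<And>a. a < length ds' \<Longrightarrow> M a \<in> free_piece n ds (ds' ! a)"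
  shows "mat_map (length ds') (length ds) M (vcomp ds' d v) = vcomp ds d (mat_map (length ds') (length ds) M v)"
proof
  fix b
  show "mat_map (length ds') (length ds) M (vcomp ds' d v) b = vcomp ds d (mat_map (length ds') (length ds) M v) b"
  proof (cases "b < length ds")
    case True
    have "hcomp (d - ds ! b) (v a * M a b) = hcomp (d - ds' ! a) (v a) * M a b" if "a < length ds'" for a
      using M[OF that] True hcomp_mult[of "M a b" n "ds' ! a - ds ! b" "d - ds ! b" "v a"]
      by (simp add: free_piece_def)
    then show ?thesis using True by (simp add: mat_map_def vcomp_def hcomp_sum)
  qed (simp add: mat_map_def vcomp_def)
qed

lemma free_piece_diff: "v \<in> free_piece n ds d \<Longrightarrow> w \<in> free_piece n ds d \<Longrightarrow> (\<lambda>b. v b - w b) \<in> free_piece n ds d"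
  by (auto simp: free_piece_def free_mod_def hom_part_diff)

lemma mat_map_free_piece:
  assumes M: "\<And>a. a < length ds' \<Longrightarrow> M a \<in> free_piece n ds (ds' ! a)" and v: "v \<in> free_piece n ds' d"
  shows "mat_map (length ds') (length ds) M v \<in> free_piece n ds d"
proof -
  have "mat_map (length ds') (length ds) M v \<in> free_mod n (length ds)"
    using M v by (auto simp: mat_map_def free_mod_def free_piece_def)
  then have "vcomp ds d (mat_map (length ds') (length ds) M v) \<in> free_piece n ds d" by (rule vcomp_in_free_piece)
  then show ?thesis using vcomp_mat_map[OF M, of d v] vcomp_free_piece[OF v] by simp
qed

lemma mat_map_add: "mat_map r s M (\<lambda>b. v b + w b) = (\<lambda>b. mat_map r s M v b + mat_map r s M w b)"
  by (rule ext) (simp add: mat_map_def distrib_right sum.distrib)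

lemma mat_map_diff: "mat_map r s M (\<lambda>b. v b - w b) = (\<lambda>b. mat_map r s M v b - mat_map r s M w b)"
  by (rule ext) (simp add: mat_map_def left_diff_distrib sum_subtractf)

lemma mat_map_scale: "mat_map r s M (\<lambda>b. p * v b) = (\<lambda>b. p * mat_map r s M v b)"
  by (rule ext) (simp add: mat_map_def sum_distrib_left mult.assoc)

lemma mat_map_sum: "mat_map r s M (\<lambda>b. \<Sum>i\<in>A. f i b) = (\<lambda>b. \<Sum>i\<in>A. mat_map r s M (f i) b)"
proof
  fix b
  have "(\<Sum>a<r. (\<Sum>i\<in>A. f i a) * M a b) = (\<Sum>i\<in>A. \<Sum>a<r. f i a * M a b)"
    unfolding sum_distrib_right by (rule sum.swap)
  then show "mat_map r s M (\<lambda>b. \<Sum>i\<in>A. f i b) b = (\<Sum>i\<in>A. mat_map r s M (f i) b)" by (simp add: mat_map_def)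
qed

lemma mat_map_vcobd: "mat_map r s M (vcobd c T) = vcobd (\<lambda>S. mat_map r s M (c S)) T"
  unfolding vcobd_def cobd_def by (simp add: mat_map_sum mat_map_scale)

lemma vcobd_cong: "(\<And>k. k \<in> T \<Longrightarrow> c (T - {k}) = c' (T - {k})) \<Longrightarrow> vcobd c T = vcobd c' T"
  unfolding vcobd_def by (intro ext cobd_cong) simp

lemma vcobd_vcobd: "finite T \<Longrightarrow> vcobd (vcobd c) T = (\<lambda>_. 0)"
  unfolding vcobd_def using cobd_cobd by fastforce

lemma vcobd_diff: "vcobd (\<lambda>S b. c S b - d S b) T = (\<lambda>b. vcobd c T b - vcobd d T b)"
  unfolding vcobd_def by (simp add: cobd_diff)

lemma vcobd_free_mod:
  assumes "T \<subseteq> {1..n}" "\<And>S. S \<subseteq> {1..n} \<Longrightarrow> c S \<in> free_mod n r"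
  shows "vcobd c T \<in> free_mod n r"
  unfolding vcobd_def using assms by (intro submod_cobd[OF submod_free_mod]) blast+

lemma vcobd_free_piece:
  assumes T: "T \<subseteq> {1..n}" and c: "\<And>S. S \<subseteq> {1..n} \<Longrightarrow> c S \<in> free_piece n ds (j - int (n - card S))"
  shows "vcobd c T \<in> free_piece n ds (j - int (n - card T))"
proof -
  have "c S \<in> free_mod n (length ds)" if "S \<subseteq> {1..n}" for S using c[OF that] by (simp add: free_piece_def)
  then have "vcobd c T \<in> free_mod n (length ds)" by (rule vcobd_free_mod[OF T])
  moreover have "vcobd c T b \<in> hom_part n (j - int (n - card T) - ds ! b)" if b: "b < length ds" for b
    unfolding vcobd_def cobd_def
  proof (rule hom_part_sum)
    fix k assume k: "k \<in> T"
    have fin: "finite T" using T by (rule finite_subset_ivl)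
    have "card T \<le> n" using card_mono[OF _ T] by simp
    moreover have "0 < card T" using k fin by (auto simp: card_gt_0_iff)
    ultimately have "int (n - card (T - {k})) = int (n - card T) + 1" using k fin by (simp add: of_nat_diff)
    moreover have "T - {k} \<subseteq> {1..n}" using T by blast
    ultimately have "c (T - {k}) b \<in> hom_part n (j - int (n - card T) - 1 - ds ! b)"
      using c[of "T - {k}"] b by (simp add: free_piece_def algebra_simps)
    then have "pos_sign k T * var k * c (T - {k}) b \<in> hom_part n (1 + (j - int (n - card T) - 1 - ds ! b))"
      using k T by (intro hom_part_mult hom_part_pos_sign_var) blast+
    then show "pos_sign k T * var k * c (T - {k}) b \<in> hom_part n (j - int (n - card T) - ds ! b)"
      by (simp add: algebra_simps)
  qed
  ultimately show ?thesis by (simp add: free_piece_def)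
qed

lemma vkoszul_exact_free:
  fixes c :: "nat set \<Rightarrow> nat \<Rightarrow> 'k::field mpoly"
  assumes c: "\<And>T. T \<subseteq> {1..n} \<Longrightarrow> c T \<in> free_piece n ds (j - int (n - card T))"
    and p: "p < n \<or> p = n \<and> (\<forall>b. c {1..n} b \<in> graded_max_ideal n)"
    and cocycle: "\<And>T. T \<subseteq> {1..n} \<Longrightarrow> card T = Suc p \<Longrightarrow> vcobd c T = (\<lambda>_. 0)"
  shows "\<exists>e. (\<forall>T\<subseteq>{1..n}. e T \<in> free_piece n ds (j - int (n - card T))) \<and>
    (\<forall>T\<subseteq>{1..n}. card T = p \<longrightarrow> c T = vcobd e T)"
proof -
  have "\<exists>e. (\<forall>T\<subseteq>{1..n}. e T \<in> hom_part n (j - ds ! b - int (n - card T))) \<and>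
    (\<forall>T\<subseteq>{1..n}. card T = p \<longrightarrow> c T b = cobd var e T)" if b: "b < length ds" for b
  proof (rule koszul_exact_free)
    show "c T b \<in> hom_part n (j - ds ! b - int (n - card T))" if "T \<subseteq> {1..n}" for T
      using c[OF that] b by (simp add: free_piece_def algebra_simps)
    show "p < n \<or> p = n \<and> Poly_Mapping.lookup (c {1..n} b) 0 = 0"
      using p by (auto simp: graded_max_ideal_def)
    show "cobd var (\<lambda>T. c T b) T = 0" if "T \<subseteq> {1..n}" "card T = Suc p" for T
      using fun_cong[OF cocycle[OF that], of b] by (simp add: vcobd_def)
  qed
  then have "\<forall>b. \<exists>e. b < length ds \<longrightarrow> (\<forall>T\<subseteq>{1..n}. e T \<in> hom_part n (j - ds ! b - int (n - card T))) \<and>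
    (\<forall>T\<subseteq>{1..n}. card T = p \<longrightarrow> c T b = cobd var e T)" by blast
  then obtain e where e: "\<And>b. b < length ds \<Longrightarrow> (\<forall>T\<subseteq>{1..n}. e b T \<in> hom_part n (j - ds ! b - int (n - card T))) \<and>
    (\<forall>T\<subseteq>{1..n}. card T = p \<longrightarrow> c T b = cobd var (e b) T)" by metis
  define e' where "e' = (\<lambda>T b. if b < length ds then e b T else 0)"
  have "e' T \<in> free_piece n ds (j - int (n - card T))" if "T \<subseteq> {1..n}" for T
    using e that by (auto simp: e'_def free_piece_def free_mod_def hom_part_def algebra_simps)
  moreover have "c T = vcobd e' T" if T: "T \<subseteq> {1..n}" "card T = p" for T
  proof
    fix b
    show "c T b = vcobd e' T b"
    proof (cases "b < length ds")
      case True
      then show ?thesis using e[OF True] T by (simp add: vcobd_def e'_def)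
    next
      case False
      then show ?thesis using c[OF T(1)] by (simp add: vcobd_def e'_def free_piece_def free_mod_def cobd_def)
    qed
  qed
  ultimately show ?thesis by (intro exI[of _ e']) blast
qed

subsection \<open>The generators of a minimal resolution\<close>

locale graded_resolution =
  fixes n :: nat and I :: "'k::field mpoly set" and ds :: "nat \<Rightarrow> int list"
    and D :: "nat \<Rightarrow> nat \<Rightarrow> nat \<Rightarrow> 'k mpoly"
  assumes n: "0 < n" and I: "poly_ideal n I" and Imax: "I \<subseteq> graded_max_ideal n"
    and res: "min_graded_free_resolution n I ds D"
begin

abbreviation fmod :: "nat \<Rightarrow> (nat \<Rightarrow> 'k mpoly) set" where
  "fmod i \<equiv> free_mod n (length (ds i))"

definition \<phi> :: "nat \<Rightarrow> (nat \<Rightarrow> 'k mpoly) \<Rightarrow> nat \<Rightarrow> 'k mpoly" where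
  "\<phi> i = mat_map (length (ds (Suc i))) (length (ds i)) (\<lambda>a b. if b < length (ds i) then D i a b else 0)"

text \<open>For \<open>i = 0\<close> the kernel of the augmentation is taken, so that \<open>syz i\<close> is the image of the next map for
  all \<open>i\<close>.\<close>

definition syz :: "nat \<Rightarrow> (nat \<Rightarrow> 'k mpoly) set" where
  "syz i = (case i of 0 \<Rightarrow> {v \<in> fmod 0. v 0 \<in> I} | Suc i' \<Rightarrow> {v \<in> fmod i. \<phi> i' v = (\<lambda>_. 0)})"

lemma ds0: "ds 0 = [0]"
  using res by (simp add: min_graded_free_resolution_def)

lemma \<phi>_eq: "\<phi> i = mat_map (length (ds (Suc i))) (length (ds i)) (D i)"
  unfolding \<phi>_def by (intro ext) (simp add: mat_map_def)

lemma entry_free_piece: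
  "a < length (ds (Suc i)) \<Longrightarrow> (\<lambda>b. if b < length (ds i) then D i a b else 0) \<in> free_piece n (ds i) (ds (Suc i) ! a)"
  using res by (auto simp: min_graded_free_resolution_def free_piece_def free_mod_def hom_part_def)

lemma \<phi>_free_piece: "v \<in> free_piece n (ds (Suc i)) d \<Longrightarrow> \<phi> i v \<in> free_piece n (ds i) d"
  unfolding \<phi>_def by (rule mat_map_free_piece[OF entry_free_piece])

lemma \<phi>_image: "\<phi> i ` fmod (Suc i) = syz i"
proof (cases i)
  case 0
  then show ?thesis using res by (simp add: min_graded_free_resolution_def \<phi>_eq syz_def ds0)
next
  case (Suc j)
  then show ?thesis using res by (auto simp: min_graded_free_resolution_def \<phi>_eq syz_def)
qed

lemma \<phi>_diff: "\<phi> i (\<lambda>b. v b - w b) = (\<lambda>b. \<phi> i v b - \<phi> i w b)"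
  unfolding \<phi>_def by (rule mat_map_diff)

lemma \<phi>_vcobd: "\<phi> i (vcobd c T) = vcobd (\<lambda>S. \<phi> i (c S)) T"
  unfolding \<phi>_def by (rule mat_map_vcobd)

lemma syz_Suc: "v \<in> syz (Suc i) \<longleftrightarrow> v \<in> fmod (Suc i) \<and> \<phi> i v = (\<lambda>_. 0)"
  by (simp add: syz_def)

lemma syz_zero: "(\<lambda>_. 0) \<in> syz i"
  using poly_idealD(2)[OF I] by (cases i) (auto simp: syz_def free_mod_def \<phi>_def mat_map_def)

lemma syz_graded_max:
  assumes "v \<in> syz i"
  shows "v b \<in> graded_max_ideal n"
proof (cases "b < length (ds i)")
  case True
  obtain g where g: "g \<in> fmod (Suc i)" "v = \<phi> i g" using assms \<phi>_image[of i] by blast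
  have "v b = (\<Sum>a<length (ds (Suc i)). g a * D i a b)" using g True by (simp add: \<phi>_eq mat_map_def)
  also have "\<dots> \<in> graded_max_ideal n"
    using res True g(1) unfolding min_graded_free_resolution_def free_mod_def
    by (intro poly_ideal_sum[OF poly_ideal_graded_max] poly_idealD(4)[OF poly_ideal_graded_max]) simp_all
  finally show ?thesis .
next
  case False
  then have "v b = 0" using assms by (cases i) (auto simp: syz_def free_mod_def)
  then show ?thesis using poly_idealD(2)[OF poly_ideal_graded_max] by simp
qed

lemma lift_free_piece:
  assumes v: "v \<in> syz i" "v \<in> free_piece n (ds i) d"
  obtains g where "g \<in> free_piece n (ds (Suc i)) d" "\<phi> i g = v"
proof -
  obtain g where g: "g \<in> fmod (Suc i)" "v = \<phi> i g" using v(1) \<phi>_image[of i] by blast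
  have "\<phi> i (vcomp (ds (Suc i)) d g) = vcomp (ds i) d (\<phi> i g)"
    unfolding \<phi>_def by (rule vcomp_mat_map[OF entry_free_piece])
  also have "\<dots> = v" using vcomp_free_piece[OF v(2)] g by simp
  finally show ?thesis using that vcomp_in_free_piece[OF g(1)] by blast
qed

text \<open>Exactness at cochain degree \<open>p\<close> and in total degree \<open>j\<close> of the Koszul complex of the
  \<open>i\<close>-th free module modulo its syzygies, which is the \<open>i\<close>-th syzygy module of \<open>R/I\<close>.\<close>

definition kexact :: "nat \<Rightarrow> nat \<Rightarrow> int \<Rightarrow> bool" where
  "kexact i p j \<longleftrightarrow>
     (\<forall>c. (\<forall>T\<subseteq>{1..n}. c T \<in> free_piece n (ds i) (j - int (n - card T))) \<longrightarrow>
        (\<forall>T\<subseteq>{1..n}. card T = Suc p \<longrightarrow> vcobd c T \<in> syz i) \<longrightarrow>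
        (\<exists>e. (\<forall>T\<subseteq>{1..n}. e T \<in> free_piece n (ds i) (j - int (n - card T))) \<and>
             (\<forall>T\<subseteq>{1..n}. card T = p \<longrightarrow> (\<lambda>b. c T b - vcobd e T b) \<in> syz i)))"

lemma kexactD:
  assumes "kexact i p j" "\<And>T. T \<subseteq> {1..n} \<Longrightarrow> c T \<in> free_piece n (ds i) (j - int (n - card T))"
    "\<And>T. T \<subseteq> {1..n} \<Longrightarrow> card T = Suc p \<Longrightarrow> vcobd c T \<in> syz i"
  shows "\<exists>e. (\<forall>T\<subseteq>{1..n}. e T \<in> free_piece n (ds i) (j - int (n - card T))) \<and>
             (\<forall>T\<subseteq>{1..n}. card T = p \<longrightarrow> (\<lambda>b. c T b - vcobd e T b) \<in> syz i)"
  using assms unfolding kexact_def by simp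

lemma fmod_free_piece: "v \<in> free_piece n (ds i) d \<Longrightarrow> v \<in> fmod i"
  by (simp add: free_piece_def)

lemma lift_cochain:
  assumes "\<And>T. T \<subseteq> {1..n} \<Longrightarrow> card T = q \<Longrightarrow> h T \<in> syz i \<and> h T \<in> free_piece n (ds i) (j - int (n - card T))"
  shows "\<exists>g. (\<forall>T\<subseteq>{1..n}. g T \<in> free_piece n (ds (Suc i)) (j - int (n - card T))) \<and>
    (\<forall>T\<subseteq>{1..n}. card T = q \<longrightarrow> \<phi> i (g T) = h T)"
proof -
  have "\<exists>g. T \<subseteq> {1..n} \<and> card T = q \<longrightarrow> g \<in> free_piece n (ds (Suc i)) (j - int (n - card T)) \<and> \<phi> i g = h T" for T
    using lift_free_piece[of "h T" i "j - int (n - card T)"] assms[of T] by metis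
  then obtain g0 where g0: "\<And>T. T \<subseteq> {1..n} \<Longrightarrow> card T = q \<Longrightarrow>
      g0 T \<in> free_piece n (ds (Suc i)) (j - int (n - card T)) \<and> \<phi> i (g0 T) = h T" by metis
  have "(\<lambda>_. 0) \<in> free_piece n (ds (Suc i)) d" for d by (simp add: free_piece_def free_mod_def)
  then have "(if card T = q then g0 T else (\<lambda>_. 0)) \<in> free_piece n (ds (Suc i)) (j - int (n - card T))"
    if "T \<subseteq> {1..n}" for T using g0[OF that] by (cases "card T = q") (simp, simp only: if_False)
  then show ?thesis using g0
    by (intro exI[of _ "\<lambda>T. if card T = q then g0 T else (\<lambda>_. 0)"]) simp
qed

text \<open>Dimension shifting: \<open>\<phi> i\<close> induces an embedding of the \<open>(i + 1)\<close>-st free module modulo its syzygies into the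
\<open>i\<close>-th free module with quotient the \<open>i\<close>-th free module modulo its syzygies, and the Koszul complex of a
free module is exact below the top degree. The case \<open>p + 1 = n\<close> uses that the syzygies lie in the graded
maximal ideal times the free module.\<close>

lemma kexact_shift:
  assumes p: "p < n"
  shows "kexact i p j \<longleftrightarrow> kexact (Suc i) (Suc p) j"
proof
  assume ex: "kexact (Suc i) (Suc p) j"
  show "kexact i p j"
    unfolding kexact_def
  proof (intro allI impI)
    fix c assume c0: "\<forall>T\<subseteq>{1..n}. c T \<in> free_piece n (ds i) (j - int (n - card T))"
      and cocycle: "\<forall>T\<subseteq>{1..n}. card T = Suc p \<longrightarrow> vcobd c T \<in> syz i"
    have c: "c T \<in> free_piece n (ds i) (j - int (n - card T))" if "T \<subseteq> {1..n}" for T using c0 that by blast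
    have "vcobd c T \<in> syz i \<and> vcobd c T \<in> free_piece n (ds i) (j - int (n - card T))"
      if T: "T \<subseteq> {1..n}" "card T = Suc p" for T
      using cocycle T vcobd_free_piece[OF T(1) c] by simp
    from lift_cochain[OF this] obtain g where
      "(\<forall>T\<subseteq>{1..n}. g T \<in> free_piece n (ds (Suc i)) (j - int (n - card T))) \<and>
       (\<forall>T\<subseteq>{1..n}. card T = Suc p \<longrightarrow> \<phi> i (g T) = vcobd c T)" ..
    then have g: "\<And>T. T \<subseteq> {1..n} \<Longrightarrow> g T \<in> free_piece n (ds (Suc i)) (j - int (n - card T))"
      "\<And>T. T \<subseteq> {1..n} \<Longrightarrow> card T = Suc p \<Longrightarrow> \<phi> i (g T) = vcobd c T" by simp_all
    have gc: "vcobd g T \<in> syz (Suc i)" if T: "T \<subseteq> {1..n}" "card T = Suc (Suc p)" for T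
    proof -
      have fin: "finite T" using T(1) by (rule finite_subset_ivl)
      have "\<phi> i (vcobd g T) = vcobd (vcobd c) T"
        unfolding \<phi>_vcobd
      proof (rule vcobd_cong)
        fix k assume "k \<in> T"
        then show "\<phi> i (g (T - {k})) = vcobd c (T - {k})" using T fin by (intro g(2)) auto
      qed
      then show ?thesis
        using vcobd_vcobd[OF fin, of c] fmod_free_piece[OF vcobd_free_piece[OF T(1) g(1)]] by (simp add: syz_Suc)
    qed
    from kexactD[where c = g, OF ex g(1) gc] obtain e where
      "(\<forall>T\<subseteq>{1..n}. e T \<in> free_piece n (ds (Suc i)) (j - int (n - card T))) \<and>
       (\<forall>T\<subseteq>{1..n}. card T = Suc p \<longrightarrow> (\<lambda>b. g T b - vcobd e T b) \<in> syz (Suc i))" ..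
    then have e: "\<And>T. T \<subseteq> {1..n} \<Longrightarrow> e T \<in> free_piece n (ds (Suc i)) (j - int (n - card T))"
      "\<And>T. T \<subseteq> {1..n} \<Longrightarrow> card T = Suc p \<Longrightarrow> (\<lambda>b. g T b - vcobd e T b) \<in> syz (Suc i)" by simp_all
    define c' where "c' = (\<lambda>T b. c T b - \<phi> i (e T) b)"
    have c': "c' T \<in> free_piece n (ds i) (j - int (n - card T))" if "T \<subseteq> {1..n}" for T
      unfolding c'_def by (rule free_piece_diff[OF c[OF that] \<phi>_free_piece[OF e(1)[OF that]]])
    have c'0: "vcobd c' T = (\<lambda>_. 0)" if T: "T \<subseteq> {1..n}" "card T = Suc p" for T
    proof -
      have "vcobd c' T = (\<lambda>b. vcobd c T b - \<phi> i (vcobd e T) b)"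
        unfolding c'_def vcobd_diff \<phi>_vcobd ..
      also have "\<dots> = \<phi> i (\<lambda>b. g T b - vcobd e T b)" unfolding \<phi>_diff g(2)[OF T] ..
      also have "\<dots> = (\<lambda>_. 0)" using e(2)[OF T] by (simp add: syz_Suc)
      finally show ?thesis .
    qed
    from vkoszul_exact_free[where c = c' and p = p, OF c' disjI1[OF p] c'0] obtain b where
      "(\<forall>T\<subseteq>{1..n}. b T \<in> free_piece n (ds i) (j - int (n - card T))) \<and>
       (\<forall>T\<subseteq>{1..n}. card T = p \<longrightarrow> c' T = vcobd b T)" ..
    then have b: "\<forall>T\<subseteq>{1..n}. b T \<in> free_piece n (ds i) (j - int (n - card T))"
      "\<And>T. T \<subseteq> {1..n} \<Longrightarrow> card T = p \<Longrightarrow> c' T = vcobd b T" by simp_all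
    have "(\<lambda>x. c T x - vcobd b T x) \<in> syz i" if T: "T \<subseteq> {1..n}" "card T = p" for T
    proof -
      have "(\<lambda>x. c T x - vcobd b T x) = \<phi> i (e T)"
        unfolding b(2)[OF T, symmetric] c'_def by simp
      then show ?thesis using \<phi>_image[of i] fmod_free_piece[OF e(1)[OF T(1)]] by auto
    qed
    then show "\<exists>e. (\<forall>T\<subseteq>{1..n}. e T \<in> free_piece n (ds i) (j - int (n - card T))) \<and>
             (\<forall>T\<subseteq>{1..n}. card T = p \<longrightarrow> (\<lambda>b. c T b - vcobd e T b) \<in> syz i)"
      using b(1) by blast
  qed
next
  assume ex: "kexact i p j"
  show "kexact (Suc i) (Suc p) j"
    unfolding kexact_def
  proof (intro allI impI)
    fix g assume g0: "\<forall>T\<subseteq>{1..n}. g T \<in> free_piece n (ds (Suc i)) (j - int (n - card T))"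
      and cocycle: "\<forall>T\<subseteq>{1..n}. card T = Suc (Suc p) \<longrightarrow> vcobd g T \<in> syz (Suc i)"
    have g: "g T \<in> free_piece n (ds (Suc i)) (j - int (n - card T))" if "T \<subseteq> {1..n}" for T using g0 that by blast
    define h where "h = (\<lambda>T. \<phi> i (g T))"
    have h: "h T \<in> free_piece n (ds i) (j - int (n - card T))" "h T \<in> syz i" if "T \<subseteq> {1..n}" for T
      unfolding h_def using \<phi>_free_piece[OF g[OF that]] \<phi>_image[of i] fmod_free_piece[OF g[OF that]] by auto
    have h0: "vcobd h T = (\<lambda>_. 0)" if "T \<subseteq> {1..n}" "card T = Suc (Suc p)" for T
      unfolding h_def \<phi>_vcobd[symmetric] using cocycle that by (simp add: syz_Suc)
    have "Suc p < n \<or> Suc p = n \<and> (\<forall>b. h {1..n} b \<in> graded_max_ideal n)"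
      using p syz_graded_max[OF h(2)[of "{1..n}"]] by auto
    from vkoszul_exact_free[where c = h and p = "Suc p", OF h(1) this h0] obtain c where
      "(\<forall>T\<subseteq>{1..n}. c T \<in> free_piece n (ds i) (j - int (n - card T))) \<and>
       (\<forall>T\<subseteq>{1..n}. card T = Suc p \<longrightarrow> h T = vcobd c T)" ..
    then have c: "\<And>T. T \<subseteq> {1..n} \<Longrightarrow> c T \<in> free_piece n (ds i) (j - int (n - card T))"
      "\<And>T. T \<subseteq> {1..n} \<Longrightarrow> card T = Suc p \<Longrightarrow> h T = vcobd c T" by simp_all
    have "vcobd c T \<in> syz i" if "T \<subseteq> {1..n}" "card T = Suc p" for T
      using c(2)[OF that] h(2)[OF that(1)] by simp
    from kexactD[where c = c, OF ex c(1) this] obtain e where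
      "(\<forall>T\<subseteq>{1..n}. e T \<in> free_piece n (ds i) (j - int (n - card T))) \<and>
       (\<forall>T\<subseteq>{1..n}. card T = p \<longrightarrow> (\<lambda>b. c T b - vcobd e T b) \<in> syz i)" ..
    then have e: "\<And>T. T \<subseteq> {1..n} \<Longrightarrow> e T \<in> free_piece n (ds i) (j - int (n - card T))"
      "\<And>T. T \<subseteq> {1..n} \<Longrightarrow> card T = p \<Longrightarrow> (\<lambda>b. c T b - vcobd e T b) \<in> syz i" by simp_all
    have "(\<lambda>b. c T b - vcobd e T b) \<in> syz i \<and> (\<lambda>b. c T b - vcobd e T b) \<in> free_piece n (ds i) (j - int (n - card T))"
      if T: "T \<subseteq> {1..n}" "card T = p" for T
      using e(2)[OF T] free_piece_diff[OF c(1)[OF T(1)] vcobd_free_piece[OF T(1) e(1)]] by blast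
    from lift_cochain[where h = "\<lambda>T b. c T b - vcobd e T b", OF this] obtain f where
      "(\<forall>T\<subseteq>{1..n}. f T \<in> free_piece n (ds (Suc i)) (j - int (n - card T))) \<and>
       (\<forall>T\<subseteq>{1..n}. card T = p \<longrightarrow> \<phi> i (f T) = (\<lambda>b. c T b - vcobd e T b))" ..
    then have f: "\<And>T. T \<subseteq> {1..n} \<Longrightarrow> f T \<in> free_piece n (ds (Suc i)) (j - int (n - card T))"
      "\<And>T. T \<subseteq> {1..n} \<Longrightarrow> card T = p \<Longrightarrow> \<phi> i (f T) = (\<lambda>b. c T b - vcobd e T b)" by simp_all
    have "(\<lambda>b. g T b - vcobd f T b) \<in> syz (Suc i)" if T: "T \<subseteq> {1..n}" "card T = Suc p" for T
    proof -
      have fin: "finite T" using T(1) by (rule finite_subset_ivl)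
      have "\<phi> i (vcobd f T) = vcobd (\<lambda>S b. c S b - vcobd e S b) T"
        unfolding \<phi>_vcobd
      proof (rule vcobd_cong)
        fix k assume "k \<in> T"
        then show "\<phi> i (f (T - {k})) = (\<lambda>b. c (T - {k}) b - vcobd e (T - {k}) b)"
          using T fin by (intro f(2)) auto
      qed
      also have "\<dots> = (\<lambda>b. vcobd c T b - vcobd (vcobd e) T b)" by (rule vcobd_diff)
      also have "\<dots> = h T" unfolding vcobd_vcobd[OF fin] c(2)[OF T] by simp
      finally have "\<phi> i (\<lambda>b. g T b - vcobd f T b) = (\<lambda>_. 0)" unfolding \<phi>_diff h_def by simp
      moreover have "(\<lambda>b. g T b - vcobd f T b) \<in> fmod (Suc i)"
        using free_piece_diff[OF g[OF T(1)] vcobd_free_piece[OF T(1) f(1)]] by (rule fmod_free_piece)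
      ultimately show ?thesis by (simp add: syz_Suc)
    qed
    then show "\<exists>e. (\<forall>T\<subseteq>{1..n}. e T \<in> free_piece n (ds (Suc i)) (j - int (n - card T))) \<and>
             (\<forall>T\<subseteq>{1..n}. card T = Suc p \<longrightarrow> (\<lambda>b. g T b - vcobd e T b) \<in> syz (Suc i))"
      using f(1) by blast
  qed
qed

text \<open>The top Koszul cohomology of a module is its reduction modulo the graded maximal ideal. By minimality the
syzygies do not contribute, and what remains is spanned by the basis of the \<open>i\<close>-th free module.\<close>

lemma kexact_top: "kexact i n j \<longleftrightarrow> j \<notin> set (ds i)"
proof
  assume ex: "kexact i n j"
  show "j \<notin> set (ds i)"
  proof
    assume "j \<in> set (ds i)"
    then obtain a where a: "a < length (ds i)" "ds i ! a = j" by (auto simp: in_set_conv_nth)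
    define c where "c = (\<lambda>(T::nat set) b. if T = {1..n} \<and> b = a then (1 :: 'k mpoly) else 0)"
    have "1 \<in> hom_part n 0" by (simp add: hom_part_def)
    then have c: "c T \<in> free_piece n (ds i) (j - int (n - card T))" for T
      using a by (auto simp: c_def free_piece_def free_mod_def)
    have "vcobd c T \<in> syz i" if "T \<subseteq> {1..n}" "card T = Suc n" for T
      using card_mono[OF _ that(1)] that(2) by simp
    from kexactD[where c = c, OF ex c this] obtain e where
      "(\<forall>T\<subseteq>{1..n}. e T \<in> free_piece n (ds i) (j - int (n - card T))) \<and>
       (\<forall>T\<subseteq>{1..n}. card T = n \<longrightarrow> (\<lambda>b. c T b - vcobd e T b) \<in> syz i)" ..
    then have e: "\<And>T. T \<subseteq> {1..n} \<Longrightarrow> e T \<in> free_piece n (ds i) (j - int (n - card T))"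
      "(\<lambda>b. c {1..n} b - vcobd e {1..n} b) \<in> syz i" by simp_all
    have "1 - vcobd e {1..n} a \<in> graded_max_ideal n"
      using syz_graded_max[OF e(2), of a] by (simp add: c_def)
    moreover have "vcobd e {1..n} a \<in> graded_max_ideal n"
      unfolding vcobd_def cobd_def
    proof (rule poly_ideal_sum[OF poly_ideal_graded_max])
      fix k assume k: "k \<in> {1..n}"
      have hv: "pos_sign k {1..n} * var k \<in> (hom_part n 1 :: 'k mpoly set)"
        by (rule hom_part_pos_sign_var[OF k])
      then have "pos_sign k {1..n} * var k \<in> (graded_max_ideal n :: 'k mpoly set)"
        using hom_part_lookup[OF hv, of 0] by (simp add: graded_max_ideal_def hom_part_def)
      moreover have "e ({1..n} - {k}) a \<in> polys n"
        using e(1)[of "{1..n} - {k}"] a(1) by (auto simp: free_piece_def free_mod_def)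
      ultimately show "pos_sign k {1..n} * var k * e ({1..n} - {k}) a \<in> graded_max_ideal n"
        by (rule poly_idealD(5)[OF poly_ideal_graded_max, rotated])
    qed
    ultimately have "(1 :: 'k mpoly) \<in> graded_max_ideal n"
      using poly_idealD(3)[OF poly_ideal_graded_max] by fastforce
    then show False by (simp add: graded_max_ideal_def)
  qed
next
  assume j: "j \<notin> set (ds i)"
  show "kexact i n j"
    unfolding kexact_def
  proof (intro allI impI)
    fix c :: "nat set \<Rightarrow> nat \<Rightarrow> 'k mpoly"
    assume c: "\<forall>T\<subseteq>{1..n}. c T \<in> free_piece n (ds i) (j - int (n - card T))"
    have "c {1..n} b \<in> graded_max_ideal n" for b
    proof (cases "b < length (ds i)")
      case True
      have "c {1..n} \<in> free_piece n (ds i) (j - int (n - card {1..n}))" using c by blast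
      then have cb: "c {1..n} b \<in> hom_part n (j - ds i ! b)" using True by (simp add: free_piece_def)
      have "ds i ! b \<noteq> j" using j True nth_mem by blast
      then have "Poly_Mapping.lookup (c {1..n} b) 0 = 0" by (intro hom_part_lookup[OF cb]) simp
      then show ?thesis using cb by (simp add: graded_max_ideal_def hom_part_def)
    next
      case False
      have "c {1..n} \<in> fmod i" using c fmod_free_piece by blast
      then have "c {1..n} b = 0" using False by (simp add: free_mod_def)
      then show ?thesis using poly_idealD(2)[OF poly_ideal_graded_max] by simp
    qed
    then have *: "n < n \<or> n = n \<and> (\<forall>b. c {1..n} b \<in> graded_max_ideal n)" by blast
    have "vcobd c T = (\<lambda>_. 0)" if "T \<subseteq> {1..n}" "card T = Suc n" for T
      using card_mono[OF _ that(1)] that(2) by simp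
    from vkoszul_exact_free[where c = c and p = n, OF _ * this] obtain e where
      e: "(\<forall>T\<subseteq>{1..n}. e T \<in> free_piece n (ds i) (j - int (n - card T))) \<and>
       (\<forall>T\<subseteq>{1..n}. card T = n \<longrightarrow> c T = vcobd e T)" using c by blast
    then show "\<exists>e. (\<forall>T\<subseteq>{1..n}. e T \<in> free_piece n (ds i) (j - int (n - card T))) \<and>
             (\<forall>T\<subseteq>{1..n}. card T = n \<longrightarrow> (\<lambda>b. c T b - vcobd e T b) \<in> syz i)"
      using syz_zero by (intro exI[of _ e]) simp
  qed
qed

text \<open>For a positive index the module in question embeds into a free module and therefore has no socle.\<close>

lemma kexact_bottom: "kexact (Suc i) 0 j"
  unfolding kexact_def
proof (intro allI impI)
  fix c assume c: "\<forall>T\<subseteq>{1..n}. c T \<in> free_piece n (ds (Suc i)) (j - int (n - card T))"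
    and cocycle: "\<forall>T\<subseteq>{1..n}. card T = Suc 0 \<longrightarrow> vcobd c T \<in> syz (Suc i)"
  have "vcobd c {1} \<in> syz (Suc i)" using cocycle n by (simp add: subset_iff)
  moreover have "pos_sign 1 {1} = (1 :: 'k mpoly)" unfolding pos_sign_def by (simp add: less_Suc_eq_0_disj cong: conj_cong)
  then have "vcobd c {1} = (\<lambda>b. var 1 * c {} b)" unfolding vcobd_def cobd_def by simp
  ultimately have "\<phi> i (\<lambda>b. var 1 * c {} b) = (\<lambda>_. 0)" by (simp add: syz_Suc)
  then have "(\<lambda>b. var 1 * \<phi> i (c {}) b) = (\<lambda>_. 0)" unfolding \<phi>_def mat_map_scale .
  moreover have "(var 1 :: 'k mpoly) \<noteq> 0" by (metis lookup_single_eq lookup_zero var_def zero_neq_one)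
  ultimately have "\<phi> i (c {}) = (\<lambda>_. 0)" by (metis mult_eq_0_iff)
  moreover have "c {} \<in> fmod (Suc i)" using c fmod_free_piece by blast
  ultimately have "c {} \<in> syz (Suc i)" by (simp add: syz_Suc)
  moreover have "T = {}" if "T \<subseteq> {1..n}" "card T = 0" for T :: "nat set"
    using that finite_subset_ivl[OF that(1)] by simp
  moreover have "(\<lambda>_. 0) \<in> free_piece n (ds (Suc i)) d" for d by (simp add: free_piece_def free_mod_def)
  ultimately show "\<exists>e. (\<forall>T\<subseteq>{1..n}. e T \<in> free_piece n (ds (Suc i)) (j - int (n - card T))) \<and>
             (\<forall>T\<subseteq>{1..n}. card T = 0 \<longrightarrow> (\<lambda>b. c T b - vcobd e T b) \<in> syz (Suc i))"
    by (intro exI[of _ "\<lambda>_ _. 0"]) (auto simp: vcobd_def cobd_def)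
qed

text \<open>The degrees of the generators of a minimal resolution are given by the graded Tor modules of \<open>R/I\<close> and the
residue field, here computed by the Koszul complex of \<open>R/I\<close>.\<close>

lemma generator_degree_iff: "j \<in> set (ds i) \<longleftrightarrow> i \<le> n \<and> \<not> kexact 0 (n - i) j"
proof -
  have shift: "kexact i p j \<longleftrightarrow> kexact (i + m) (p + m) j" if "p + m \<le> n" for i p m
    using that
  proof (induction m)
    case (Suc m)
    then show ?case using kexact_shift[of "p + m" "i + m" j] by simp
  qed simp
  show ?thesis
  proof (cases "i \<le> n")
    case True
    then show ?thesis using shift[of "n - i" i 0] kexact_top[of i j] by simp
  next
    case False
    then have "kexact (i - n) 0 j" using kexact_bottom[of "i - n - 1" j] by (simp add: Suc_diff_Suc)
    then have "kexact i n j" using shift[of 0 n "i - n"] False by simp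
    then show ?thesis using kexact_top[of i j] False by simp
  qed
qed

end

subsection \<open>Existence of minimal graded free resolutions\<close>

lemma mspan_add: "v \<in> mspan n G \<Longrightarrow> w \<in> mspan n G \<Longrightarrow> (\<lambda>b. v b + w b) \<in> mspan n G"
proof (induction rule: mspan.induct)
  case (step v p g)
  then have "(\<lambda>b. p * g b + (v b + w b)) \<in> mspan n G" by (intro mspan.step) auto
  then show ?case by (simp add: add.assoc)
qed simp

lemma mspan_scale: "v \<in> mspan n G \<Longrightarrow> q \<in> polys n \<Longrightarrow> (\<lambda>b. q * v b) \<in> mspan n G"
proof (induction rule: mspan.induct)
  case (step v p g)
  then have "(\<lambda>b. (q * p) * g b + q * v b) \<in> mspan n G" by (intro mspan.step) auto
  then show ?case by (simp add: distrib_left mult.assoc)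
qed (simp add: mspan.zero)

lemma mspan_base: "g \<in> G \<Longrightarrow> g \<in> mspan n G"
  using mspan.step[OF mspan.zero polys_1, of g G] by simp

lemma mspan_least: "submod n r N \<Longrightarrow> G \<subseteq> N \<Longrightarrow> mspan n G \<subseteq> N"
proof
  fix v assume N: "submod n r N" "G \<subseteq> N" and "v \<in> mspan n G"
  from this(3) show "v \<in> N"
  proof (induction rule: mspan.induct)
    case (step v p g)
    then show ?case using submodD(3,4)[OF N(1)] N(2) by blast
  qed (use submodD(2)[OF N(1)] in simp)
qed

lemma submod_mspan: "G \<subseteq> free_mod n r \<Longrightarrow> submod n r (mspan n G)"
  using mspan_least[OF submod_free_mod, of G n r] mspan.zero mspan_add mspan_scale
  by (subst submod_def) blast

lemma submod_image_mat_map: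
  fixes M :: "nat \<Rightarrow> nat \<Rightarrow> 'k::field mpoly"
  assumes "\<And>a. a < s \<Longrightarrow> M a \<in> free_mod n r"
  shows "submod n r (mat_map s r M ` free_mod n s)"
  unfolding submod_def
proof (intro conjI ballI)
  show "mat_map s r M ` free_mod n s \<subseteq> free_mod n r"
    using mat_map_in_submod[where M = M, OF submod_free_mod assms] by blast
  show "(\<lambda>_. 0) \<in> mat_map s r M ` free_mod n s"
    using submodD(2)[OF submod_free_mod] by (intro image_eqI[of _ _ "\<lambda>_. 0"]) (auto simp: mat_map_def)
next
  fix v w assume "v \<in> mat_map s r M ` free_mod n s" "w \<in> mat_map s r M ` free_mod n s"
  then obtain v' w' where "v' \<in> free_mod n s" "v = mat_map s r M v'" "w' \<in> free_mod n s" "w = mat_map s r M w'"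
    by blast
  then show "(\<lambda>b. v b + w b) \<in> mat_map s r M ` free_mod n s"
    using submodD(3)[OF submod_free_mod, of v' n s w'] mat_map_add[of s r M v' w']
    by (intro image_eqI[of _ _ "\<lambda>b. v' b + w' b"]) simp_all
next
  fix p :: "'k mpoly" and v assume p: "p \<in> polys n" and "v \<in> mat_map s r M ` free_mod n s"
  then obtain v' where "v' \<in> free_mod n s" "v = mat_map s r M v'" by blast
  then show "(\<lambda>b. p * v b) \<in> mat_map s r M ` free_mod n s"
    using submodD(4)[OF submod_free_mod p, of v' s] mat_map_scale[of s r M p v']
    by (intro image_eqI[of _ _ "\<lambda>b. p * v' b"]) simp_all
qed

lemma submod_kernel: "submod n s {v \<in> free_mod n s. mat_map s r M v = (\<lambda>_. 0)}"
proof -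
  have "mat_map s r M (\<lambda>_. 0) = (\<lambda>_. 0)" by (auto simp: mat_map_def)
  then show ?thesis
    using submod_free_mod[of n s] by (simp add: submod_def mat_map_add mat_map_scale) blast
qed

definition graded_submod :: "nat \<Rightarrow> int list \<Rightarrow> (nat \<Rightarrow> 'k::field mpoly) set \<Rightarrow> bool" where
  "graded_submod n ds N \<longleftrightarrow> submod n (length ds) N \<and> (\<forall>v\<in>N. \<forall>d. vcomp ds d v \<in> N) \<and>
     (\<forall>v\<in>N. \<forall>b. v b \<in> graded_max_ideal n)"

lemma vcomp_sum:
  assumes v: "v \<in> free_mod n (length ds)"
  shows "v = (\<lambda>b. \<Sum>d\<in>(\<Union>b<length ds. (\<lambda>m. int (monom_degree m) + ds ! b) ` Poly_Mapping.keys (v b)). vcomp ds d v b)"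
proof
  fix b
  let ?D = "\<Union>b<length ds. (\<lambda>m. int (monom_degree m) + ds ! b) ` Poly_Mapping.keys (v b)"
  show "v b = (\<Sum>d\<in>?D. vcomp ds d v b)"
  proof (cases "b < length ds")
    case True
    show ?thesis
    proof (rule poly_mapping_eqI)
      fix m
      have "Poly_Mapping.lookup (\<Sum>d\<in>?D. vcomp ds d v b) m =
          (\<Sum>d\<in>?D. if d = int (monom_degree m) + ds ! b then Poly_Mapping.lookup (v b) m else 0)"
        unfolding lookup_sum using True by (intro sum.cong refl) (auto simp: vcomp_def lookup_hcomp)
      also have "\<dots> = (if int (monom_degree m) + ds ! b \<in> ?D then Poly_Mapping.lookup (v b) m else 0)"
        by (rule sum.delta) simp
      also have "\<dots> = Poly_Mapping.lookup (v b) m"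
      proof (cases "m \<in> Poly_Mapping.keys (v b)")
        case True
        then have "int (monom_degree m) + ds ! b \<in> ?D" using \<open>b < length ds\<close> by blast
        then show ?thesis by (rule if_P)
      next
        case False
        then show ?thesis by (simp add: in_keys_iff)
      qed
      finally show "Poly_Mapping.lookup (v b) m = Poly_Mapping.lookup (\<Sum>d\<in>?D. vcomp ds d v b) m" ..
    qed
  next
    case False
    then show ?thesis using v by (simp add: vcomp_def free_mod_def)
  qed
qed

lemma homogeneous_generators:
  fixes N :: "(nat \<Rightarrow> 'k::field mpoly) set"
  assumes N: "graded_submod n ds N"
  shows "\<exists>H. finite H \<and> (\<forall>(d, w)\<in>H. w \<in> N \<and> w \<in> free_piece n ds d) \<and> N = mspan n (snd ` H)"
proof -
  have sub: "submod n (length ds) N" using N by (simp add: graded_submod_def)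
  obtain s M where M: "\<And>k. k < s \<Longrightarrow> M k \<in> N" "N = mat_map s (length ds) M ` free_mod n s"
    using submod_finitely_generated[OF sub] by blast
  define D where "D = (\<lambda>k. \<Union>b<length ds. (\<lambda>m. int (monom_degree m) + ds ! b) ` Poly_Mapping.keys (M k b))"
  define H where "H = (\<Union>k<s. (\<lambda>d. (d, vcomp ds d (M k))) ` D k)"
  have finH: "finite H" by (auto simp: H_def D_def)
  have free: "M k \<in> free_mod n (length ds)" if "k < s" for k using M(1)[OF that] submodD(1)[OF sub] by blast
  have H: "w \<in> N \<and> w \<in> free_piece n ds d" if dw: "(d, w) \<in> H" for d w
  proof -
    obtain k where k: "k < s" "w = vcomp ds d (M k)" using dw by (auto simp: H_def)
    then show ?thesis using N M(1)[OF k(1)] vcomp_in_free_piece[OF free[OF k(1)]] by (simp add: graded_submod_def)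
  qed
  then have HN: "snd ` H \<subseteq> N" by auto
  then have subm: "submod n (length ds) (mspan n (snd ` H))"
    using submodD(1)[OF sub] by (intro submod_mspan) blast
  have "M k \<in> mspan n (snd ` H)" if k: "k < s" for k
  proof -
    have "vcomp ds d (M k) \<in> mspan n (snd ` H)" if "d \<in> D k" for d
      using that k by (intro mspan_base) (force simp: H_def)
    then have "(\<lambda>b. \<Sum>d\<in>D k. vcomp ds d (M k) b) \<in> mspan n (snd ` H)" by (rule submod_sum[OF subm])
    then show ?thesis using vcomp_sum[OF free[OF k]] by (simp add: D_def)
  qed
  then have "N \<subseteq> mspan n (snd ` H)" unfolding M(2) using mat_map_in_submod[OF subm] by blast
  then have "N = mspan n (snd ` H)" using mspan_least[OF sub HN] by blast
  then show ?thesis using finH H by blast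
qed

lemma hcomp_degree_0: "hcomp 0 p = const (Poly_Mapping.lookup p 0)"
proof (rule poly_mapping_eqI)
  fix m
  have "monom_degree m = 0 \<longleftrightarrow> m = 0"
    by (auto simp: monom_degree_def in_keys_iff poly_mapping_eq_iff fun_eq_iff)
  then show "Poly_Mapping.lookup (hcomp 0 p) m = Poly_Mapping.lookup (const (Poly_Mapping.lookup p 0)) m"
    by (auto simp: lookup_hcomp const_def lookup_single when_def)
qed

text \<open>A generating set of least cardinality is minimal in the graded sense: a relation with a unit
  coefficient would express one generator by the others.\<close>

lemma minimal_presentation:
  fixes N :: "(nat \<Rightarrow> 'k::field mpoly) set"
  assumes N: "graded_submod n ds N"
  shows "\<exists>ds' M. (\<forall>a<length ds'. M a \<in> N \<and> M a \<in> free_piece n ds (ds' ! a)) \<and>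
    N = mat_map (length ds') (length ds) M ` free_mod n (length ds') \<and>
    graded_submod n ds' {v \<in> free_mod n (length ds'). mat_map (length ds') (length ds) M v = (\<lambda>_. 0)}"
proof -
  have sub: "submod n (length ds) N" using N by (simp add: graded_submod_def)
  define gens where "gens = (\<lambda>H. finite H \<and> (\<forall>(d, w)\<in>H. w \<in> N \<and> w \<in> free_piece n ds d) \<and> N = mspan n (snd ` H))"
  from homogeneous_generators[OF N] obtain H0 where "gens H0" unfolding gens_def ..
  from ex_has_least_nat[of gens, OF this, of card] obtain H where
    H: "gens H" and least: "\<And>H'. gens H' \<Longrightarrow> card H \<le> card H'" by blast
  obtain xs where xs: "set xs = H" "distinct xs" using H finite_distinct_list unfolding gens_def by blast
  define ds' where "ds' = map fst xs"
  define M where "M = (\<lambda>a. snd (xs ! a))"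
  have len: "length ds' = length xs" by (simp add: ds'_def)
  have M: "M a \<in> N" "M a \<in> free_piece n ds (ds' ! a)" if a: "a < length ds'" for a
  proof -
    have mem: "xs ! a \<in> H" using xs a len nth_mem by metis
    have ball: "\<forall>(d, w)\<in>H. w \<in> N \<and> w \<in> free_piece n ds d" using H unfolding gens_def by blast
    from bspec[OF ball mem] show "M a \<in> N" "M a \<in> free_piece n ds (ds' ! a)"
      using a by (simp_all add: M_def ds'_def case_prod_beta)
  qed
  have Mfree: "M a \<in> free_mod n (length ds)" if "a < length ds'" for a
    using M(2)[OF that] by (simp add: free_piece_def)
  let ?f = "mat_map (length ds') (length ds) M"
  let ?K = "{v \<in> free_mod n (length ds'). ?f v = (\<lambda>_. 0)}"
  have "N = ?f ` free_mod n (length ds')"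
  proof
    show "?f ` free_mod n (length ds') \<subseteq> N" using mat_map_in_submod[where M = M, OF sub M(1)] by blast
    have "w \<in> ?f ` free_mod n (length ds')" if wH: "w \<in> snd ` H" for w
    proof -
      obtain a where a: "a < length ds'" "w = M a"
        using wH xs(1) len by (auto simp: M_def in_set_conv_nth)
      let ?u = "\<lambda>b. if b = a then 1 else 0 :: 'k mpoly"
      have "?f ?u = M a"
      proof
        fix b
        have "(\<Sum>k<length ds'. ?u k * M k b) = (\<Sum>k<length ds'. if k = a then M a b else 0)"
          by (intro sum.cong) auto
        then show "?f ?u b = M a b" using a Mfree[OF a(1)] by (simp add: mat_map_def free_mod_def)
      qed
      moreover have "?u \<in> free_mod n (length ds')" using a by (auto simp: free_mod_def)
      ultimately show ?thesis using a(2) by (intro image_eqI[of _ _ ?u]) auto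
    qed
    then have "mspan n (snd ` H) \<subseteq> ?f ` free_mod n (length ds')"
      by (intro mspan_least[OF submod_image_mat_map[OF Mfree]]) blast+
    then show "N \<subseteq> ?f ` free_mod n (length ds')" using H by (simp add: gens_def)
  qed
  moreover have "graded_submod n ds' ?K"
    unfolding graded_submod_def
  proof (intro conjI ballI allI)
    show "submod n (length ds') ?K" by (rule submod_kernel)
    show comp: "vcomp ds' d v \<in> ?K" if "v \<in> ?K" for v d
    proof -
      have "vcomp ds d (\<lambda>_. 0) = (\<lambda>_. 0)" by (auto simp: vcomp_def)
      then show ?thesis
        using that vcomp_in_free_piece[of v n ds' d] vcomp_mat_map[of ds' M n ds d v, OF M(2)]
        by (simp add: free_piece_def)
    qed
    fix v b assume v: "v \<in> ?K"
    show "v b \<in> graded_max_ideal n"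
    proof (rule ccontr)
      assume nm: "v b \<notin> graded_max_ideal n"
      have vb: "v b \<in> polys n" using v by (auto simp: free_mod_def) (metis not_le polys_0)
      define c where "c = Poly_Mapping.lookup (v b) 0"
      have c: "c \<noteq> 0" using nm vb by (simp add: graded_max_ideal_def c_def)
      then have b: "b < length ds'" using v unfolding c_def by (auto simp: free_mod_def not_le[symmetric])
      define w where "w = vcomp ds' (ds' ! b) v"
      have w: "w \<in> ?K" unfolding w_def by (rule comp[OF v])
      have wb: "w b = const c" using b by (simp add: w_def vcomp_def hcomp_degree_0 c_def)
      let ?H' = "H - {xs ! b}"
      have HN: "snd ` ?H' \<subseteq> N" using H by (auto simp: gens_def)
      then have subm: "submod n (length ds) (mspan n (snd ` ?H'))"
        using submodD(1)[OF sub] by (intro submod_mspan) blast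
      have "M b = (\<lambda>x. \<Sum>a\<in>{..<length ds'} - {b}. (- const (1 / c) * w a) * M a x)"
      proof
        fix x
        have "(\<Sum>a<length ds'. w a * M a x) = 0"
        proof (cases "x < length ds")
          case True
          then show ?thesis using w by (auto simp: mat_map_def dest: fun_cong[of _ _ x])
        next
          case False
          then show ?thesis using Mfree by (intro sum.neutral) (auto simp: free_mod_def)
        qed
        then have "const c * M b x + (\<Sum>a\<in>{..<length ds'} - {b}. w a * M a x) = 0"
          using b wb by (simp add: sum.remove[of _ b])
        then have eq: "const c * M b x = - (\<Sum>a\<in>{..<length ds'} - {b}. w a * M a x)"
          by (simp add: eq_neg_iff_add_eq_0)
        have "const (1 / c) * const c = (1 :: 'k mpoly)" using c by (simp add: const_def mult_single)
        then have "M b x = const (1 / c) * (const c * M b x)" by (simp flip: mult.assoc)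
        also have "\<dots> = (\<Sum>a\<in>{..<length ds'} - {b}. (- const (1 / c) * w a) * M a x)"
          unfolding eq by (simp add: sum_distrib_left sum_negf mult.assoc)
        finally show "M b x = (\<Sum>a\<in>{..<length ds'} - {b}. (- const (1 / c) * w a) * M a x)" .
      qed
      also have "\<dots> \<in> mspan n (snd ` ?H')"
      proof (intro submod_sum[OF subm] submodD(4)[OF subm] mspan_base)
        fix a assume a: "a \<in> {..<length ds'} - {b}"
        show "- const (1 / c) * w a \<in> polys n" using w a by (auto simp: free_mod_def)
        have "xs ! a \<in> ?H'" using a b xs len by (auto simp: nth_eq_iff_index_eq)
        then show "M a \<in> snd ` ?H'" by (auto simp: M_def)
      qed
      finally have Mb: "M b \<in> mspan n (snd ` ?H')" .
      have "snd ` H \<subseteq> mspan n (snd ` ?H')"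
      proof
        fix y assume "y \<in> snd ` H"
        then obtain z where z: "z \<in> H" "y = snd z" by blast
        show "y \<in> mspan n (snd ` ?H')"
        proof (cases "z = xs ! b")
          case True
          then show ?thesis using Mb z by (simp add: M_def)
        next
          case False
          then have "y \<in> snd ` ?H'" using z by blast
          then show ?thesis by (rule mspan_base)
        qed
      qed
      then have "N \<subseteq> mspan n (snd ` ?H')" using mspan_least[OF subm] H by (simp add: gens_def)
      then have "N = mspan n (snd ` ?H')" using mspan_least[OF sub HN] by blast
      moreover have "finite ?H'" "\<forall>(d, w)\<in>?H'. w \<in> N \<and> w \<in> free_piece n ds d"
        using H unfolding gens_def by (simp, blast)
      ultimately have "gens ?H'" unfolding gens_def by blast
      moreover have "card ?H' < card H"
        using H[unfolded gens_def] xs(1) b len nth_mem[of b xs] by (intro card_Diff1_less) auto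
      ultimately show False using least by fastforce
    qed
  qed
  ultimately show ?thesis using M by blast
qed

theorem min_graded_free_resolution_exists:
  fixes I :: "'k::field mpoly set"
  assumes I: "poly_ideal n I" "I \<subseteq> graded_max_ideal n" and hom: "\<And>p d. p \<in> I \<Longrightarrow> hcomp d p \<in> I"
  shows "\<exists>ds D. min_graded_free_resolution n I ds D"
proof -
  define N0 where "N0 = {v \<in> free_mod n 1. v 0 \<in> I}"
  define P where "P = (\<lambda>(k::nat) (x :: int list \<times> (nat \<Rightarrow> 'k mpoly) set).
    graded_submod n (fst x) (snd x) \<and> (k = 0 \<longrightarrow> x = ([0], N0)))"
  define Q where "Q = (\<lambda>(k::nat) (x :: int list \<times> (nat \<Rightarrow> 'k mpoly) set) (y :: int list \<times> (nat \<Rightarrow> 'k mpoly) set).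
    \<exists>M. (\<forall>a<length (fst y). M a \<in> snd x \<and> M a \<in> free_piece n (fst x) (fst y ! a)) \<and>
      snd x = mat_map (length (fst y)) (length (fst x)) M ` free_mod n (length (fst y)) \<and>
      snd y = {v \<in> free_mod n (length (fst y)). mat_map (length (fst y)) (length (fst x)) M v = (\<lambda>_. 0)})"
  have "graded_submod n [0] N0"
    unfolding graded_submod_def
  proof (intro conjI ballI allI)
    show "submod n (length [0::int]) N0"
      using poly_idealD(2-4)[OF I(1)] by (auto simp: submod_def N0_def free_mod_def)
    fix v assume v: "v \<in> N0"
    show "vcomp [0] d v \<in> N0" for d
      using v hom by (auto simp: vcomp_def N0_def free_mod_def)
    show "v b \<in> graded_max_ideal n" for b
      using v I(2) poly_idealD(2)[OF poly_ideal_graded_max] by (cases b) (auto simp: N0_def free_mod_def)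
  qed
  then have "P 0 ([0], N0)" by (simp add: P_def)
  then have ex: "\<exists>x. P 0 x" by blast
  have "\<exists>y. P (Suc k) y \<and> Q k x y" if Px: "P k x" for k x
  proof -
    obtain ds' M where "(\<forall>a<length ds'. M a \<in> snd x \<and> M a \<in> free_piece n (fst x) (ds' ! a)) \<and>
      snd x = mat_map (length ds') (length (fst x)) M ` free_mod n (length ds') \<and>
      graded_submod n ds' {v \<in> free_mod n (length ds'). mat_map (length ds') (length (fst x)) M v = (\<lambda>_. 0)}"
      using minimal_presentation[of n "fst x" "snd x"] Px unfolding P_def by blast
    then show ?thesis
      by (intro exI[of _ "(ds', {v \<in> free_mod n (length ds'). mat_map (length ds') (length (fst x)) M v = (\<lambda>_. 0)})"])
        (auto simp: P_def Q_def)
  qed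
  then obtain f where f: "\<And>k. P k (f k)" "\<And>k. Q k (f k) (f (Suc k))"
    using dependent_nat_choice[of P Q, OF ex] by blast
  define ds where "ds = (\<lambda>k. fst (f k))"
  have "\<forall>k. \<exists>M. (\<forall>a<length (ds (Suc k)). M a \<in> snd (f k) \<and> M a \<in> free_piece n (ds k) (ds (Suc k) ! a)) \<and>
      snd (f k) = mat_map (length (ds (Suc k))) (length (ds k)) M ` free_mod n (length (ds (Suc k))) \<and>
      snd (f (Suc k)) = {v \<in> free_mod n (length (ds (Suc k))). mat_map (length (ds (Suc k))) (length (ds k)) M v = (\<lambda>_. 0)}"
    using f(2) unfolding Q_def ds_def by blast
  from choice[OF this] obtain D where D0: "\<forall>k. (\<forall>a<length (ds (Suc k)). D k a \<in> snd (f k) \<and> D k a \<in> free_piece n (ds k) (ds (Suc k) ! a)) \<and>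
      snd (f k) = mat_map (length (ds (Suc k))) (length (ds k)) (D k) ` free_mod n (length (ds (Suc k))) \<and>
      snd (f (Suc k)) = {v \<in> free_mod n (length (ds (Suc k))). mat_map (length (ds (Suc k))) (length (ds k)) (D k) v = (\<lambda>_. 0)}" ..
  have D: "\<And>k a. a < length (ds (Suc k)) \<Longrightarrow> D k a \<in> snd (f k) \<and> D k a \<in> free_piece n (ds k) (ds (Suc k) ! a)"
    "\<And>k. snd (f k) = mat_map (length (ds (Suc k))) (length (ds k)) (D k) ` free_mod n (length (ds (Suc k)))"
    "\<And>k. snd (f (Suc k)) = {v \<in> free_mod n (length (ds (Suc k))). mat_map (length (ds (Suc k))) (length (ds k)) (D k) v = (\<lambda>_. 0)}"
    using D0[THEN spec] by blast+
  have f0: "f 0 = ([0], N0)" using f(1)[of 0] by (simp add: P_def)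
  have "min_graded_free_resolution n I ds D"
    unfolding min_graded_free_resolution_def
  proof (intro conjI allI impI)
    show ds0: "ds 0 = [0]" using f0 by (simp add: ds_def)
    show "D i a b \<in> hom_part n (ds (Suc i) ! a - ds i ! b)" if "a < length (ds (Suc i))" "b < length (ds i)" for i a b
      using D(1)[OF that(1)] that(2) by (simp add: free_piece_def)
    show "D i a b \<in> graded_max_ideal n" if "a < length (ds (Suc i))" for i a b
      using D(1)[OF that] f(1)[of i] by (simp add: P_def graded_submod_def)
    show "mat_map (length (ds 1)) 1 (D 0) ` free_mod n (length (ds 1)) = {v \<in> free_mod n 1. v 0 \<in> I}"
      using D(2)[of 0] f0 ds0 by (simp add: N0_def)
    show "mat_map (length (ds (i + 2))) (length (ds (i + 1))) (D (i + 1)) ` free_mod n (length (ds (i + 2)))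
        = {v \<in> free_mod n (length (ds (i + 1))). mat_map (length (ds (i + 1))) (length (ds i)) (D i) v = (\<lambda>_. 0)}" for i
      using D(2)[of "Suc i"] D(3)[of i] by simp
  qed
  then show ?thesis by blast
qed

section \<open>Regularity\<close>

lemma finite_edges: "simple_graph {1..n} E \<Longrightarrow> finite E"
  by (rule finite_subset[of E "Pow {1..n}"]) (auto simp: simple_graph_def)

lemma matching_number_props:
  assumes "finite E"
  shows "matching E M \<Longrightarrow> card M \<le> matching_number E" "\<exists>M. matching E M \<and> card M = matching_number E"
proof -
  let ?S = "{card M | M. matching E M}"
  have "?S \<subseteq> card ` Pow E" by (auto simp: matching_def)
  then have fin: "finite ?S" using assms by (meson finite_Pow_iff finite_imageI finite_subset)
  have "matching E {}" by (simp add: matching_def)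
  then have ne: "?S \<noteq> {}" by blast
  show "card M \<le> matching_number E" if "matching E M"
    unfolding matching_number_def by (rule Max_ge[OF fin]) (use that in blast)
  have "matching_number E \<in> ?S" unfolding matching_number_def by (rule Max_in[OF fin ne])
  then show "\<exists>M. matching E M \<and> card M = matching_number E" by auto
qed

lemma induced_matching_number_props:
  assumes "finite E"
  shows "induced_matching E M \<Longrightarrow> card M \<le> induced_matching_number E"
    "\<exists>M. induced_matching E M \<and> card M = induced_matching_number E"
proof -
  let ?S = "{card M | M. induced_matching E M}"
  have "?S \<subseteq> card ` Pow E" by (auto simp: induced_matching_def matching_def)
  then have fin: "finite ?S" using assms by (meson finite_Pow_iff finite_imageI finite_subset)
  have "induced_matching E {}" by (simp add: induced_matching_def matching_def)
  then have ne: "?S \<noteq> {}" by blast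
  show "card M \<le> induced_matching_number E" if "induced_matching E M"
    unfolding induced_matching_number_def by (rule Max_ge[OF fin]) (use that in blast)
  have "induced_matching_number E \<in> ?S" unfolding induced_matching_number_def by (rule Max_in[OF fin ne])
  then show "\<exists>M. induced_matching E M \<and> card M = induced_matching_number E" by auto
qed

context graded_resolution
begin

lemma free_piece_scalar: "v \<in> free_piece n (ds 0) d \<longleftrightarrow> v 0 \<in> hom_part n d \<and> (\<forall>b>0. v b = 0)"
  by (auto simp: free_piece_def free_mod_def ds0 hom_part_def)

lemma syz_scalar: "v \<in> syz 0 \<longleftrightarrow> v 0 \<in> I \<and> (\<forall>b>0. v b = 0)"
  using poly_idealD(1)[OF I] by (auto simp: syz_def free_mod_def ds0)

lemma kexact_edge_iff:
  assumes IE: "I = mono_ideal n (edge_mono E)"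
  shows "kexact 0 p j \<longleftrightarrow> (\<forall>W\<subseteq>{1..n}. int (card W) = j \<longrightarrow> n - card W \<le> p \<longrightarrow>
    acyclic_at TYPE('k) (indeps E W) (p - (n - card W)))"
proof
  assume ex: "kexact 0 p j"
  show "\<forall>W\<subseteq>{1..n}. int (card W) = j \<longrightarrow> n - card W \<le> p \<longrightarrow>
    acyclic_at TYPE('k) (indeps E W) (p - (n - card W))"
  proof (intro allI impI, rule ccontr)
    fix W assume W: "W \<subseteq> {1..n}" "int (card W) = j" "n - card W \<le> p"
      and na: "\<not> acyclic_at TYPE('k) (indeps E W) (p - (n - card W))"
    have "p = p - (n - card W) + (n - card W)" using W(3) by simp
    from koszul_not_exact_edge[OF W(1) na this] obtain c :: "nat set \<Rightarrow> 'k mpoly" where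
      c: "\<forall>T\<subseteq>{1..n}. c T \<in> hom_part n (int (card W) - int (n - card T))"
      "\<forall>T\<subseteq>{1..n}. card T = Suc p \<longrightarrow> cobd var c T \<in> mono_ideal n (edge_mono E)"
      "\<not> (\<exists>b. (\<forall>T\<subseteq>{1..n}. b T \<in> polys n) \<and>
         (\<forall>T\<subseteq>{1..n}. card T = p \<longrightarrow> c T - cobd var b T \<in> mono_ideal n (edge_mono E)))" by blast
    define c' where "c' = (\<lambda>T b. if b = (0::nat) then c T else 0)"
    have c': "c' T \<in> free_piece n (ds 0) (j - int (n - card T))" if "T \<subseteq> {1..n}" for T
      using c(1) that W(2) by (simp add: free_piece_scalar c'_def)
    have v0: "vcobd c' T 0 = cobd var c T" "\<forall>b>0. vcobd c' T b = 0" for T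
      by (auto simp: vcobd_def c'_def cobd_def)
    have cc: "vcobd c' T \<in> syz 0" if "T \<subseteq> {1..n}" "card T = Suc p" for T
      unfolding syz_scalar using c(2) that v0 IE by simp
    from kexactD[OF ex c' cc] obtain e where
      "(\<forall>T\<subseteq>{1..n}. e T \<in> free_piece n (ds 0) (j - int (n - card T))) \<and>
       (\<forall>T\<subseteq>{1..n}. card T = p \<longrightarrow> (\<lambda>b. c' T b - vcobd e T b) \<in> syz 0)" ..
    then have be: "\<forall>T\<subseteq>{1..n}. e T 0 \<in> polys n"
      "\<forall>T\<subseteq>{1..n}. card T = p \<longrightarrow> c T - cobd var (\<lambda>S. e S 0) T \<in> mono_ideal n (edge_mono E)"
      unfolding syz_scalar by (auto simp: free_piece_scalar hom_part_def IE c'_def vcobd_def)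
    show False by (rule notE[OF c(3)], rule exI[of _ "\<lambda>S. e S 0"]) (rule conjI[OF be])
  qed
next
  assume ac: "\<forall>W\<subseteq>{1..n}. int (card W) = j \<longrightarrow> n - card W \<le> p \<longrightarrow>
    acyclic_at TYPE('k) (indeps E W) (p - (n - card W))"
  show "kexact 0 p j"
    unfolding kexact_def
  proof (intro allI impI)
    fix c assume c: "\<forall>T\<subseteq>{1..n}. c T \<in> free_piece n (ds 0) (j - int (n - card T))"
      and cocycle: "\<forall>T\<subseteq>{1..n}. card T = Suc p \<longrightarrow> vcobd c T \<in> syz 0"
    have c0: "c T 0 \<in> hom_part n (j - int (n - card T))" "\<And>b. b > 0 \<Longrightarrow> c T b = 0" if "T \<subseteq> {1..n}" for T
      using c that by (auto simp: free_piece_scalar)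
    have "\<exists>b. (\<forall>T\<subseteq>{1..n}. b T \<in> polys n \<and>
        (\<forall>m\<in>Poly_Mapping.keys (b T). int (monom_degree (m + sqfree ({1..n} - T))) = j)) \<and>
      (\<forall>T\<subseteq>{1..n}. card T = p \<longrightarrow> c T 0 - cobd var b T \<in> mono_ideal n (edge_mono E))"
    proof (rule koszul_exact_edge[where Q = "\<lambda>u. int (monom_degree u) = j"])
      show "c T 0 \<in> polys n" if "T \<subseteq> {1..n}" for T using c0[OF that] by (simp add: hom_part_def)
      show "cobd var (\<lambda>T. c T 0) T \<in> mono_ideal n (edge_mono E)" if "T \<subseteq> {1..n}" "card T = Suc p" for T
      proof -
        have "vcobd c T \<in> syz 0" using cocycle that by simp
        then have "vcobd c T 0 \<in> I" unfolding syz_scalar ..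
        then show ?thesis by (simp add: IE vcobd_def)
      qed
      show "int (monom_degree (m + sqfree ({1..n} - T))) = j"
        if "T \<subseteq> {1..n}" "card T = p" "m \<in> Poly_Mapping.keys (c T 0)" for T m
        using c0(1)[OF that(1)] that hom_part_iff_total_degree by blast
      show "acyclic_at TYPE('k) (indeps E W) (p - (n - card W))"
        if "W \<subseteq> {1..n}" "int (monom_degree (sqfree W)) = j" "n - card W \<le> p" for W
        using ac that finite_subset_ivl[OF that(1)] by simp
    qed
    then obtain b where b: "\<forall>T\<subseteq>{1..n}. b T \<in> polys n \<and>
        (\<forall>m\<in>Poly_Mapping.keys (b T). int (monom_degree (m + sqfree ({1..n} - T))) = j)"
      "\<forall>T\<subseteq>{1..n}. card T = p \<longrightarrow> c T 0 - cobd var b T \<in> mono_ideal n (edge_mono E)" by blast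
    define e where "e = (\<lambda>T b'. if b' = (0::nat) then b T else 0)"
    have "e T \<in> free_piece n (ds 0) (j - int (n - card T))" if "T \<subseteq> {1..n}" for T
    proof -
      have "b T \<in> hom_part n (j - int (n - card T))"
        unfolding hom_part_iff_total_degree[OF that] using b(1) that by blast
      then show ?thesis by (simp add: free_piece_scalar e_def)
    qed
    moreover have "vcobd e T 0 = cobd var b T" "\<forall>b'>0. vcobd e T b' = 0" for T
      by (auto simp: vcobd_def e_def cobd_def)
    then have "(\<lambda>b. c T b - vcobd e T b) \<in> syz 0" if "T \<subseteq> {1..n}" "card T = p" for T
      unfolding syz_scalar using b(2) that c0(2)[OF that(1)] IE by simp
    ultimately show "\<exists>e. (\<forall>T\<subseteq>{1..n}. e T \<in> free_piece n (ds 0) (j - int (n - card T))) \<and>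
             (\<forall>T\<subseteq>{1..n}. card T = p \<longrightarrow> (\<lambda>b. c T b - vcobd e T b) \<in> syz 0)"
      by blast
  qed
qed

end

lemma not_acyclic_at_card_le:
  assumes "W \<subseteq> {1..n}" "\<not> acyclic_at TYPE('k::field) (indeps E W) k"
  shows "k \<le> card W"
proof -
  have "\<exists>F\<in>indeps E W. card F = k" using assms(2) by (auto simp: acyclic_at_def)
  then show ?thesis using card_mono[OF finite_subset_ivl[OF assms(1)]] by (auto simp: indeps_def)
qed

text \<open>Hochster's formula, in the form of a criterion for a Betti number to be nonzero.\<close>

theorem betti_edge_ideal:
  assumes n: "0 < n" and E: "simple_graph {1..n} E"
  shows "betti n (edge_ideal n E :: 'k::field mpoly set) i j \<noteq> 0 \<longleftrightarrow>
    (\<exists>W\<subseteq>{1..n}. int (card W) = j \<and> i \<le> card W \<and> \<not> acyclic_at TYPE('k) (indeps E W) (card W - i))"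
proof -
  let ?I = "mono_ideal n (edge_mono E) :: 'k mpoly set"
  have E2: "\<forall>e\<in>E. card e = 2" using E by (simp add: simple_graph_def)
  have Imax: "?I \<subseteq> graded_max_ideal n"
  proof
    fix p :: "'k mpoly" assume p: "p \<in> ?I"
    have "\<not> edge_mono E 0" using E2 by (auto simp: edge_mono_def)
    then show "p \<in> graded_max_ideal n" using p by (auto simp: graded_max_ideal_def mono_ideal_def in_keys_iff)
  qed
  have "hcomp d p \<in> ?I" if "p \<in> ?I" for p d
    using that by (auto simp: mono_ideal_def keys_hcomp)
  then have "\<exists>ds D. min_graded_free_resolution n ?I ds D"
    by (rule min_graded_free_resolution_exists[OF poly_ideal_edge_mono Imax])
  then have "\<exists>D. min_graded_free_resolution n ?I (SOME ds. \<exists>D. min_graded_free_resolution n ?I ds D) D"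
    by (rule someI_ex)
  then obtain ds D where ds: "ds = (SOME ds. \<exists>D. min_graded_free_resolution n ?I ds D)"
    "min_graded_free_resolution n ?I ds D" by blast
  interpret graded_resolution n ?I ds D
    by unfold_locales (use n Imax ds poly_ideal_edge_mono in auto)
  have card_le: "card W \<le> n" if "W \<subseteq> {1..n}" for W using card_mono[OF _ that] by simp
  have "betti n (edge_ideal n E :: 'k mpoly set) i j \<noteq> 0 \<longleftrightarrow> j \<in> set (ds i)"
    by (simp add: betti_def edge_ideal_eq[OF E] count_list_0_iff flip: ds(1))
  also have "\<dots> \<longleftrightarrow> i \<le> n \<and> (\<exists>W\<subseteq>{1..n}. int (card W) = j \<and> n - card W \<le> n - i \<and>
      \<not> acyclic_at TYPE('k) (indeps E W) (n - i - (n - card W)))"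
    unfolding generator_degree_iff kexact_edge_iff[OF refl] by blast
  also have "\<dots> \<longleftrightarrow> (\<exists>W\<subseteq>{1..n}. int (card W) = j \<and> i \<le> card W \<and> \<not> acyclic_at TYPE('k) (indeps E W) (card W - i))"
  proof -
    have "i \<le> n \<and> n - card W \<le> n - i \<longleftrightarrow> i \<le> card W" "i \<le> card W \<Longrightarrow> n - i - (n - card W) = card W - i"
      if "W \<subseteq> {1..n}" for W using card_le[OF that] by auto
    then show ?thesis by metis
  qed
  finally show ?thesis .
qed

text \<open>By Hochster's formula, \<open>j - i\<close> is the degree of a nonvanishing cohomology group of an induced subcomplex. It
is at most the matching number by \<open>cohomology_degree_le_matching\<close>, and an induced matching of that size
attains it.\<close>

theorem reg_edge_ideal:
  assumes n: "0 < n" and E: "simple_graph {1..n} E"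
    and im: "induced_matching_number E = matching_number E"
  shows "quot_reg n (edge_ideal n E :: 'k::field mpoly set) = int (matching_number E)"
proof -
  let ?I = "edge_ideal n E :: 'k mpoly set"
  have E2: "\<forall>e\<in>E. card e = 2" using E by (simp add: simple_graph_def)
  note fin = finite_edges[OF E]
  define K where "K = {k. \<exists>W\<subseteq>{1..n}. \<not> acyclic_at TYPE('k) (indeps E W) k}"
  have "{j - int i | i j. betti n ?I i j \<noteq> 0} = int ` K"
  proof (intro subset_antisym subsetI)
    fix x assume "x \<in> {j - int i | i j. betti n ?I i j \<noteq> 0}"
    then obtain i j W where "x = j - int i" "W \<subseteq> {1..n}" "int (card W) = j" "i \<le> card W"
      "\<not> acyclic_at TYPE('k) (indeps E W) (card W - i)"
      unfolding betti_edge_ideal[OF n E] by blast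
    then have "x = int (card W - i)" "card W - i \<in> K" by (auto simp: K_def of_nat_diff)
    then show "x \<in> int ` K" by blast
  next
    fix x assume "x \<in> int ` K"
    then obtain k W where k: "x = int k" "W \<subseteq> {1..n}" "\<not> acyclic_at TYPE('k) (indeps E W) k"
      unfolding K_def by blast
    have le: "k \<le> card W" by (rule not_acyclic_at_card_le[OF k(2,3)])
    then have "betti n ?I (card W - k) (int (card W)) \<noteq> 0"
      unfolding betti_edge_ideal[OF n E] using k by (intro exI[of _ W]) simp
    moreover have "x = int (card W) - int (card W - k)" using le k(1) by (simp add: of_nat_diff)
    ultimately show "x \<in> {j - int i | i j. betti n ?I i j \<noteq> 0}" by blast
  qed
  moreover have "k \<le> matching_number E" if "k \<in> K" for k
  proof -
    obtain W where W: "W \<subseteq> {1..n}" "\<not> acyclic_at TYPE('k) (indeps E W) k" using \<open>k \<in> K\<close> by (auto simp: K_def)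
    obtain M where "matching E M" "k \<le> card M"
      using cohomology_degree_le_matching[OF E2 finite_subset_ivl[OF W(1)] W(2)] by blast
    then show ?thesis using matching_number_props(1)[OF fin] by force
  qed
  moreover have "matching_number E \<in> K"
  proof -
    obtain M where M: "induced_matching E M" "card M = matching_number E"
      using induced_matching_number_props(2)[OF fin] im by auto
    have ME: "M \<subseteq> E" using M(1) by (simp add: induced_matching_def matching_def)
    then have "finite M" "\<Union>M \<subseteq> {1..n}"
      using fin finite_subset E by (auto simp: simple_graph_def)
    then show ?thesis
      using induced_matching_not_acyclic[OF E2 _ M(1), where ?'a = 'k] M(2) by (auto simp: K_def)
  qed
  ultimately have "Max (int ` K) = int (matching_number E)"
    by (intro Max_eqI finite_imageI) (auto intro: finite_subset[of K "{..matching_number E}"])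
  then show ?thesis unfolding quot_reg_def using \<open>_ = int ` K\<close> by simp
qed

section \<open>Krull dimension\<close>

subsection \<open>Algebraic dependence\<close>

text \<open>More unknowns than equations.\<close>

lemma homogeneous_system_solution:
  fixes M :: "'t \<Rightarrow> 's \<Rightarrow> 'k::field"
  assumes "finite S" "finite T" "card S < card T"
  shows "\<exists>c. (\<exists>t\<in>T. c t \<noteq> 0) \<and> (\<forall>s\<in>S. (\<Sum>t\<in>T. c t * M t s) = 0)"
  using assms
proof (induction S arbitrary: T M rule: finite_induct)
  case empty
  then obtain t where "t \<in> T" by fastforce
  then show ?case by (intro exI[of _ "\<lambda>_. 1"]) auto
next
  case (insert s S)
  show ?case
  proof (cases "\<forall>t\<in>T. M t s = 0")
    case True
    have "card S < card T" using insert.prems insert.hyps by simp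
    then obtain c where "\<exists>t\<in>T. c t \<noteq> 0" "\<forall>s\<in>S. (\<Sum>t\<in>T. c t * M t s) = 0"
      using insert.IH[OF insert.prems(1), of M] by blast
    then show ?thesis using True by (intro exI[of _ c]) simp
  next
    case False
    then obtain t0 where t0: "t0 \<in> T" "M t0 s \<noteq> 0" by blast
    define T' where "T' = T - {t0}"
    have T': "finite T'" "card S < card T'" "T = insert t0 T'" "t0 \<notin> T'"
      using insert.prems insert.hyps t0 by (auto simp: T'_def)
    from insert.IH[OF T'(1,2), of "\<lambda>t x. M t x - M t s / M t0 s * M t0 x"] obtain c where
      c: "\<exists>t\<in>T'. c t \<noteq> 0" "\<forall>x\<in>S. (\<Sum>t\<in>T'. c t * (M t x - M t s / M t0 s * M t0 x)) = 0" by blast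
    define d where "d = (\<lambda>t. if t = t0 then - (\<Sum>t\<in>T'. c t * (M t s / M t0 s)) else c t)"
    have sum_d: "(\<Sum>t\<in>T. d t * M t x) = (\<Sum>t\<in>T'. c t * (M t x - M t s / M t0 s * M t0 x))" for x
    proof -
      have "(\<Sum>t\<in>T'. d t * M t x) = (\<Sum>t\<in>T'. c t * M t x)"
        using T'(4) by (intro sum.cong) (auto simp: d_def)
      then have "(\<Sum>t\<in>T. d t * M t x) = d t0 * M t0 x + (\<Sum>t\<in>T'. c t * M t x)"
        using T' by simp
      then show ?thesis by (simp add: d_def right_diff_distrib sum_subtractf sum_distrib_right mult.assoc)
    qed
    have "(\<Sum>t\<in>T. d t * M t s) = 0" unfolding sum_d using t0 by simp
    moreover have "\<forall>x\<in>S. (\<Sum>t\<in>T. d t * M t x) = 0" unfolding sum_d by (rule c(2))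
    moreover have "\<exists>t\<in>T. d t \<noteq> 0" using c(1) T' by (auto simp: d_def)
    ultimately show ?thesis by (intro exI[of _ d]) simp
  qed
qed

fun list_power :: "'a::comm_ring_1 list \<Rightarrow> nat list \<Rightarrow> 'a" where
  "list_power (f # fs) (e # es) = f ^ e * list_power fs es"
| "list_power _ _ = 1"

definition exponents_le :: "nat set \<Rightarrow> nat \<Rightarrow> 'k::field mpoly \<Rightarrow> bool" where
  "exponents_le A B p \<longleftrightarrow> (\<forall>m\<in>Poly_Mapping.keys p. Poly_Mapping.keys m \<subseteq> A \<and> (\<forall>k. Poly_Mapping.lookup m k \<le> B))"

lemma exponents_le_mono: "exponents_le A B p \<Longrightarrow> B \<le> C \<Longrightarrow> exponents_le A C p"
  unfolding exponents_le_def by (meson order_trans)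

lemma exponents_le_1: "exponents_le A 0 1"
  by (auto simp: exponents_le_def)

lemma exponents_le_mult:
  assumes "exponents_le A B p" "exponents_le A C q"
  shows "exponents_le A (B + C) (p * q)"
  unfolding exponents_le_def
proof (intro ballI)
  fix m assume "m \<in> Poly_Mapping.keys (p * q)"
  then obtain a b where "m = a + b" "a \<in> Poly_Mapping.keys p" "b \<in> Poly_Mapping.keys q"
    using keys_mult[of p q] by blast
  then show "Poly_Mapping.keys m \<subseteq> A \<and> (\<forall>k. Poly_Mapping.lookup m k \<le> B + C)"
    using assms by (auto simp: exponents_le_def keys_add_nat lookup_add intro: add_mono)
qed

lemma exponents_le_power: "exponents_le A B p \<Longrightarrow> exponents_le A (e * B) (p ^ e)"
  by (induction e) (simp_all add: exponents_le_1 exponents_le_mult)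

lemma exponents_le_list_power:
  assumes "\<forall>f\<in>set fs. exponents_le A B f" "length es = length fs" "set es \<subseteq> {..N}"
  shows "exponents_le A (length fs * N * B) (list_power fs es)"
  using assms
proof (induction fs es rule: list_power.induct)
  case (1 f fs e es)
  have "exponents_le A (e * B + length fs * N * B) (f ^ e * list_power fs es)"
    using 1 by (intro exponents_le_mult exponents_le_power) auto
  moreover have "e * B \<le> N * B" using 1 by (intro mult_right_mono) auto
  then have "e * B + length fs * N * B \<le> length (f # fs) * N * B" by (simp add: algebra_simps)
  ultimately show ?case by (simp add: exponents_le_mono)
qed (auto simp: exponents_le_1 intro: exponents_le_mono[OF exponents_le_1])

lemma card_bounded_monomials:
  assumes "finite A"
  shows "finite {m :: nat \<Rightarrow>\<^sub>0 nat. Poly_Mapping.keys m \<subseteq> A \<and> (\<forall>k. Poly_Mapping.lookup m k \<le> L)}"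
    "card {m :: nat \<Rightarrow>\<^sub>0 nat. Poly_Mapping.keys m \<subseteq> A \<and> (\<forall>k. Poly_Mapping.lookup m k \<le> L)} \<le> (L + 1) ^ card A"
proof -
  let ?M = "{m :: nat \<Rightarrow>\<^sub>0 nat. Poly_Mapping.keys m \<subseteq> A \<and> (\<forall>k. Poly_Mapping.lookup m k \<le> L)}"
  let ?f = "\<lambda>m. restrict (Poly_Mapping.lookup m) A"
  have inj: "inj_on ?f ?M"
  proof (rule inj_onI)
    fix m m' assume m: "m \<in> ?M" "m' \<in> ?M" "?f m = ?f m'"
    show "m = m'"
    proof (rule poly_mapping_eqI)
      fix k
      show "Poly_Mapping.lookup m k = Poly_Mapping.lookup m' k"
      proof (cases "k \<in> A")
        case True
        then show ?thesis using fun_cong[OF m(3), of k] by simp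
      next
        case False
        then have "k \<notin> Poly_Mapping.keys m" "k \<notin> Poly_Mapping.keys m'" using m by auto
        then show ?thesis by (simp add: in_keys_iff)
      qed
    qed
  qed
  have sub: "?f ` ?M \<subseteq> Pi\<^sub>E A (\<lambda>_. {..L})" by auto
  have fin: "finite (Pi\<^sub>E A (\<lambda>_. {..L}))" using assms by (intro finite_PiE) auto
  show "finite ?M" using finite_imageD[OF finite_subset[OF sub fin] inj] .
  have "card ?M \<le> card (Pi\<^sub>E A (\<lambda>_. {..L}))" by (rule card_inj_on_le[OF inj sub fin])
  also have "\<dots> = (L + 1) ^ card A" using assms by (simp add: card_PiE)
  finally show "card ?M \<le> (L + 1) ^ card A" .
qed

text \<open>More polynomials than variables are algebraically dependent: the number of monomials in the
  polynomials with exponents at most \<open>N\<close> grows faster than the dimension of the space that contains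
  them.\<close>

lemma algebraic_dependence:
  fixes fs :: "'k::field mpoly list"
  assumes A: "finite A" "card A < length fs" and fs: "\<forall>f\<in>set fs. \<forall>m\<in>Poly_Mapping.keys f. Poly_Mapping.keys m \<subseteq> A"
  shows "\<exists>T c. finite T \<and> (\<forall>es\<in>T. length es = length fs) \<and> (\<exists>es\<in>T. c es \<noteq> 0) \<and>
    (\<Sum>es\<in>T. const (c es) * list_power fs es) = 0"
proof -
  define B where "B = Suc (Max (insert 0 (\<Union>f\<in>set fs. \<Union>m\<in>Poly_Mapping.keys f. Poly_Mapping.lookup m ` A)))"
  have B: "exponents_le A B f" if f: "f \<in> set fs" for f
    unfolding exponents_le_def
  proof (intro ballI conjI allI)
    fix m k assume m: "m \<in> Poly_Mapping.keys f"
    then show "Poly_Mapping.keys m \<subseteq> A" using fs f by blast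
    show "Poly_Mapping.lookup m k \<le> B"
    proof (cases "k \<in> A")
      case True
      then have "Poly_Mapping.lookup m k \<le> Max (insert 0 (\<Union>f\<in>set fs. \<Union>m\<in>Poly_Mapping.keys f. Poly_Mapping.lookup m ` A))"
        using f m A by (intro Max_ge) auto
      then show ?thesis by (simp add: B_def)
    next
      case False
      then have "k \<notin> Poly_Mapping.keys m" using fs f m by blast
      then show ?thesis by (simp add: in_keys_iff)
    qed
  qed
  let ?k = "length fs"
  define C where "C = ?k * B"
  define N where "N = C ^ card A"
  define T where "T = {es. set es \<subseteq> {..N} \<and> length es = ?k}"
  define S where "S = {m :: nat \<Rightarrow>\<^sub>0 nat. Poly_Mapping.keys m \<subseteq> A \<and> (\<forall>k. Poly_Mapping.lookup m k \<le> ?k * N * B)}"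
  have T: "finite T" "card T = (N + 1) ^ ?k"
    unfolding T_def using finite_lists_length_eq[of "{..N}" ?k] card_lists_length_eq[of "{..N}" ?k] by auto
  have "1 \<le> C" using A(2) by (auto simp: C_def B_def)
  have "card S \<le> (?k * N * B + 1) ^ card A" unfolding S_def by (rule card_bounded_monomials(2)[OF A(1)])
  also have "\<dots> \<le> (C * (N + 1)) ^ card A"
    using \<open>1 \<le> C\<close> by (intro power_mono) (auto simp: C_def algebra_simps)
  also have "\<dots> = N * (N + 1) ^ card A" by (simp only: power_mult_distrib N_def)
  also have "\<dots> < (N + 1) * (N + 1) ^ card A" by simp
  also have "\<dots> = (N + 1) ^ Suc (card A)" by simp
  also have "\<dots> \<le> (N + 1) ^ ?k" using A(2) by (intro power_increasing) auto
  finally have "card S < card T" using T(2) by simp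
  from homogeneous_system_solution[OF _ T(1) this, of "\<lambda>es m. Poly_Mapping.lookup (list_power fs es) m"]
  obtain c where c: "\<exists>es\<in>T. c es \<noteq> 0" "\<forall>m\<in>S. (\<Sum>es\<in>T. c es * Poly_Mapping.lookup (list_power fs es) m) = 0"
    using card_bounded_monomials(1)[OF A(1)] unfolding S_def by blast
  have "(\<Sum>es\<in>T. const (c es) * list_power fs es) = 0"
  proof (rule poly_mapping_eqI)
    fix m
    have "(\<Sum>es\<in>T. c es * Poly_Mapping.lookup (list_power fs es) m) = 0"
    proof (cases "m \<in> S")
      case False
      have "Poly_Mapping.lookup (list_power fs es) m = 0" if "es \<in> T" for es
      proof (rule ccontr)
        assume "Poly_Mapping.lookup (list_power fs es) m \<noteq> 0"
        then have "m \<in> Poly_Mapping.keys (list_power fs es)" by (simp add: in_keys_iff)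
        moreover have "exponents_le A (?k * N * B) (list_power fs es)"
          using that B by (intro exponents_le_list_power) (auto simp: T_def)
        ultimately show False using False by (auto simp: S_def exponents_le_def)
      qed
      then show ?thesis by simp
    qed (use c in blast)
    then show "Poly_Mapping.lookup (\<Sum>es\<in>T. const (c es) * list_power fs es) m = Poly_Mapping.lookup 0 m"
      by (simp add: lookup_sum)
  qed
  then show ?thesis using T(1) c(1) by (intro exI[of _ T] exI[of _ c]) (auto simp: T_def)
qed

subsection \<open>Chains of primes\<close>

definition poly_prime :: "nat \<Rightarrow> 'k::field mpoly set \<Rightarrow> bool" where
  "poly_prime n P \<longleftrightarrow> poly_ideal n P \<and> P \<noteq> polys n \<and>
     (\<forall>p\<in>polys n. \<forall>q\<in>polys n. p * q \<in> P \<longrightarrow> p \<in> P \<or> q \<in> P)"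

lemma unit_not_in_prime:
  assumes P: "poly_prime n P" and c: "c \<noteq> 0"
  shows "const c \<notin> P"
proof
  assume "const c \<in> P"
  have "poly_ideal n P" using P by (simp add: poly_prime_def)
  have "p \<in> P" if "p \<in> polys n" for p
  proof -
    have "(p * const (1 / c)) * const c \<in> P"
      using that \<open>const c \<in> P\<close> by (intro poly_idealD(4)[OF \<open>poly_ideal n P\<close>]) auto
    moreover have "const (1 / c) * const c = 1" using c by (simp add: const_def mult_single)
    ultimately show ?thesis by (simp add: mult.assoc)
  qed
  then have "P = polys n" using poly_idealD(1)[OF \<open>poly_ideal n P\<close>] by blast
  then show False using P by (simp add: poly_prime_def)
qed

lemma prime_power: "poly_prime n P \<Longrightarrow> f \<in> polys n \<Longrightarrow> g \<in> polys n \<Longrightarrow> f ^ m * g \<in> P \<Longrightarrow> f \<in> P \<or> g \<in> P"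
proof (induction m)
  case (Suc m)
  have "f * (f ^ m * g) \<in> P" using Suc.prems(4) by (simp add: mult.assoc)
  moreover have "f ^ m * g \<in> polys n" using Suc.prems by auto
  ultimately have "f \<in> P \<or> f ^ m * g \<in> P" using Suc.prems(1,2) unfolding poly_prime_def by blast
  then show ?case using Suc by blast
qed simp

lemma list_power_polys: "set fs \<subseteq> polys n \<Longrightarrow> list_power fs es \<in> polys n"
  by (induction fs es rule: list_power.induct) auto

text \<open>The elements separating the members of a chain of primes satisfy no relation. A relation is
  divided by the power of the first element with the least exponent occurring in it; modulo the next
  prime only the terms with that exponent remain.\<close>

lemma prime_chain_no_relation:
  fixes fs :: "'k::field mpoly list"
  assumes "\<And>i. i \<le> length fs \<Longrightarrow> poly_prime n (P i)"
    and "\<And>i. i < length fs \<Longrightarrow> P i \<subseteq> P (Suc i) \<and> fs ! i \<in> P (Suc i) \<and> fs ! i \<notin> P i"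
    and "finite T" "\<And>es. es \<in> T \<Longrightarrow> length es = length fs" "\<exists>es\<in>T. c es \<noteq> 0"
  shows "(\<Sum>es\<in>T. const (c es) * list_power fs es) \<notin> P 0"
  using assms
proof (induction fs arbitrary: P T c)
  case Nil
  then have "T = {[]}" "c [] \<noteq> 0" by force+
  then show ?case using unit_not_in_prime[of n "P 0" "c []"] Nil.prems(1) by simp
next
  case (Cons f fs)
  have P0: "poly_prime n (P 0)" "poly_ideal n (P 0)" and P1: "poly_prime n (P 1)" "poly_ideal n (P 1)"
    using Cons.prems(1)[of 0] Cons.prems(1)[of 1] by (auto simp: poly_prime_def)
  have f: "P 0 \<subseteq> P 1" "f \<in> P 1" "f \<notin> P 0" using Cons.prems(2)[of 0] by auto
  have fp: "f \<in> polys n" using f(2) poly_idealD(1)[OF P1(2)] by blast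
  have fsp: "set fs \<subseteq> polys n"
  proof
    fix g assume "g \<in> set fs"
    then obtain i where i: "i < length fs" "g = fs ! i" by (auto simp: in_set_conv_nth)
    then have "g \<in> P (Suc (Suc i))" using Cons.prems(2)[of "Suc i"] by simp
    moreover have "poly_ideal n (P (Suc (Suc i)))" using Cons.prems(1)[of "Suc (Suc i)"] i by (simp add: poly_prime_def)
    ultimately show "g \<in> polys n" using poly_idealD(1) by blast
  qed
  define T0 where "T0 = {es\<in>T. c es \<noteq> 0}"
  define m where "m = Min (hd ` T0)"
  define T1 where "T1 = {es\<in>T0. hd es = m}"
  have fin: "finite T0" "finite T1" using Cons.prems(3) by (auto simp: T0_def T1_def)
  have ne: "T0 \<noteq> {}" using Cons.prems(5) by (auto simp: T0_def)
  have form: "es = hd es # tl es" "length (tl es) = length fs" if "es \<in> T0" for es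
    using that Cons.prems(4)[of es] by (auto simp: T0_def) (metis length_0_conv list.collapse nat.distinct(1))
  have m_le: "m \<le> hd es" if "es \<in> T0" for es unfolding m_def using that fin by (intro Min_le) auto
  have "m \<in> hd ` T0" unfolding m_def using fin ne by (intro Min_in) auto
  then have ne1: "T1 \<noteq> {}" by (auto simp: T1_def)
  define R where "R = (\<Sum>es\<in>T0 - T1. const (c es) * (f ^ (hd es - m - 1) * list_power fs (tl es)))"
  define S where "S = (\<Sum>es\<in>T1. const (c es) * list_power fs (tl es))"
  have RS: "R \<in> polys n" "S \<in> polys n"
    unfolding R_def S_def using fp fsp by (auto intro!: polys_sum polys_mult polys_power list_power_polys)
  have rel: "const (c es) * list_power (f # fs) es = f ^ m * (if es \<in> T1 then const (c es) * list_power fs (tl es)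
      else f * (const (c es) * (f ^ (hd es - m - 1) * list_power fs (tl es))))" if es: "es \<in> T0" for es
  proof -
    have lp: "list_power (f # fs) es = f ^ hd es * list_power fs (tl es)"
      by (subst form(1)[OF es]) simp
    show ?thesis
    proof (cases "es \<in> T1")
      case True
      then show ?thesis using lp by (simp add: T1_def mult_ac)
    next
      case False
      then have "hd es = m + Suc (hd es - m - 1)" using m_le[OF es] es by (auto simp: T1_def)
      then have "f ^ hd es = f ^ m * (f * f ^ (hd es - m - 1))" by (metis power_Suc power_add)
      then show ?thesis using lp False by (simp add: mult_ac)
    qed
  qed
  have "(\<Sum>es\<in>T. const (c es) * list_power (f # fs) es) = (\<Sum>es\<in>T0. const (c es) * list_power (f # fs) es)"
    using Cons.prems(3) by (intro sum.mono_neutral_right) (auto simp: T0_def const_def)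
  also have "\<dots> = f ^ m * (\<Sum>es\<in>T0. if es \<in> T1 then const (c es) * list_power fs (tl es)
      else f * (const (c es) * (f ^ (hd es - m - 1) * list_power fs (tl es))))"
    unfolding sum_distrib_left by (intro sum.cong refl rel)
  also have "(\<Sum>es\<in>T0. if es \<in> T1 then const (c es) * list_power fs (tl es)
      else f * (const (c es) * (f ^ (hd es - m - 1) * list_power fs (tl es)))) = S + f * R"
  proof -
    have "T0 \<inter> {es. es \<in> T1} = T1" "T0 \<inter> - {es. es \<in> T1} = T0 - T1" by (auto simp: T1_def)
    then show ?thesis using fin by (simp add: sum.If_cases S_def R_def sum_distrib_left)
  qed
  finally have eq: "(\<Sum>es\<in>T. const (c es) * list_power (f # fs) es) = f ^ m * (S + f * R)" .
  show ?case
  proof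
    assume "(\<Sum>es\<in>T. const (c es) * list_power (f # fs) es) \<in> P 0"
    then have "f \<in> P 0 \<or> S + f * R \<in> P 0"
      unfolding eq using fp RS by (intro prime_power[OF P0(1)]) auto
    then have "S + f * R \<in> P 1" using f by blast
    moreover have "f * R \<in> P 1" using poly_idealD(5)[OF P1(2) RS(1) f(2)] .
    ultimately have "S \<in> P 1" using poly_idealD(7)[OF P1(2), of "S + f * R" "f * R"] by simp
    moreover have "S = (\<Sum>es\<in>tl ` T1. const (c (m # es)) * list_power fs es)"
    proof -
      have inj: "inj_on tl T1"
        using form(1) by (intro inj_onI) (metis (mono_tags, lifting) T1_def mem_Collect_eq)
      show ?thesis unfolding S_def sum.reindex[OF inj]
        using form(1) by (intro sum.cong) (auto simp: T1_def)
    qed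
    moreover have "(\<Sum>es\<in>tl ` T1. const (c (m # es)) * list_power fs es) \<notin> P (Suc 0)"
    proof (rule Cons.IH[where P = "\<lambda>i. P (Suc i)" and c = "\<lambda>es. c (m # es)"])
      show "poly_prime n (P (Suc i))" if "i \<le> length fs" for i using Cons.prems(1)[of "Suc i"] that by simp
      show "P (Suc i) \<subseteq> P (Suc (Suc i)) \<and> fs ! i \<in> P (Suc (Suc i)) \<and> fs ! i \<notin> P (Suc i)" if "i < length fs" for i
        using Cons.prems(2)[of "Suc i"] that by simp
      show "finite (tl ` T1)" using fin by simp
      show "length es = length fs" if "es \<in> tl ` T1" for es using that form(2) by (auto simp: T1_def)
      obtain es where es: "es \<in> T1" using ne1 by blast
      then have "m # tl es = es" using form(1)[of es] by (auto simp: T1_def)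
      then show "\<exists>es\<in>tl ` T1. c (m # es) \<noteq> 0" using es by (intro bexI[of _ "tl es"]) (auto simp: T1_def T0_def)
    qed
    ultimately show False by simp
  qed
qed

definition restrict_to :: "nat set \<Rightarrow> 'k::field mpoly \<Rightarrow> 'k mpoly" where
  "restrict_to A p = (\<Sum>m\<in>{m\<in>Poly_Mapping.keys p. Poly_Mapping.keys m \<subseteq> A}. Poly_Mapping.single m (Poly_Mapping.lookup p m))"

lemma lookup_restrict_to:
  "Poly_Mapping.lookup (restrict_to A p) m = (if Poly_Mapping.keys m \<subseteq> A then Poly_Mapping.lookup p m else 0)"
proof -
  have "Poly_Mapping.lookup (restrict_to A p) m =
      (\<Sum>l\<in>{l\<in>Poly_Mapping.keys p. Poly_Mapping.keys l \<subseteq> A}. if l = m then Poly_Mapping.lookup p m else 0)"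
    unfolding restrict_to_def lookup_sum by (intro sum.cong refl) (auto simp: lookup_single when_def)
  then show ?thesis by (auto simp: in_keys_iff)
qed

lemma keys_restrict_to: "m \<in> Poly_Mapping.keys (restrict_to A p) \<longleftrightarrow> m \<in> Poly_Mapping.keys p \<and> Poly_Mapping.keys m \<subseteq> A"
  unfolding in_keys_iff[of m "restrict_to A p"] in_keys_iff[of m p] lookup_restrict_to by simp

lemma restrict_to_add: "restrict_to A (p + q) = restrict_to A p + restrict_to A q"
  by (intro poly_mapping_eqI) (simp add: lookup_restrict_to lookup_add)

lemma restrict_to_sum: "restrict_to A (sum f X) = (\<Sum>i\<in>X. restrict_to A (f i))"
proof (induction X rule: infinite_finite_induct)
  case (insert x X)
  then show ?case by (simp add: restrict_to_add)
qed (simp_all add: restrict_to_def)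

lemma restrict_to_single_mult:
  "restrict_to A (Poly_Mapping.single m c * q) =
    (if Poly_Mapping.keys m \<subseteq> A then Poly_Mapping.single m c * restrict_to A q else 0)"
proof (rule poly_mapping_eqI)
  fix l
  show "Poly_Mapping.lookup (restrict_to A (Poly_Mapping.single m c * q)) l =
    Poly_Mapping.lookup (if Poly_Mapping.keys m \<subseteq> A then Poly_Mapping.single m c * restrict_to A q else 0) l"
  proof (cases "\<exists>k. l = m + k")
    case True
    then obtain k where "l = m + k" by blast
    then show ?thesis by (auto simp: lookup_restrict_to keys_add_nat)
  next
    case False
    then have "\<And>p. Poly_Mapping.lookup (Poly_Mapping.single m c * p) l = 0" by (intro lookup_single_times_not) auto
    then show ?thesis by (simp add: lookup_restrict_to)
  qed
qed

lemma restrict_to_mult: "restrict_to A (p * q) = restrict_to A p * restrict_to A q"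
proof -
  have "p * q = (\<Sum>m\<in>Poly_Mapping.keys p. Poly_Mapping.single m (Poly_Mapping.lookup p m) * q)"
    by (subst poly_mapping_sum_single[of p]) (simp add: sum_distrib_right)
  then have "restrict_to A (p * q) = (\<Sum>m\<in>Poly_Mapping.keys p.
      if Poly_Mapping.keys m \<subseteq> A then Poly_Mapping.single m (Poly_Mapping.lookup p m) * restrict_to A q else 0)"
    by (simp add: restrict_to_sum restrict_to_single_mult)
  also have "\<dots> = restrict_to A p * restrict_to A q"
    unfolding restrict_to_def[of A p] sum_distrib_right by (rule sum.inter_filter[symmetric]) simp
  finally show ?thesis .
qed

text \<open>The prime generated by the variables outside \<open>A\<close>; it is the kernel of the ring homomorphism
  \<open>restrict_to A\<close>.\<close>

definition var_prime :: "nat \<Rightarrow> nat set \<Rightarrow> 'k::field mpoly set" where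
  "var_prime n A = mono_ideal n (\<lambda>m. \<not> Poly_Mapping.keys m \<subseteq> A)"

lemma poly_ideal_var_prime: "poly_ideal n (var_prime n A)"
  unfolding var_prime_def by (rule poly_ideal_mono_ideal) (auto simp: keys_add_nat)

lemma var_prime_iff: "p \<in> polys n \<Longrightarrow> p \<in> var_prime n A \<longleftrightarrow> restrict_to A p = 0"
  unfolding var_prime_def mono_ideal_def
  by (auto simp: poly_mapping_eq_iff fun_eq_iff lookup_restrict_to in_keys_iff)

lemma poly_prime_var_prime: "poly_prime n (var_prime n A)"
  unfolding poly_prime_def
proof (intro conjI ballI impI poly_ideal_var_prime)
  have "(1 :: 'a mpoly) \<notin> var_prime n A" by (simp add: var_prime_def mono_ideal_def)
  then show "var_prime n A \<noteq> (polys n :: 'a mpoly set)" using polys_1 by blast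
  fix p q :: "'a mpoly" assume "p \<in> polys n" "q \<in> polys n" "p * q \<in> var_prime n A"
  then show "p \<in> var_prime n A \<or> q \<in> var_prime n A"
    by (simp add: var_prime_iff restrict_to_mult)
qed

lemma var_prime_le:
  assumes P: "poly_ideal n P" and vars: "\<And>k. k \<in> {1..n} - A \<Longrightarrow> var k \<in> P"
  shows "var_prime n A \<subseteq> (P :: 'k::field mpoly set)"
proof
  fix p :: "'k mpoly" assume p: "p \<in> var_prime n A"
  have "Poly_Mapping.single m (Poly_Mapping.lookup p m) \<in> P" if m: "m \<in> Poly_Mapping.keys p" for m
  proof -
    have mn: "Poly_Mapping.keys m \<subseteq> {1..n}" "\<not> Poly_Mapping.keys m \<subseteq> A"
      using p m by (auto simp: var_prime_def mono_ideal_def polys_iff)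
    then obtain k where k: "k \<in> Poly_Mapping.keys m" "k \<in> {1..n} - A" by blast
    have "m = (m - Poly_Mapping.single k 1) + Poly_Mapping.single k 1"
      using k by (intro poly_mapping_eqI) (auto simp: lookup_add lookup_minus lookup_single when_def in_keys_iff)
    then have "Poly_Mapping.single m (Poly_Mapping.lookup p m) =
        Poly_Mapping.single (m - Poly_Mapping.single k 1) (Poly_Mapping.lookup p m) * var k"
      by (simp add: var_def mult_single)
    moreover have "Poly_Mapping.keys (m - Poly_Mapping.single k 1) \<subseteq> {1..n}"
      using mn by (auto simp: in_keys_iff lookup_minus subset_iff)
    ultimately show ?thesis using poly_idealD(4)[OF P polys_single vars[OF k(2)]] by simp
  qed
  then have "(\<Sum>m\<in>Poly_Mapping.keys p. Poly_Mapping.single m (Poly_Mapping.lookup p m)) \<in> P"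
    by (intro poly_ideal_sum[OF P]) auto
  then show "p \<in> P" using poly_mapping_sum_single[of p] by simp
qed

subsection \<open>Primes of the quotient\<close>

lemma coset_eq_iff:
  assumes I: "poly_ideal n I"
  shows "I +>\<^bsub>poly_ring n\<^esub> x = I +>\<^bsub>poly_ring n\<^esub> y \<longleftrightarrow> x - y \<in> I"
proof -
  have mem: "z \<in> I +>\<^bsub>poly_ring n\<^esub> x \<longleftrightarrow> z - x \<in> I" for z x
    by (force simp: a_r_coset_def r_coset_def)
  show ?thesis
  proof
    assume "I +>\<^bsub>poly_ring n\<^esub> x = I +>\<^bsub>poly_ring n\<^esub> y"
    moreover have "x \<in> I +>\<^bsub>poly_ring n\<^esub> x" using poly_idealD(2)[OF I] by (simp add: mem)
    ultimately show "x - y \<in> I" using mem by blast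
  next
    assume xy: "x - y \<in> I"
    have "z - x \<in> I \<longleftrightarrow> z - y \<in> I" for z
      using poly_idealD(3)[OF I _ xy, of "z - x"] poly_idealD(7)[OF I _ xy, of "z - y"] by auto
    then show "I +>\<^bsub>poly_ring n\<^esub> x = I +>\<^bsub>poly_ring n\<^esub> y" using mem by (intro Set.set_eqI) blast
  qed
qed

lemma carrier_quot: "carrier (poly_ring n Quot I) = (\<lambda>x. I +>\<^bsub>poly_ring n\<^esub> x) ` polys n"
  by (auto simp: FactRing_def A_RCOSETS_def')

lemma quot_mult:
  assumes "poly_ideal n I" "x \<in> polys n" "y \<in> polys n"
  shows "(I +>\<^bsub>poly_ring n\<^esub> x) \<otimes>\<^bsub>poly_ring n Quot I\<^esub> (I +>\<^bsub>poly_ring n\<^esub> y) = I +>\<^bsub>poly_ring n\<^esub> (x * y)"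
  using ideal.rcoset_mult_add[of I "poly_ring n" x y] assms by (simp add: FactRing_def ideal_poly_ring_iff)

lemma prime_of_quot:
  fixes I :: "'k::field mpoly set"
  assumes I: "poly_ideal n I" and P: "primeideal P (poly_ring n Quot I)"
  shows "poly_prime n {r \<in> polys n. I +>\<^bsub>poly_ring n\<^esub> r \<in> P}" "I \<subseteq> {r \<in> polys n. I +>\<^bsub>poly_ring n\<^esub> r \<in> P}"
proof -
  interpret P: primeideal P "poly_ring n Quot I" by (rule P)
  have id: "ideal I (poly_ring n)" using I by (simp add: ideal_poly_ring_iff)
  have "ideal {r \<in> polys n. I +>\<^bsub>poly_ring n\<^esub> r \<in> P} (poly_ring n)"
    by (rule ring_hom_ring.ideal_vimage[OF ideal.rcos_ring_hom_ring[OF id] P.is_ideal])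
  then have pid: "poly_ideal n {r \<in> polys n. I +>\<^bsub>poly_ring n\<^esub> r \<in> P}" by (simp add: ideal_poly_ring_iff)
  have "\<exists>r\<in>polys n. I +>\<^bsub>poly_ring n\<^esub> r \<notin> P"
    using P.I_notcarr P.a_subset unfolding carrier_quot by blast
  moreover have "r \<in> {r \<in> polys n. I +>\<^bsub>poly_ring n\<^esub> r \<in> P} \<or> s \<in> {r \<in> polys n. I +>\<^bsub>poly_ring n\<^esub> r \<in> P}"
    if "r \<in> polys n" "s \<in> polys n" "r * s \<in> {r \<in> polys n. I +>\<^bsub>poly_ring n\<^esub> r \<in> P}" for r s
    using P.I_prime[of "I +>\<^bsub>poly_ring n\<^esub> r" "I +>\<^bsub>poly_ring n\<^esub> s"] that quot_mult[OF I that(1,2)]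
    by (auto simp: carrier_quot)
  ultimately show "poly_prime n {r \<in> polys n. I +>\<^bsub>poly_ring n\<^esub> r \<in> P}" using pid unfolding poly_prime_def by blast
  show "I \<subseteq> {r \<in> polys n. I +>\<^bsub>poly_ring n\<^esub> r \<in> P}"
  proof
    fix x assume x: "x \<in> I"
    have "I +>\<^bsub>poly_ring n\<^esub> x = I +>\<^bsub>poly_ring n\<^esub> 0" using x by (simp add: coset_eq_iff[OF I])
    moreover have "I +>\<^bsub>poly_ring n\<^esub> 0 \<in> P" using poly_idealD(2)[OF pid] by simp
    ultimately show "x \<in> {r \<in> polys n. I +>\<^bsub>poly_ring n\<^esub> r \<in> P}" using x poly_idealD(1)[OF I] by auto
  qed
qed

lemma prime_in_quot:
  fixes I :: "'k::field mpoly set"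
  assumes I: "poly_ideal n I" and P: "poly_prime n P" "I \<subseteq> P"
  shows "primeideal ((\<lambda>x. I +>\<^bsub>poly_ring n\<^esub> x) ` P) (poly_ring n Quot I)"
    "x \<in> polys n \<Longrightarrow> I +>\<^bsub>poly_ring n\<^esub> x \<in> (\<lambda>x. I +>\<^bsub>poly_ring n\<^esub> x) ` P \<longleftrightarrow> x \<in> P"
proof -
  have id: "ideal I (poly_ring n)" using I by (simp add: ideal_poly_ring_iff)
  have pid: "poly_ideal n P" using P by (simp add: poly_prime_def)
  have mem: "I +>\<^bsub>poly_ring n\<^esub> x \<in> (\<lambda>x. I +>\<^bsub>poly_ring n\<^esub> x) ` P \<longleftrightarrow> x \<in> P" for x
  proof
    assume "I +>\<^bsub>poly_ring n\<^esub> x \<in> (\<lambda>x. I +>\<^bsub>poly_ring n\<^esub> x) ` P"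
    then obtain y where "y \<in> P" "x - y \<in> I" by (auto simp: coset_eq_iff[OF I])
    then show "x \<in> P" using poly_idealD(3)[OF pid, of "x - y" y] P(2) by auto
  qed auto
  then show "I +>\<^bsub>poly_ring n\<^esub> x \<in> (\<lambda>x. I +>\<^bsub>poly_ring n\<^esub> x) ` P \<longleftrightarrow> x \<in> P" .
  show "primeideal ((\<lambda>x. I +>\<^bsub>poly_ring n\<^esub> x) ` P) (poly_ring n Quot I)"
  proof (rule primeidealI)
    show "ideal ((\<lambda>x. I +>\<^bsub>poly_ring n\<^esub> x) ` P) (poly_ring n Quot I)"
      using PR.ring_ideal_imp_quot_ideal[OF id] pid by (simp add: ideal_poly_ring_iff)
    show "cring (poly_ring n Quot I)" by (rule ideal.quotient_is_cring[OF id cring_poly_ring])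
    obtain r where r: "r \<in> polys n" "r \<notin> P" using P(1) poly_idealD(1)[OF pid] unfolding poly_prime_def by blast
    have "I +>\<^bsub>poly_ring n\<^esub> r \<in> carrier (poly_ring n Quot I)" unfolding carrier_quot using r(1) by (rule imageI)
    moreover have "I +>\<^bsub>poly_ring n\<^esub> r \<notin> (\<lambda>x. I +>\<^bsub>poly_ring n\<^esub> x) ` P" using mem r(2) by simp
    ultimately show "carrier (poly_ring n Quot I) \<noteq> (\<lambda>x. I +>\<^bsub>poly_ring n\<^esub> x) ` P" by metis
    fix a b assume "a \<in> carrier (poly_ring n Quot I)" "b \<in> carrier (poly_ring n Quot I)"
      and ab: "a \<otimes>\<^bsub>poly_ring n Quot I\<^esub> b \<in> (\<lambda>x. I +>\<^bsub>poly_ring n\<^esub> x) ` P"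
    then obtain x y where xy: "x \<in> polys n" "a = I +>\<^bsub>poly_ring n\<^esub> x" "y \<in> polys n" "b = I +>\<^bsub>poly_ring n\<^esub> y"
      unfolding carrier_quot by blast
    then have "x * y \<in> P" using ab quot_mult[OF I xy(1,3)] mem by simp
    then show "a \<in> (\<lambda>x. I +>\<^bsub>poly_ring n\<^esub> x) ` P \<or> b \<in> (\<lambda>x. I +>\<^bsub>poly_ring n\<^esub> x) ` P"
      using P(1) xy unfolding poly_prime_def by blast
  qed
qed

text \<open>For the lower bound the variables in \<open>A\<close> are added one by one to the prime generated by all other variables.
For the upper bound, the variables not contained in the smallest prime of a chain form an independent set
\<open>B\<close>. As the other variables lie in all primes of the chain, the elements separating its members can be
chosen as polynomials in the variables of \<open>B\<close>. They satisfy no relation, so there are at most as many of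
them as variables.\<close>

theorem quot_dim_edge_ideal:
  assumes E: "simple_graph {1..n} E"
    and A: "A \<in> indeps E {1..n}" and max: "\<And>F. F \<in> indeps E {1..n} \<Longrightarrow> card F \<le> card A"
  shows "quot_dim n (edge_ideal n E :: 'k::field mpoly set) = card A"
proof -
  let ?R = "poly_ring n :: 'k mpoly ring"
  let ?I = "mono_ideal n (edge_mono E) :: 'k mpoly set"
  note I = poly_ideal_edge_mono[of n E, where ?'a = 'k]
  let ?S = "{d. \<exists>P. (\<forall>i\<le>d. primeideal (P i) (?R Quot ?I)) \<and> (\<forall>i<d. P i \<subset> P (Suc i))}"
  have An: "A \<subseteq> {1..n}" using A by (simp add: indeps_def)
  have finA: "finite A" "A \<subseteq> {1..n}" using finite_subset_ivl[OF An] An by simp_all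
  have "card A \<in> ?S"
  proof -
    obtain xs where xs: "set xs = A" "distinct xs" using finite_distinct_list[OF finA(1)] by blast
    have len: "length xs = card A" using distinct_card[OF xs(2)] xs(1) by simp
    define P where "P = (\<lambda>i. var_prime n (set (drop i xs)) :: 'k mpoly set)"
    have IP: "?I \<subseteq> P i" for i
    proof
      fix p assume p: "p \<in> ?I"
      have "\<not> Poly_Mapping.keys m \<subseteq> set (drop i xs)" if m: "m \<in> Poly_Mapping.keys p" for m
      proof
        assume "Poly_Mapping.keys m \<subseteq> set (drop i xs)"
        then have "Poly_Mapping.keys m \<subseteq> A" using set_drop_subset[of i xs] xs(1) by blast
        moreover obtain e where "e \<in> E" "e \<subseteq> Poly_Mapping.keys m" using p m by (auto simp: mono_ideal_def edge_mono_def)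
        ultimately show False using A unfolding indeps_def by blast
      qed
      then show "p \<in> P i" using p by (simp add: P_def var_prime_def mono_ideal_def)
    qed
    have prime: "poly_prime n (P i)" for i unfolding P_def by (rule poly_prime_var_prime)
    let ?Q = "\<lambda>i. (\<lambda>x. ?I +>\<^bsub>?R\<^esub> x) ` P i"
    have "?Q i \<subset> ?Q (Suc i)" if i: "i < card A" for i
    proof -
      have drop: "drop i xs = xs ! i # drop (Suc i) xs" using i len by (simp add: Cons_nth_drop_Suc)
      have v: "var (xs ! i) \<in> (polys n :: 'k mpoly set)"
        using i len xs(1) finA(2) nth_mem[of i xs] by (intro polys_var) auto
      have "xs ! i \<notin> set (drop (Suc i) xs)" using drop xs(2) by (metis distinct.simps(2) distinct_drop)
      then have "var (xs ! i) \<in> P (Suc i)" using v by (auto simp: P_def var_prime_def mono_ideal_def var_def)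
      moreover have "(var (xs ! i) :: 'k mpoly) \<notin> P i" by (simp add: P_def var_prime_def mono_ideal_def var_def drop)
      moreover have "P i \<subseteq> P (Suc i)" unfolding P_def var_prime_def mono_ideal_def by (auto simp: drop)
      ultimately show ?thesis
        using prime_in_quot(2)[OF I prime IP v, of i] prime_in_quot(2)[OF I prime IP v, of "Suc i"] by blast
    qed
    moreover have "primeideal (?Q i) (?R Quot ?I)" for i by (rule prime_in_quot(1)[OF I prime IP])
    ultimately show ?thesis by (intro CollectI exI[of _ ?Q]) blast
  qed
  moreover have "d \<le> card A" if d: "d \<in> ?S" for d
  proof (rule ccontr)
    assume nd: "\<not> d \<le> card A"
    obtain P where P: "\<And>i. i \<le> d \<Longrightarrow> primeideal (P i) (?R Quot ?I)" "\<And>i. i < d \<Longrightarrow> P i \<subset> P (Suc i)"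
      using d by blast
    define Q where "Q = (\<lambda>i. {r \<in> polys n. ?I +>\<^bsub>?R\<^esub> r \<in> P i})"
    have Q: "poly_prime n (Q i)" "?I \<subseteq> Q i" if "i \<le> d" for i
      unfolding Q_def using prime_of_quot[OF I P(1)[OF that]] by auto
    have Q0: "poly_ideal n (Q 0)" using Q(1)[of 0] by (simp add: poly_prime_def)
    define B where "B = {k\<in>{1..n}. var k \<notin> Q 0}"
    have "B \<in> indeps E {1..n}"
      unfolding indeps_def
    proof (intro CollectI conjI ballI)
      show "B \<subseteq> {1..n}" by (auto simp: B_def)
      fix e assume e: "e \<in> E"
      show "\<not> e \<subseteq> B"
      proof
        assume eB: "e \<subseteq> B"
        have "card e = 2" using E e by (simp add: simple_graph_def)
        then obtain i j where ij: "e = {i, j}" "i \<noteq> j" by (auto simp: card_2_iff)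
        then have ijn: "i \<in> {1..n}" "j \<in> {1..n}" using eB by (auto simp: B_def)
        have "(var i * var j :: 'k mpoly) = Poly_Mapping.single (sqfree {i, j}) 1"
          using ij by (simp add: var_def mult_single sqfree_def)
        moreover have "edge_mono E (sqfree {i, j})" using e ij by (auto simp: edge_mono_def)
        ultimately have "(var i * var j :: 'k mpoly) \<in> ?I" using ijn by (auto simp: mono_ideal_def)
        then have "var i \<in> Q 0 \<or> var j \<in> Q 0"
          using Q[of 0] polys_var[OF ijn(1)] polys_var[OF ijn(2)] unfolding poly_prime_def by blast
        then show False using eB ij by (auto simp: B_def)
      qed
    qed
    then have cB: "card B \<le> card A" by (rule max)
    have finB: "finite B" by (simp add: B_def)
    have vp: "var_prime n B \<subseteq> Q 0" by (rule var_prime_le[OF Q0]) (auto simp: B_def)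
    have "\<exists>f. (\<forall>m\<in>Poly_Mapping.keys f. Poly_Mapping.keys m \<subseteq> B) \<and> f \<in> Q (Suc i) \<and> f \<notin> Q i" if i: "i < d" for i
    proof -
      have "Q 0 \<subseteq> Q j" if "j \<le> d" for j
        using that
      proof (induction j)
        case (Suc j)
        have "Q j \<subseteq> Q (Suc j)" using P(2)[of j] Suc.prems unfolding Q_def by auto
        then show ?case using Suc by auto
      qed simp
      then have Q0i: "Q 0 \<subseteq> Q i" "Q 0 \<subseteq> Q (Suc i)" using i by simp_all
      have idl: "poly_ideal n (Q i)" "poly_ideal n (Q (Suc i))"
        using Q(1)[of i] Q(1)[of "Suc i"] i by (auto simp: poly_prime_def)
      obtain x where x: "x \<in> P (Suc i)" "x \<notin> P i" using P(2)[OF i] by blast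
      have "P (Suc i) \<subseteq> carrier (?R Quot ?I)"
        using P(1)[of "Suc i"] i by (meson Suc_leI additive_subgroup.a_subset ideal.axioms(1) primeideal.axioms(1))
      then obtain f where f: "f \<in> polys n" "x = ?I +>\<^bsub>?R\<^esub> f" using x unfolding carrier_quot by blast
      let ?g = "restrict_to B f"
      have gp: "?g \<in> polys n" using f(1) by (auto simp: polys_iff in_keys_iff lookup_restrict_to split: if_splits)
      have "restrict_to B (f - ?g) = 0" by (intro poly_mapping_eqI) (simp add: lookup_restrict_to lookup_minus)
      then have fg: "f - ?g \<in> Q 0" using vp var_prime_iff[of "f - ?g" n B] f(1) gp by blast
      have "f \<in> Q (Suc i)" "f \<notin> Q i" using f x by (auto simp: Q_def)
      then have "?g \<in> Q (Suc i)" "?g \<notin> Q i"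
        using poly_idealD(7)[OF idl(2), of f "f - ?g"] poly_idealD(3)[OF idl(1), of "f - ?g" ?g] fg Q0i by auto
      moreover have "\<forall>m\<in>Poly_Mapping.keys ?g. Poly_Mapping.keys m \<subseteq> B"
        by (simp add: keys_restrict_to)
      ultimately show ?thesis by blast
    qed
    then obtain f where f: "\<And>i. i < d \<Longrightarrow> (\<forall>m\<in>Poly_Mapping.keys (f i). Poly_Mapping.keys m \<subseteq> B) \<and> f i \<in> Q (Suc i) \<and> f i \<notin> Q i"
      by metis
    let ?fs = "map f [0..<d]"
    obtain T c where T: "finite T" "\<forall>es\<in>T. length es = length ?fs" "\<exists>es\<in>T. c es \<noteq> 0"
      "(\<Sum>es\<in>T. const (c es) * list_power ?fs es) = 0"
      using algebraic_dependence[OF finB, of ?fs] cB nd f by auto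
    have "(\<Sum>es\<in>T. const (c es) * list_power ?fs es) \<notin> Q 0"
    proof (rule prime_chain_no_relation)
      show "poly_prime n (Q i)" if "i \<le> length ?fs" for i using Q(1) that by simp
      show "Q i \<subseteq> Q (Suc i) \<and> ?fs ! i \<in> Q (Suc i) \<and> ?fs ! i \<notin> Q i" if "i < length ?fs" for i
        using f[of i] P(2)[of i] that by (auto simp: Q_def)
    qed (use T in auto)
    then show False using T(4) poly_idealD(2)[OF Q0] by simp
  qed
  ultimately show ?thesis
    unfolding quot_dim_def krull_dim_def edge_ideal_eq[OF E] by (intro cSup_eq_maximum) auto
qed

section \<open>Hilbert function\<close>

abbreviation coset :: "nat \<Rightarrow> 'k::field mpoly set \<Rightarrow> 'k mpoly \<Rightarrow> 'k mpoly set" where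
  "coset n I x \<equiv> I +>\<^bsub>poly_ring n\<^esub> x"

lemma coset_ring_ops:
  fixes I :: "'k::field mpoly set"
  assumes I: "poly_ideal n I"
  shows "x \<in> polys n \<Longrightarrow> y \<in> polys n \<Longrightarrow> coset n I x \<oplus>\<^bsub>poly_ring n Quot I\<^esub> coset n I y = coset n I (x + y)"
    "\<one>\<^bsub>poly_ring n Quot I\<^esub> = coset n I 1" "\<zero>\<^bsub>poly_ring n Quot I\<^esub> = coset n I 0"
    "x \<in> polys n \<Longrightarrow> coset n I x \<in> carrier (poly_ring n Quot I)"
proof -
  interpret I: ideal I "poly_ring n" using I by (simp add: ideal_poly_ring_iff)
  interpret h: ring_hom_ring "poly_ring n" "poly_ring n Quot I" "coset n I" by (rule I.rcos_ring_hom_ring)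
  show "x \<in> polys n \<Longrightarrow> y \<in> polys n \<Longrightarrow> coset n I x \<oplus>\<^bsub>poly_ring n Quot I\<^esub> coset n I y = coset n I (x + y)"
    using h.hom_add[of x y] by simp
  show "\<one>\<^bsub>poly_ring n Quot I\<^esub> = coset n I 1" using h.hom_one by simp
  show "\<zero>\<^bsub>poly_ring n Quot I\<^esub> = coset n I 0" using h.hom_zero by simp
  show "x \<in> polys n \<Longrightarrow> coset n I x \<in> carrier (poly_ring n Quot I)" by (rule h.hom_closed)
qed

lemma const_simps:
  "const a * const b = const (a * b)" "const a + const b = const (a + b)" "const 1 = 1" "const 0 = 0"
  "- const a = const (- a)"
  by (simp_all add: const_def mult_single single_add single_uminus)

lemma subfield_const:
  fixes I :: "'k::field mpoly set"
  assumes I: "poly_ideal n I" and proper: "1 \<notin> I"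
  shows "subfield (range (\<lambda>c. coset n I (const c))) (poly_ring n Quot I)"
proof -
  let ?A = "poly_ring n Quot I"
  let ?F = "range (\<lambda>c. coset n I (const c))"
  have id: "ideal I (poly_ring n)" using I by (simp add: ideal_poly_ring_iff)
  interpret A: cring ?A by (rule ideal.quotient_is_cring[OF id cring_poly_ring])
  note ops = coset_ring_ops[OF I]
  have carr: "coset n I (const c) \<in> carrier ?A" for c by (rule ops(4)) simp
  have mult: "coset n I (const a) \<otimes>\<^bsub>?A\<^esub> coset n I (const b) = coset n I (const (a * b))" for a b
    using quot_mult[OF I, of "const a" "const b"] by (simp add: const_simps)
  have add: "coset n I (const a) \<oplus>\<^bsub>?A\<^esub> coset n I (const b) = coset n I (const (a + b))" for a b
    using ops(1)[of "const a" "const b"] by (simp add: const_simps)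
  have one: "\<one>\<^bsub>?A\<^esub> = coset n I (const 1)" and zero: "\<zero>\<^bsub>?A\<^esub> = coset n I (const 0)"
    using ops(2,3) by (simp_all add: const_simps)
  have minus: "\<ominus>\<^bsub>?A\<^esub> coset n I (const a) = coset n I (const (- a))" for a
    by (rule A.minus_equality) (simp_all add: add carr zero)
  have "subring ?F ?A"
    by (rule A.subringI) (auto simp: carr one minus mult add)
  then have sub: "subcring ?F ?A" by (rule A.subcringI')
  have nz: "coset n I (const c) = \<zero>\<^bsub>?A\<^esub> \<longleftrightarrow> c = 0" for c
  proof
    assume "coset n I (const c) = \<zero>\<^bsub>?A\<^esub>"
    then have cI: "const c \<in> I" by (simp add: ops(3) coset_eq_iff[OF I])
    show "c = 0"
    proof (rule ccontr)
      assume "c \<noteq> 0"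
      then have "const (1 / c) * const c = 1" by (simp add: const_simps)
      then show False using poly_idealD(4)[OF I polys_const cI, of "1 / c"] proper by simp
    qed
  qed (simp add: zero)
  show ?thesis
  proof (rule A.subfieldI[OF sub])
    show "Units (?A\<lparr>carrier := ?F\<rparr>) = ?F - {\<zero>\<^bsub>?A\<^esub>}"
    proof (intro subset_antisym subsetI)
      fix x assume "x \<in> Units (?A\<lparr>carrier := ?F\<rparr>)"
      then obtain a b where ab: "x = coset n I (const a)" "coset n I (const a) \<otimes>\<^bsub>?A\<^esub> coset n I (const b) = \<one>\<^bsub>?A\<^esub>"
        by (auto simp: Units_def)
      have "a \<noteq> 0"
      proof
        assume "a = 0"
        then have "coset n I (const 1) = \<zero>\<^bsub>?A\<^esub>" using ab(2) by (simp add: mult one zero)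
        then show False using nz by simp
      qed
      then show "x \<in> ?F - {\<zero>\<^bsub>?A\<^esub>}" using ab(1) nz by auto
    next
      fix x assume x: "x \<in> ?F - {\<zero>\<^bsub>?A\<^esub>}"
      then obtain a where a: "x = coset n I (const a)" "a \<noteq> 0" using nz by auto
      have "coset n I (const (1 / a)) \<otimes>\<^bsub>?A\<^esub> x = \<one>\<^bsub>?A\<^esub>" "x \<otimes>\<^bsub>?A\<^esub> coset n I (const (1 / a)) = \<one>\<^bsub>?A\<^esub>"
        using a by (simp_all add: mult one)
      then show "x \<in> Units (?A\<lparr>carrier := ?F\<rparr>)" using x by (auto simp: Units_def)
    qed
  qed
qed

definition std_monos :: "nat \<Rightarrow> ((nat \<Rightarrow>\<^sub>0 nat) \<Rightarrow> bool) \<Rightarrow> nat \<Rightarrow> (nat \<Rightarrow>\<^sub>0 nat) set" where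
  "std_monos n P k = {m. Poly_Mapping.keys m \<subseteq> {1..n} \<and> monom_degree m = k \<and> \<not> P m}"

lemma lookup_le_degree: "Poly_Mapping.lookup m i \<le> monom_degree m"
proof (cases "i \<in> Poly_Mapping.keys m")
  case True
  then show ?thesis unfolding monom_degree_def by (intro member_le_sum) auto
qed (simp add: in_keys_iff)

lemma finite_monos_degree: "finite A \<Longrightarrow> finite {m. Poly_Mapping.keys m \<subseteq> A \<and> monom_degree m = k}"
  by (rule finite_subset[OF _ card_bounded_monomials(1)[of A k]]) (auto simp: lookup_le_degree)

lemma finite_std_monos: "finite (std_monos n P k)"
  by (rule finite_subset[OF _ finite_monos_degree[of "{1..n}" k]]) (auto simp: std_monos_def)

definition mono_comb :: "'k::field list \<Rightarrow> (nat \<Rightarrow>\<^sub>0 nat) list \<Rightarrow> 'k mpoly" where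
  "mono_comb cs ms = sum_list (map2 (\<lambda>c m. Poly_Mapping.single m c) cs ms)"

lemma mono_comb_polys:
  "(\<forall>m\<in>set ms. Poly_Mapping.keys m \<subseteq> {1..n}) \<Longrightarrow> mono_comb cs ms \<in> polys n"
proof (induction cs ms rule: list_induct2')
  case (4 c cs m ms)
  then show ?case by (auto simp: mono_comb_def intro!: polys_add polys_single)
qed (simp_all add: mono_comb_def)

lemma lookup_mono_comb_notin: "l \<notin> set ms \<Longrightarrow> Poly_Mapping.lookup (mono_comb cs ms) l = 0"
  by (induction cs ms rule: list_induct2') (auto simp: mono_comb_def lookup_add lookup_single when_def)

lemma lookup_mono_comb_nth:
  "distinct ms \<Longrightarrow> i < length ms \<Longrightarrow> i < length cs \<Longrightarrow> Poly_Mapping.lookup (mono_comb cs ms) (ms ! i) = cs ! i"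
proof (induction cs ms arbitrary: i rule: list_induct2')
  case (4 c cs m ms)
  have comb: "mono_comb (c # cs) (m # ms) = Poly_Mapping.single m c + mono_comb cs ms"
    by (simp add: mono_comb_def)
  show ?case
  proof (cases i)
    case 0
    then show ?thesis using 4 by (simp add: comb lookup_add lookup_mono_comb_notin)
  next
    case (Suc j)
    then have "ms ! j \<noteq> m" using 4 nth_mem[of j ms] by auto
    then show ?thesis using 4 Suc by (simp add: comb lookup_add lookup_single when_def)
  qed
qed simp_all

lemma mono_comb_map: "distinct ms \<Longrightarrow> mono_comb (map f ms) ms = (\<Sum>m\<in>set ms. Poly_Mapping.single m (f m))"
  by (simp add: mono_comb_def sum_list_distinct_conv_sum_set map2_map_map[of _ f ms id, simplified])

text \<open>The standard monomials of degree \<open>k\<close> form a basis of the graded piece.\<close>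

theorem hilbert_fun_mono_ideal:
  fixes P :: "(nat \<Rightarrow>\<^sub>0 nat) \<Rightarrow> bool"
  assumes P: "\<And>m m'. P m \<Longrightarrow> P (m' + m)" and P0: "\<not> P 0"
  shows "hilbert_fun n (mono_ideal n P :: 'k::field mpoly set) k = card (std_monos n P k)"
proof -
  let ?I = "mono_ideal n P :: 'k mpoly set"
  let ?A = "poly_ring n Quot ?I"
  let ?F = "range (\<lambda>c. coset n ?I (const c))"
  have I: "poly_ideal n ?I" by (rule poly_ideal_mono_ideal) (rule P)
  have id: "ideal ?I (poly_ring n)" using I by (simp add: ideal_poly_ring_iff)
  have "(1 :: 'k mpoly) \<notin> ?I"
  proof
    assume "(1 :: 'k mpoly) \<in> ?I"
    then have "\<forall>m\<in>Poly_Mapping.keys (1 :: 'k mpoly). P m" unfolding mono_ideal_def by blast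
    then show False using P0 by simp
  qed
  then have F: "subfield ?F ?A" by (rule subfield_const[OF I])
  interpret A: cring ?A by (rule ideal.quotient_is_cring[OF id cring_poly_ring])
  note ops = coset_ring_ops[OF I]
  obtain ms where ms: "set ms = std_monos n P k" "distinct ms" using finite_distinct_list[OF finite_std_monos] by blast
  have msn: "Poly_Mapping.keys m \<subseteq> {1..n}" "monom_degree m = k" "\<not> P m" if "m \<in> set ms" for m
    using that by (auto simp: ms(1) std_monos_def)
  let ?\<mu> = "\<lambda>m. coset n ?I (Poly_Mapping.single m 1)"
  have carr: "set (map ?\<mu> ms) \<subseteq> carrier ?A" using msn(1) ops(4) by auto
  have comb: "A.combine (map (\<lambda>c. coset n ?I (const c)) cs) (map ?\<mu> ls) = coset n ?I (mono_comb cs ls)"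
    if "\<forall>m\<in>set ls. Poly_Mapping.keys m \<subseteq> {1..n}" for cs ls
    using that
  proof (induction cs ls rule: list_induct2')
    case (4 c cs m ls)
    have "coset n ?I (const c) \<otimes>\<^bsub>?A\<^esub> ?\<mu> m = coset n ?I (Poly_Mapping.single m c)"
      using 4 by (subst quot_mult[OF I]) (auto simp: const_def mult_single intro!: polys_single)
    then show ?case
      using 4 ops(1)[of "Poly_Mapping.single m c" "mono_comb cs ls"] mono_comb_polys[of ls n cs]
      by (simp add: mono_comb_def polys_single)
  qed (simp_all add: mono_comb_def ops(3))
  have "A.independent ?F (map ?\<mu> ms)"
  proof (rule A.trivial_combine_imp_independent[OF F carr])
    fix Ks assume Ks: "set Ks \<subseteq> ?F" "A.combine Ks (map ?\<mu> ms) = \<zero>\<^bsub>?A\<^esub>"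
    have "Ks \<in> lists ?F" using Ks(1) by auto
    then obtain cs where cs: "Ks = map (\<lambda>c. coset n ?I (const c)) cs"
      by (auto simp: lists_image)
    have "coset n ?I (mono_comb cs ms) = coset n ?I 0"
      using Ks(2) comb[of ms cs] msn(1) by (simp add: cs ops(3))
    then have mI: "mono_comb cs ms \<in> ?I" by (simp add: coset_eq_iff[OF I])
    have "cs ! i = 0" if "i < length cs" "i < length ms" for i
    proof -
      have "\<not> P (ms ! i)" using that msn(3) nth_mem by blast
      then have "Poly_Mapping.lookup (mono_comb cs ms) (ms ! i) = 0"
        using mI by (auto simp: mono_ideal_def in_keys_iff)
      then show ?thesis using lookup_mono_comb_nth[OF ms(2) that(2,1)] by simp
    qed
    then show "set (take (length (map ?\<mu> ms)) Ks) \<subseteq> {\<zero>\<^bsub>?A\<^esub>}"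
      by (auto simp: cs in_set_conv_nth ops(3) const_simps)
  qed
  then have dim: "A.dimension (length (map ?\<mu> ms)) ?F (A.Span ?F (map ?\<mu> ms))" by (rule A.dimension_independent)
  have "A.Span ?F (map ?\<mu> ms) = coset n ?I ` hom_part n (int k)"
  proof (intro subset_antisym subsetI)
    fix x assume "x \<in> A.Span ?F (map ?\<mu> ms)"
    then obtain Ks where Ks: "set Ks \<subseteq> ?F" "x = A.combine Ks (map ?\<mu> ms)"
      unfolding A.Span_eq_combine_set_length_version[OF F carr] by blast
    have "Ks \<in> lists ?F" using Ks(1) by auto
    then obtain cs where cs: "Ks = map (\<lambda>c. coset n ?I (const c)) cs" by (auto simp: lists_image)
    have "x = coset n ?I (mono_comb cs ms)" using Ks(2) comb[of ms cs] msn(1) by (simp add: cs)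
    moreover have "mono_comb cs ms \<in> hom_part n (int k)"
      unfolding hom_part_def
    proof (intro CollectI conjI ballI)
      show "mono_comb cs ms \<in> polys n" using msn(1) by (intro mono_comb_polys) auto
      fix m assume "m \<in> Poly_Mapping.keys (mono_comb cs ms)"
      then have "m \<in> set ms" using lookup_mono_comb_notin[of m ms cs] by (auto simp: in_keys_iff)
      then show "int (monom_degree m) = int k" using msn by simp
    qed
    ultimately show "x \<in> coset n ?I ` hom_part n (int k)" by blast
  next
    fix x assume "x \<in> coset n ?I ` hom_part n (int k)"
    then obtain p where p: "p \<in> hom_part n (int k)" "x = coset n ?I p" by blast
    let ?cs = "map (Poly_Mapping.lookup p) ms"
    have pp: "p \<in> polys n" using p by (simp add: hom_part_def)
    have mp: "mono_comb ?cs ms \<in> polys n" using msn(1) by (intro mono_comb_polys) auto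
    have "p - mono_comb ?cs ms \<in> ?I"
    proof (rule mono_idealI)
      show "p - mono_comb ?cs ms \<in> polys n" using pp mp by simp
      fix m assume m: "Poly_Mapping.keys m \<subseteq> {1..n}" "\<not> P m"
      have "Poly_Mapping.lookup (mono_comb ?cs ms) m = (if m \<in> set ms then Poly_Mapping.lookup p m else 0)"
        unfolding mono_comb_map[OF ms(2)] lookup_sum lookup_single when_def by (rule sum.delta) simp
      moreover have "Poly_Mapping.lookup p m = 0" if "m \<notin> set ms"
        using that m hom_part_lookup[OF p(1), of m] by (auto simp: ms(1) std_monos_def)
      ultimately show "Poly_Mapping.lookup (p - mono_comb ?cs ms) m = 0" by (simp add: lookup_minus)
    qed
    then have "x = coset n ?I (mono_comb ?cs ms)" by (simp add: p(2) coset_eq_iff[OF I])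
    also have "\<dots> = A.combine (map (\<lambda>c. coset n ?I (const c)) ?cs) (map ?\<mu> ms)"
      using comb[of ms ?cs] msn(1) by simp
    finally show "x \<in> A.Span ?F (map ?\<mu> ms)"
      unfolding A.Span_eq_combine_set_length_version[OF F carr] by (force simp: image_iff)
  qed
  then have "(A.dim over ?F) (coset n ?I ` hom_part n (int k)) = length ms"
    using A.dimI[OF F dim] by simp
  moreover have "length ms = card (std_monos n P k)" using distinct_card[OF ms(2)] ms(1) by simp
  ultimately show ?thesis by (simp add: hilbert_fun_def Let_def)
qed

section \<open>The \<open>h\<close>-polynomial\<close>

definition monos_support :: "nat set \<Rightarrow> nat \<Rightarrow> (nat \<Rightarrow>\<^sub>0 nat) set" where
  "monos_support F k = {m. Poly_Mapping.keys m = F \<and> monom_degree m = k}"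

lemma finite_monos_support: "finite F \<Longrightarrow> finite (monos_support F k)"
  by (rule finite_subset[OF _ finite_monos_degree[of F k]]) (auto simp: monos_support_def)

lemma card_monos_support_Suc:
  assumes "finite F" "x \<notin> F"
  shows "card (monos_support (insert x F) (Suc k)) =
    card (monos_support (insert x F) k) + card (monos_support F k)"
proof -
  let ?f = "\<lambda>m. m + Poly_Mapping.single x (1::nat)"
  have "monos_support (insert x F) (Suc k) = ?f ` (monos_support (insert x F) k \<union> monos_support F k)"
  proof (intro subset_antisym subsetI)
    fix m assume m: "m \<in> monos_support (insert x F) (Suc k)"
    let ?m = "m - Poly_Mapping.single x 1"
    have x: "x \<in> Poly_Mapping.keys m" using m by (simp add: monos_support_def)
    have eq: "m = ?f ?m"
      using x by (intro poly_mapping_eqI) (auto simp: lookup_add lookup_minus lookup_single when_def in_keys_iff)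
    have "monom_degree ?m = k"
      using arg_cong[OF eq, of monom_degree] m by (simp add: monom_degree_add monos_support_def)
    moreover have "Poly_Mapping.keys ?m = insert x F \<or> Poly_Mapping.keys ?m = F"
    proof -
      have "insert x (Poly_Mapping.keys ?m) = insert x F"
        using arg_cong[OF eq, of Poly_Mapping.keys] m by (simp add: keys_add_nat monos_support_def)
      then show ?thesis using assms(2) by (metis insert_absorb insert_ident)
    qed
    ultimately show "m \<in> ?f ` (monos_support (insert x F) k \<union> monos_support F k)"
      using eq by (auto simp: monos_support_def)
  next
    fix m assume "m \<in> ?f ` (monos_support (insert x F) k \<union> monos_support F k)"
    then obtain l where l: "m = ?f l" "l \<in> monos_support (insert x F) k \<or> l \<in> monos_support F k" by blast
    have "Poly_Mapping.keys m = insert x (Poly_Mapping.keys l)" "monom_degree m = Suc (monom_degree l)"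
      unfolding l(1) keys_add_nat monom_degree_add by simp_all
    then show "m \<in> monos_support (insert x F) (Suc k)"
      using l(2) by (elim disjE) (simp_all add: monos_support_def)
  qed
  then have "card (monos_support (insert x F) (Suc k)) = card (monos_support (insert x F) k \<union> monos_support F k)"
    by (simp add: card_image inj_on_def)
  also have "\<dots> = card (monos_support (insert x F) k) + card (monos_support F k)"
    using assms by (intro card_Un_disjoint finite_monos_support) (auto simp: monos_support_def)
  finally show ?thesis .
qed

lemma monos_support_series:
  assumes "finite F"
  shows "Abs_fps (\<lambda>k. int (card (monos_support F k))) * (1 - fps_X) ^ card F = fps_X ^ card F"
  using assms
proof (induction F rule: finite_induct)
  case empty
  have "monos_support {} k = (if k = 0 then {0} else {})" for k
    by (auto simp: monos_support_def monom_degree_def)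
  then have "Abs_fps (\<lambda>k. int (card (monos_support {} k))) = 1"
    by (intro fps_ext) (simp add: fps_one_nth)
  then show ?case by simp
next
  case (insert x F)
  let ?H = "\<lambda>F. Abs_fps (\<lambda>k. int (card (monos_support F k)))"
  have "?H (insert x F) * (1 - fps_X) = fps_X * ?H F"
  proof (rule fps_ext)
    fix k
    have "monos_support (insert x F) 0 = {}"
    proof (rule ccontr)
      assume "monos_support (insert x F) 0 \<noteq> {}"
      then obtain m where m: "Poly_Mapping.keys m = insert x F" "monom_degree m = 0" by (auto simp: monos_support_def)
      then have "Poly_Mapping.lookup m x = 0" using lookup_le_degree[of m x] by simp
      moreover have "x \<in> Poly_Mapping.keys m" using m by simp
      ultimately show False by (simp add: in_keys_iff)
    qed
    then show "fps_nth (?H (insert x F) * (1 - fps_X)) k = fps_nth (fps_X * ?H F) k"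
      using card_monos_support_Suc[OF insert.hyps, of "k - 1"]
      by (cases k) (simp_all add: right_diff_distrib)
  qed
  then have "?H (insert x F) * (1 - fps_X) ^ card (insert x F) = fps_X * (?H F * (1 - fps_X) ^ card F)"
    using insert.hyps by (simp add: mult.assoc[symmetric])
  then show ?case using insert by simp
qed

text \<open>Sorting the standard monomials by their support \<open>F\<close> writes the Hilbert series as the sum of
\<open>t\<^sup>k / (1 - t)\<^sup>k\<close>, \<open>k = card F\<close>, over the independent sets \<open>F\<close>. So \<open>h\<close> is the sum of
\<open>t\<^sup>k * (1 - t)\<^sup>d\<^sup>-\<^sup>k\<close>, and its coefficient at \<open>t\<^sup>d\<close> is the Euler characteristic up to sign.\<close>

theorem degree_h_poly_edge_ideal:
  assumes E: "simple_graph {1..n} E" and d: "quot_dim n (edge_ideal n E :: 'k::field mpoly set) = d"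
    and le: "\<And>F. F \<in> indeps E {1..n} \<Longrightarrow> card F \<le> d"
    and chi: "(\<Sum>F\<in>indeps E {1..n}. (- 1) ^ card F) \<noteq> (0::int)"
  shows "degree (h_poly n (edge_ideal n E :: 'k mpoly set)) = d"
proof -
  let ?I = "edge_ideal n E :: 'k mpoly set"
  let ?\<Delta> = "indeps E {1..n}"
  have fin\<Delta>: "finite ?\<Delta>" by (rule finite_subset[of _ "Pow {1..n}"]) (auto simp: indeps_def)
  have finF: "finite F" if "F \<in> ?\<Delta>" for F
  proof -
    have "F \<subseteq> {1..n}" using that by (simp add: indeps_def)
    then show ?thesis by (rule finite_subset_ivl)
  qed
  have E2: "\<forall>e\<in>E. card e = 2" using E by (simp add: simple_graph_def)
  have std: "std_monos n (edge_mono E) k = (\<Union>F\<in>?\<Delta>. monos_support F k)" for k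
    by (auto simp: std_monos_def monos_support_def indeps_def edge_mono_def)
  have "card (std_monos n (edge_mono E) k) = (\<Sum>F\<in>?\<Delta>. card (monos_support F k))" for k
    unfolding std using fin\<Delta> finite_monos_support[OF finF]
    by (intro card_UN_disjoint) (auto simp: monos_support_def)
  moreover have "\<not> edge_mono E 0" using E2 by (auto simp: edge_mono_def)
  ultimately have hf: "hilbert_fun n ?I k = (\<Sum>F\<in>?\<Delta>. card (monos_support F k))" for k
    unfolding edge_ideal_eq[OF E] using hilbert_fun_mono_ideal[of "edge_mono E" n k] edge_mono_add by metis
  define h where "h = (\<Sum>F\<in>?\<Delta>. monom 1 (card F) * [:1, - 1:] ^ (d - card F) :: int poly)"
  have "hilbert_series n ?I = (\<Sum>F\<in>?\<Delta>. Abs_fps (\<lambda>k. int (card (monos_support F k))))"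
    unfolding hilbert_series_def hf by (rule fps_ext) (simp add: fps_sum_nth)
  then have "hilbert_series n ?I * (1 - fps_X) ^ d =
      (\<Sum>F\<in>?\<Delta>. Abs_fps (\<lambda>k. int (card (monos_support F k))) * (1 - fps_X) ^ d)"
    by (simp add: sum_distrib_right)
  also have "\<dots> = (\<Sum>F\<in>?\<Delta>. fps_X ^ card F * (1 - fps_X) ^ (d - card F))"
  proof (rule sum.cong[OF refl])
    fix F assume F: "F \<in> ?\<Delta>"
    have e: "(1 - fps_X) ^ d = (1 - fps_X :: int fps) ^ card F * (1 - fps_X) ^ (d - card F)"
      using le[OF F] by (simp flip: power_add)
    show "Abs_fps (\<lambda>k. int (card (monos_support F k))) * (1 - fps_X) ^ d =
        fps_X ^ card F * (1 - fps_X) ^ (d - card F)"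
      unfolding e mult.assoc[symmetric] monos_support_series[OF finF[OF F]] ..
  qed
  also have "\<dots> = fps_of_poly h"
  proof -
    have lin: "fps_of_poly [:1, - 1:] = (1 - fps_X :: int fps)"
      by (simp add: fps_of_poly_pCons)
    show ?thesis
      unfolding h_def fps_of_poly_sum fps_of_poly_mult fps_of_poly_power fps_of_poly_monom lin by simp
  qed
  finally have h: "hilbert_series n ?I * (1 - fps_X) ^ d = fps_of_poly h" .
  have "h_poly n ?I = h"
    unfolding h_poly_def d h by (rule the_equality) auto
  moreover have "degree h \<le> d"
    unfolding h_def
  proof (rule degree_sum_le[OF fin\<Delta>])
    fix F assume F: "F \<in> ?\<Delta>"
    have "degree (monom (1::int) (card F) * [:1, - 1:] ^ (d - card F)) \<le> card F + (d - card F)"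
      by (rule order_trans[OF degree_mult_le]) (simp add: degree_monom_eq degree_power_eq)
    then show "degree (monom (1::int) (card F) * [:1, - 1:] ^ (d - card F)) \<le> d" using le[OF F] by simp
  qed
  moreover have "coeff h d = (\<Sum>F\<in>?\<Delta>. (- 1) ^ (d - card F))"
    unfolding h_def coeff_sum
  proof (rule sum.cong[OF refl])
    fix F assume F: "F \<in> ?\<Delta>"
    have "lead_coeff ([:1, - 1:] ^ (d - card F) :: int poly) = (- 1) ^ (d - card F)"
      by (simp add: lead_coeff_power)
    moreover have "degree ([:1, - 1:] ^ (d - card F) :: int poly) = d - card F" by (simp add: degree_power_eq)
    ultimately show "coeff (monom (1::int) (card F) * [:1, - 1:] ^ (d - card F)) d = (- 1) ^ (d - card F)"
      using le[OF F] by (simp add: coeff_monom_mult)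
  qed
  then have "coeff h d = (- 1) ^ d * (\<Sum>F\<in>?\<Delta>. (- 1) ^ card F)"
  proof -
    have "(- 1 :: int) ^ (d - card F) = (- 1) ^ d * (- 1) ^ card F" if "F \<in> ?\<Delta>" for F
    proof -
      have "(- 1 :: int) ^ d = (- 1) ^ (d - card F) * (- 1) ^ card F" using le[OF that] by (simp flip: power_add)
      then show ?thesis by (simp flip: power_mult_distrib add: mult.assoc)
    qed
    then show ?thesis using \<open>coeff h d = _\<close> by (simp add: sum_distrib_left)
  qed
  then have "coeff h d \<noteq> 0" using chi by simp
  ultimately show ?thesis using le_degree[of h d] by (metis le_antisym)
qed

section \<open>The shape of Cameron--Walker graphs\<close>

text \<open>Each vertex \<open>a\<close> of \<open>A\<close> has a leaf \<open>lf a\<close>, the members \<open>e\<close> of \<open>T\<close> are the bases of triangles with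
apex \<open>ap e\<close>, and \<open>G\<close> is the bipartite graph between \<open>A\<close> and \<open>U\<close>. Only one leaf is singled out at each
vertex of \<open>A\<close>; all others are counted in \<open>U\<close>.\<close>

locale cw_shape =
  fixes n :: nat and E :: "nat set set" and A :: "nat set" and lf :: "nat \<Rightarrow> nat" and U :: "nat set"
    and T :: "nat set set" and ap :: "nat set \<Rightarrow> nat" and G :: "(nat \<times> nat) set"
  assumes verts: "{1..n} = A \<union> lf ` A \<union> U \<union> \<Union>T"
    and disj: "A \<inter> lf ` A = {}" "A \<inter> U = {}" "A \<inter> \<Union>T = {}" "lf ` A \<inter> U = {}" "lf ` A \<inter> \<Union>T = {}" "U \<inter> \<Union>T = {}"
    and inj_lf: "inj_on lf A"
    and card_T: "\<And>e. e \<in> T \<Longrightarrow> card e = 2" and disjnt_T: "pairwise disjnt T"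
    and ap: "\<And>e. e \<in> T \<Longrightarrow> ap e \<in> U"
    and G: "G \<subseteq> A \<times> U" and dom: "\<And>u. u \<in> U \<Longrightarrow> \<exists>a. (a, u) \<in> G"
    and edges: "E = {{a, lf a} | a. a \<in> A} \<union> {{a, u} | a u. (a, u) \<in> G} \<union> T \<union> {{x, ap e} | x e. e \<in> T \<and> x \<in> e}"
begin

lemma subs: "A \<subseteq> {1..n}" "lf ` A \<subseteq> {1..n}" "U \<subseteq> {1..n}" "\<Union>T \<subseteq> {1..n}"
  unfolding verts by auto

lemma fin: "finite A" "finite U" "finite T" "finite (\<Union>T)" "finite G"
proof -
  show "finite A" "finite U" "finite (\<Union>T)" using subs finite_subset_ivl by auto
  then show "finite T" "finite G" using finite_UnionD finite_subset[OF G] by auto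
qed

lemma sep:
  "a \<in> A \<Longrightarrow> a \<noteq> lf b \<or> b \<notin> A" "a \<in> A \<Longrightarrow> a \<notin> U" "a \<in> A \<Longrightarrow> e \<in> T \<Longrightarrow> a \<notin> e"
  "a \<in> A \<Longrightarrow> lf a \<notin> U" "a \<in> A \<Longrightarrow> lf a \<notin> A" "a \<in> A \<Longrightarrow> e \<in> T \<Longrightarrow> lf a \<notin> e" "u \<in> U \<Longrightarrow> e \<in> T \<Longrightarrow> u \<notin> e"
  using disj by auto

lemma same_triangle: "e \<in> T \<Longrightarrow> e' \<in> T \<Longrightarrow> x \<in> e \<Longrightarrow> x \<in> e' \<Longrightarrow> e = e'"
  using disjnt_T by (auto simp: pairwise_def disjnt_def)

lemma GD: "(a, u) \<in> G \<Longrightarrow> a \<in> A" "(a, u) \<in> G \<Longrightarrow> u \<in> U"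
  using G by auto

lemma adj_iff:
  "{x, y} \<in> E \<longleftrightarrow> (x \<in> A \<and> y = lf x) \<or> (y \<in> A \<and> x = lf y) \<or> (x, y) \<in> G \<or> (y, x) \<in> G \<or> {x, y} \<in> T \<or>
    (\<exists>e\<in>T. x \<in> e \<and> y = ap e) \<or> (\<exists>e\<in>T. y \<in> e \<and> x = ap e)"
  unfolding edges by (auto simp: doubleton_eq_iff)

lemma adj_A: "a \<in> A \<Longrightarrow> {x, a} \<in> E \<longleftrightarrow> x = lf a \<or> (a, x) \<in> G"
  unfolding adj_iff using sep GD ap by (smt (verit) insert_iff)

lemma adj_lf: "a \<in> A \<Longrightarrow> {x, lf a} \<in> E \<longleftrightarrow> x = a"
  unfolding adj_iff using sep GD ap inj_lf by (smt (verit) insert_iff inj_onD)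

lemma adj_U: "u \<in> U \<Longrightarrow> {x, u} \<in> E \<longleftrightarrow> (x, u) \<in> G \<or> (\<exists>e\<in>T. x \<in> e \<and> ap e = u)"
  unfolding adj_iff using sep GD ap by (smt (verit) insert_iff)

lemma adj_T: "e \<in> T \<Longrightarrow> y \<in> e \<Longrightarrow> {x, y} \<in> E \<longleftrightarrow> (x \<in> e \<and> x \<noteq> y) \<or> x = ap e"
proof -
  assume e: "e \<in> T" "y \<in> e"
  have "{x, y} \<in> T \<longleftrightarrow> x \<in> e \<and> x \<noteq> y"
  proof
    assume "{x, y} \<in> T"
    then have "{x, y} = e" "card {x, y} = 2" using same_triangle[of "{x, y}" e y] e card_T by auto
    then show "x \<in> e \<and> x \<noteq> y" by auto
  next
    assume "x \<in> e \<and> x \<noteq> y"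
    then have "e = {x, y}" using card_T[OF e(1)] e(2) by (auto simp: card_2_iff)
    then show "{x, y} \<in> T" using e by simp
  qed
  moreover have "y \<notin> A" "y \<notin> U" "\<And>a. a \<in> A \<Longrightarrow> y \<noteq> lf a" using sep e by blast+
  moreover have "(\<exists>e'\<in>T. y \<in> e' \<and> x = ap e') \<longleftrightarrow> x = ap e" using same_triangle e by blast
  moreover have "\<not> (\<exists>e'\<in>T. x \<in> e' \<and> y = ap e')" using ap \<open>y \<notin> U\<close> by blast
  moreover have "(x, y) \<notin> G" "(y, x) \<notin> G" using GD \<open>y \<notin> A\<close> \<open>y \<notin> U\<close> by blast+
  ultimately show ?thesis unfolding adj_iff by blast
qed

lemma edge_card: "\<forall>e\<in>E. card e = 2"
proof
  fix f assume "f \<in> E"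
  then consider a where "f = {a, lf a}" "a \<in> A" | a u where "f = {a, u}" "(a, u) \<in> G" | "f \<in> T"
    | x e where "f = {x, ap e}" "e \<in> T" "x \<in> e"
    unfolding edges by blast
  then show "card f = 2"
  proof cases
    case 1
    then show ?thesis using sep(5)[of a] by (auto simp: card_insert_if)
  next
    case 2
    then show ?thesis using sep(2)[OF GD(1)[OF 2(2)]] GD(2)[OF 2(2)] by (auto simp: card_insert_if)
  next
    case 3
    then show ?thesis by (rule card_T)
  next
    case 4
    then show ?thesis using sep(7)[OF ap[OF 4(2)] 4(2)] by (auto simp: card_insert_if)
  qed
qed

lemma simple: "simple_graph {1..n} E"
  unfolding simple_graph_def
proof (intro conjI ballI)
  fix f assume "f \<in> E"
  then show "f \<subseteq> {1..n}" unfolding verts edges using GD ap by blast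
qed (use edge_card in auto)

subsection \<open>Counting\<close>

lemma card_UnT: "card (\<Union>T) = 2 * card T"
proof -
  have "card (\<Union>T) = (\<Sum>e\<in>T. card e)"
    using disjnt_T card_T by (intro card_Union_disjoint) (auto intro: card_ge_0_finite)
  then show ?thesis using card_T by simp
qed

lemma card_n: "n = 2 * card A + card U + 2 * card T"
proof -
  have "n = card {1..n}" by simp
  also have "\<dots> = card (A \<union> lf ` A \<union> U) + card (\<Union>T)"
    unfolding verts using fin disj by (intro card_Un_disjoint) auto
  also have "card (A \<union> lf ` A \<union> U) = card (A \<union> lf ` A) + card U"
    using fin disj by (intro card_Un_disjoint) auto
  also have "card (A \<union> lf ` A) = card A + card (lf ` A)"
    using fin disj by (intro card_Un_disjoint) auto
  finally show ?thesis using card_image[OF inj_lf] card_UnT by simp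
qed

definition U0 :: "nat set" where "U0 = U - ap ` T"
definition U1 :: "nat set" where "U1 = ap ` T"

lemma U_split: "U = U0 \<union> U1" "U0 \<inter> U1 = {}" "finite U0" "finite U1" "card U = card U0 + card U1" "U1 \<subseteq> U" "U0 \<subseteq> U"
proof -
  show *: "U = U0 \<union> U1" "U0 \<inter> U1 = {}" "finite U0" "finite U1" "U1 \<subseteq> U" "U0 \<subseteq> U"
    using ap fin by (auto simp: U0_def U1_def)
  then show "card U = card U0 + card U1" using card_Un_disjoint[of U0 U1] by simp
qed

lemma card_U1_le: "card U1 \<le> card T"
  unfolding U1_def using fin(3) by (rule card_image_le)

subsection \<open>Matchings\<close>

definition M0 :: "nat set set" where "M0 = (\<lambda>a. {a, lf a}) ` A \<union> T"

lemma card_M0: "card M0 = card A + card T"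
proof -
  have "inj_on (\<lambda>a. {a, lf a}) A"
    using sep(1) by (intro inj_onI) (metis doubleton_eq_iff)
  moreover have "(\<lambda>a. {a, lf a}) ` A \<inter> T = {}" using sep(3) by auto
  ultimately show ?thesis unfolding M0_def using fin by (simp add: card_Un_disjoint card_image)
qed

text \<open>All edges which do not meet \<open>U\<close> belong to \<open>M0\<close>, and an edge between two members of \<open>M0\<close>
  would not meet \<open>U\<close>.\<close>

lemma induced_M0: "induced_matching E M0"
proof -
  have key: "e = e'" if "e \<in> M0" "e' \<in> M0" "x \<in> e" "y \<in> e'" "x = y \<or> {x, y} \<in> E" for e e' x y
  proof -
    have disjoint: "\<Union>M0 \<inter> U = {}" using disj by (auto simp: M0_def)
    have eM: "(\<exists>b\<in>A. e = {b, lf b}) \<or> e \<in> T" using that(1) by (auto simp: M0_def)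
    have yU: "x \<notin> U" "y \<notin> U" using disjoint that by auto
    from that(2) consider a where "a \<in> A" "e' = {a, lf a}" | "e' \<in> T" by (auto simp: M0_def)
    then show ?thesis
    proof cases
      case 1
      then have xa: "x = a \<or> x = lf a"
        using that(4,5) adj_A[OF 1(1), of x] adj_lf[OF 1(1), of x] yU(1) GD by auto
      have "e \<notin> T" using xa that(3) sep(3,6)[OF 1(1), of e] by auto
      then obtain b where b: "b \<in> A" "e = {b, lf b}" using eM by blast
      have "lf b \<noteq> a" "lf a \<noteq> b" using sep(5)[OF b(1)] sep(5)[OF 1(1)] 1(1) b(1) by auto
      moreover have "x = b \<or> x = lf b" using that(3) b(2) by simp
      ultimately have "b = a" using xa inj_onD[OF inj_lf _ b(1) 1(1)] by metis
      then show ?thesis using b 1 by simp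
    next
      case 2
      have xe: "x \<in> e'" using that(4,5) adj_T[OF 2 that(4), of x] yU(1) ap[OF 2] by metis
      have "e \<in> T"
      proof (rule ccontr)
        assume "e \<notin> T"
        then obtain b where "b \<in> A" "e = {b, lf b}" using eM by blast
        then show False using xe that(3) sep(3,6)[of b, OF _ 2] by auto
      qed
      then show ?thesis using same_triangle[OF _ 2 that(3)] xe by blast
    qed
  qed
  have "M0 \<subseteq> E" by (auto simp: M0_def edges)
  moreover have "pairwise disjnt M0" using key by (auto simp: pairwise_def disjnt_def)
  moreover have False if "e \<in> M0" "e' \<in> M0" "e \<noteq> e'" "f \<in> E" "f \<inter> e \<noteq> {}" "f \<inter> e' \<noteq> {}" for e e' f
  proof -
    obtain x y where xy: "x \<in> f" "x \<in> e" "y \<in> f" "y \<in> e'"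
      using \<open>f \<inter> e \<noteq> {}\<close> \<open>f \<inter> e' \<noteq> {}\<close> by blast
    have "card f = 2" using edge_card that(4) by blast
    then have "x = y \<or> f = {x, y}" using xy by (auto simp: card_2_iff)
    then show False using key[OF that(1,2) xy(2,4)] that(3,4) by auto
  qed
  ultimately show ?thesis unfolding induced_matching_def matching_def by blast
qed

text \<open>Two disjoint edges meet different members of \<open>M0\<close>: an edge at \<open>A\<close> is charged to its
  vertex in \<open>A\<close>, any other edge lies in a triangle and is charged to its base.\<close>

lemma matching_le: "matching E N \<Longrightarrow> card N \<le> card A + card T"
proof -
  assume N: "matching E N"
  then have NE: "N \<subseteq> E" and dN: "\<And>f f' x. f \<in> N \<Longrightarrow> f' \<in> N \<Longrightarrow> x \<in> f \<Longrightarrow> x \<in> f' \<Longrightarrow> f = f'"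
    unfolding matching_def pairwise_def disjnt_def by blast+
  have "finite N" by (rule finite_subset[OF NE finite_edges[OF simple]])
  let ?N1 = "{f\<in>N. f \<inter> A \<noteq> {}}" and ?N2 = "{f\<in>N. f \<inter> A = {}}"
  have "\<forall>f\<in>?N1. \<exists>a. a \<in> f \<and> a \<in> A" by blast
  then obtain g where g: "\<forall>f\<in>?N1. g f \<in> f \<and> g f \<in> A" by metis
  have inj1: "inj_on g ?N1"
  proof (rule inj_onI)
    fix f f' assume "f \<in> ?N1" "f' \<in> ?N1" "g f = g f'"
    then show "f = f'" using g dN[of f f' "g f"] by auto
  qed
  have c1: "card ?N1 \<le> card A" by (rule card_inj_on_le[OF inj1]) (use g fin in auto)
  have "\<exists>e. e \<in> T \<and> f \<subseteq> insert (ap e) e" if f: "f \<in> ?N2" for f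
  proof -
    have fE: "f \<in> E" and fA: "f \<inter> A = {}" using f NE by auto
    from fE consider a where "f = {a, lf a}" "a \<in> A" | a u where "f = {a, u}" "(a, u) \<in> G" | "f \<in> T"
      | x e where "f = {x, ap e}" "e \<in> T" "x \<in> e"
      unfolding edges by blast
    then show ?thesis
    proof cases
      case 2
      then show ?thesis using fA GD(1) by blast
    qed (use fA in blast)+
  qed
  then have "\<forall>f\<in>?N2. \<exists>e. e \<in> T \<and> f \<subseteq> insert (ap e) e" by (rule ballI)
  from bchoice[OF this] obtain h where
    h0: "\<forall>f\<in>?N2. h f \<in> T \<and> f \<subseteq> insert (ap (h f)) (h f)" ..
  note h = bspec[OF h0]
  have inj2: "inj_on h ?N2"
  proof (rule inj_onI, rule ccontr)
    fix f f' assume f: "f \<in> ?N2" "f' \<in> ?N2" "h f = h f'" "f \<noteq> f'"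
    have "f \<inter> f' = {}" using dN f by blast
    moreover have cf: "card f = 2" "card f' = 2" using f NE edge_card by auto
    then have finf: "finite f" "finite f'" by (auto intro: card_ge_0_finite)
    ultimately have "card (f \<union> f') = 4" using cf by (simp add: card_Un_disjoint)
    have finh: "finite (h f)" using card_T[of "h f"] h[OF f(1)] by (auto intro: card_ge_0_finite)
    have "f \<union> f' \<subseteq> insert (ap (h f)) (h f)" using h[OF f(1)] h[OF f(2)] f(3) by auto
    then have "card (f \<union> f') \<le> card (insert (ap (h f)) (h f))" using finh by (intro card_mono) auto
    also have "\<dots> \<le> Suc (card (h f))" using finh by (simp add: card_insert_if)
    also have "\<dots> = 3" using card_T[of "h f"] h[OF f(1)] by simp
    finally show False using \<open>card (f \<union> f') = 4\<close> by simp
  qed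
  have c2: "card ?N2 \<le> card T" by (rule card_inj_on_le[OF inj2]) (use h0 fin in auto)
  have "N = ?N1 \<union> ?N2" by blast
  then have "card N \<le> card ?N1 + card ?N2" using card_Un_le[of ?N1 ?N2] by metis
  then show ?thesis using c1 c2 by simp
qed

lemma matching_numbers: "matching_number E = card A + card T" "induced_matching_number E = card A + card T"
proof -
  note finE = finite_edges[OF simple]
  have "matching E M0" using induced_M0 by (simp add: induced_matching_def)
  then have *: "card A + card T \<le> matching_number E" using matching_number_props(1)[OF finE, of M0] card_M0 by simp
  obtain M where "matching E M" "card M = matching_number E" using matching_number_props(2)[OF finE] by blast
  then show "matching_number E = card A + card T" using * matching_le[of M] by simp
  have *: "card A + card T \<le> induced_matching_number E"
    using induced_matching_number_props(1)[OF finE induced_M0] card_M0 by simp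
  obtain M where "induced_matching E M" "card M = induced_matching_number E"
    using induced_matching_number_props(2)[OF finE] by blast
  then show "induced_matching_number E = card A + card T"
    using * matching_le[of M] by (simp add: induced_matching_def)
qed

subsection \<open>Independent sets\<close>

definition pick :: "nat set \<Rightarrow> nat" where "pick e = (SOME x. x \<in> e)"

lemma pick: "e \<in> T \<Longrightarrow> pick e \<in> e"
  unfolding pick_def using card_T[of e] by (cases "e = {}") (simp_all add: some_in_eq)

text \<open>The independent set with given traces \<open>A'\<close> on \<open>A\<close> and \<open>B\<close> on \<open>U\<close> which is completed by leaves and by one
base vertex of each triangle with apex outside \<open>B\<close>.\<close>

definition std_set :: "nat set \<Rightarrow> nat set \<Rightarrow> nat set" where
  "std_set A' B = A' \<union> lf ` (A - A') \<union> B \<union> pick ` {e\<in>T. ap e \<notin> B}"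

lemma std_set_cases:
  assumes "x \<in> std_set A' B"
  obtains (A) "x \<in> A'" | (lf) a where "a \<in> A" "a \<notin> A'" "x = lf a" | (U) "x \<in> B"
    | (T) e where "e \<in> T" "x = pick e" "x \<in> e" "ap e \<notin> B"
  using assms pick unfolding std_set_def by (elim UnE imageE) auto

lemma std_set_Int_U: "A' \<subseteq> A \<Longrightarrow> B \<subseteq> U \<Longrightarrow> std_set A' B \<inter> U = B"
proof (intro subset_antisym subsetI)
  fix x assume "A' \<subseteq> A" "x \<in> std_set A' B \<inter> U"
  then have "x \<in> std_set A' B" "x \<in> U" by auto
  then show "x \<in> B"
  proof (cases rule: std_set_cases)
    case A
    then show ?thesis using sep(2)[of x] \<open>A' \<subseteq> A\<close> \<open>x \<in> U\<close> by blast
  next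
    case (lf a)
    then show ?thesis using sep(4)[of a] \<open>x \<in> U\<close> by blast
  next
    case (T e)
    then show ?thesis using sep(7)[OF \<open>x \<in> U\<close>, of e] by blast
  qed
qed (auto simp: std_set_def)

lemma indep_iff: "F \<in> indeps E {1..n} \<longleftrightarrow> F \<subseteq> {1..n} \<and> (\<forall>x\<in>F. \<forall>y\<in>F. {x, y} \<notin> E)"
proof
  assume F: "F \<in> indeps E {1..n}"
  have "{x, y} \<notin> E" if "x \<in> F" "y \<in> F" for x y
  proof
    assume "{x, y} \<in> E"
    have "\<forall>e\<in>E. \<not> e \<subseteq> F" using F by (simp add: indeps_def)
    from bspec[OF this \<open>{x, y} \<in> E\<close>] show False using that by simp
  qed
  then show "F \<subseteq> {1..n} \<and> (\<forall>x\<in>F. \<forall>y\<in>F. {x, y} \<notin> E)" using F by (simp add: indeps_def)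
next
  assume F: "F \<subseteq> {1..n} \<and> (\<forall>x\<in>F. \<forall>y\<in>F. {x, y} \<notin> E)"
  have "\<not> e \<subseteq> F" if "e \<in> E" for e
  proof
    assume "e \<subseteq> F"
    have "card e = 2" using edge_card that by blast
    then obtain x y where "e = {x, y}" by (auto simp: card_2_iff)
    then show False using F that \<open>e \<subseteq> F\<close> by simp
  qed
  then show "F \<in> indeps E {1..n}" using F by (simp add: indeps_def)
qed

lemma indep_std_set:
  assumes A': "A' \<subseteq> A" and B: "B \<subseteq> U" and no: "\<And>a b. a \<in> A' \<Longrightarrow> b \<in> B \<Longrightarrow> (a, b) \<notin> G"
  shows "std_set A' B \<in> indeps E {1..n}"
  unfolding indep_iff
proof (intro conjI ballI)
  let ?S = "std_set A' B"
  have "?S \<subseteq> {1..n}"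
  proof
    fix x assume "x \<in> ?S"
    then show "x \<in> {1..n}" by (cases rule: std_set_cases) (use A' B in \<open>unfold verts, blast+\<close>)
  qed
  then show "?S \<subseteq> {1..n}" .
  have cases: "x \<in> A' \<or> (\<exists>a. a \<in> A \<and> a \<notin> A' \<and> x = lf a) \<or> x \<in> B \<or> (\<exists>e\<in>T. x = pick e \<and> x \<in> e \<and> ap e \<notin> B)"
    if "x \<in> ?S" for x
    using that by (cases rule: std_set_cases) blast+
  have S_A: "x \<in> A'" if "x \<in> ?S" "x \<in> A" for x
  proof -
    have "x \<noteq> lf a" if "a \<in> A" for a using sep(5)[OF that] \<open>x \<in> A\<close> by auto
    moreover have "x \<notin> B" using sep(2)[OF that(2)] B by auto
    moreover have "x \<notin> e" if "e \<in> T" for e using sep(3)[OF \<open>x \<in> A\<close> that] .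
    ultimately show ?thesis using cases[OF that(1)] by metis
  qed
  have S_lf: "a \<notin> A'" if "lf a \<in> ?S" "a \<in> A" for a
  proof -
    have "a' = a" if "a' \<in> A" "lf a = lf a'" for a' using inj_onD[OF inj_lf that(2) \<open>a \<in> A\<close> that(1)] by simp
    moreover have "lf a \<notin> A'" "lf a \<notin> B" using sep(4,5)[OF that(2)] A' B by auto
    moreover have "lf a \<notin> e" if "e \<in> T" for e using sep(6)[OF \<open>a \<in> A\<close> that] .
    ultimately show ?thesis using cases[OF that(1)] by metis
  qed
  have S_U: "x \<in> B" if "x \<in> ?S" "x \<in> U" for x
    using that std_set_Int_U[OF A' B] by blast
  have S_T: "x = pick e \<and> ap e \<notin> B" if "x \<in> ?S" "e \<in> T" "x \<in> e" for x e
  proof -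
    have "x \<notin> A" "x \<notin> U" "\<And>a. a \<in> A \<Longrightarrow> x \<noteq> lf a" using sep that(2,3) by blast+
    then obtain e' where "e' \<in> T" "x = pick e'" "x \<in> e'" "ap e' \<notin> B" using cases[OF \<open>x \<in> ?S\<close>] A' B by blast
    then show ?thesis using same_triangle[of e' e x] that(2,3) by blast
  qed
  fix x y assume x: "x \<in> ?S" and y: "y \<in> ?S"
  have "y \<in> {1..n}" using \<open>?S \<subseteq> {1..n}\<close> y by blast
  then consider "y \<in> A" | a where "a \<in> A" "y = lf a" | "y \<in> U" | e where "e \<in> T" "y \<in> e" unfolding verts by blast
  then show "{x, y} \<notin> E"
  proof cases
    case 1
    have "x \<noteq> lf y" using S_A[OF y 1] S_lf[of y] x 1 by metis
    moreover have "(y, x) \<notin> G" using no[OF S_A[OF y 1] S_U[OF x]] GD(2) by metis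
    ultimately show ?thesis unfolding adj_A[OF 1] by simp
  next
    case 2
    have "x \<noteq> a" using S_A[of a] S_lf[of a] x y 2 by metis
    then show ?thesis unfolding 2(2) adj_lf[OF 2(1)] .
  next
    case 3
    have "(x, y) \<notin> G" using no[OF S_A[OF x] S_U[OF y 3]] GD(1) by metis
    moreover have "ap e \<noteq> y" if "e \<in> T" "x \<in> e" for e using S_T[OF x that] S_U[OF y 3] by auto
    ultimately show ?thesis unfolding adj_U[OF 3] by blast
  next
    case 4
    have "\<not> (x \<in> e \<and> x \<noteq> y)" using S_T[OF x 4(1)] S_T[OF y 4] by blast
    moreover have "x \<noteq> ap e" using S_T[OF y 4] S_U[OF x] ap[OF 4(1)] by auto
    ultimately show ?thesis unfolding adj_T[OF 4] by simp
  qed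
qed

text \<open>Only the vertices of \<open>U\<close> without a triangle need an assumption: an apex outside \<open>B\<close> has a neighbour in the base
of its triangle.\<close>

lemma max_indep_std_set:
  assumes A': "A' \<subseteq> A" and B: "B \<subseteq> U" and no: "\<And>a b. a \<in> A' \<Longrightarrow> b \<in> B \<Longrightarrow> (a, b) \<notin> G"
    and domB: "\<And>u. u \<in> U0 - B \<Longrightarrow> \<exists>a\<in>A'. (a, u) \<in> G"
  shows "max_indep E {1..n} (std_set A' B)"
  unfolding max_indep_def
proof (intro conjI ballI)
  show "std_set A' B \<in> indeps E {1..n}" by (rule indep_std_set[OF A' B no])
  fix v assume v: "v \<in> {1..n} - std_set A' B"
  then consider "v \<in> A" | a where "a \<in> A" "v = lf a" | "v \<in> U" | e where "e \<in> T" "v \<in> e" unfolding verts by blast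
  then show "\<exists>s\<in>std_set A' B. {v, s} \<in> E"
  proof cases
    case 1
    then have "lf v \<in> std_set A' B" using v by (auto simp: std_set_def)
    then show ?thesis using adj_lf[OF 1, of v] by blast
  next
    case 2
    then have "a \<in> std_set A' B" using v by (auto simp: std_set_def)
    then show ?thesis using adj_A[OF 2(1), of v] 2(2) by blast
  next
    case 3
    have vB: "v \<notin> B" using v by (auto simp: std_set_def)
    show ?thesis
    proof (cases "v \<in> U0")
      case True
      then obtain a where "a \<in> A'" "(a, v) \<in> G" using domB vB by blast
      then show ?thesis using adj_U[OF 3, of a] by (intro bexI[of _ a]) (auto simp: std_set_def insert_commute)
    next
      case False
      then obtain e where e: "e \<in> T" "ap e = v" using 3 by (auto simp: U0_def)
      then have "pick e \<in> std_set A' B" using vB by (auto simp: std_set_def)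
      then show ?thesis using adj_U[OF 3, of "pick e"] pick[OF e(1)] e
        by (intro bexI[of _ "pick e"]) (auto simp: insert_commute)
    qed
  next
    case 4
    show ?thesis
    proof (cases "ap e \<in> B")
      case True
      then have "ap e \<in> std_set A' B" by (simp add: std_set_def)
      moreover have "{v, ap e} \<in> E" using adj_T[OF 4, of "ap e"] by (simp add: insert_commute)
      ultimately show ?thesis by blast
    next
      case False
      then have "pick e \<in> std_set A' B" using 4 by (auto simp: std_set_def)
      moreover from this have "pick e \<noteq> v" using v by auto
      ultimately show ?thesis using adj_T[OF 4, of "pick e"] pick[OF 4(1)]
        by (intro bexI[of _ "pick e"]) (auto simp: insert_commute)
    qed
  qed
qed

text \<open>A maximal independent set contains exactly one vertex of each whisker, and exactly one vertex of
  the base of each triangle whose apex it avoids.\<close>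

lemma card_max_indep:
  assumes S: "max_indep E {1..n} S"
  shows "card S = card A + card (S \<inter> U) + card {e\<in>T. ap e \<notin> S}"
proof -
  have ind: "\<And>x y. x \<in> S \<Longrightarrow> y \<in> S \<Longrightarrow> {x, y} \<notin> E" and Sn: "S \<subseteq> {1..n}"
    using S indep_iff by (auto simp: max_indep_def)
  have max: "\<exists>s\<in>S. {v, s} \<in> E" if "v \<in> {1..n}" "v \<notin> S" for v using S that by (auto simp: max_indep_def)
  have finS: "finite S" using Sn by (rule finite_subset_ivl)
  let ?w = "\<lambda>a. if a \<in> S then a else lf a"
  have w: "?w a \<in> S" if a: "a \<in> A" for a
  proof (cases "a \<in> S")
    case False
    have "lf a \<in> S"
    proof (rule ccontr)
      assume "lf a \<notin> S"
      moreover have "lf a \<in> {1..n}" using subs(2) a by blast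
      ultimately obtain s where "s \<in> S" "{lf a, s} \<in> E" using max by blast
      then show False using adj_lf[OF a, of s] False by (simp add: insert_commute)
    qed
    then show ?thesis using False by simp
  qed simp
  have "S \<inter> (A \<union> lf ` A) = ?w ` A"
  proof (intro subset_antisym subsetI)
    fix x assume x: "x \<in> S \<inter> (A \<union> lf ` A)"
    show "x \<in> ?w ` A"
    proof (cases "x \<in> A")
      case True
      then show ?thesis using x by (intro image_eqI[of _ _ x]) auto
    next
      case False
      then obtain a where a: "a \<in> A" "x = lf a" using x by auto
      have "a \<notin> S" using ind[of a x] x adj_lf[OF a(1), of a] a by auto
      then show ?thesis using a by (intro image_eqI[of _ _ a]) auto
    qed
  next
    fix x assume "x \<in> ?w ` A"
    then obtain a where "a \<in> A" "x = ?w a" by blast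
    then show "x \<in> S \<inter> (A \<union> lf ` A)" using w[of a] by auto
  qed
  moreover have "inj_on ?w A"
  proof (rule inj_onI)
    fix a b assume "a \<in> A" "b \<in> A" "?w a = ?w b"
    then show "a = b" using sep(5)[of a] sep(5)[of b] inj_onD[OF inj_lf, of a b] by (auto split: if_splits)
  qed
  ultimately have c1: "card (S \<inter> (A \<union> lf ` A)) = card A" by (metis card_image)
  let ?Q = "{e\<in>T. ap e \<notin> S}"
  have "\<exists>x. x \<in> S \<and> x \<in> e" if e: "e \<in> ?Q" for e
  proof (rule ccontr)
    assume no: "\<nexists>x. x \<in> S \<and> x \<in> e"
    have pe: "pick e \<in> e" using pick e by blast
    then have "pick e \<in> {1..n}" using subs(4) e by blast
    then obtain s where "s \<in> S" "{pick e, s} \<in> E" using max no pe by blast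
    then show False using adj_T[of e "pick e" s] e pe no by (auto simp: insert_commute)
  qed
  then have "\<forall>e\<in>?Q. \<exists>x. x \<in> S \<and> x \<in> e" by (rule ballI)
  from bchoice[OF this] obtain g where g0: "\<forall>e\<in>?Q. g e \<in> S \<and> g e \<in> e" ..
  note g = bspec[OF g0]
  have "S \<inter> \<Union>T = g ` ?Q"
  proof (intro subset_antisym subsetI)
    fix x assume "x \<in> S \<inter> \<Union>T"
    then obtain e where e: "x \<in> S" "e \<in> T" "x \<in> e" by blast
    have "ap e \<notin> S" using ind[OF _ e(1), of "ap e"] adj_T[OF e(2,3), of "ap e"] by metis
    then have eQ: "e \<in> ?Q" using e by blast
    have "g e = x" using ind[OF _ e(1), of "g e"] g[OF eQ] adj_T[OF e(2,3), of "g e"] by metis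
    then show "x \<in> g ` ?Q" using eQ by blast
  next
    fix x assume "x \<in> g ` ?Q"
    then obtain e where "e \<in> ?Q" "x = g e" by blast
    then show "x \<in> S \<inter> \<Union>T" using g[of e] by blast
  qed
  moreover have "inj_on g ?Q"
  proof (rule inj_onI)
    fix e e' assume "e \<in> ?Q" "e' \<in> ?Q" "g e = g e'"
    then show "e = e'" using g[of e] g[of e'] same_triangle[of e e' "g e"] by simp
  qed
  ultimately have c3: "card (S \<inter> \<Union>T) = card ?Q" using card_image[of g ?Q] by simp
  have "(S \<inter> (A \<union> lf ` A) \<union> S \<inter> U) \<union> S \<inter> \<Union>T = S" using Sn unfolding verts by blast
  then have "card S = card ((S \<inter> (A \<union> lf ` A) \<union> S \<inter> U) \<union> S \<inter> \<Union>T)" by simp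
  also have "\<dots> = card (S \<inter> (A \<union> lf ` A)) + card (S \<inter> U) + card (S \<inter> \<Union>T)"
  proof -
    have split: "card (S \<inter> X \<union> S \<inter> Y \<union> S \<inter> Z) = card (S \<inter> X) + card (S \<inter> Y) + card (S \<inter> Z)"
      if "X \<inter> Y = {}" "X \<inter> Z = {}" "Y \<inter> Z = {}" for X Y Z
    proof -
      have "(S \<inter> X \<union> S \<inter> Y) \<inter> (S \<inter> Z) = {}" "(S \<inter> X) \<inter> (S \<inter> Y) = {}" using that by blast+
      then show ?thesis using finS by (simp add: card_Un_disjoint)
    qed
    show ?thesis by (rule split) (simp_all add: Int_Un_distrib2 disj)
  qed
  finally show ?thesis using c1 c3 by simp
qed

end

subsection \<open>The invariants\<close>

text \<open>If the members of a family \<open>I\<close> other than \<open>X\<close> can be paired off by inserting or removing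
  one element, then only \<open>X\<close> contributes to the signed sum. The element \<open>t (F \<inter> X)\<close> depends only on
  \<open>F \<inter> X\<close> and does not belong to \<open>X\<close>, so inserting or removing it is an involution.\<close>

lemma signed_sum_toggle:
  fixes I :: "'a set set"
  assumes fin: "finite I" "\<And>F. F \<in> I \<Longrightarrow> finite F" and X: "X \<in> I"
    and sub: "\<And>F. F \<in> I \<Longrightarrow> F \<noteq> X \<Longrightarrow> \<not> X \<subseteq> F"
    and t: "\<And>F. F \<in> I \<Longrightarrow> F \<noteq> X \<Longrightarrow> t (F \<inter> X) \<notin> X"
    and ins: "\<And>F. F \<in> I \<Longrightarrow> F \<noteq> X \<Longrightarrow> insert (t (F \<inter> X)) F \<in> I"
    and del: "\<And>F x. F \<in> I \<Longrightarrow> F - {x} \<in> I"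
  shows "(\<Sum>F\<in>I. (-1) ^ card F) = ((-1) ^ card X :: int)"
proof -
  let ?J = "I - {X}"
  define \<phi> where "\<phi> F = (if t (F \<inter> X) \<in> F then F - {t (F \<inter> X)} else insert (t (F \<inter> X)) F)" for F
  have cap: "\<phi> F \<inter> X = F \<inter> X" if "F \<in> ?J" for F
    using t[of F] that by (auto simp: \<phi>_def)
  have mem: "\<phi> F \<in> ?J" if F: "F \<in> ?J" for F
  proof -
    have "\<phi> F \<in> I" using F ins[of F] del[of F] by (simp add: \<phi>_def)
    moreover have "\<phi> F \<noteq> X" using cap[OF F] sub[of F] F by blast
    ultimately show ?thesis by simp
  qed
  have inv: "\<phi> (\<phi> F) = F" if F: "F \<in> ?J" for F
    using cap[OF F] unfolding \<phi>_def[of "\<phi> F"] by (auto simp: \<phi>_def)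
  have sign: "(-1) ^ card (\<phi> F) = - ((-1) ^ card F :: int)" if F: "F \<in> ?J" for F
  proof (cases "t (F \<inter> X) \<in> F")
    case True
    then have "card F = Suc (card (\<phi> F))"
      using F fin(2)[of F] card.remove[of F "t (F \<inter> X)"] by (simp add: \<phi>_def)
    then show ?thesis by simp
  next
    case False
    then show ?thesis using F fin(2)[of F] by (simp add: \<phi>_def)
  qed
  have "bij_betw \<phi> ?J ?J" by (rule bij_betw_byWitness[where f' = \<phi>]) (use inv mem in auto)
  then have "(\<Sum>F\<in>?J. (-1) ^ card F) = (\<Sum>F\<in>?J. (-1) ^ card (\<phi> F) :: int)"
    by (rule sum.reindex_bij_betw[symmetric])
  also have "\<dots> = (\<Sum>F\<in>?J. - ((-1) ^ card F))" by (rule sum.cong[OF refl sign])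
  finally have "(\<Sum>F\<in>?J. (-1) ^ card F) = (0 :: int)" by (simp add: sum_negf)
  then show ?thesis using sum.remove[OF fin(1) X, of "\<lambda>F. (-1) ^ card F :: int"] by simp
qed

context cw_shape
begin

text \<open>The graph is covered by the whiskers, the triangles and the vertices which are apex of no triangle,
  and an independent set meets each of these cliques at most once.\<close>

lemma card_indep_le:
  assumes "F \<in> indeps E {1..n}"
  shows "card F \<le> card A + card T + card U0"
proof -
  have F: "F \<subseteq> {1..n}" and ind: "\<And>x y. x \<in> F \<Longrightarrow> y \<in> F \<Longrightarrow> {x, y} \<notin> E" using assms indep_iff by auto
  define K where "K = (\<lambda>a. {a, lf a}) ` A \<union> (\<lambda>e. insert (ap e) e) ` T \<union> (\<lambda>u. {u}) ` U0"
  have "finite K" using fin U_split(3) by (simp add: K_def)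
  have clique: "x = y \<or> {x, y} \<in> E" if K: "k \<in> K" and x: "x \<in> k" and y: "y \<in> k" for k x y
  proof -
    from K consider a where "a \<in> A" "k = {a, lf a}" | e where "e \<in> T" "k = insert (ap e) e" | u where "k = {u}"
      unfolding K_def by blast
    then show ?thesis
    proof cases
      case 1
      then show ?thesis using x y adj_lf[OF 1(1), of a] by (auto simp: insert_commute)
    next
      case 2
      show ?thesis
      proof (cases "y \<in> e")
        case True
        then show ?thesis using x 2 adj_T[OF 2(1) True, of x] by auto
      next
        case False
        then have "y = ap e" using y 2 by auto
        moreover have "x = ap e \<or> {ap e, x} \<in> E" using x 2 adj_T[OF 2(1), of x "ap e"] by auto
        ultimately show ?thesis by (auto simp: insert_commute)
      qed
    qed (use x y in auto)
  qed
  have "\<exists>k. k \<in> K \<and> x \<in> k" if "x \<in> F" for x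
  proof -
    have "x \<in> {1..n}" using F that by blast
    then consider "x \<in> A" | a where "a \<in> A" "x = lf a" | "x \<in> U0" | e where "e \<in> T" "x = ap e"
      | e where "e \<in> T" "x \<in> e"
      unfolding verts U0_def by blast
    then show ?thesis unfolding K_def by cases blast+
  qed
  then have "\<forall>x\<in>F. \<exists>k. k \<in> K \<and> x \<in> k" by (rule ballI)
  from bchoice[OF this] obtain h where h: "\<forall>x\<in>F. h x \<in> K \<and> x \<in> h x" ..
  have "inj_on h F"
  proof (rule inj_onI)
    fix x y assume xy: "x \<in> F" "y \<in> F" "h x = h y"
    then show "x = y" using clique[of "h x" x y] bspec[OF h xy(1)] bspec[OF h xy(2)] ind[OF xy(1,2)] by simp
  qed
  moreover have "h ` F \<subseteq> K" using h by (intro image_subsetI) simp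
  ultimately have "card F \<le> card K" by (rule card_inj_on_le[OF _ _ \<open>finite K\<close>])
  also have "\<dots> \<le> card ((\<lambda>a. {a, lf a}) ` A \<union> (\<lambda>e. insert (ap e) e) ` T) + card ((\<lambda>u. {u}) ` U0)"
    unfolding K_def by (rule card_Un_le)
  also have "card ((\<lambda>a. {a, lf a}) ` A \<union> (\<lambda>e. insert (ap e) e) ` T)
      \<le> card ((\<lambda>a. {a, lf a}) ` A) + card ((\<lambda>e. insert (ap e) e) ` T)" by (rule card_Un_le)
  also have "card ((\<lambda>a. {a, lf a}) ` A) \<le> card A" using fin(1) by (rule card_image_le)
  also have "card ((\<lambda>e. insert (ap e) e) ` T) \<le> card T" using fin(3) by (rule card_image_le)
  also have "card ((\<lambda>u. {u}) ` U0) \<le> card U0" using U_split(3) by (rule card_image_le)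
  finally show ?thesis by simp
qed

text \<open>The admissible sets are the traces on \<open>U\<close> of the maximal independent sets, and \<open>size B\<close> is the common
cardinality of those with trace \<open>B\<close>.\<close>

definition admissible :: "nat set \<Rightarrow> bool" where
  "admissible B \<longleftrightarrow> B \<subseteq> U \<and> (\<forall>u\<in>U0 - B. \<exists>a. (a, u) \<in> G \<and> (\<forall>b\<in>B. (a, b) \<notin> G))"

definition size :: "nat set \<Rightarrow> nat" where
  "size B = card A + card B + card {e\<in>T. ap e \<notin> B}"

lemma card_max_indep_size:
  assumes "max_indep E {1..n} S"
  shows "card S = size (S \<inter> U)"
proof -
  have "{e\<in>T. ap e \<notin> S} = {e\<in>T. ap e \<notin> S \<inter> U}" using ap by blast
  then show ?thesis using card_max_indep[OF assms] by (simp add: size_def)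
qed

lemma admissible_max_indep:
  assumes S: "max_indep E {1..n} S"
  shows "admissible (S \<inter> U)"
  unfolding admissible_def
proof (intro conjI ballI)
  have ind: "\<And>x y. x \<in> S \<Longrightarrow> y \<in> S \<Longrightarrow> {x, y} \<notin> E"
    using S indep_iff by (simp add: max_indep_def)
  fix u assume "u \<in> U0 - S \<inter> U"
  then have u: "u \<in> U" "u \<notin> S" "\<And>e. e \<in> T \<Longrightarrow> ap e \<noteq> u" by (auto simp: U0_def)
  moreover have "u \<in> {1..n}" using subs(3) u(1) by blast
  ultimately obtain s where s: "s \<in> S" "{u, s} \<in> E" using S unfolding max_indep_def by blast
  then have "(s, u) \<in> G" using adj_U[OF u(1), of s] u(3) by (auto simp: insert_commute)
  moreover have "(s, b) \<notin> G" if "b \<in> S \<inter> U" for b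
    using ind[of s b] adj_U[of b s] s(1) that by auto
  ultimately show "\<exists>a. (a, u) \<in> G \<and> (\<forall>b\<in>S \<inter> U. (a, b) \<notin> G)" by blast
qed simp

lemma max_indep_admissible:
  assumes B: "admissible B"
  obtains S where "max_indep E {1..n} S" "S \<inter> U = B"
proof -
  let ?A = "{a\<in>A. \<forall>b\<in>B. (a, b) \<notin> G}"
  have BU: "B \<subseteq> U" using B by (simp add: admissible_def)
  have "max_indep E {1..n} (std_set ?A B)"
  proof (rule max_indep_std_set)
    fix u assume "u \<in> U0 - B"
    then obtain a where "(a, u) \<in> G" "\<forall>b\<in>B. (a, b) \<notin> G" using B unfolding admissible_def by blast
    then show "\<exists>a\<in>?A. (a, u) \<in> G" using GD(1)[of a u] by blast
  qed (use BU in auto)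
  then show ?thesis using that std_set_Int_U[of ?A B] BU by auto
qed

text \<open>A vertex of \<open>A\<close> is shed because of its leaf, and an apex because of a base vertex of its triangle, all of whose
neighbours lie in that triangle. The leaves, the bases and the vertices of \<open>U0\<close> remain.\<close>

lemma shedding: "shedding_core E {1..n} (A \<union> U1)"
  unfolding shedding_core_def
proof (intro conjI ballI impI)
  fix c assume "c \<in> (A \<union> U1) \<inter> {1..n}"
  then consider "c \<in> A" | e where "e \<in> T" "c = ap e" by (auto simp: U1_def)
  then show "\<exists>s\<in>{1..n} - (A \<union> U1). {s, c} \<in> E \<and> nbrs E s \<inter> {1..n} \<subseteq> insert c (nbrs E c) \<and> nbrs E s \<inter> (A \<union> U1) = {c}"
  proof cases
    case 1
    have nb: "nbrs E (lf c) = {c}" using adj_lf[OF 1] by (auto simp: nbrs_def)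
    have "lf c \<in> {1..n} - (A \<union> U1)" using subs(2) 1 sep(4,5)[OF 1] U_split(6) by blast
    moreover have "{lf c, c} \<in> E" using adj_lf[OF 1] by (simp add: insert_commute)
    ultimately show ?thesis using nb 1 by (intro bexI[of _ "lf c"]) auto
  next
    case 2
    note p = pick[OF 2(1)]
    have cU: "c \<in> U" "c \<in> U1" using ap[OF 2(1)] 2 by (auto simp: U1_def)
    have nb: "x \<in> nbrs E (pick e) \<longleftrightarrow> x \<in> e \<and> x \<noteq> pick e \<or> x = c" for x
      using adj_T[OF 2(1) p, of x] 2(2) by (simp add: nbrs_def)
    have nbc: "x \<in> nbrs E c" if "x \<in> e" for x
      using adj_T[OF 2(1) that, of c] 2(2) by (simp add: nbrs_def insert_commute)
    have eC: "x \<notin> A \<union> U1" if "x \<in> e" for x using sep(3)[OF _ 2(1)] sep(7)[OF _ 2(1)] U_split(6) that by blast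
    have "pick e \<in> {1..n} - (A \<union> U1)" using subs(4) p 2(1) eC[OF p] by blast
    moreover have "{pick e, c} \<in> E" using adj_T[OF 2(1) p, of c] 2(2) by (simp add: insert_commute)
    moreover have "nbrs E (pick e) \<inter> {1..n} \<subseteq> insert c (nbrs E c)" using nb nbc by blast
    moreover have "nbrs E (pick e) \<inter> (A \<union> U1) = {c}"
    proof (rule Set.set_eqI)
      fix x show "x \<in> nbrs E (pick e) \<inter> (A \<union> U1) \<longleftrightarrow> x \<in> {c}" using nb[of x] eC[of x] cU by auto
    qed
    ultimately show ?thesis by blast
  qed
next
  fix s u u' assume s: "s \<in> {1..n} - (A \<union> U1)" and u: "u \<in> {1..n} - (A \<union> U1)" and u': "u' \<in> {1..n} - (A \<union> U1)"
    and e: "{s, u} \<in> E" "{s, u'} \<in> E"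
  from s consider a where "a \<in> A" "s = lf a" | "s \<in> U0" | f where "f \<in> T" "s \<in> f"
    unfolding verts U0_def U1_def by blast
  then show "u = u'"
  proof cases
    case 1
    then show ?thesis using adj_lf[OF 1(1), of u] adj_lf[OF 1(1), of u'] e by (simp add: insert_commute)
  next
    case 2
    then have "s \<in> U" "\<And>e. e \<in> T \<Longrightarrow> ap e \<noteq> s" by (auto simp: U0_def)
    then have "(u, s) \<in> G" using adj_U[of s u] e(1) by (auto simp: insert_commute)
    then show ?thesis using GD(1) u by blast
  next
    case 3
    have "u \<noteq> ap f" "u' \<noteq> ap f" using u u' 3 by (auto simp: U1_def)
    then have "u \<in> f" "u \<noteq> s" "u' \<in> f" "u' \<noteq> s"
      using adj_T[OF 3, of u] adj_T[OF 3, of u'] e by (auto simp: insert_commute)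
    then show ?thesis using card_T[OF 3(1)] 3(2) by (auto simp: card_2_iff)
  qed
qed

text \<open>The reduced Euler characteristic. The maximal independent set \<open>X\<close> takes all of \<open>A\<close> and one vertex
  from the base of each triangle. If an independent set lacks a vertex \<open>a\<close> of \<open>A\<close>, the leaf at \<open>a\<close> can be
  inserted or removed. If it contains \<open>A\<close>, it avoids \<open>U\<close>; if it then lacks the chosen vertex of a triangle,
  the other base vertex can be inserted or removed.\<close>

lemma euler_characteristic: "(\<Sum>F\<in>indeps E {1..n}. (-1) ^ card F) \<noteq> (0 :: int)"
proof -
  define X where "X = std_set A {}"
  have XA: "X = A \<union> pick ` T" by (simp add: X_def std_set_def)
  have domA: "\<exists>a\<in>A. {a, u} \<in> E" if "u \<in> U" for u using dom[OF that] GD(1) adj_U[OF that] by blast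
  have maxX: "max_indep E {1..n} X"
    unfolding X_def by (rule max_indep_std_set) (use dom GD U_split(7) in blast)+
  have fI: "F \<subseteq> {1..n}" "finite F" "\<And>x y. x \<in> F \<Longrightarrow> y \<in> F \<Longrightarrow> {x, y} \<notin> E" if "F \<in> indeps E {1..n}" for F
    using that indep_iff[of F] finite_subset_ivl[of F] by auto
  have sub: "F = X" if F: "F \<in> indeps E {1..n}" "X \<subseteq> F" for F
  proof (rule ccontr)
    assume "F \<noteq> X"
    then obtain v where v: "v \<in> F" "v \<notin> X" using F(2) by blast
    then have "v \<in> {1..n} - X" using fI(1)[OF F(1)] by blast
    then obtain s where "s \<in> X" "{v, s} \<in> E" using maxX unfolding max_indep_def by blast
    then show False using fI(3)[OF F(1) v(1), of s] F(2) by blast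
  qed
  define other where "other e = (SOME x. x \<in> e \<and> x \<noteq> pick e)" for e
  have other: "other e \<in> e \<and> other e \<noteq> pick e" if e: "e \<in> T" for e
  proof -
    obtain x y where "e = {x, y}" "x \<noteq> y" using card_T[OF e] by (auto simp: card_2_iff)
    then have "\<exists>x. x \<in> e \<and> x \<noteq> pick e" by (cases "pick e = x") auto
    then show ?thesis unfolding other_def by (rule someI_ex)
  qed
  define t where "t D = (if A \<subseteq> D then other (SOME e. e \<in> T \<and> pick e \<notin> D) else lf (SOME a. a \<in> A \<and> a \<notin> D))" for D
  have t: "t (F \<inter> X) \<notin> X \<and> t (F \<inter> X) \<in> {1..n} \<and> (\<forall>x\<in>F. {x, t (F \<inter> X)} \<notin> E)"
    if F: "F \<in> indeps E {1..n}" "F \<noteq> X" for F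
  proof (cases "A \<subseteq> F \<inter> X")
    case True
    have "\<not> X \<subseteq> F" using sub F by blast
    then have ex: "\<exists>e. e \<in> T \<and> pick e \<notin> F \<inter> X" using True XA by blast
    define e where "e = (SOME e. e \<in> T \<and> pick e \<notin> F \<inter> X)"
    have e: "e \<in> T" "pick e \<notin> F \<inter> X" using someI_ex[OF ex] by (simp_all add: e_def)
    have te: "t (F \<inter> X) = other e" unfolding t_def if_P[OF True] e_def ..
    have oe: "other e \<in> e" "other e \<noteq> pick e" using other[OF e(1)] by auto
    have peX: "pick e \<in> X" using XA e(1) by blast
    have "other e \<noteq> pick e'" if "e' \<in> T" for e'
      using same_triangle[OF e(1) that oe(1)] pick[OF that] oe(2) by metis
    moreover have "other e \<notin> A" using sep(3)[OF _ e(1)] oe(1) by blast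
    ultimately have "other e \<notin> X" using XA by blast
    moreover have "other e \<in> {1..n}" using subs(4) e(1) oe(1) by blast
    moreover have "{x, other e} \<notin> E" if x: "x \<in> F" for x
    proof
      assume "{x, other e} \<in> E"
      then consider "x \<in> e" "x \<noteq> other e" | "x = ap e" using adj_T[OF e(1) oe(1), of x] by blast
      then show False
      proof cases
        case 1
        then have "x = pick e" using card_T[OF e(1)] oe pick[OF e(1)] by (auto simp: card_2_iff)
        then show False using e(2) peX x by blast
      next
        case 2
        then obtain a where "a \<in> A" "{a, x} \<in> E" using domA[of x] ap[OF e(1)] by blast
        then show False using fI(3)[OF F(1), of a x] True x by blast
      qed
    qed
    ultimately show ?thesis unfolding te by blast
  next
    case False
    then have ex: "\<exists>a. a \<in> A \<and> a \<notin> F \<inter> X" by blast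
    define a where "a = (SOME a. a \<in> A \<and> a \<notin> F \<inter> X)"
    have a: "a \<in> A" "a \<notin> F \<inter> X" using someI_ex[OF ex] by (simp_all add: a_def)
    have ta: "t (F \<inter> X) = lf a" unfolding t_def if_not_P[OF False] a_def ..
    have "lf a \<noteq> pick e" if "e \<in> T" for e using sep(6)[OF a(1) that] pick[OF that] by metis
    then have "lf a \<notin> X" using sep(5)[OF a(1)] XA by blast
    moreover have "lf a \<in> {1..n}" using subs(2) a(1) by blast
    moreover have "{x, lf a} \<notin> E" if "x \<in> F" for x
      using adj_lf[OF a(1), of x] a XA that by blast
    ultimately show ?thesis unfolding ta by blast
  qed
  have "(\<Sum>F\<in>indeps E {1..n}. (-1) ^ card F) = ((-1) ^ card X :: int)"
  proof (rule signed_sum_toggle[where t = t])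
    show "finite (indeps E {1..n})" using finite_subset[of "indeps E {1..n}" "Pow {1..n}"] fI(1) by blast
    show "X \<in> indeps E {1..n}" using maxX by (simp add: max_indep_def)
    fix F assume F: "F \<in> indeps E {1..n}"
    show "finite F" by (rule fI(2)[OF F])
    show "F - {x} \<in> indeps E {1..n}" for x using F unfolding indep_iff by blast
    assume FX: "F \<noteq> X"
    show "\<not> X \<subseteq> F" using sub[OF F] FX by blast
    show "t (F \<inter> X) \<notin> X" using t[OF F FX] by blast
    have self: "{t (F \<inter> X)} \<notin> E" using edge_card by force
    show "insert (t (F \<inter> X)) F \<in> indeps E {1..n}"
      unfolding indep_iff
    proof (intro conjI ballI)
      show "insert (t (F \<inter> X)) F \<subseteq> {1..n}" using t[OF F FX] fI(1)[OF F] by blast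
      fix x y assume "x \<in> insert (t (F \<inter> X)) F" "y \<in> insert (t (F \<inter> X)) F"
      then show "{x, y} \<notin> E" using t[OF F FX] fI(3)[OF F, of x y] self by (auto simp: insert_commute)
    qed
  qed
  then show ?thesis by simp
qed

theorem invariants:
  assumes "A \<noteq> {}" and B: "admissible B" "size B = d" and le: "\<And>B. admissible B \<Longrightarrow> d \<le> size B"
  shows "invariants TYPE('k::field) n E =
    (d, card A + card T, card A + card T + card U0, card A + card T + card U0)"
proof -
  let ?I = "edge_ideal n E :: 'k mpoly set"
  have n: "0 < n" using assms(1) subs(1) by auto
  obtain S where S: "max_indep E {1..n} S" "S \<inter> U = B" using max_indep_admissible[OF B(1)] .
  have depth: "quot_depth n ?I = d"
  proof (rule depth_edge_ideal[OF simple shedding _ S(1)])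
    show "d \<le> card S" if "max_indep E {1..n} S" for S
      using le[OF admissible_max_indep[OF that]] card_max_indep_size[OF that] by simp
    show "card S = d" using card_max_indep_size[OF S(1)] S(2) B(2) by simp
  qed
  have reg: "quot_reg n ?I = int (card A + card T)"
    using reg_edge_ideal[OF n simple] matching_numbers by simp
  have "admissible U0" by (simp add: admissible_def U_split(7))
  then obtain F where F: "max_indep E {1..n} F" "F \<inter> U = U0" using max_indep_admissible by blast
  have "{e\<in>T. ap e \<notin> U0} = T" by (auto simp: U0_def)
  then have cF: "card F = card A + card T + card U0" using card_max_indep_size[OF F(1)] F(2) by (simp add: size_def)
  have dim: "quot_dim n ?I = card A + card T + card U0"
    unfolding cF[symmetric]
  proof (rule quot_dim_edge_ideal[OF simple])
    show "F \<in> indeps E {1..n}" using F(1) by (simp add: max_indep_def)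
    show "card F' \<le> card F" if "F' \<in> indeps E {1..n}" for F' using card_indep_le[OF that] cF by simp
  qed
  have "degree (h_poly n ?I) = card A + card T + card U0"
    by (rule degree_h_poly_edge_ideal[OF simple dim card_indep_le euler_characteristic])
  then show ?thesis using depth reg dim by (simp add: invariants_def Let_def)
qed

end

section \<open>Cameron--Walker graphs have this shape\<close>

lemma connected_closed:
  assumes "connected_graph V E" "x \<in> R" "x \<in> V" "\<And>v w. v \<in> R \<Longrightarrow> {v, w} \<in> E \<Longrightarrow> w \<in> R"
  shows "V \<subseteq> R"
proof
  fix w assume "w \<in> V"
  then have "(x, w) \<in> {(a, b). {a, b} \<in> E}\<^sup>*" using assms(1,3) by (simp add: connected_graph_def)
  then show "w \<in> R" by (induction rule: rtrancl_induct) (use assms(2,4) in auto)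
qed

locale cw_graph =
  fixes n :: nat and E M :: "nat set set"
  assumes n: "n \<ge> 5" and cw: "cameron_walker {1..n} E" and indM: "induced_matching E M"
    and card_M: "card M = matching_number E"
begin

lemma E: "simple_graph {1..n} E" "connected_graph {1..n} E" "finite E" "\<not> star_graph {1..n} E" "\<not> star_triangle {1..n} E"
  using cw finite_edges[of n E] unfolding cameron_walker_def by blast+

lemma edge: "{x, y} \<in> E \<Longrightarrow> x \<noteq> y" "{x, y} \<in> E \<Longrightarrow> x \<in> {1..n}" "{x, y} \<in> E \<Longrightarrow> y \<in> {1..n}"
proof -
  assume e: "{x, y} \<in> E"
  have *: "{x, y} \<subseteq> {1..n} \<and> card {x, y} = 2" using E(1) e unfolding simple_graph_def by blast
  then show "x \<noteq> y" by auto
  show "x \<in> {1..n}" "y \<in> {1..n}" using * by blast+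
qed

lemma edgeE: "f \<in> E \<Longrightarrow> (\<And>x y. f = {x, y} \<Longrightarrow> thesis) \<Longrightarrow> thesis"
proof -
  assume f: "f \<in> E" and hyp: "\<And>x y. f = {x, y} \<Longrightarrow> thesis"
  have "card f = 2" using E(1) f by (simp add: simple_graph_def)
  then obtain x y where "f = {x, y}" by (auto simp: card_2_iff)
  then show thesis by (rule hyp)
qed

lemma M: "M \<subseteq> E" "finite M" "\<And>e e' x. e \<in> M \<Longrightarrow> e' \<in> M \<Longrightarrow> x \<in> e \<Longrightarrow> x \<in> e' \<Longrightarrow> e = e'"
  "\<And>e e' x y. e \<in> M \<Longrightarrow> e' \<in> M \<Longrightarrow> x \<in> e \<Longrightarrow> y \<in> e' \<Longrightarrow> {x, y} \<in> E \<Longrightarrow> e = e'"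
  "\<And>N. matching E N \<Longrightarrow> card N \<le> card M"
proof -
  have m: "matching E M" using indM by (simp add: induced_matching_def)
  then show ME: "M \<subseteq> E" by (simp add: matching_def)
  show "finite M" using ME E(3) by (rule finite_subset)
  show "e = e'" if "e \<in> M" "e' \<in> M" "x \<in> e" "x \<in> e'" for e e' x
  proof (rule ccontr)
    assume "e \<noteq> e'"
    then have "disjnt e e'" using m that unfolding matching_def by (metis pairwiseD)
    then show False using that by (auto simp: disjnt_def)
  qed
  show "e = e'" if "e \<in> M" "e' \<in> M" "x \<in> e" "y \<in> e'" "{x, y} \<in> E" for e e' x y
  proof (rule ccontr)
    assume "e \<noteq> e'"
    then have "\<not> (\<exists>f\<in>E. f \<inter> e \<noteq> {} \<and> f \<inter> e' \<noteq> {})"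
      using indM that(1,2) unfolding induced_matching_def by simp
    moreover have "{x, y} \<inter> e \<noteq> {}" "{x, y} \<inter> e' \<noteq> {}" using that(3,4) by auto
    ultimately show False using that(5) by metis
  qed
  show "card N \<le> card M" if "matching E N" for N
    using matching_number_props(1)[OF E(3) that] card_M by simp
qed

lemma M_pair: "e \<in> M \<Longrightarrow> x \<in> e \<Longrightarrow> (\<And>y. e = {x, y} \<Longrightarrow> x \<noteq> y \<Longrightarrow> thesis) \<Longrightarrow> thesis"
proof -
  assume e: "e \<in> M" "x \<in> e" and hyp: "\<And>y. e = {x, y} \<Longrightarrow> x \<noteq> y \<Longrightarrow> thesis"
  have eE: "e \<in> E" using e(1) M(1) by blast
  then obtain u v where "e = {u, v}" by (rule edgeE)
  then have "\<exists>y. e = {x, y}" using e(2) by (auto simp: insert_commute)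
  then obtain y where "e = {x, y}" ..
  then show thesis using hyp[of y] edge(1)[of x y] eE by simp
qed

definition U :: "nat set" where "U = {1..n} - \<Union>M"

lemma U_disjnt: "u \<in> U \<Longrightarrow> e \<in> M \<Longrightarrow> u \<notin> e"
  unfolding U_def by blast

text \<open>Since \<open>M\<close> is a maximum matching, there are no augmenting paths of length one and three.\<close>

lemma U_indep: "x \<in> U \<Longrightarrow> y \<in> U \<Longrightarrow> {x, y} \<notin> E"
proof
  assume xy: "x \<in> U" "y \<in> U" "{x, y} \<in> E"
  have nM: "{x, y} \<notin> M" using U_disjnt[OF xy(1), of "{x, y}"] by auto
  have "matching E (insert {x, y} M)"
    unfolding matching_def
  proof (intro conjI)
    show "insert {x, y} M \<subseteq> E" using M(1) xy(3) by simp
    have "disjnt {x, y} e" if "e \<in> M" for e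
      using U_disjnt[OF xy(1) that] U_disjnt[OF xy(2) that] by (simp add: disjnt_def)
    moreover have "pairwise disjnt M" using indM by (simp add: induced_matching_def matching_def)
    ultimately show "pairwise disjnt (insert {x, y} M)" by (simp add: pairwise_insert disjnt_sym)
  qed
  then have "card (insert {x, y} M) \<le> card M" by (rule M(5))
  then show False using nM M(2) by simp
qed

lemma U_nbrs_eq:
  assumes e: "{a, b} \<in> M" and x: "x \<in> U" "{a, x} \<in> E" and y: "y \<in> U" "{b, y} \<in> E"
  shows "x = y"
proof (rule ccontr)
  assume "x \<noteq> y"
  let ?M = "M - {{a, b}}"
  have ab: "a \<noteq> b" using edge(1)[of a b] e M(1) by blast
  have nab: "x \<noteq> a" "x \<noteq> b" "y \<noteq> a" "y \<noteq> b" using U_disjnt[OF x(1) e] U_disjnt[OF y(1) e] by auto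
  have out: "a \<notin> f" "b \<notin> f" "x \<notin> f" "y \<notin> f" if f: "f \<in> ?M" for f
    using M(3)[OF e, of f] f U_disjnt[OF x(1), of f] U_disjnt[OF y(1), of f] by auto
  have "matching E (insert {a, x} (insert {b, y} ?M))"
    unfolding matching_def
  proof (intro conjI)
    show "insert {a, x} (insert {b, y} ?M) \<subseteq> E" using M(1) x(2) y(2) by blast
    have "disjnt {a, x} f" "disjnt {b, y} f" if "f \<in> ?M" for f
      using out[OF that] by (simp_all add: disjnt_def)
    moreover have "disjnt {a, x} {b, y}" using ab nab \<open>x \<noteq> y\<close> by (simp add: disjnt_def)
    moreover have "pairwise disjnt ?M"
      using indM by (simp add: induced_matching_def matching_def pairwise_def)
    ultimately show "pairwise disjnt (insert {a, x} (insert {b, y} ?M))"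
      unfolding pairwise_insert using disjnt_sym by (metis insertE)
  qed
  then have "card (insert {a, x} (insert {b, y} ?M)) \<le> card M" by (rule M(5))
  moreover have "{a, x} \<notin> ?M" using out(1)[of "{a, x}"] by blast
  moreover have "{b, y} \<notin> ?M" using out(2)[of "{b, y}"] by blast
  moreover have "{a, x} \<noteq> {b, y}" using ab nab by (auto simp: doubleton_eq_iff)
  moreover have "Suc (card ?M) = card M" using card.remove[OF M(2) e] by simp
  ultimately show False using M(2) by simp
qed

lemma nbr_M:
  assumes "e \<in> M" "x \<in> e" "{x, y} \<in> E"
  shows "y \<in> e \<or> y \<in> U"
proof (rule ccontr)
  assume no: "\<not> (y \<in> e \<or> y \<in> U)"
  then obtain e' where "e' \<in> M" "y \<in> e'" using edge(3)[OF assms(3)] unfolding U_def by blast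
  then show False using M(4)[OF assms(1) _ assms(2) _ assms(3), of e'] no by blast
qed

text \<open>Otherwise the two ends of \<open>e\<close> would form a component of the graph.\<close>

lemma U_nbr_ex:
  assumes e: "e \<in> M"
  shows "\<exists>x\<in>e. \<exists>u\<in>U. {x, u} \<in> E"
proof (rule ccontr)
  assume no: "\<not> ?thesis"
  have "e \<in> E" using e M(1) by blast
  then obtain x y where xy: "e = {x, y}" by (rule edgeE)
  have xy1: "x \<in> {1..n}" using edge(2)[of x y] \<open>e \<in> E\<close> xy by blast
  have "{1..n} \<subseteq> e"
  proof (rule connected_closed[OF E(2) _ xy1])
    show "x \<in> e" using xy by simp
    show "w \<in> e" if "v \<in> e" "{v, w} \<in> E" for v w using nbr_M[OF e that] no that by blast
  qed
  then have "card {1..n} \<le> card e" by (rule card_mono[rotated]) (simp add: xy)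
  also have "\<dots> \<le> 2" unfolding xy by (simp add: card_insert_if)
  finally show False using n by simp
qed

text \<open>An edge of \<open>M\<close> with a neighbour in \<open>U\<close> common to both ends is the base of a triangle; of any other edge exactly
one end has neighbours in \<open>U\<close>.\<close>

definition T :: "nat set set" where "T = {e \<in> M. \<exists>u. u \<in> U \<and> (\<forall>x\<in>e. {x, u} \<in> E)}"
definition ap :: "nat set \<Rightarrow> nat" where "ap e = (SOME u. u \<in> U \<and> (\<forall>x\<in>e. {x, u} \<in> E))"
definition A :: "nat set" where "A = {a. \<exists>e. e \<in> M \<and> e \<notin> T \<and> a \<in> e \<and> (\<exists>u\<in>U. {a, u} \<in> E)}"
definition lf :: "nat \<Rightarrow> nat" where "lf a = (SOME b. {a, b} \<in> M)"
definition G :: "(nat \<times> nat) set" where "G = {(a, u). a \<in> A \<and> u \<in> U \<and> {a, u} \<in> E}"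

lemma ap: "e \<in> T \<Longrightarrow> ap e \<in> U" "e \<in> T \<Longrightarrow> x \<in> e \<Longrightarrow> {x, ap e} \<in> E"
proof -
  assume "e \<in> T"
  then have "\<exists>u. u \<in> U \<and> (\<forall>x\<in>e. {x, u} \<in> E)" by (simp add: T_def)
  from someI_ex[OF this] have *: "ap e \<in> U \<and> (\<forall>x\<in>e. {x, ap e} \<in> E)" unfolding ap_def .
  then show "ap e \<in> U" ..
  show "{x, ap e} \<in> E" if "x \<in> e" using * that by blast
qed

lemma TM: "e \<in> T \<Longrightarrow> e \<in> M" by (simp add: T_def)

lemma ap_unique: "e \<in> T \<Longrightarrow> x \<in> e \<Longrightarrow> u \<in> U \<Longrightarrow> {x, u} \<in> E \<Longrightarrow> u = ap e"
proof -
  assume e: "e \<in> T" "x \<in> e" and u: "u \<in> U" "{x, u} \<in> E"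
  obtain y where y: "e = {x, y}" using M_pair[OF TM[OF e(1)] e(2)] .
  have "{x, y} \<in> M" using TM[OF e(1)] y by simp
  moreover have "{y, ap e} \<in> E" using ap(2)[OF e(1), of y] y by simp
  ultimately show "u = ap e" using U_nbrs_eq[OF _ u ap(1)[OF e(1)]] by blast
qed

lemma lf: "a \<in> A \<Longrightarrow> {a, lf a} \<in> M" "a \<in> A \<Longrightarrow> {a, lf a} \<notin> T" "a \<in> A \<Longrightarrow> u \<in> U \<Longrightarrow> {lf a, u} \<notin> E"
  "a \<in> A \<Longrightarrow> \<exists>u\<in>U. {a, u} \<in> E"
proof -
  assume a: "a \<in> A"
  then obtain e u where e: "e \<in> M" "e \<notin> T" "a \<in> e" and u: "u \<in> U" "{a, u} \<in> E" unfolding A_def by blast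
  obtain b where b: "e = {a, b}" using M_pair[OF e(1,3)] .
  have "{a, b} \<in> M" using e(1) b by simp
  then show l: "{a, lf a} \<in> M" unfolding lf_def by (rule someI)
  then have "{a, lf a} = e" using M(3)[OF l e(1), of a] e(3) by simp
  then show l2: "{a, lf a} \<notin> T" using e(2) by simp
  show "\<exists>u\<in>U. {a, u} \<in> E" using u by blast
  show "{lf a, v} \<notin> E" if v: "v \<in> U" for v
  proof
    assume "{lf a, v} \<in> E"
    then have "u = v" "{lf a, v} \<in> E" using U_nbrs_eq[OF l u v] by blast+
    then have "u \<in> U \<and> (\<forall>x\<in>{a, lf a}. {x, u} \<in> E)" using u by simp
    then have "{a, lf a} \<in> T" unfolding T_def using l by blast
    then show False using l2 by blast
  qed
qed

lemma M_cases:
  assumes "e \<in> M"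
  obtains "e \<in> T" | a where "a \<in> A" "e = {a, lf a}"
proof (cases "e \<in> T")
  case False
  obtain a u where a: "a \<in> e" "u \<in> U" "{a, u} \<in> E" using U_nbr_ex[OF assms] by blast
  then have "a \<in> A" using False assms unfolding A_def by blast
  moreover have "e = {a, lf a}" using M(3)[OF assms lf(1)[OF \<open>a \<in> A\<close>] a(1)] by simp
  ultimately show ?thesis using that by blast
qed

lemma V_cases:
  assumes "x \<in> {1..n}"
  obtains "x \<in> A" | a where "a \<in> A" "x = lf a" | "x \<in> U" | e where "e \<in> T" "x \<in> e"
proof (cases "x \<in> U")
  case False
  then obtain e where e: "e \<in> M" "x \<in> e" using assms unfolding U_def by blast
  from e(1) show ?thesis
  proof (cases rule: M_cases)
    case 1
    then show ?thesis using that(4) e by blast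
  next
    case (2 a)
    then show ?thesis using that(1,2) e(2) by auto
  qed
qed (rule that)

lemma adj_M:
  assumes "e \<in> M" "x \<in> e" "{x, y} \<in> E"
  shows "(\<exists>a\<in>A. {x, y} = {a, lf a}) \<or> (x, y) \<in> G \<or> {x, y} \<in> T \<or> (\<exists>e\<in>T. x \<in> e \<and> y = ap e)"
proof (cases "y \<in> U")
  case True
  from assms(1) show ?thesis
  proof (cases rule: M_cases)
    case 1
    then show ?thesis using ap_unique[OF 1 assms(2) True assms(3)] assms(2) by blast
  next
    case (2 a)
    have "x \<noteq> lf a" using lf(3)[OF 2(1) True] assms(3) by blast
    then have "x = a" using assms(2) 2(2) by simp
    then show ?thesis using 2(1) True assms(3) by (simp add: G_def)
  qed
next
  case False
  then have "y \<in> e" using nbr_M[OF assms] by blast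
  moreover obtain z where "e = {x, z}" using M_pair[OF assms(1,2)] .
  ultimately have e: "e = {x, y}" using edge(1)[OF assms(3)] by auto
  from assms(1) show ?thesis by (cases rule: M_cases) (use e in auto)
qed

text \<open>A vertex of \<open>U\<close> with no neighbour in \<open>A\<close> is only joined to triangles, which have no further
  neighbours, so the graph would be a star triangle.\<close>

lemma U_dom:
  assumes u: "u \<in> U"
  shows "\<exists>a. (a, u) \<in> G"
proof (rule ccontr)
  assume no: "\<nexists>a. (a, u) \<in> G"
  define T' where "T' = {e \<in> T. ap e = u}"
  define R where "R = insert u (\<Union>T')"
  have uV: "u \<in> {1..n}" using u by (simp add: U_def)
  have nbr_u: "v \<in> \<Union>T'" if v: "{u, v} \<in> E" for v
  proof -
    have vu: "{v, u} \<in> E" using v by (simp add: insert_commute)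
    have "v \<in> {1..n}" using edge(3)[OF v] .
    moreover have "v \<notin> U" using U_indep[OF u] v by blast
    ultimately obtain e where e: "e \<in> M" "v \<in> e" unfolding U_def by blast
    from e(1) show ?thesis
    proof (cases rule: M_cases)
      case 1
      then show ?thesis using ap_unique[OF 1 e(2) u vu] e(2) by (auto simp: T'_def)
    next
      case (2 a)
      have "v \<noteq> lf a" using lf(3)[OF 2(1) u] vu by blast
      then have "(v, u) \<in> G" using 2 e(2) u vu by (simp add: G_def)
      then show ?thesis using no by blast
    qed
  qed
  have nbr_T: "w \<in> e \<or> w = u" if e: "e \<in> T'" "x \<in> e" "{x, w} \<in> E" for e x w
    using nbr_M[of e x w] ap_unique[of e x w] e TM[of e] by (auto simp: T'_def)
  have VR: "{1..n} \<subseteq> R"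
  proof (rule connected_closed[OF E(2) _ uV])
    show "u \<in> R" by (simp add: R_def)
    fix v w assume vw: "v \<in> R" "{v, w} \<in> E"
    show "w \<in> R"
    proof (cases "v = u")
      case True
      then show ?thesis using nbr_u[of w] vw(2) by (simp add: R_def)
    next
      case False
      then obtain e where "e \<in> T'" "v \<in> e" using vw(1) unfolding R_def by blast
      then show ?thesis using nbr_T[of e v w] vw(2) unfolding R_def by blast
    qed
  qed
  have T'E: "\<Union>T' \<subseteq> {1..n}"
  proof
    fix x assume "x \<in> \<Union>T'"
    then obtain e where "e \<in> T" "x \<in> e" by (auto simp: T'_def)
    then show "x \<in> {1..n}" using edge(2)[OF ap(2)] by blast
  qed
  have V: "{1..n} = insert u (\<Union>T')" using VR T'E uV unfolding R_def by blast
  have "star_triangle {1..n} E"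
    unfolding star_triangle_def
  proof (intro exI conjI)
    show "{1..n} = insert u (\<Union>T')" by (rule V)
    show "T' \<noteq> {}"
    proof
      assume "T' = {}"
      then have "card {1..n} = 1" unfolding V by simp
      then show False using n by simp
    qed
    show "\<forall>e\<in>T'. card e = 2"
    proof
      fix e assume "e \<in> T'"
      then have "e \<in> E" using TM[of e] M(1) by (auto simp: T'_def)
      then show "card e = 2" using E(1) by (simp add: simple_graph_def)
    qed
    show "pairwise disjnt T'"
    proof (rule pairwise_subset)
      show "pairwise disjnt M" using indM by (simp add: induced_matching_def matching_def)
      show "T' \<subseteq> M" using TM unfolding T'_def by blast
    qed
    show "u \<notin> \<Union>T'" using U_disjnt[OF u] TM unfolding T'_def by blast
    show "E = T' \<union> {{u, v} | v. v \<in> \<Union>T'}"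
    proof (intro subset_antisym subsetI)
      fix f assume f: "f \<in> E"
      then obtain x y where xy: "f = {x, y}" by (rule edgeE)
      have x: "x \<in> {1..n}" using edge(2)[of x y] f xy by simp
      show "f \<in> T' \<union> {{u, v} | v. v \<in> \<Union>T'}"
      proof (cases "x = u")
        case True
        then show ?thesis using nbr_u[of y] f xy by blast
      next
        case False
        then obtain e where e: "e \<in> T'" "x \<in> e" using x unfolding V by blast
        show ?thesis
        proof (cases "y = u")
          case True
          then have "f = {u, x}" using xy by auto
          then show ?thesis using e by blast
        next
          case False
          then have "y \<in> e" using nbr_T[OF e, of y] f xy by blast
          moreover have "e \<in> M" using e(1) TM by (simp add: T'_def)
          then obtain z where "e = {x, z}" using M_pair[OF _ e(2)] by blast
          ultimately have "e = {x, y}" using edge(1)[of x y] f xy by auto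
          then show ?thesis using e(1) xy by simp
        qed
      qed
    next
      fix f assume "f \<in> T' \<union> {{u, v} | v. v \<in> \<Union>T'}"
      then consider "f \<in> T'" | v e where "f = {u, v}" "v \<in> e" "e \<in> T'" by blast
      then show "f \<in> E"
      proof cases
        case 1
        then show ?thesis using TM[of f] M(1) by (auto simp: T'_def)
      next
        case 2
        then show ?thesis using ap(2)[of e v] by (simp add: T'_def insert_commute)
      qed
    qed
  qed
  then show False using E(5) by blast
qed

lemma A_disjnt: "a \<in> A \<Longrightarrow> a \<notin> U" "a \<in> A \<Longrightarrow> lf a \<notin> U" "a \<in> A \<Longrightarrow> e \<in> T \<Longrightarrow> a \<notin> e" "a \<in> A \<Longrightarrow> e \<in> T \<Longrightarrow> lf a \<notin> e"
  "a \<in> A \<Longrightarrow> lf a \<notin> A"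
proof -
  assume a: "a \<in> A"
  note l = lf(1)[OF a]
  show "a \<notin> U" "lf a \<notin> U" using U_disjnt[OF _ l] by blast+
  show "a \<notin> e" "lf a \<notin> e" if "e \<in> T"
    using M(3)[OF l TM[OF that], of a] M(3)[OF l TM[OF that], of "lf a"] lf(2)[OF a] that by auto
  show "lf a \<notin> A"
  proof
    assume "lf a \<in> A"
    then obtain u where "u \<in> U" "{lf a, u} \<in> E" using lf(4) by blast
    then show False using lf(3)[OF a] by blast
  qed
qed

lemma shape: "cw_shape n E A lf U T ap G"
proof
  show "{1..n} = A \<union> lf ` A \<union> U \<union> \<Union>T"
  proof (intro subset_antisym subsetI)
    fix x assume "x \<in> {1..n}"
    then show "x \<in> A \<union> lf ` A \<union> U \<union> \<Union>T" by (cases rule: V_cases) blast+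
  next
    have MV: "x \<in> {1..n}" if "e \<in> M" "x \<in> e" for e x
    proof -
      have "e \<in> E" using that(1) M(1) by blast
      then have "e \<subseteq> {1..n}" using E(1) by (simp add: simple_graph_def)
      then show ?thesis using that(2) by blast
    qed
    fix x assume "x \<in> A \<union> lf ` A \<union> U \<union> \<Union>T"
    then consider a where "a \<in> A" "x \<in> {a, lf a}" | "x \<in> U" | e where "e \<in> T" "x \<in> e" by blast
    then show "x \<in> {1..n}"
    proof cases
      case 1
      then show ?thesis using MV[OF lf(1)] by blast
    next
      case 2
      then show ?thesis by (simp add: U_def)
    next
      case 3
      then show ?thesis using MV[OF TM] by blast
    qed
  qed
  show "A \<inter> lf ` A = {}" "A \<inter> U = {}" "A \<inter> \<Union>T = {}" "lf ` A \<inter> U = {}" "lf ` A \<inter> \<Union>T = {}"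
    using A_disjnt by blast+
  show "U \<inter> \<Union>T = {}" using U_disjnt TM by blast
  show "inj_on lf A"
  proof (rule inj_onI)
    fix a b assume ab: "a \<in> A" "b \<in> A" "lf a = lf b"
    then have "{a, lf a} = {b, lf b}" using M(3)[OF lf(1)[OF ab(1)] lf(1)[OF ab(2)], of "lf a"] by simp
    then show "a = b" using A_disjnt(5)[OF ab(1)] ab by (auto simp: doubleton_eq_iff)
  qed
  show "card e = 2" if "e \<in> T" for e using that TM[of e] M(1) E(1) by (auto simp: simple_graph_def)
  show "pairwise disjnt T"
  proof (rule pairwise_subset)
    show "pairwise disjnt M" using indM by (simp add: induced_matching_def matching_def)
    show "T \<subseteq> M" using TM by blast
  qed
  show "ap e \<in> U" if "e \<in> T" for e by (rule ap(1)[OF that])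
  show "G \<subseteq> A \<times> U" by (auto simp: G_def)
  show "\<exists>a. (a, u) \<in> G" if "u \<in> U" for u by (rule U_dom[OF that])
  let ?R = "{{a, lf a} | a. a \<in> A} \<union> {{a, u} | a u. (a, u) \<in> G} \<union> T \<union> {{x, ap e} | x e. e \<in> T \<and> x \<in> e}"
  have main: "{x, y} \<in> ?R" if "e \<in> M" "x \<in> e" "{x, y} \<in> E" for e x y
    using adj_M[OF that] by blast
  show "E = ?R"
  proof (intro subset_antisym subsetI)
    fix f assume f: "f \<in> E"
    then obtain x y where xy: "f = {x, y}" by (rule edgeE)
    have V: "x \<in> {1..n}" "y \<in> {1..n}" using edge(2,3)[of x y] f xy by simp_all
    show "f \<in> ?R"
    proof (cases "x \<in> U")
      case True
      then have "y \<notin> U" using U_indep[of x y] f xy by blast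
      then obtain e where "e \<in> M" "y \<in> e" using V(2) unfolding U_def by blast
      then show ?thesis using main[of e y x] f xy by (simp add: insert_commute)
    next
      case False
      then obtain e where "e \<in> M" "x \<in> e" using V(1) unfolding U_def by blast
      then show ?thesis using main[of e x y] f xy by simp
    qed
  next
    fix f assume "f \<in> ?R"
    then consider a where "a \<in> A" "f = {a, lf a}" | a u where "(a, u) \<in> G" "f = {a, u}" | "f \<in> T"
      | x e where "e \<in> T" "x \<in> e" "f = {x, ap e}" by blast
    then show "f \<in> E"
    proof cases
      case 1
      then show ?thesis using lf(1) M(1) by blast
    next
      case 2
      then show ?thesis by (simp add: G_def)
    next
      case 3
      then show ?thesis using TM M(1) by blast
    next
      case 4
      then show ?thesis using ap(2) by blast
    qed
  qed
qed

lemma U_nonempty: "U \<noteq> {}"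
proof
  assume "U = {}"
  moreover have "1 \<in> {1..n}" using n by simp
  ultimately have "1 \<in> \<Union>M" unfolding U_def by blast
  then show False using U_nbr_ex \<open>U = {}\<close> by blast
qed

lemma A_nonempty: "A \<noteq> {}"
proof -
  obtain u where "u \<in> U" using U_nonempty by blast
  then obtain a where "(a, u) \<in> G" using U_dom by blast
  then show ?thesis by (auto simp: G_def)
qed

text \<open>A single vertex in \<open>A\<close> and no triangle: then all edges meet at that vertex.\<close>

lemma not_star: "\<not> (card A = 1 \<and> T = {})"
proof
  interpret cw_shape n E A lf U T ap G by (rule shape)
  assume as: "card A = 1 \<and> T = {}"
  then obtain a where a: "A = {a}" by (auto simp: card_1_singleton_iff)
  have G: "(x, u) \<in> G \<longleftrightarrow> x = a \<and> u \<in> U" for x u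
  proof
    assume "(x, u) \<in> G"
    then show "x = a \<and> u \<in> U" using a by (auto simp: G_def)
  next
    assume *: "x = a \<and> u \<in> U"
    then obtain b where "(b, u) \<in> G" using U_dom by blast
    then show "(x, u) \<in> G" using * a by (auto simp: G_def)
  qed
  have "star_graph {1..n} E"
    unfolding star_graph_def
  proof (intro exI conjI)
    show "insert (lf a) U \<noteq> {}" by simp
    show "a \<notin> insert (lf a) U" using A_disjnt(1,5)[of a] a by auto
    show "{1..n} = insert a (insert (lf a) U)" unfolding verts a using as by (simp add: insert_commute)
    have "{{x, lf x} | x. x \<in> A} = {{a, lf a}}" unfolding a by auto
    moreover have "{{x, u} | x u. (x, u) \<in> G} = {{a, v} | v. v \<in> U}" unfolding G by auto
    moreover have "{{x, ap e} | x e. e \<in> T \<and> x \<in> e} = {}" using as by simp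
    ultimately have "E = {{a, lf a}} \<union> {{a, v} | v. v \<in> U}" using edges as by simp
    then show "E = {{a, v} | v. v \<in> insert (lf a) U}" by auto
  qed
  then show False using E(4) by blast
qed

end

theorem cameron_walker_shape:
  assumes "n \<ge> 5" "cameron_walker {1..n} E"
  obtains A lf U T ap G where "cw_shape n E A lf U T ap G" "A \<noteq> {}" "U \<noteq> {}" "\<not> (card A = 1 \<and> T = {})"
proof -
  have E: "simple_graph {1..n} E" "induced_matching_number E = matching_number E"
    using assms(2) unfolding cameron_walker_def by blast+
  obtain M where M: "induced_matching E M" "card M = matching_number E"
    using induced_matching_number_props(2)[OF finite_edges[OF E(1)]] E(2) by auto
  interpret cw_graph n E M by standard (use assms M in auto)
  show ?thesis by (rule that[OF shape A_nonempty U_nonempty not_star])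
qed

section \<open>The possible invariants\<close>

context cw_shape
begin

text \<open>An apex outside \<open>B\<close> contributes a vertex in each of its triangles.\<close>

lemma size_ge:
  assumes B: "B \<subseteq> U"
  shows "card A + card U1 + card (B \<inter> U0) \<le> size B"
proof -
  have fB: "finite B" using B fin(2) by (rule finite_subset)
  let ?Q = "{e\<in>T. ap e \<notin> B}"
  have fQ: "finite ?Q" using fin(3) by simp
  have "U1 - B \<subseteq> ap ` ?Q" unfolding U1_def by blast
  then have "card (U1 - B) \<le> card (ap ` ?Q)" by (rule card_mono[OF finite_imageI[OF fQ]])
  also have "\<dots> \<le> card ?Q" using fQ by (rule card_image_le)
  finally have 1: "card (U1 - B) \<le> card ?Q" .
  have 2: "card U1 = card (U1 - B) + card (U1 \<inter> B)"
    using card_Diff_subset_Int[of U1 B] card_mono[OF U_split(4), of "U1 \<inter> B"] U_split(4) by simp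
  have "(B \<inter> U0) \<inter> (U1 \<inter> B) = {}" "(B \<inter> U0) \<union> (U1 \<inter> B) = B" using B U_split(1,2) by blast+
  then have 3: "card B = card (B \<inter> U0) + card (U1 \<inter> B)"
    using card_Un_disjoint[of "B \<inter> U0" "U1 \<inter> B"] fB by simp
  show ?thesis unfolding size_def using 1 2 3 by simp
qed

lemma admissible_empty: "admissible {}" "size {} = card A + card T"
  using dom U_split(7) by (auto simp: admissible_def size_def)

lemma admissible_U: "admissible U" "size U = card A + card U"
proof -
  show "admissible U" by (auto simp: admissible_def U0_def)
  have *: "{e\<in>T. ap e \<notin> U} = {}" using ap by blast
  show "size U = card A + card U" unfolding size_def * by simp
qed

text \<open>If every vertex of \<open>U\<close> is an apex, \<open>B = U\<close> attains the lower bound \<open>card A + card U1\<close>. In any case the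
  depth is at most the size \<open>card A + card T\<close> of \<open>B = {}\<close>. If it is smaller there must be a triangle. If
  moreover \<open>A\<close> has only one vertex, this vertex is adjacent to a vertex of \<open>B\<close>, and so \<open>B\<close> must contain
  all of \<open>U0\<close>; this gives the gap of two in the last case.\<close>

lemma depth_cases:
  assumes "A \<noteq> {}"
  obtains B d where "admissible B" "size B = d" "\<forall>B. admissible B \<longrightarrow> d \<le> size B"
    "card U0 = 0 \<and> d = card A + card U1 \<or> card U0 \<ge> 1 \<and> d = card A + card T \<or>
     card U0 \<ge> 1 \<and> card U1 \<ge> 1 \<and> card U1 + 2 \<le> d \<and> d < card A + card T"
proof -
  define d where "d = (LEAST k. \<exists>B. admissible B \<and> size B = k)"
  have "\<exists>B. admissible B \<and> size B = card A + card T" using admissible_empty by blast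
  from LeastI[of "\<lambda>k. \<exists>B. admissible B \<and> size B = k", OF this]
  obtain B where B: "admissible B" "size B = d" unfolding d_def by blast
  have le: "d \<le> size B" if "admissible B" for B unfolding d_def using that by (intro Least_le) blast
  have BU: "B \<subseteq> U" using B(1) by (simp add: admissible_def)
  have m: "card A \<ge> 1" using assms fin(1) by (simp add: Suc_le_eq card_gt_0_iff)
  have ge: "card A + card U1 + card (B \<inter> U0) \<le> d" using size_ge[OF BU] B(2) by simp
  have dr: "d \<le> card A + card T" using le[OF admissible_empty(1)] admissible_empty(2) by simp
  have "card U0 = 0 \<and> d = card A + card U1 \<or> card U0 \<ge> 1 \<and> d = card A + card T \<or>
     card U0 \<ge> 1 \<and> card U1 \<ge> 1 \<and> card U1 + 2 \<le> d \<and> d < card A + card T"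
  proof (cases "card U0 = 0")
    case True
    then have "d \<le> card A + card U1" using le[OF admissible_U(1)] admissible_U(2) U_split(5) by simp
    then show ?thesis using ge True by simp
  next
    case z: False
    show ?thesis
    proof (cases "d = card A + card T")
      case False
      then have lt: "d < card A + card T" using dr by simp
      have "T \<noteq> {}" using lt ge by auto
      then have "U1 \<noteq> {}" by (simp add: U1_def)
      then have q: "card U1 \<ge> 1" using U_split(4) by (simp add: Suc_le_eq card_gt_0_iff)
      have "card U1 + 2 \<le> d"
      proof (cases "card A = 1")
        case True
        then obtain a where a: "A = {a}" by (auto simp: card_1_singleton_iff)
        have "B \<noteq> {}" using B(2) lt admissible_empty(2) by auto
        then obtain b where b: "b \<in> B" by blast
        have Ga: "(a', u) \<in> G \<Longrightarrow> a' = a" for a' u using GD(1)[of a' u] a by simp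
        obtain a' where "(a', b) \<in> G" using dom[of b] b BU by blast
        then have ab: "(a, b) \<in> G" using Ga by blast
        have "U0 \<subseteq> B"
        proof
          fix u assume u: "u \<in> U0"
          show "u \<in> B"
          proof (rule ccontr)
            assume "u \<notin> B"
            then obtain a' where "(a', u) \<in> G" "\<forall>b\<in>B. (a', b) \<notin> G" using B(1) u unfolding admissible_def by blast
            then show False using Ga[of a' u] ab b by blast
          qed
        qed
        then have "B \<inter> U0 = U0" by blast
        then have "card A + card U1 + card U0 \<le> d" using ge by simp
        then show ?thesis using True z by linarith
      qed (use m ge in linarith)
      then show ?thesis using z q lt by linarith
    qed (use z in simp)
  qed
  with B le show ?thesis by (intro that[of B d]) simp_all
qed

end

text \<open>With \<open>m\<close>, \<open>t\<close>, \<open>z\<close>, \<open>q\<close> as in the proof, the three cases of \<open>depth_cases\<close> give the three families, and the tuples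
with first entry \<open>2\<close> come from the first two cases.\<close>

lemma CW_invariants_subset:
  assumes n: "n \<ge> 5" and x: "x \<in> CW_invariants TYPE('k::field) n"
  obtains a r d where "x = (a, r, d, d)"
    "a = 2 \<and> r = 2 \<and> (d = n - 2 \<or> d = n - 3) \<or> a = 2 \<and> odd n \<and> r = (n - 1) div 2 \<and> d = (n - 1) div 2 \<or>
     3 \<le> a \<and> r = d \<and> a \<le> d \<and> d \<le> (n - 1) div 2 \<and> n < a + 2 * d \<or>
     3 \<le> a \<and> r = a \<and> a < d \<and> d \<le> n - a \<and> n \<le> 2 * a + d - 1 \<or>
     3 \<le> a \<and> a < r \<and> r < d \<and> d < n - r \<and> n + 2 \<le> a + r + d"
proof -
  obtain E where E: "cameron_walker {1..n} E" "x = invariants TYPE('k) n E"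
    using x unfolding CW_invariants_def CW_def by blast
  obtain A lf U T ap G where shape: "cw_shape n E A lf U T ap G" and ne: "A \<noteq> {}" "U \<noteq> {}" "\<not> (card A = 1 \<and> T = {})"
    using cameron_walker_shape[OF n E(1)] .
  interpret cw_shape n E A lf U T ap G by (rule shape)
  obtain B a where B: "admissible B" "size B = a" "\<forall>B. admissible B \<longrightarrow> a \<le> size B"
    and cases: "card U0 = 0 \<and> a = card A + card U1 \<or> card U0 \<ge> 1 \<and> a = card A + card T \<or>
     card U0 \<ge> 1 \<and> card U1 \<ge> 1 \<and> card U1 + 2 \<le> a \<and> a < card A + card T"
    using depth_cases[OF ne(1)] .
  have inv: "x = (a, card A + card T, card A + card T + card U0, card A + card T + card U0)"
    unfolding E(2) by (rule invariants[OF ne(1) B(1,2)]) (use B(3) in simp)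
  define m t z q where mtzq: "m = card A" "t = card T" "z = card U0" "q = card U1"
  have num: "n = 2 * m + 2 * t + z + q" "q \<le> t" using card_n U_split(5) card_U1_le by (simp_all add: mtzq)
  have m: "m \<ge> 1" using ne(1) fin(1) by (simp add: mtzq Suc_le_eq card_gt_0_iff)
  have zq: "z + q \<ge> 1" using ne(2) fin(2) U_split(5) unfolding mtzq by (metis Suc_leI card_gt_0_iff One_nat_def)
  have q0: "q = 0 \<Longrightarrow> t = 0" using U_split(4) fin(3) by (auto simp: mtzq U1_def)
  have mt: "m + t \<ge> 2"
    using m ne(3) fin(3) card_0_eq[of T] unfolding mtzq by linarith
  from cases have "z = 0 \<and> a = m + q \<or> z \<ge> 1 \<and> a = m + t \<or> z \<ge> 1 \<and> q \<ge> 1 \<and> q + 2 \<le> a \<and> a < m + t"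
    unfolding mtzq .
  then consider "z = 0" "a = m + q" | "z \<ge> 1" "a = m + t" | "z \<ge> 1" "q \<ge> 1" "q + 2 \<le> a" "a < m + t"
    by linarith
  then show ?thesis
  proof cases
    case 1
    then have n1: "n = 2 * (m + t) + q" "q \<ge> 1" using num(1) zq by simp_all
    show ?thesis
    proof (cases "a = 2")
      case True
      then have "q = 1" using 1 m n1(2) by simp
      then have "odd n \<and> m + t = (n - 1) div 2" using n1(1) by simp
      then show ?thesis using that[OF inv] True 1 unfolding mtzq by simp
    next
      case False
      have "3 \<le> a \<and> a \<le> m + t \<and> m + t \<le> (n - 1) div 2 \<and> n < a + 2 * (m + t)"
        using False 1 m n1 num(2) by auto
      then show ?thesis using that[OF inv] 1 unfolding mtzq by simp
    qed
  next
    case 2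
    show ?thesis
    proof (cases "a = 2")
      case True
      then have "q \<le> 1" using 2 m num(2) by simp
      then have "m + t + z = n - 2 \<or> m + t + z = n - 3" using True 2 num(1) by arith
      then show ?thesis using that[OF inv] True 2 unfolding mtzq by simp
    next
      case False
      have "3 \<le> a \<and> a < m + t + z \<and> m + t + z \<le> n - a \<and> n \<le> 2 * a + (m + t + z) - 1"
        using False mt 2 m num by auto
      then show ?thesis using that[OF inv] 2 unfolding mtzq by simp
    qed
  next
    case 3
    have "3 \<le> a \<and> a < m + t \<and> m + t < m + t + z \<and> m + t + z < n - (m + t) \<and> n + 2 \<le> a + (m + t) + (m + t + z)"
      using 3 num by auto
    then show ?thesis using that[OF inv] unfolding mtzq by simp
  qed
qed

section \<open>Realization\<close>

context cw_shape
begin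

text \<open>Connectedness is witnessed by a vertex of \<open>A\<close> adjacent to all of \<open>U\<close>. There are two disjoint edges, so the
graph is no star, and a leaf has degree one, which is impossible in a star triangle.\<close>

lemma cameron_walker:
  assumes a0: "a0 \<in> A" "\<And>u. u \<in> U \<Longrightarrow> (a0, u) \<in> G" and nbr: "\<And>a. a \<in> A \<Longrightarrow> \<exists>u. (a, u) \<in> G"
    and not_star: "card A \<ge> 2 \<or> T \<noteq> {}"
  shows "cameron_walker {1..n} E"
  unfolding cameron_walker_def
proof (intro conjI notI)
  show "simple_graph {1..n} E" by (rule simple)
  show "induced_matching_number E = matching_number E" using matching_numbers by simp
  let ?r = "{(a, b). {a, b} \<in> E}"
  have U: "(u, a0) \<in> ?r\<^sup>*" if u: "u \<in> U" for u
  proof -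
    have "{a0, u} \<in> E" using adj_U[OF u] a0(2)[OF u] by blast
    then have "(u, a0) \<in> ?r" by (simp add: insert_commute)
    then show ?thesis by blast
  qed
  have AA: "(a, a0) \<in> ?r\<^sup>*" if a: "a \<in> A" for a
  proof -
    obtain u where u: "(a, u) \<in> G" using nbr[OF a] by blast
    then have "(a, u) \<in> ?r" using adj_U[OF GD(2)[OF u]] by blast
    then show ?thesis using U[OF GD(2)[OF u]] by (rule converse_rtrancl_into_rtrancl)
  qed
  have reach: "(v, a0) \<in> ?r\<^sup>*" if v: "v \<in> {1..n}" for v
  proof -
    from v consider "v \<in> A" | a where "a \<in> A" "v = lf a" | "v \<in> U" | e where "e \<in> T" "v \<in> e" unfolding verts by blast
    then show ?thesis
    proof cases
      case 2
      have "{a, v} \<in> E" using adj_lf[OF 2(1)] 2(2) by simp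
      then have "(v, a) \<in> ?r" by (simp add: insert_commute)
      then show ?thesis using AA[OF 2(1)] by (rule converse_rtrancl_into_rtrancl)
    next
      case 4
      have "{ap e, v} \<in> E" using adj_T[OF 4] by simp
      then have "(v, ap e) \<in> ?r" by (simp add: insert_commute)
      then show ?thesis using U[OF ap[OF 4(1)]] by (rule converse_rtrancl_into_rtrancl)
    qed (use AA U in blast)+
  qed
  have "sym ?r" by (simp add: sym_def insert_commute)
  then have "sym (?r\<^sup>*)" by (rule sym_rtrancl)
  then have "(u, v) \<in> ?r\<^sup>*" if "u \<in> {1..n}" "v \<in> {1..n}" for u v
    using reach[OF that(1)] reach[OF that(2)] by (meson rtrancl_trans symD)
  moreover have "{1..n} \<noteq> {}" using a0(1) subs(1) by blast
  ultimately show "connected_graph {1..n} E" unfolding connected_graph_def by blast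
next
  assume "star_graph {1..n} E"
  then obtain c where c: "\<And>f. f \<in> E \<Longrightarrow> c \<in> f" unfolding star_graph_def by blast
  have wh: "{a, lf a} \<in> E" if "a \<in> A" for a using adj_lf[OF that] by blast
  show False
  proof (cases "T = {}")
    case True
    then have "A \<noteq> {a0}" using not_star by auto
    then obtain a where a: "a \<in> A" "a \<noteq> a0" using a0(1) by blast
    have "c \<in> {a, lf a}" "c \<in> {a0, lf a0}" using c wh a(1) a0(1) by blast+
    then show False using a sep(5)[OF a(1)] sep(5)[OF a0(1)] a0(1) inj_onD[OF inj_lf _ a(1) a0(1)] by auto
  next
    case False
    then obtain e where e: "e \<in> T" by blast
    then have "e \<in> E" unfolding edges by blast
    then have "c \<in> e" "c \<in> {a0, lf a0}" using c wh a0(1) by blast+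
    then show False using sep(3,6)[OF a0(1) e] by auto
  qed
next
  assume "star_triangle {1..n} E"
  then obtain c T' where T': "T' \<noteq> {}" "\<forall>e\<in>T'. card e = 2" "c \<notin> \<Union>T'" "{1..n} = insert c (\<Union>T')"
    "E = T' \<union> {{c, v} | v. v \<in> \<Union>T'}"
    unfolding star_triangle_def by blast
  have lf1: "x = a0" if "{x, lf a0} \<in> E" for x using adj_lf[OF a0(1), of x] that by blast
  have cE: "{c, v} \<in> E" if "v \<in> e" "e \<in> T'" for v e unfolding T'(5) using that by blast
  have "lf a0 \<in> {1..n}" using subs(2) a0(1) by blast
  then consider "lf a0 = c" | e where "e \<in> T'" "lf a0 \<in> e" using T'(4) by blast
  then show False
  proof cases
    case 1
    obtain e where e: "e \<in> T'" using T'(1) by blast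
    have "v = a0" if "v \<in> e" for v using lf1[of v] cE[OF that e] 1 by (simp add: insert_commute)
    then have "e \<subseteq> {a0}" by blast
    then have "card e \<le> 1" using card_mono[of "{a0}" e] by simp
    then show False using T'(2) e by simp
  next
    case 2
    have "c = a0" using lf1[OF cE[OF 2(2,1)]] .
    have "card e = 2" using T'(2) 2(1) by blast
    then obtain x y where "e = {x, y}" "x \<noteq> y" by (auto simp: card_2_iff)
    then obtain y where y: "e = {y, lf a0}" "y \<noteq> lf a0" using 2(2) by (auto simp: insert_commute)
    then have "y = a0" using lf1[of y] 2(1) T'(5) by blast
    then show False using \<open>c = a0\<close> T'(3) y(1) 2(1) by blast
  qed
qed

lemma invariants_min_depth:
  assumes "A \<noteq> {}" "admissible B" "size B = card A + card U1"
  shows "invariants TYPE('k::field) n E =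
    (card A + card U1, card A + card T, card A + card T + card U0, card A + card T + card U0)"
proof (rule invariants[OF assms])
  fix B assume "admissible B"
  then have "B \<subseteq> U" by (simp add: admissible_def)
  then show "card A + card U1 \<le> size B" using size_ge[of B] by linarith
qed

end

text \<open>The vertices are numbered in the order \<open>A\<close>, leaves, \<open>U0\<close>, \<open>U1\<close>, bases of triangles. The \<open>i\<close>-th triangle is
attached to the \<open>i\<close>-th apex, except that the last apex receives all surplus triangles. The minimal size
\<open>m + q\<close> is attained by \<open>B = U\<close> if \<open>z = 0\<close> and by \<open>B = {}\<close> if \<open>t = q\<close>. Otherwise \<open>B\<close> consists of the last
apex only, which saves its surplus triangles; a second vertex of \<open>A\<close>, not adjacent to this apex, then dominates
\<open>U0\<close>. For that reason only the vertex \<open>1\<close> is joined to the apexes when \<open>z > 0\<close>.\<close>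

lemma CW_invariants_realize:
  fixes m t z q n :: nat
  assumes m: "m \<ge> 1" and q: "q \<le> t" "q = 0 \<Longrightarrow> t = 0" and zq: "z + q \<ge> 1" and not_star: "m \<ge> 2 \<or> t \<ge> 1"
    and n: "n = 2 * m + 2 * t + z + q" and depth: "z = 0 \<or> m \<ge> 2 \<and> q \<ge> 1 \<or> t = q"
  shows "(m + q, m + t, m + t + z, m + t + z) \<in> CW_invariants TYPE('k::field) n"
proof -
  define c where "c = 2 * m + z + q"
  define A where "A = {1..m}"
  define lf where "lf a = m + a" for a :: nat
  define U where "U = {2 * m + 1..c}"
  define ed where "ed i = {c + 2 * i + 1, c + 2 * i + 2}" for i :: nat
  define T where "T = ed ` {..<t}"
  define w where "w i = 2 * m + z + 1 + min (q - 1) i" for i :: nat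
  define ap where "ap e = w ((Min e - c - 1) div 2)" for e :: "nat set"
  define G where "G = {(a, u). a \<in> A \<and> u \<in> U \<and> (a = 1 \<or> z = 0 \<or> u \<le> 2 * m + z)}"
  define E where "E = {{a, lf a} | a. a \<in> A} \<union> {{a, u} | a u. (a, u) \<in> G} \<union> T \<union> {{x, ap e} | x e. e \<in> T \<and> x \<in> e}"
  have ap_ed: "ap (ed i) = w i" for i by (simp add: ap_def ed_def)
  have w: "2 * m + z + 1 \<le> w i \<and> w i \<le> 2 * m + z + q" if "i < t" for i
    using q that unfolding w_def by linarith
  have wU: "w i \<in> U" if "i < t" for i using w[OF that] by (simp add: U_def c_def)
  have lfA: "lf ` A = {m + 1..2 * m}" unfolding lf_def A_def image_add_atLeastAtMost by (simp add: mult_2)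
  have UT: "\<Union>T = {c + 1..c + 2 * t}"
  proof (rule Set.set_eqI)
    fix x
    have "x \<in> \<Union>T \<longleftrightarrow> (\<exists>i<t. x = c + 2 * i + 1 \<or> x = c + 2 * i + 2)" by (auto simp: T_def ed_def)
    also have "\<dots> \<longleftrightarrow> x \<in> {c + 1..c + 2 * t}"
    proof
      assume "x \<in> {c + 1..c + 2 * t}"
      then show "\<exists>i<t. x = c + 2 * i + 1 \<or> x = c + 2 * i + 2"
        by (intro exI[of _ "(x - c - 1) div 2"]) (simp, presburger)
    qed auto
    finally show "x \<in> \<Union>T \<longleftrightarrow> x \<in> {c + 1..c + 2 * t}" .
  qed
  have disj_ed: "x \<notin> ed j" if "x \<in> ed i" "i \<noteq> j" for x i j using that by (auto simp: ed_def)
  interpret cw_shape n E A lf U T ap G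
  proof
    show "{1..n} = A \<union> lf ` A \<union> U \<union> \<Union>T" unfolding lfA UT unfolding A_def U_def n c_def by auto
    show "A \<inter> lf ` A = {}" "A \<inter> U = {}" "A \<inter> \<Union>T = {}" "lf ` A \<inter> U = {}" "lf ` A \<inter> \<Union>T = {}" "U \<inter> \<Union>T = {}"
      unfolding lfA UT by (auto simp: A_def U_def c_def)
    show "inj_on lf A" by (auto simp: lf_def inj_on_def)
    show "card e = 2" if "e \<in> T" for e using that by (auto simp: T_def ed_def)
    show "pairwise disjnt T"
    proof (rule pairwiseI)
      fix e e' assume "e \<in> T" "e' \<in> T" "e \<noteq> e'"
      then obtain i j where ij: "e = ed i" "e' = ed j" "i \<noteq> j" by (auto simp: T_def)
      then show "disjnt e e'" using disj_ed[OF _ ij(3)] unfolding disjnt_def by blast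
    qed
    show "ap e \<in> U" if "e \<in> T" for e using that wU by (auto simp: T_def ap_ed)
    show "G \<subseteq> A \<times> U" by (auto simp: G_def)
    show "\<exists>a. (a, u) \<in> G" if "u \<in> U" for u using that m by (intro exI[of _ 1]) (simp add: G_def A_def)
  qed (rule E_def)
  have U1w: "U1 = w ` {..<t}" unfolding U1_def unfolding T_def image_image ap_ed ..
  have U1: "U1 = {2 * m + z + 1..2 * m + z + q}"
  proof (intro subset_antisym subsetI)
    fix x assume "x \<in> U1"
    then obtain i where "i < t" "x = w i" unfolding U1w by blast
    then show "x \<in> {2 * m + z + 1..2 * m + z + q}" using w[of i] by simp
  next
    fix x assume x: "x \<in> {2 * m + z + 1..2 * m + z + q}"
    then have "x = w (x - (2 * m + z + 1))" "x - (2 * m + z + 1) < t" using q(1) by (auto simp: w_def)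
    then show "x \<in> U1" unfolding U1w by blast
  qed
  have inj_ed: "inj_on ed X" for X
  proof (rule inj_onI)
    fix i j assume "ed i = ed j"
    then have "c + 2 * i + 1 \<in> ed j" by (metis ed_def insertI1)
    then show "i = j" using disj_ed[of "c + 2 * i + 1" i j] by (auto simp: ed_def)
  qed
  have cards: "card A = m" "card T = t" "card U1 = q" "card U = z + q"
    unfolding U1 by (simp_all add: A_def T_def U_def c_def card_image[OF inj_ed])
  have cU0: "card U0 = z" using U_split(5) cards by simp
  have U0: "U0 = {2 * m + 1..2 * m + z}" unfolding U0_def U1_def[symmetric] U1 by (auto simp: U_def c_def)
  have A1: "A \<noteq> {}" "1 \<in> A" using m by (auto simp: A_def)
  have "cameron_walker {1..n} E"
  proof (rule cameron_walker[OF A1(2)])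
    show "(1, u) \<in> G" if "u \<in> U" for u using that A1(2) by (simp add: G_def)
    show "\<exists>u. (a, u) \<in> G" if "a \<in> A" for a
      using that zq by (intro exI[of _ "2 * m + 1"]) (auto simp: G_def U_def c_def)
    show "card A \<ge> 2 \<or> T \<noteq> {}" using not_star cards by auto
  qed
  moreover have "\<exists>B. admissible B \<and> size B = card A + card U1"
    using depth
  proof (elim disjE conjE)
    assume "z = 0"
    then show ?thesis using admissible_U cards by (intro exI[of _ U]) simp
  next
    assume "t = q"
    then show ?thesis using admissible_empty cards by (intro exI[of _ "{}"]) simp
  next
    assume mq: "m \<ge> 2" "q \<ge> 1"
    show ?thesis
    proof (cases "z = 0")
      case True
      then show ?thesis using admissible_U cards by (intro exI[of _ U]) simp
    next
      case z: False
      let ?u = "2 * m + z + q"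
      have "admissible {?u}"
        unfolding admissible_def
      proof (intro conjI ballI)
        show "{?u} \<subseteq> U" using mq zq by (auto simp: U_def c_def)
        fix u assume u: "u \<in> U0 - {?u}"
        have "(2, u) \<in> G" using u mq U_split(7) unfolding U0 by (auto simp: G_def A_def U_def c_def)
        moreover have "(2, ?u) \<notin> G" using z mq by (simp add: G_def)
        ultimately show "\<exists>a. (a, u) \<in> G \<and> (\<forall>b\<in>{?u}. (a, b) \<notin> G)" by blast
      qed
      moreover have "{e\<in>T. ap e \<notin> {?u}} = ed ` {..<q - 1}"
      proof (intro subset_antisym subsetI)
        fix e assume "e \<in> {e\<in>T. ap e \<notin> {?u}}"
        then obtain i where "i < t" "e = ed i" "w i \<noteq> ?u" by (auto simp: T_def ap_ed)
        then show "e \<in> ed ` {..<q - 1}" using mq by (auto simp: w_def split: if_splits)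
      next
        fix e assume "e \<in> ed ` {..<q - 1}"
        then obtain i where "i < q - 1" "e = ed i" by blast
        then show "e \<in> {e\<in>T. ap e \<notin> {?u}}" using q(1) by (auto simp: T_def ap_ed w_def)
      qed
      then have "size {?u} = card A + card U1"
        unfolding size_def using mq cards by (simp add: card_image[OF inj_ed])
      ultimately show ?thesis by blast
    qed
  qed
  then obtain B where "admissible B" "size B = card A + card U1" by blast
  from invariants_min_depth[OF A1(1) this, where 'k = 'k]
  have "invariants TYPE('k) n E = (m + q, m + t, m + t + z, m + t + z)" unfolding cards cU0 .
  ultimately show ?thesis unfolding CW_invariants_def CW_def by (metis (mono_tags, lifting) mem_Collect_eq)
qed

text \<open>The parameters for a tuple \<open>(a, r, d, d)\<close> are \<open>m = a - q\<close>, \<open>t = r - m\<close>, \<open>z = d - r\<close> and, from the number of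
vertices, \<open>q = n - r - d\<close>. The inequalities that define the families say that these are possible. For
\<open>n = 5\<close> the tuple \<open>(2, 2, n - 3, n - 3)\<close> arises from a graph with \<open>z = 0\<close>, not from one with \<open>a < d\<close>.\<close>

theorem theorem4p4:
  fixes n :: nat
  assumes "n \<ge> 5"
  shows "CW_invariants TYPE('k::field) n =
           CW2_invariants TYPE('k) n
           \<union> {(a, d, d, d) | a d. 3 \<le> a \<and> a \<le> d \<and> d \<le> (n - 1) div 2 \<and> n < a + 2 * d}
           \<union> {(a, a, d, d) | a d. 3 \<le> a \<and> a < d \<and> d \<le> n - a \<and> n \<le> 2 * a + d - 1}
           \<union> {(a, r, d, d) | a r d. 3 \<le> a \<and> a < r \<and> r < d \<and> d < n - r \<and> n + 2 \<le> a + r + d}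
         \<and> CW2_invariants TYPE('k) n =
             (if even n then {(2, 2, n - 2, n - 2), (2, 2, n - 3, n - 3)}
              else {(2, 2, n - 2, n - 2), (2, 2, n - 3, n - 3),
                    (2, (n - 1) div 2, (n - 1) div 2, (n - 1) div 2)})"
proof -
  let ?C = "CW_invariants TYPE('k) n"
  let ?S1 = "{(a, d, d, d) | a d. 3 \<le> a \<and> a \<le> d \<and> d \<le> (n - 1) div 2 \<and> n < a + 2 * d}"
  let ?S2 = "{(a, a, d, d) | a d. 3 \<le> a \<and> a < d \<and> d \<le> n - a \<and> n \<le> 2 * a + d - 1}"
  let ?S3 = "{(a, r, d, d) | a r d. 3 \<le> a \<and> a < r \<and> r < d \<and> d < n - r \<and> n + 2 \<le> a + r + d}"
  have C1: "(a, d, d, d) \<in> ?C" if "2 \<le> a" "a \<le> d" "d \<le> (n - 1) div 2" "n < a + 2 * d" for a d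
  proof -
    define q m where "q = n - 2 * d" and "m = a - q"
    then have *: "q \<ge> 1" "m \<ge> 1" "m + q = a" "q \<le> d - m" "m + (d - m) = d" "n = 2 * d + q"
      using that assms by auto
    have "(m + q, m + (d - m), m + (d - m) + 0, m + (d - m) + 0) \<in> ?C"
      by (rule CW_invariants_realize) (use * assms in auto)
    then show ?thesis using * by simp
  qed
  have C2: "(a, a, d, d) \<in> ?C" if "2 \<le> a" "a < d" "d \<le> n - a" "n \<le> 2 * a + d - 1" for a d
  proof -
    define q m where "q = n - a - d" and "m = a - q"
    then have *: "m \<ge> 1" "m + q = a" "n = a + d + q" using that by auto
    have "(m + q, m + q, m + q + (d - a), m + q + (d - a)) \<in> ?C"
      by (rule CW_invariants_realize) (use * that in auto)
    then show ?thesis using * that by simp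
  qed
  have C3: "(a, r, d, d) \<in> ?C" if "3 \<le> a" "a < r" "r < d" "d < n - r" "n + 2 \<le> a + r + d" for a r d
  proof -
    define q m where "q = n - r - d" and "m = a - q"
    then have *: "q \<ge> 1" "m \<ge> 2" "m + q = a" "n = r + d + q" using that by auto
    have "(m + q, m + (r - m), m + (r - m) + (d - r), m + (r - m) + (d - r)) \<in> ?C"
      by (rule CW_invariants_realize) (use * that in auto)
    then show ?thesis using * that by simp
  qed
  have D2: "(2, 2, n - 2, n - 2) \<in> ?C" using C2[of 2 "n - 2"] assms by simp
  have D3: "(2, 2, n - 3, n - 3) \<in> ?C"
  proof (cases "n = 5")
    case True
    then show ?thesis using C1[of 2 2] by simp
  next
    case False
    then show ?thesis using C2[of 2 "n - 3"] assms by simp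
  qed
  have D1: "(2, (n - 1) div 2, (n - 1) div 2, (n - 1) div 2) \<in> ?C" if "odd n"
  proof (rule C1)
    show "2 \<le> (n - 1) div 2" "n < 2 + 2 * ((n - 1) div 2)" using that assms by presburger+
  qed simp_all
  let ?P = "if even n then {(2, 2, n - 2, n - 2), (2, 2, n - 3, n - 3)}
              else {(2, 2, n - 2, n - 2), (2, 2, n - 3, n - 3),
                    (2, (n - 1) div 2, (n - 1) div 2, (n - 1) div 2)}"
  have le: "x \<in> ?P \<or> x \<in> ?S1 \<union> ?S2 \<union> ?S3" if "x \<in> ?C" for x
    using assms that
  proof (cases rule: CW_invariants_subset)
    case (1 a r d)
    from 1(2) show ?thesis
    proof (elim disjE)
      assume "a = 2 \<and> r = 2 \<and> (d = n - 2 \<or> d = n - 3)"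
      then have "x \<in> ?P" using 1(1) by auto
      then show ?thesis ..
    next
      assume "a = 2 \<and> odd n \<and> r = (n - 1) div 2 \<and> d = (n - 1) div 2"
      then have "x \<in> ?P" using 1(1) by simp
      then show ?thesis ..
    next
      assume "3 \<le> a \<and> r = d \<and> a \<le> d \<and> d \<le> (n - 1) div 2 \<and> n < a + 2 * d"
      then have "x \<in> ?S1" using 1(1) by blast
      then show ?thesis by blast
    next
      assume "3 \<le> a \<and> r = a \<and> a < d \<and> d \<le> n - a \<and> n \<le> 2 * a + d - 1"
      then have "x \<in> ?S2" using 1(1) by blast
      then show ?thesis by blast
    next
      assume "3 \<le> a \<and> a < r \<and> r < d \<and> d < n - r \<and> n + 2 \<le> a + r + d"
      then have "x \<in> ?S3" using 1(1) by blast
      then show ?thesis by blast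
    qed
  qed
  have ge: "?S1 \<union> ?S2 \<union> ?S3 \<subseteq> ?C" using C1 C2 C3 by auto
  have P: "?P \<subseteq> ?C" using D1 D2 D3 by auto
  have CW2: "x \<in> CW2_invariants TYPE('k) n \<longleftrightarrow> x \<in> ?C \<and> fst x = 2" for x
    by (cases x) (auto simp: CW2_invariants_def)
  have P2: "fst x = 2" if "x \<in> ?P" for x using that by (auto split: if_splits)
  have S2: "fst x \<noteq> 2" if "x \<in> ?S1 \<union> ?S2 \<union> ?S3" for x using that by auto
  have eq: "CW2_invariants TYPE('k) n = ?P"
  proof (rule Set.set_eqI)
    fix x show "x \<in> CW2_invariants TYPE('k) n \<longleftrightarrow> x \<in> ?P"
      using CW2[of x] le[of x] P P2[of x] S2[of x] by blast
  qed
  moreover have "?C = ?P \<union> ?S1 \<union> ?S2 \<union> ?S3"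
  proof (rule Set.set_eqI)
    fix x show "x \<in> ?C \<longleftrightarrow> x \<in> ?P \<union> ?S1 \<union> ?S2 \<union> ?S3"
      using le[of x] ge P by blast
  qed
  ultimately show ?thesis by simp
qed

end
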